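(* Let $g\colon[0,\infty)\to\mathbb R$ be a Borel function. Let $B$ be a Brownian motion starting from $x_0>0$, $\tau^B_0:=\inf\{t\ge0:B_t=0\}$, and let $B^{\tau^B_0}=(B_{t\wedge\tau^B_0})_{t\ge0}$ be the stopped process. The following are equivalent: (a) $g(B^{\tau^B_0})$ is a semimartingale; (b) the restriction $g|_{(0,\infty)}$ is a difference of two convex functions $(0,\infty)\to\mathbb R$, and $\int_{(0,z)}x\,|g''|(dx)<\infty$ for some $z\in(0,\infty)$; (c) $g=h_1-h_2$ with functions $h_i\colon[0,\infty)\to\mathbb R$ that are convex and continuous at $0$, $i=1,2$.
   Context: $B$ is an $(\mathcal F_t,\mathsf P)$-Brownian motion on a filtered probability space $(\Omega,\mathcal F,(\mathcal F_t)_{t\in[0,\infty)},\mathsf P)$, and "semimartingale" means semimartingale on $[0,\infty)$ with respect to $(\mathcal F_t)$. When $g|_{(0,\infty)}$ is a difference of two convex functions, $g''(dx)$ denotes the locally finite signed measure on $(0,\infty)$ with $g''((x,y])=g'_+(y)-g'_+(x)$, $0<x<y<\infty$ ($g'_+$ the right derivative), and $|g''|(dx)$ denotes its variation measure.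
   Formalization: The implication from (b) to (c) is stated only for g continuous at 0, since (c) forces this and g equal to the indicator of {0} satisfies (a) and (b) but not (c); (a) iff (b) and (c) implies (b) hold for every Borel g. *)

theory Defs
  imports "HOL-Probability.Probability"
begin

section \<open>Processes on a filtered probability space\<close>

text \<open>
  Time runs through \<open>[0,\<infinity>)\<close>, represented by the nonnegative reals: the values of a filtration or a
  process at negative times never matter.  The usual conditions (completeness and
  right-continuity of the filtration) are not imposed.  For this reason the path properties in the
  definitions of a local martingale and of a semimartingale are required almost surely; under the
  usual conditions this agrees with requiring them for all paths.
\<close>

locale filtered_prob_space = prob_space M for M :: "'a measure" +
  fixes F :: "real \<Rightarrow> 'a measure"
  assumes subalgebra_F: "\<And>t. 0 \<le> t \<Longrightarrow> subalgebra M (F t)"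
    and mono_F: "\<And>s t. 0 \<le> s \<Longrightarrow> s \<le> t \<Longrightarrow> sets (F s) \<subseteq> sets (F t)"

definition adapted :: "(real \<Rightarrow> 'a measure) \<Rightarrow> (real \<Rightarrow> 'a \<Rightarrow> real) \<Rightarrow> bool" where
  "adapted F X \<longleftrightarrow> (\<forall>t\<ge>0. X t \<in> borel_measurable (F t))"

definition brownian_motion ::
  "'a measure \<Rightarrow> (real \<Rightarrow> 'a measure) \<Rightarrow> real \<Rightarrow> (real \<Rightarrow> 'a \<Rightarrow> real) \<Rightarrow> bool" where
  "brownian_motion M F x0 B \<longleftrightarrow>
     adapted F B \<and>
     (\<forall>\<omega>\<in>space M. B 0 \<omega> = x0 \<and> continuous_on {0..} (\<lambda>t. B t \<omega>)) \<and>
     (\<forall>s t. 0 \<le> s \<and> s < t \<longrightarrow>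
        distributed M lborel (\<lambda>\<omega>. B t \<omega> - B s \<omega>) (\<lambda>x. ennreal (normal_density 0 (sqrt (t - s)) x)) \<and>
        prob_space.indep_set M (sets (F s))
          (sets (vimage_algebra (space M) (\<lambda>\<omega>. B t \<omega> - B s \<omega>) borel)))"

text \<open>Random times take values in \<open>[0,\<infinity>]\<close>; the infimum of the empty set is \<open>\<infinity>\<close>.\<close>

definition stopping_time_ext :: "'a measure \<Rightarrow> (real \<Rightarrow> 'a measure) \<Rightarrow> ('a \<Rightarrow> ereal) \<Rightarrow> bool" where
  "stopping_time_ext M F T \<longleftrightarrow>
     (\<forall>\<omega>\<in>space M. 0 \<le> T \<omega>) \<and> (\<forall>t\<ge>0. Measurable.pred (F t) (\<lambda>\<omega>. T \<omega> \<le> ereal t))"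

definition hitting_time :: "(real \<Rightarrow> 'a \<Rightarrow> real) \<Rightarrow> real \<Rightarrow> 'a \<Rightarrow> ereal" where
  "hitting_time X a \<omega> = Inf {ereal t | t. 0 \<le> t \<and> X t \<omega> = a}"

definition stopped :: "('a \<Rightarrow> ereal) \<Rightarrow> (real \<Rightarrow> 'a \<Rightarrow> real) \<Rightarrow> real \<Rightarrow> 'a \<Rightarrow> real" where
  "stopped T X t \<omega> = X (real_of_ereal (min (ereal t) (T \<omega>))) \<omega>"

definition cadlag :: "(real \<Rightarrow> real) \<Rightarrow> bool" where
  "cadlag f \<longleftrightarrow> (\<forall>t\<ge>0. (f \<longlongrightarrow> f t) (at_right t)) \<and> (\<forall>t>0. \<exists>l. (f \<longlongrightarrow> l) (at_left t))"

definition finite_variation_on :: "real \<Rightarrow> real \<Rightarrow> (real \<Rightarrow> real) \<Rightarrow> bool" where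
  "finite_variation_on a b f \<longleftrightarrow>
     (\<exists>K. \<forall>n (p :: nat \<Rightarrow> real). mono p \<and> p ` {..n} \<subseteq> {a..b} \<longrightarrow>
        (\<Sum>i<n. \<bar>f (p (Suc i)) - f (p i)\<bar>) \<le> K)"

definition martingale ::
  "'a measure \<Rightarrow> (real \<Rightarrow> 'a measure) \<Rightarrow> (real \<Rightarrow> 'a \<Rightarrow> real) \<Rightarrow> bool" where
  "martingale M F X \<longleftrightarrow>
     adapted F X \<and> (\<forall>t\<ge>0. integrable M (X t)) \<and>
     (\<forall>s t. 0 \<le> s \<and> s \<le> t \<longrightarrow> (AE \<omega> in M. real_cond_exp M (F s) (X t) \<omega> = X s \<omega>))"

definition local_martingale ::
  "'a measure \<Rightarrow> (real \<Rightarrow> 'a measure) \<Rightarrow> (real \<Rightarrow> 'a \<Rightarrow> real) \<Rightarrow> bool" where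
  "local_martingale M F X \<longleftrightarrow>
     adapted F X \<and> (AE \<omega> in M. cadlag (\<lambda>t. X t \<omega>)) \<and>
     (\<exists>T :: nat \<Rightarrow> 'a \<Rightarrow> ereal.
        (\<forall>n. stopping_time_ext M F (T n)) \<and>
        (AE \<omega> in M. incseq (\<lambda>n. T n \<omega>) \<and> (\<lambda>n. T n \<omega>) \<longlonglongrightarrow> \<infinity>) \<and>
        (\<forall>n. martingale M F (\<lambda>t \<omega>. stopped (T n) X t \<omega> - X 0 \<omega>)))"

definition finite_variation_process ::
  "'a measure \<Rightarrow> (real \<Rightarrow> 'a measure) \<Rightarrow> (real \<Rightarrow> 'a \<Rightarrow> real) \<Rightarrow> bool" where
  "finite_variation_process M F A \<longleftrightarrow>
     adapted F A \<and>
     (AE \<omega> in M. cadlag (\<lambda>t. A t \<omega>) \<and> (\<forall>t\<ge>0. finite_variation_on 0 t (\<lambda>s. A s \<omega>)))"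

definition semimartingale ::
  "'a measure \<Rightarrow> (real \<Rightarrow> 'a measure) \<Rightarrow> (real \<Rightarrow> 'a \<Rightarrow> real) \<Rightarrow> bool" where
  "semimartingale M F X \<longleftrightarrow>
     adapted F X \<and>
     (\<exists>N A. local_martingale M F N \<and> finite_variation_process M F A \<and>
        (AE \<omega> in M. N 0 \<omega> = 0 \<and> A 0 \<omega> = 0 \<and> (\<forall>t\<ge>0. X t \<omega> = X 0 \<omega> + N t \<omega> + A t \<omega>)))"


section \<open>Locally finite signed measures on the open half-line\<close>

text \<open>
  A locally finite signed measure on \<open>(0,\<infinity>)\<close> need not assign a value to every Borel set (its positive
  and negative part may both be infinite).  It is therefore represented by a real-valued set
  function, whose values matter only on the Borel sets that are relatively compact in \<open>(0,\<infinity>)\<close>.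
\<close>

definition rel_compact_borel :: "real set set" where
  "rel_compact_borel = {A \<in> sets borel. \<exists>a b. 0 < a \<and> A \<subseteq> {a..b}}"

definition locally_finite_signed_measure :: "(real set \<Rightarrow> real) \<Rightarrow> bool" where
  "locally_finite_signed_measure \<nu> \<longleftrightarrow>
     (\<forall>A :: nat \<Rightarrow> real set. range A \<subseteq> rel_compact_borel \<and> disjoint_family A \<and>
        (\<Union>i. A i) \<in> rel_compact_borel \<longrightarrow> (\<lambda>i. \<nu> (A i)) sums \<nu> (\<Union>i. A i))"

definition variation :: "(real set \<Rightarrow> real) \<Rightarrow> real set \<Rightarrow> ennreal" where
  "variation \<nu> E =
     (SUP \<A>\<in>{\<A>. finite \<A> \<and> disjoint \<A> \<and> \<A> \<subseteq> rel_compact_borel \<and> \<Union>\<A> \<subseteq> E}.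
        \<Sum>A\<in>\<A>. ennreal \<bar>\<nu> A\<bar>)"

definition variation_measure :: "(real set \<Rightarrow> real) \<Rightarrow> real measure" where
  "variation_measure \<nu> =
     measure_of {0<..} (sets (restrict_space borel {0<..})) (variation \<nu>)"

abbreviation right_derivative :: "(real \<Rightarrow> real) \<Rightarrow> real \<Rightarrow> real" where
  "right_derivative g x \<equiv> vector_derivative g (at_right x)"

text \<open>
  If \<open>g\<close> is a difference of two convex functions on \<open>(0,\<infinity>)\<close>, there is exactly one such \<open>\<nu>\<close>, up to its
  irrelevant values outside \<^const>\<open>rel_compact_borel\<close>.
\<close>

definition second_derivative_measure :: "(real \<Rightarrow> real) \<Rightarrow> (real set \<Rightarrow> real) \<Rightarrow> bool" where
  "second_derivative_measure g \<nu> \<longleftrightarrow>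
     locally_finite_signed_measure \<nu> \<and>
     (\<forall>x y. 0 < x \<and> x < y \<longrightarrow> \<nu> {x<..y} = right_derivative g y - right_derivative g x)"

definition difference_of_convex_on :: "real set \<Rightarrow> (real \<Rightarrow> real) \<Rightarrow> bool" where
  "difference_of_convex_on S g \<longleftrightarrow>
     (\<exists>u v. convex_on S u \<and> convex_on S v \<and> (\<forall>x\<in>S. g x = u x - v x))"


subsection \<open>The variation is a measure\<close>

text \<open>
  \<^const>\<open>measure_of\<close> yields the zero measure when its last argument is not countably additive; the
  following shows that this does not happen in \<^const>\<open>variation_measure\<close>.
\<close>

lemma rel_compact_borel_empty: "{} \<in> rel_compact_borel"
  using zero_less_one[where 'a = real] unfolding rel_compact_borel_def by blast

lemma rel_compact_borel_Int:
  assumes "A \<in> rel_compact_borel" "E \<in> sets borel"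
  shows "A \<inter> E \<in> rel_compact_borel"
proof -
  obtain a b where "0 < a" "A \<subseteq> {a..b}" "A \<in> sets borel"
    using assms(1) by (auto simp: rel_compact_borel_def)
  then have "A \<inter> E \<in> sets borel" "0 < a \<and> A \<inter> E \<subseteq> {a..b}"
    using assms(2) by auto
  then show ?thesis
    unfolding rel_compact_borel_def by blast
qed

lemma locally_finite_signed_measure_empty:
  assumes "locally_finite_signed_measure \<nu>"
  shows "\<nu> {} = 0"
proof -
  define A :: "nat \<Rightarrow> real set" where "A = (\<lambda>_. {})"
  have "range A \<subseteq> rel_compact_borel" "disjoint_family A" "(\<Union>i. A i) \<in> rel_compact_borel"
    by (simp_all add: A_def rel_compact_borel_empty disjoint_family_on_def image_subset_iff)
  then have "(\<lambda>i. \<nu> (A i)) sums \<nu> (\<Union>i. A i)"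
    using assms unfolding locally_finite_signed_measure_def by blast
  then have "(\<lambda>i::nat. \<nu> {}) sums \<nu> {}"
    unfolding A_def by (simp only: UN_empty2)
  then have "(\<lambda>i::nat. \<nu> {}) \<longlonglongrightarrow> 0"
    by (intro summable_LIMSEQ_zero sums_summable)
  then show ?thesis
    by (simp add: LIMSEQ_const_iff)
qed

lemma variation_upper:
  assumes "finite \<A>" "disjoint \<A>" "\<A> \<subseteq> rel_compact_borel" "\<Union>\<A> \<subseteq> E"
  shows "(\<Sum>A\<in>\<A>. ennreal \<bar>\<nu> A\<bar>) \<le> variation \<nu> E"
  unfolding variation_def using assms by (intro SUP_upper) auto

lemma variation_empty:
  assumes "locally_finite_signed_measure \<nu>"
  shows "variation \<nu> {} = 0"
proof -
  have "(\<Sum>A\<in>\<A>. ennreal \<bar>\<nu> A\<bar>) = 0" if "\<Union>\<A> \<subseteq> {}" for \<A>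
    using that locally_finite_signed_measure_empty[OF assms] by (intro sum.neutral) auto
  then show ?thesis
    unfolding variation_def by (intro antisym SUP_least) auto
qed

lemma variation_mono: "E \<subseteq> E' \<Longrightarrow> variation \<nu> E \<le> variation \<nu> E'"
  unfolding variation_def by (intro SUP_subset_mono) auto

lemma variation_superadd:
  assumes \<nu>: "locally_finite_signed_measure \<nu>" and dj: "E1 \<inter> E2 = {}"
  shows "variation \<nu> E1 + variation \<nu> E2 \<le> variation \<nu> (E1 \<union> E2)"
proof -
  define fam where
    "fam E = {\<A>. finite \<A> \<and> disjoint \<A> \<and> \<A> \<subseteq> rel_compact_borel \<and> \<Union>\<A> \<subseteq> E}" for E
  have ne: "fam E \<noteq> {}" for E
    by (auto simp: fam_def disjoint_def intro!: exI[of _ "{}"])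
  have pair: "(\<Sum>A\<in>\<A>. ennreal \<bar>\<nu> A\<bar>) + (\<Sum>A\<in>\<B>. ennreal \<bar>\<nu> A\<bar>) \<le> variation \<nu> (E1 \<union> E2)"
    if A: "\<A> \<in> fam E1" and B: "\<B> \<in> fam E2" for \<A> \<B>
  proof -
    let ?A = "\<A> - {{}}" and ?B = "\<B> - {{}}"
    have eq: "(\<Sum>A\<in>\<C>. ennreal \<bar>\<nu> A\<bar>) = (\<Sum>A\<in>\<C> - {{}}. ennreal \<bar>\<nu> A\<bar>)" if "finite \<C>" for \<C>
      using that locally_finite_signed_measure_empty[OF \<nu>]
      by (intro sum.mono_neutral_right) auto
    have int: "?A \<inter> ?B = {}"
      using A B dj by (fastforce simp: fam_def)
    have dAB: "a \<inter> b = {}" if "a \<in> ?A" "b \<in> ?B" for a b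
    proof -
      have "a \<subseteq> E1" "b \<subseteq> E2" using that A B by (auto simp: fam_def)
      then show ?thesis using dj by auto
    qed
    have "disjoint (?A \<union> ?B)"
      unfolding disjoint_def
    proof (intro ballI impI)
      fix a b assume ab: "a \<in> ?A \<union> ?B" "b \<in> ?A \<union> ?B" "a \<noteq> b"
      have "disjoint \<A>" "disjoint \<B>" using A B by (auto simp: fam_def)
      then show "a \<inter> b = {}"
        using ab dAB[of a b] dAB[of b a] unfolding disjoint_def by blast
    qed
    then have "(\<Sum>A\<in>?A \<union> ?B. ennreal \<bar>\<nu> A\<bar>) \<le> variation \<nu> (E1 \<union> E2)"
      using A B by (intro variation_upper) (auto simp: fam_def)
    then show ?thesis
      using A B eq[of \<A>] eq[of \<B>] int by (simp add: fam_def sum.union_disjoint)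
  qed
  have v: "variation \<nu> E = (SUP \<A>\<in>fam E. \<Sum>A\<in>\<A>. ennreal \<bar>\<nu> A\<bar>)" for E
    by (simp add: variation_def fam_def)
  have one: "variation \<nu> E1 + (\<Sum>A\<in>\<B>. ennreal \<bar>\<nu> A\<bar>) \<le> variation \<nu> (E1 \<union> E2)" if "\<B> \<in> fam E2" for \<B>
    unfolding v[of E1] ennreal_SUP_add_left[OF ne, symmetric]
    using pair that by (intro SUP_least)
  have "variation \<nu> E1 + variation \<nu> E2 =
      (SUP \<B>\<in>fam E2. variation \<nu> E1 + (\<Sum>A\<in>\<B>. ennreal \<bar>\<nu> A\<bar>))"
    unfolding v[of E2] by (rule ennreal_SUP_add_right[OF ne])
  also have "\<dots> \<le> variation \<nu> (E1 \<union> E2)"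
    using one by (intro SUP_least)
  finally show ?thesis .
qed

lemma variation_sum_le:
  assumes \<nu>: "locally_finite_signed_measure \<nu>" and dj: "disjoint_family (E :: nat \<Rightarrow> real set)"
  shows "(\<Sum>i<n. variation \<nu> (E i)) \<le> variation \<nu> (\<Union>i<n. E i)"
proof (induction n)
  case 0
  then show ?case by simp
next
  case (Suc n)
  have "(\<Sum>i<Suc n. variation \<nu> (E i)) \<le> variation \<nu> (\<Union>i<n. E i) + variation \<nu> (E n)"
    using Suc by (simp add: add_right_mono)
  also have "\<dots> \<le> variation \<nu> ((\<Union>i<n. E i) \<union> E n)"
  proof (rule variation_superadd[OF \<nu>])
    have "E i \<inter> E n = {}" if "i < n" for i
      using disjoint_family_onD[OF dj, of i n] that by simp
    then show "(\<Union>i<n. E i) \<inter> E n = {}"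
      by blast
  qed
  also have "(\<Union>i<n. E i) \<union> E n = (\<Union>i<Suc n. E i)"
    by (simp add: lessThan_Suc Un_commute)
  finally show ?case .
qed

lemma abs_le_suminf_variation:
  assumes "f sums (s::real)"
  shows "ennreal \<bar>s\<bar> \<le> (\<Sum>i. ennreal \<bar>f i\<bar>)"
proof (cases "(\<Sum>i. ennreal \<bar>f i\<bar>) = \<infinity>")
  case False
  then have s: "summable (\<lambda>i. \<bar>f i\<bar>)"
    by (intro summable_suminf_not_top) (simp_all add: infinity_ennreal_def)
  have "\<bar>s\<bar> \<le> (\<Sum>i. \<bar>f i\<bar>)"
    using summable_rabs[OF s] assms by (simp add: sums_iff)
  then show ?thesis
    using s by (simp add: suminf_ennreal2 ennreal_leI)
qed simp

lemma variation_countable_subadd: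
  assumes \<nu>: "locally_finite_signed_measure \<nu>" and dj: "disjoint_family E"
    and E: "\<And>i::nat. E i \<in> sets borel"
  shows "variation \<nu> (\<Union>i. E i) \<le> (\<Sum>i. variation \<nu> (E i))"
  unfolding variation_def[of \<nu> "\<Union>i. E i"]
proof (intro SUP_least, clarify)
  fix \<A> assume A: "finite \<A>" "disjoint \<A>" "\<A> \<subseteq> rel_compact_borel" "\<Union>\<A> \<subseteq> (\<Union>i. E i)"
  have *: "ennreal \<bar>\<nu> a\<bar> \<le> (\<Sum>i. ennreal \<bar>\<nu> (a \<inter> E i)\<bar>)" if "a \<in> \<A>" for a
  proof (rule abs_le_suminf_variation)
    have eq: "(\<Union>i. a \<inter> E i) = a" using that A by auto
    have "range (\<lambda>i. a \<inter> E i) \<subseteq> rel_compact_borel"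
      using that A E by (auto intro!: rel_compact_borel_Int)
    moreover have "disjoint_family (\<lambda>i. a \<inter> E i)"
      using dj by (auto simp: disjoint_family_on_def)
    ultimately have "(\<lambda>i. \<nu> (a \<inter> E i)) sums \<nu> (\<Union>i. a \<inter> E i)"
      using that A(3)
      by (intro \<nu>[unfolded locally_finite_signed_measure_def, rule_format]) (auto simp only: eq)
    then show "(\<lambda>i. \<nu> (a \<inter> E i)) sums \<nu> a" by (simp only: eq)
  qed
  have **: "(\<Sum>a\<in>\<A>. ennreal \<bar>\<nu> (a \<inter> E i)\<bar>) \<le> variation \<nu> (E i)" for i
  proof -
    let ?A = "{a\<in>\<A>. a \<inter> E i \<noteq> {}}"
    have "(\<Sum>a\<in>\<A>. ennreal \<bar>\<nu> (a \<inter> E i)\<bar>) = (\<Sum>a\<in>?A. ennreal \<bar>\<nu> (a \<inter> E i)\<bar>)"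
      using A locally_finite_signed_measure_empty[OF \<nu>] by (intro sum.mono_neutral_right) auto
    also have "\<dots> = (\<Sum>b\<in>(\<lambda>a. a \<inter> E i) ` ?A. ennreal \<bar>\<nu> b\<bar>)"
    proof -
      have "inj_on (\<lambda>a. a \<inter> E i) ?A"
      proof (rule inj_onI)
        fix a b assume "a \<in> ?A" "b \<in> ?A" "a \<inter> E i = b \<inter> E i"
        then show "a = b"
          using A(2) unfolding disjoint_def by blast
      qed
      then show ?thesis
        by (simp add: sum.reindex)
    qed
    also have "\<dots> \<le> variation \<nu> (E i)"
    proof (rule variation_upper)
      show "finite ((\<lambda>a. a \<inter> E i) ` ?A)"
        using A(1) by simp
      show "disjoint ((\<lambda>a. a \<inter> E i) ` ?A)"
        using A(2) unfolding disjoint_def by blast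
      show "(\<lambda>a. a \<inter> E i) ` ?A \<subseteq> rel_compact_borel"
        using A(3) rel_compact_borel_Int[OF _ E] by blast
      show "\<Union> ((\<lambda>a. a \<inter> E i) ` ?A) \<subseteq> E i"
        by blast
    qed
    finally show ?thesis .
  qed
  have "(\<Sum>a\<in>\<A>. ennreal \<bar>\<nu> a\<bar>) \<le> (\<Sum>a\<in>\<A>. \<Sum>i. ennreal \<bar>\<nu> (a \<inter> E i)\<bar>)"
    using * by (rule sum_mono)
  also have "\<dots> = (\<Sum>i. \<Sum>a\<in>\<A>. ennreal \<bar>\<nu> (a \<inter> E i)\<bar>)"
    by (rule suminf_sum[symmetric]) auto
  also have "\<dots> \<le> (\<Sum>i. variation \<nu> (E i))"
    using ** by (intro suminf_le) auto
  finally show "(\<Sum>a\<in>\<A>. ennreal \<bar>\<nu> a\<bar>) \<le> (\<Sum>i. variation \<nu> (E i))" .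
qed

lemma sigma_algebra_pos: "sigma_algebra {0<..} (sets (restrict_space borel {0::real<..}))"
  using sets.sigma_algebra_axioms[of "restrict_space borel {0::real<..}"]
  by (simp add: space_restrict_space)

lemma sets_variation_measure: "sets (variation_measure \<nu>) = sets (restrict_space borel {0<..})"
  unfolding variation_measure_def by (rule sigma_algebra.sets_measure_of_eq[OF sigma_algebra_pos])

lemma emeasure_variation_measure:
  assumes \<nu>: "locally_finite_signed_measure \<nu>"
    and E: "E \<in> sets borel" "E \<subseteq> {0<..}"
  shows "emeasure (variation_measure \<nu>) E = variation \<nu> E"
proof (rule emeasure_measure_of[OF variation_measure_def])
  show "sets (restrict_space borel {0<..}) \<subseteq> Pow {0::real<..}"
    by (auto simp: sets_restrict_space)
  show "E \<in> sets (variation_measure \<nu>)"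
    using E by (simp add: sets_variation_measure sets_restrict_space_iff)
  show "positive (sets (variation_measure \<nu>)) (variation \<nu>)"
    by (simp add: positive_def variation_empty[OF \<nu>])
  show "countably_additive (sets (variation_measure \<nu>)) (variation \<nu>)"
  proof (rule countably_additiveI)
    fix A :: "nat \<Rightarrow> real set"
    assume A: "range A \<subseteq> sets (variation_measure \<nu>)" "disjoint_family A"
    have "A i \<in> sets borel" for i
      using A(1) sets_restrict_space_iff[of "{0::real<..}" borel "A i"]
      by (auto simp: sets_variation_measure)
    then have "variation \<nu> (\<Union>i. A i) \<le> (\<Sum>i. variation \<nu> (A i))"
      by (rule variation_countable_subadd[OF \<nu> A(2)])
    moreover have "(\<Sum>i. variation \<nu> (A i)) \<le> variation \<nu> (\<Union>i. A i)"
    proof (rule suminf_le_const)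
      show "(\<Sum>i<n. variation \<nu> (A i)) \<le> variation \<nu> (\<Union>i. A i)" for n
        by (rule order_trans[OF variation_sum_le[OF \<nu> A(2)] variation_mono]) auto
    qed auto
    ultimately show "(\<Sum>i. variation \<nu> (A i)) = variation \<nu> (\<Union>i. A i)"
      by simp
  qed
qed

end

theory Submission
 imports Defs
begin

text \<open>
 Both analytic conditions say that \<open>g\<close> is on \<open>(0,\<infinity>)\<close> a difference of convex functions that are bounded near
 \<open>0\<close>: for a convex \<open>p\<close>, boundedness near \<open>0\<close> and integrability of \<open>x\<close> against \<open>p''\<close> near \<open>0\<close> are equivalent.

 If \<open>g(B)\<close> stopped at \<open>0\<close> is a semimartingale, localise so that its variation part is bounded and sample it along
 the simple random walk that \<open>B\<close> performs on the lattice of mesh \<open>d\<close>. The conditional drift of a step from \<open>k d\<close> is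
 half the second difference of \<open>g\<close>, so the expected occupation sum of the absolute second differences is bounded
 uniformly in \<open>d\<close>. Occupation times of the walk are given by the Green function, which near \<open>0\<close> is proportional
 to \<open>x\<close>; as \<open>d\<close> tends to \<open>0\<close>, the sums over positive and over negative second differences converge to
 two convex functions with difference \<open>g\<close>.

 Conversely, for a convex \<open>h\<close> the Ito sums of \<open>h'(B)\<close> converge to a martingale part up to the exit from compact
 intervals, and \<open>h(B)\<close> minus this part is increasing by the supporting line inequality. Its expectation stays
 bounded as the lower end point tends to \<open>0\<close> because \<open>h\<close> is bounded there, so it extends past the hitting
 time. A jump of \<open>g\<close> at \<open>0\<close> adds only a process with a single jump.
\<close>

section \<open>Convex functions on the open half-line\<close>

text \<open>The obstacle in the forward direction is that the localisation (horizon, stopping time,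
  bound on the variation) holds only on an event of large probability, while the Green function
  describes the whole expectation. A second moment estimate for the occupation sum closes this gap:
  its square has expectation at most twice the maximum of the potential times the value at the
  start, and because the start is a fixed fraction of the interval, that maximum is at most
  \<open>m\<close> times the value at the start. Hence a bad event of probability
  \<open>1 / (8 * m^2)\<close>, independent of the mesh, can be absorbed. The usual conditions are
  not assumed and paths are regular only almost surely. So optional stopping is exact only at dyadic
  grid times, which approximate hitting times from above; the side matters because \<open>g\<close>
  may jump at \<open>0\<close>. In the converse, the martingale and the increasing part are given by
  limits and suprema for every outcome, which makes them adapted to the raw filtration; only their
  path properties hold almost surely.\<close>

lemmas leb_integrable_add = Bochner_Integration.integrable_add
  and leb_integrable_bound = Bochner_Integration.integrable_bound
  and leb_integrable_cong = Bochner_Integration.integrable_cong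
  and leb_integrable_diff = Bochner_Integration.integrable_diff
  and leb_integrable_sum = Bochner_Integration.integrable_sum
  and leb_integral_add = Bochner_Integration.integral_add
  and leb_integral_cong = Bochner_Integration.integral_cong
  and leb_integral_diff = Bochner_Integration.integral_diff
  and leb_integral_mult_right_zero = Bochner_Integration.integral_mult_right_zero
  and leb_integral_nonneg = Bochner_Integration.integral_nonneg
  and leb_integral_sum = Bochner_Integration.integral_sum

lemma convex_pos_slope:
 fixes f :: "real => real"
 assumes "convex_on {0<..} f" "0 < x" "x < t" "t < y"
 shows "(f t - f x) / (t - x) <= (f y - f x) / (y - x)"
  and "(f y - f x) / (y - x) <= (f y - f t) / (y - t)"
proof -
 have swap: "(a - b) / (c - d) = (b - a) / (d - c)" for a b c d :: real
  by (metis minus_diff_eq minus_divide_divide)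
 have xy: "x \<in> {0<..}" "y \<in> {0<..}" using assms by auto
 show "(f t - f x) / (t - x) <= (f y - f x) / (y - x)"
  using convex_on_slope_le(1)[OF assms(1) xy assms(3,4)]
  by (simp only: swap[of "f x" _ x])
 show "(f y - f x) / (y - x) <= (f y - f t) / (y - t)"
  using convex_on_slope_le(2)[OF assms(1) xy assms(3,4)]
  by (simp only: swap[of _ "f y" _ y])
qed

text \<open>The slopes \<open>s y\<close> decrease as \<open>y\<close> decreases to \<open>x\<close>
  and are bounded below by the slope to \<open>x/2\<close>, so their infimum is the right
  derivative. All three conclusions are read off from this infimum.\<close>

lemma convex_pos_right_derivative:
 fixes f :: "real => real"
 assumes f: "convex_on {0<..} f" and x: "0 < x"
 shows has_right_derivative_convex: "(f has_vector_derivative right_derivative f x) (at_right x)"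
  and right_derivative_le_slope: "x < y ==> right_derivative f x <= (f y - f x) / (y - x)"
  and slope_le_right_derivative: "0 < y ==> y < x ==> (f x - f y) / (x - y) <= right_derivative f x"
proof -
 define s where "s y = (f y - f x) / (y - x)" for y
 define L where "L = Inf (s ` {x<..})"
 have left: "(f x - f y) / (x - y) <= s z" if "0 < y" "y < x" "x < z" for y z
  using convex_pos_slope[OF f that] by (simp add: s_def)
 have "(f x - f (x/2)) / (x - x/2) <= s z" if "x < z" for z
  using left[of "x/2" z] x that by simp
 then have bdd: "bdd_below (s ` {x<..})"
  by (intro bdd_belowI[of _ "(f x - f (x/2)) / (x - x/2)"]) auto
 have Ls: "L <= s z" if "x < z" for z
  unfolding L_def using that bdd by (intro cInf_lower) auto
 have sL: "(f x - f y) / (x - y) <= L" if "0 < y" "y < x" for y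
  unfolding L_def by (rule cInf_greatest) (use left that in auto)
 have "(s \<longlongrightarrow> L) (at_right x)"
 proof (rule order_tendstoI)
  fix a assume "a < L"
  then show "\<forall>\<^sub>F z in at_right x. a < s z"
   using Ls by (auto simp: eventually_at_right_field intro!: exI[of _ "x+1"]) (meson less_le_trans)
 next
  fix a assume "L < a"
  then obtain y where y: "x < y" "s y < a"
   unfolding L_def using bdd cInf_lessD[of "s ` {x<..}" a] by auto
  have "s z < a" if "x < z" "z < y" for z
   using convex_pos_slope(1)[OF f x that] y(2) by (simp add: s_def)
  then show "\<forall>\<^sub>F z in at_right x. s z < a"
   using y(1) by (auto simp: eventually_at_right_field)
 qed
 then have "(f has_vector_derivative L) (at_right x)"
  unfolding has_real_derivative_iff_has_vector_derivative[symmetric] has_field_derivative_iff s_def .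
 moreover from this have "right_derivative f x = L"
  by (intro vector_derivative_within) auto
 ultimately show "(f has_vector_derivative right_derivative f x) (at_right x)"
  "x < y ==> right_derivative f x <= (f y - f x) / (y - x)"
  "0 < y ==> y < x ==> (f x - f y) / (x - y) <= right_derivative f x"
  using Ls sL by (simp_all add: s_def)
qed

lemma convex_pos_support:
 fixes f :: "real => real"
 assumes f: "convex_on {0<..} f" and x: "0 < x" and y: "0 < y"
 shows "f x + right_derivative f x * (y - x) <= f y"
proof (cases x y rule: linorder_cases)
 case less
 then show ?thesis
  using right_derivative_le_slope[OF f x less] by (simp add: field_simps)
next
 case greater
 then show ?thesis
  using slope_le_right_derivative[OF f x y greater] by (simp add: field_simps)
qed simp

lemma right_derivative_mono_convex:
 fixes f :: "real => real"
 assumes f: "convex_on {0<..} f" and "0 < x" "x <= y"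
 shows "right_derivative f x <= right_derivative f y"
proof (cases "x = y")
 case False
 then show ?thesis
  using right_derivative_le_slope[OF f, of x y] slope_le_right_derivative[OF f, of y x] assms
  by simp
qed simp

lemma convex_pos_continuous:
 fixes f :: "real => real"
 shows "convex_on {0<..} f ==> continuous_on {0<..} f"
 by (rule convex_on_continuous) auto

text \<open>For the upper bound, fix \<open>y\<close> whose slope from \<open>x\<close> is below
  \<open>a\<close>. By continuity of \<open>f\<close> the slope from a nearby \<open>z\<close> to
  the same \<open>y\<close> is still below \<open>a\<close>, and it dominates the right derivative
  at \<open>z\<close>.\<close>

lemma right_derivative_right_continuous:
 fixes f :: "real => real"
 assumes f: "convex_on {0<..} f" and x: "0 < x"
 shows "(right_derivative f \<longlongrightarrow> right_derivative f x) (at_right x)"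
proof (rule order_tendstoI)
 fix a assume a: "a < right_derivative f x"
 show "\<forall>\<^sub>F z in at_right x. a < right_derivative f z"
  unfolding eventually_at_right_field
  by (intro exI[of _ "x+1"]) (use a right_derivative_mono_convex[OF f x] in \<open>auto intro: less_le_trans\<close>)
next
 fix a assume a: "right_derivative f x < a"
 have "((%y. (f y - f x) / (y - x)) \<longlongrightarrow> right_derivative f x) (at_right x)"
  using has_right_derivative_convex[OF f x]
  unfolding has_real_derivative_iff_has_vector_derivative[symmetric] has_field_derivative_iff .
 then have "\<forall>\<^sub>F y in at_right x. (f y - f x) / (y - x) < a"
  using a by (rule order_tendstoD)
 then obtain y where y: "x < y" "(f y - f x) / (y - x) < a"
  unfolding eventually_at_right_field by (meson dense)
 have "continuous (at x) f"
  using convex_pos_continuous[OF f] x by (simp add: continuous_on_eq_continuous_at)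
 then have "(f \<longlongrightarrow> f x) (at_right x)"
  by (simp add: continuous_within filterlim_at_split)
 then have "((%z. (f y - f z) / (y - z)) \<longlongrightarrow> (f y - f x) / (y - x)) (at_right x)"
  by (intro tendsto_intros) (use y in auto)
 then have "\<forall>\<^sub>F z in at_right x. (f y - f z) / (y - z) < a"
  using y by (intro order_tendstoD)
 moreover have "\<forall>\<^sub>F z in at_right x. x < z & z < y"
  using y by (auto simp: eventually_at_right_field)
 ultimately show "\<forall>\<^sub>F z in at_right x. right_derivative f z < a"
 proof eventually_elim
  case (elim z)
  then show ?case
   using right_derivative_le_slope[OF f, of z y] x by auto
 qed
qed

text \<open>The largest point up to which the inequality with slope \<open>k - e\<close> holds cannot lie before \<open>b\<close>.\<close>

lemma right_derivative_ge_imp_increment_ge: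
 fixes f :: "real => real"
 assumes ab: "a <= b" and cont: "continuous_on {a..b} f"
  and D: "!!x. a <= x ==> x < b ==> (f has_vector_derivative D x) (at_right x)"
  and k: "!!x. a <= x ==> x < b ==> k <= D x"
 shows "k * (b - a) <= f b - f a"
proof (rule field_le_epsilon)
 fix e :: real assume e: "0 < e"
 define e' where "e' = e / (b - a + 1)"
 have e': "0 < e'" using e ab by (simp add: e'_def)
 define T where "T = {x\<in>{a..b}. (k - e') * (x - a) <= f x - f a}"
 have cl: "closed T"
  unfolding T_def by (rule continuous_on_closed_Collect_le) (auto intro!: continuous_intros cont)
 have "a \<in> T" and bdd: "bdd_above T"
  using ab by (auto simp: T_def intro!: bdd_aboveI[of _ b])
 then have S: "Sup T \<in> T"
  using closed_contains_Sup[OF _ bdd cl] by auto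
 have "\<not> Sup T < b"
 proof
  assume lt: "Sup T < b"
  let ?s = "Sup T"
  have s: "a <= ?s" using S by (auto simp: T_def)
  have "((%y. (f y - f ?s) / (y - ?s)) \<longlongrightarrow> D ?s) (at_right ?s)"
   using D[OF s lt]
   unfolding has_real_derivative_iff_has_vector_derivative[symmetric] has_field_derivative_iff .
  then have "\<forall>\<^sub>F y in at_right ?s. k - e' < (f y - f ?s) / (y - ?s)"
   using k[OF s lt] e' by (intro order_tendstoD) auto
  moreover have "\<forall>\<^sub>F y in at_right ?s. ?s < y & y < b"
   using lt by (auto simp: eventually_at_right_field)
  ultimately have "\<forall>\<^sub>F y in at_right ?s. (k - e') * (y - ?s) < f y - f ?s & ?s < y & y < b"
   by eventually_elim (auto simp: field_simps)
  then obtain y where y: "(k - e') * (y - ?s) < f y - f ?s" "?s < y" "y < b"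
   using eventually_happens[of _ "at_right ?s"] by auto
  have "(k - e') * (?s - a) <= f ?s - f a" using S by (auto simp: T_def)
  then have "y \<in> T" using y s by (auto simp: T_def algebra_simps)
  then have "y <= ?s" using bdd by (rule cSup_upper)
  then show False using y by simp
 qed
 then have "Sup T = b" using S by (auto simp: T_def)
 then have "(k - e') * (b - a) <= f b - f a" using S by (auto simp: T_def)
 moreover have "e' * (b - a) <= e"
  using ab e by (simp add: e'_def field_simps)
 ultimately show "k * (b - a) <= f b - f a + e"
  by (simp add: algebra_simps)
qed

text \<open>The convexity of the functions built later is visible only through their right
  derivatives. Monotonicity of \<open>D\<close> yields a supporting line at every point: to the
  right by the increment bound for \<open>f\<close>, to the left by the same bound for
  \<open>- f\<close>.\<close>

lemma convex_on_right_derivativeI: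
 fixes f :: "real => real"
 assumes cont: "continuous_on {0<..} f"
  and D: "!!x. 0 < x ==> (f has_vector_derivative D x) (at_right x)"
  and mono: "!!x y. 0 < x ==> x <= y ==> D x <= D y"
 shows "convex_on {0<..} f"
proof (rule pos_convex_function)
 fix x y :: real assume "x \<in> {0<..}" "y \<in> {0<..}"
 then have x: "0 < x" and y: "0 < y" by auto
 show "D x * (y - x) <= f y - f x"
 proof (cases "x <= y")
  case True
  show ?thesis
   using True x by (intro right_derivative_ge_imp_increment_ge[where D = D])
    (auto intro!: D mono continuous_on_subset[OF cont])
 next
  case False
  have "- D x * (x - y) <= - f x - - f y"
   using False y by (intro right_derivative_ge_imp_increment_ge[where D = "%x. - D x"])
    (auto intro!: has_vector_derivative_minus D mono continuous_on_subset[OF cont] continuous_intros)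
  then show ?thesis by (simp add: algebra_simps)
 qed
qed auto

section \<open>The second derivative measure of a difference of convex functions\<close>

lemma right_derivative_diff:
 fixes g p q :: "real => real"
 assumes p: "convex_on {0<..} p" and q: "convex_on {0<..} q"
  and g: "!!x. 0 < x ==> g x = p x - q x" and x: "0 < x"
 shows "(g has_vector_derivative right_derivative p x - right_derivative q x) (at_right x)"
  and "right_derivative g x = right_derivative p x - right_derivative q x"
proof -
 have "((%x. p x - q x) has_vector_derivative right_derivative p x - right_derivative q x) (at_right x)"
  by (intro has_vector_derivative_diff has_right_derivative_convex p q x)
 then show *: "(g has_vector_derivative right_derivative p x - right_derivative q x) (at_right x)"
  unfolding has_real_derivative_iff_has_vector_derivative[symmetric] has_field_derivative_iff
 proof (rule Lim_transform_eventually)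
  show "\<forall>\<^sub>F y in at_right x. (p y - q y - (p x - q x)) / (y - x) = (g y - g x) / (y - x)"
   using x g by (auto simp: eventually_at_right_field intro!: exI[of _ "x+1"])
 qed
 then show "right_derivative g x = right_derivative p x - right_derivative q x"
  by (intro vector_derivative_within) auto
qed

text \<open>The measure with distribution function \<open>right_derivative p\<close> on \<open>(0,\<infinity>)\<close>; the substitution
 \<open>x = exp y\<close> moves it to the whole line, where \<^const>\<open>interval_measure\<close> applies.\<close>

definition convex_measure :: "(real => real) => real measure" where
 "convex_measure p = distr (interval_measure (%y. right_derivative p (exp y))) borel exp"

lemma sets_convex_measure [simp]: "sets (convex_measure p) = sets borel"
 by (simp add: convex_measure_def)

lemma emeasure_convex_measure_Ioc:
 assumes p: "convex_on {0<..} p" and "0 < x" "x <= y"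
 shows "emeasure (convex_measure p) {x<..y} = ennreal (right_derivative p y - right_derivative p x)"
proof -
 have "exp -` {x<..y} = {ln x<..ln y}"
 proof -
  have "x < exp z \<longleftrightarrow> ln x < z" "exp z <= y \<longleftrightarrow> z <= ln y" for z
   using assms by (metis exp_ln exp_less_cancel_iff) (metis assms(2,3) exp_ln exp_le_cancel_iff less_le_trans)
  then show ?thesis by auto
 qed
 moreover have "continuous (at_right a) (%y. right_derivative p (exp y))" for a
 proof -
  have "filterlim exp (at_right (exp a)) (at_right a)"
   unfolding filterlim_at
   by (auto intro!: tendsto_intros simp: eventually_at_right_field) (meson gt_ex)
  from filterlim_compose[OF right_derivative_right_continuous[OF p] this]
  show ?thesis by (simp add: continuous_within)
 qed
 ultimately show ?thesis
  using assms unfolding convex_measure_def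
  by (subst emeasure_distr)
   (auto simp: emeasure_interval_measure_Ioc right_derivative_mono_convex[OF p])
qed

lemma emeasure_convex_measure_finite:
 assumes p: "convex_on {0<..} p" and A: "A \<in> rel_compact_borel"
 shows "emeasure (convex_measure p) A < \<infinity>"
proof -
 obtain a b where ab: "0 < a" "A \<subseteq> {a..b}"
  using A by (auto simp: rel_compact_borel_def)
 have "emeasure (convex_measure p) A <= emeasure (convex_measure p) {a/2<..max a b}"
  using ab by (intro emeasure_mono) auto
 also have "... < \<infinity>"
  using ab by (subst emeasure_convex_measure_Ioc[OF p]) auto
 finally show ?thesis .
qed

text \<open>Since \<open>measure\<close> turns infinite values into \<open>0\<close>, this
  difference is meaningful only on \<open>rel_compact_borel\<close>, where both measures are
  finite.\<close>

definition diff_measure :: "(real => real) => (real => real) => real set => real" where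
 "diff_measure p q A = measure (convex_measure p) A - measure (convex_measure q) A"

lemma second_derivative_measure_diff:
 assumes p: "convex_on {0<..} p" and q: "convex_on {0<..} q"
  and g: "!!x. 0 < x ==> g x = p x - q x"
 shows "second_derivative_measure g (diff_measure p q)"
 unfolding second_derivative_measure_def
proof (intro conjI allI impI)
 show "locally_finite_signed_measure (diff_measure p q)"
  unfolding locally_finite_signed_measure_def diff_measure_def
 proof (intro allI impI sums_diff)
  fix A :: "nat => real set"
  assume A: "range A \<subseteq> rel_compact_borel & disjoint_family A & (\<Union>i. A i) \<in> rel_compact_borel"
  then have "range A \<subseteq> sets borel" by (auto simp: rel_compact_borel_def)
  then show "(%i. measure (convex_measure p) (A i)) sums measure (convex_measure p) (\<Union>i. A i)"
   "(%i. measure (convex_measure q) (A i)) sums measure (convex_measure q) (\<Union>i. A i)"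
   using A emeasure_convex_measure_finite[OF p, of "\<Union>i. A i"]
    emeasure_convex_measure_finite[OF q, of "\<Union>i. A i"]
   by (auto intro!: measure_UNION)
 qed
next
 fix x y :: real assume xy: "0 < x & x < y"
 have "measure (convex_measure f) {x<..y} = right_derivative f y - right_derivative f x"
  if "convex_on {0<..} f" for f
  using xy right_derivative_mono_convex[OF that, of x y]
  by (simp add: measure_def emeasure_convex_measure_Ioc[OF that])
 then show "diff_measure p q {x<..y} = right_derivative g y - right_derivative g x"
  using xy p q by (simp add: diff_measure_def right_derivative_diff(2)[OF p q g])
qed

lemma variation_diff_measure_le:
 assumes p: "convex_on {0<..} p" and q: "convex_on {0<..} q" and E: "E \<in> sets borel"
 shows "variation (diff_measure p q) E <= emeasure (convex_measure p) E + emeasure (convex_measure q) E"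
 unfolding variation_def
proof (rule SUP_least, clarify)
 fix \<A> assume A: "finite \<A>" "disjoint \<A>" "\<A> \<subseteq> rel_compact_borel" "\<Union>\<A> \<subseteq> E"
 have meas: "\<A> \<subseteq> sets borel" using A by (auto simp: rel_compact_borel_def)
 have "ennreal \<bar>diff_measure p q B\<bar> <= emeasure (convex_measure p) B + emeasure (convex_measure q) B"
  if "B \<in> \<A>" for B
 proof -
  have fin: "emeasure (convex_measure p) B < \<infinity>" "emeasure (convex_measure q) B < \<infinity>"
   using A that emeasure_convex_measure_finite[OF p] emeasure_convex_measure_finite[OF q] by auto
  have "ennreal \<bar>diff_measure p q B\<bar> <= ennreal (measure (convex_measure p) B + measure (convex_measure q) B)"
   unfolding diff_measure_def by (intro ennreal_leI) (smt (verit) measure_nonneg)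
  also have "... = emeasure (convex_measure p) B + emeasure (convex_measure q) B"
   using fin by (simp add: emeasure_eq_ennreal_measure top.not_eq_extremum)
  finally show ?thesis .
 qed
 then have "(\<Sum>B\<in>\<A>. ennreal \<bar>diff_measure p q B\<bar>)
   <= (\<Sum>B\<in>\<A>. emeasure (convex_measure p) B + emeasure (convex_measure q) B)"
  by (rule sum_mono)
 also have "... = emeasure (convex_measure p) (\<Union>\<A>) + emeasure (convex_measure q) (\<Union>\<A>)"
 proof -
  have "disjoint_family_on (%B. B) \<A>"
   using A(2) unfolding disjoint_family_on_def disjoint_def by blast
  then show ?thesis
   using sum_emeasure[of "%B. B" \<A> "convex_measure p"] sum_emeasure[of "%B. B" \<A> "convex_measure q"] A meas
   by (simp add: sum.distrib)
 qed
 also have "... <= emeasure (convex_measure p) E + emeasure (convex_measure q) E"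
  using A E by (intro add_mono emeasure_mono) auto
 finally show "(\<Sum>B\<in>\<A>. ennreal \<bar>diff_measure p q B\<bar>) <= ..." .
qed

text \<open>Boundedness of \<open>p\<close> and \<open>q\<close> near \<open>0\<close> replaces the integrability condition on \<open>|g''|\<close>.\<close>

definition convex_diff_pos :: "(real => real) => bool" where
 "convex_diff_pos g \<longleftrightarrow> (\<exists>p q. convex_on {0<..} p & convex_on {0<..} q &
  (\<exists>C. \<forall>x\<in>{0<..1}. p x <= C & q x <= C) & (\<forall>x>0. g x = p x - q x))"

section \<open>Boundedness near \<open>0\<close> against integrability of \<open>x\<close>\<close>

lemma convex_pos_bounded_below:
 fixes p :: "real => real"
 assumes p: "convex_on {0<..} p" and b: "0 < b"
 shows "\<exists>C. \<forall>x\<in>{0<..b}. C <= p x"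
proof (intro exI ballI)
 fix x assume x: "x \<in> {0<..b}"
 have "abs (right_derivative p 1 * (x - 1)) <= abs (right_derivative p 1) * (b + 1)"
  unfolding abs_mult using x by (intro mult_left_mono) auto
 then show "p 1 - abs (right_derivative p 1) * (b + 1) <= p x"
  using convex_pos_support[OF p, of 1 x] x by auto
qed

text \<open>Dyadic decomposition of the integral of \<open>x\<close> and two bounds from convexity make the sum telescope.\<close>

lemma suminf_dyadic_convex_measure_finite:
 fixes C :: real
 assumes p: "convex_on {0<..} p" and C: "!!x. x \<in> {0<..2} ==> abs (p x) <= C"
 shows "(\<Sum>k. ennreal ((1/2)^k) * emeasure (convex_measure p) {(1/2)^Suc k<..(1/2)^k}) <= ennreal (10 * C)"
proof (rule suminf_le_const)
 fix n
 define P where "P k = right_derivative p ((1/2)^k)" for k :: nat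
 define r where "r k = p (2 * (1/2)^k)" for k :: nat
 have P_mono: "P (Suc k) <= P k" for k
  unfolding P_def by (intro right_derivative_mono_convex[OF p]) auto
 \<comment> \<open>With \<open>x = (1/2)^k\<close> the two slopes are taken over
   \<open>(x, 2x)\<close> and \<open>(x/4, x/2)\<close>, the neighbours of the shell
   \<open>(x/2, x]\<close>; the factor 4 comes from the length \<open>x/4\<close> of the second
   one.\<close>
 have step: "(1/2)^k * (P k - P (Suc k)) <= (r k - r (Suc k)) - 4 * (r (Suc (Suc k)) - r (Suc (Suc (Suc k))))" for k
 proof -
  define x :: real where "x = (1/2)^k"
  have x: "0 < x" by (simp add: x_def)
  have "P k <= (p (2*x) - p x) / (2*x - x)"
   unfolding P_def x_def[symmetric] using x by (intro right_derivative_le_slope[OF p]) auto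
  then have "x * P k <= p (2*x) - p x" using x by (simp add: field_simps)
  moreover have "(p (x/2) - p (x/4)) / (x/2 - x/4) <= P (Suc k)"
   unfolding P_def power_Suc x_def[symmetric]
   using x slope_le_right_derivative[OF p, of "x/2" "x/4"] by simp
  then have "4 * (p (x/2) - p (x/4)) <= x * P (Suc k)" using x by (simp add: field_simps)
  ultimately show ?thesis
   unfolding r_def x_def[symmetric] by (simp add: algebra_simps x_def[symmetric])
 qed
 have r: "abs (r k) <= C" for k
  unfolding r_def by (intro C) (auto simp: power_le_one)
 have telescope: "(\<Sum>k<n. (r k - r (Suc k)) - 4 * (r (Suc (Suc k)) - r (Suc (Suc (Suc k)))))
   = r 0 - r n - 4 * (r 2 - r (Suc (Suc n)))"
  by (induction n) (auto simp: numeral_2_eq_2)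
 have "(\<Sum>k<n. ennreal ((1/2)^k) * emeasure (convex_measure p) {(1/2)^Suc k<..(1/2)^k})
   = (\<Sum>k<n. ennreal ((1/2)^k * (P k - P (Suc k))))"
  using P_mono by (intro sum.cong refl, subst emeasure_convex_measure_Ioc[OF p])
   (auto simp: P_def ennreal_mult)
 also have "... = ennreal (\<Sum>k<n. (1/2)^k * (P k - P (Suc k)))"
  using P_mono by (intro sum_ennreal) auto
 also have "... <= ennreal (10 * C)"
 proof (rule ennreal_leI)
  have "(\<Sum>k<n. (1/2)^k * (P k - P (Suc k))) <= r 0 - r n - 4 * (r 2 - r (Suc (Suc n)))"
   unfolding telescope[symmetric] by (intro sum_mono step)
  \<comment> \<open>The four surviving values of \<open>r\<close> have coefficients of size 1, 1, 4
    and 4.\<close>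
  also have "... <= 10 * C"
   using r[of 0] r[of n] r[of 2] r[of "Suc (Suc n)"] by (smt (verit))
  finally show "(\<Sum>k<n. (1/2)^k * (P k - P (Suc k))) <= 10 * C" .
 qed
 finally show "(\<Sum>k<n. ennreal ((1/2)^k) * emeasure (convex_measure p) {(1/2)^Suc k<..(1/2)^k}) <= ennreal (10 * C)" .
qed auto

lemma dyadic_shell:
 assumes "0 < x" "x < (1::real)"
 obtains k :: nat where "x \<in> {(1/2)^Suc k<..(1/2)^k}"
proof -
 obtain n where n: "(1/2)^n < x"
  using real_arch_pow_inv[of x "1/2"] assms by auto
 define m where "m = (LEAST n. (1/2)^n < x)"
 have m: "(1/2)^m < x" unfolding m_def by (rule LeastI[of _ n]) fact
 have "m \<noteq> 0" using m assms by (intro notI) auto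
 then obtain k where k: "m = Suc k" by (cases m) auto
 then have "\<not> (1/2)^k < x" using not_less_Least[of k "%n. (1/2)^n < x"] by (simp add: m_def)
 then show thesis using that[of k] m k by auto
qed

lemma convex_diff_pos_imp_second_derivative:
 assumes "convex_diff_pos g"
 shows "difference_of_convex_on {0<..} g"
  and "\<exists>\<nu>. second_derivative_measure g \<nu> &
     (\<exists>z>0. (\<integral>\<^sup>+x\<in>{0<..<z}. ennreal x \<partial>variation_measure \<nu>) < \<infinity>)"
proof -
 obtain p q C0 where p: "convex_on {0<..} p" and q: "convex_on {0<..} q"
  and C0: "!!x. x \<in> {0<..1} ==> p x <= C0 & q x <= C0" and g: "!!x. 0 < x ==> g x = p x - q x"
  using assms unfolding convex_diff_pos_def by blast
 show "difference_of_convex_on {0<..} g"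
  unfolding difference_of_convex_on_def using p q g by auto
 \<comment> \<open>\<open>C0\<close> bounds only from above and only on \<open>(0,1]\<close>; a
   supporting line gives the lower bound, and continuity covers \<open>[1,2]\<close>.\<close>
 have bnd: "\<exists>C. \<forall>x\<in>{0<..2}. abs (f x) <= C" if f: "convex_on {0<..} f"
  and "!!x. x \<in> {0<..1} ==> f x <= C0" for f :: "real => real"
 proof -
  obtain C1 where C1: "\<forall>x\<in>{0<..2}. C1 <= f x" using convex_pos_bounded_below[OF f, of 2] by auto
  have "bounded (f ` {1..2})"
   by (intro compact_imp_bounded compact_continuous_image continuous_on_subset[OF convex_pos_continuous[OF f]]) auto
  then obtain C2 where C2: "\<forall>x\<in>{1..2}. abs (f x) <= C2" by (auto simp: bounded_iff)
  show ?thesis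
   by (intro exI[of _ "max (max \<bar>C0\<bar> \<bar>C1\<bar>) C2"] ballI)
    (use C1 C2 that(2) in \<open>force simp: le_max_iff_disj abs_le_iff\<close>)
 qed
 obtain Cp where Cp: "!!x. x \<in> {0<..2} ==> abs (p x) <= Cp" using bnd[OF p] C0 by blast
 obtain Cq where Cq: "!!x. x \<in> {0<..2} ==> abs (q x) <= Cq" using bnd[OF q] C0 by blast
 define \<nu> where "\<nu> = diff_measure p q"
 have \<nu>: "second_derivative_measure g \<nu>"
  unfolding \<nu>_def by (rule second_derivative_measure_diff[OF p q g])
 \<comment> \<open>On the dyadic shell \<open>I k\<close> the function \<open>x\<close> is at most
   \<open>(1/2)^k\<close>; this step function replaces \<open>x\<close> in the integral.\<close>
 define I :: "nat => real set" where "I k = {(1/2)^Suc k<..(1/2)^k}" for k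
 have lf: "locally_finite_signed_measure \<nu>" using \<nu> by (simp add: second_derivative_measure_def)
 have I_sets: "I k \<in> sets (variation_measure \<nu>)" for k
  by (auto simp: sets_variation_measure sets_restrict_space_iff I_def intro: le_less_trans[OF zero_le_power])
 have "(\<integral>\<^sup>+x\<in>{0<..<1}. ennreal x \<partial>variation_measure \<nu>)
   <= (\<integral>\<^sup>+x. (\<Sum>k. ennreal ((1/2)^k) * indicator (I k) x) \<partial>variation_measure \<nu>)"
 proof (rule nn_integral_mono)
  fix x :: real
  show "ennreal x * indicator {0<..<1} x <= (\<Sum>k. ennreal ((1/2)^k) * indicator (I k) x)"
  proof (cases "x \<in> {0<..<1}")
   case True
   then obtain k where k: "x \<in> I k" using dyadic_shell[of x] by (auto simp: I_def)
   have "ennreal x <= ennreal ((1/2)^k) * indicator (I k) x"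
    using k by (auto simp: I_def intro: ennreal_leI)
   also have "... <= (\<Sum>k. ennreal ((1/2)^k) * indicator (I k) x)"
    using sum_le_suminf[of "%k. ennreal ((1/2)^k) * indicator (I k) x" "{k}"]
    by (simp del: sum_mult_indicator sum_indicator_mult)
   finally show ?thesis using True by simp
  qed simp
 qed
 also have "... = (\<Sum>k. ennreal ((1/2)^k) * emeasure (variation_measure \<nu>) (I k))"
  using I_sets by (subst nn_integral_suminf) (auto simp: nn_integral_cmult_indicator)
 also have "... <= (\<Sum>k. ennreal ((1/2)^k) * (emeasure (convex_measure p) (I k) + emeasure (convex_measure q) (I k)))"
 proof (intro suminf_le mult_left_mono)
  fix k
  have "I k \<subseteq> {0<..}" by (auto simp: I_def intro: le_less_trans[OF zero_le_power])
  then show "emeasure (variation_measure \<nu>) (I k) <= emeasure (convex_measure p) (I k) + emeasure (convex_measure q) (I k)"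
   using emeasure_variation_measure[OF lf, of "I k"] variation_diff_measure_le[OF p q, of "I k"]
   by (simp add: \<nu>_def I_def)
 qed auto
 also have "... <= ennreal (10 * Cp) + ennreal (10 * Cq)"
  unfolding distrib_left using suminf_dyadic_convex_measure_finite[OF p Cp] suminf_dyadic_convex_measure_finite[OF q Cq]
  by (subst suminf_add[symmetric]) (auto simp: I_def intro!: add_mono)
 also have "... < \<infinity>" by (simp flip: ennreal_plus add: less_top[symmetric])
 finally show "\<exists>\<nu>. second_derivative_measure g \<nu> &
     (\<exists>z>0. (\<integral>\<^sup>+x\<in>{0<..<z}. ennreal x \<partial>variation_measure \<nu>) < \<infinity>)"
  using \<nu> by (intro exI[of _ \<nu>] conjI exI[of _ 1]) auto
qed

text \<open>The given convex \<open>p\<close> and \<open>q\<close> may be unbounded near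
  \<open>0\<close>, so a new decomposition is built. The potential \<open>w y\<close>, the integral
  of \<open>max 0 (x - y)\<close> over \<open>(0,z)\<close> against \<open>V\<close>, is convex with
  right derivative \<open>- F y\<close>, and integrability of \<open>x\<close> is exactly what
  bounds it at \<open>0\<close>. A convex \<open>H\<close> whose right derivative grows by at least
  the variation of that of \<open>g\<close> makes \<open>H + g\<close> and \<open>H - g\<close>
  convex, and \<open>g\<close> is half their difference.\<close>

lemma second_derivative_imp_convex_diff_pos:
 assumes dc: "difference_of_convex_on {0<..} g" and \<nu>: "second_derivative_measure g \<nu>"
  and z: "0 < z" and fin: "(\<integral>\<^sup>+x\<in>{0<..<z}. ennreal x \<partial>variation_measure \<nu>) < \<infinity>"
 shows "convex_diff_pos g"
proof -
 obtain p q where p: "convex_on {0<..} p" and q: "convex_on {0<..} q" and g: "!!x. 0 < x ==> g x = p x - q x"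
  using dc unfolding difference_of_convex_on_def by auto
 define V where "V = variation_measure \<nu>"
 have lf: "locally_finite_signed_measure \<nu>" using \<nu> by (simp add: second_derivative_measure_def)
 have sets_V [measurable_cong]: "sets V = sets (restrict_space borel {0<..})"
  by (simp add: V_def sets_variation_measure)
 then have V_sets: "{a<..<b} \<in> sets V" "{a<..b} \<in> sets V" if "0 <= a" for a b :: real
  using that by (auto simp: sets_restrict_space_iff)
 have meas [measurable]: "(%x. x) \<in> borel_measurable V"
  by (simp add: measurable_cong_sets[OF sets_V refl] measurable_restrict_space1)
 have [measurable]: "{0<..<z} \<in> sets V" by (rule V_sets) simp
 have int_x: "integrable V (%x. indicator {0<..<z} x * x)"
 proof (rule integrableI_nonneg)
  have "(\<integral>\<^sup>+x. ennreal (indicator {0<..<z} x * x) \<partial>V) = (\<integral>\<^sup>+x\<in>{0<..<z}. ennreal x \<partial>V)"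
   by (intro nn_integral_cong) (auto split: split_indicator)
  then show "(\<integral>\<^sup>+x. ennreal (indicator {0<..<z} x * x) \<partial>V) < \<infinity>"
   using fin by (simp add: V_def)
 qed (auto split: split_indicator)
 have int_w: "integrable V (%x. indicator {0<..<z} x * max 0 (x - y))" if "0 <= y" for y
  by (rule leb_integrable_bound[OF int_x])
   (use that in \<open>auto split: split_indicator\<close>)
 have Fin: "emeasure V {y<..<z} < \<infinity>" if y: "0 < y" for y
 proof -
  have "ennreal y * emeasure V {y<..<z} = (\<integral>\<^sup>+x. ennreal y * indicator {y<..<z} x \<partial>V)"
   using V_sets y by (subst nn_integral_cmult_indicator) auto
  also have "... <= (\<integral>\<^sup>+x\<in>{0<..<z}. ennreal x \<partial>V)"
   using y by (intro nn_integral_mono) (auto split: split_indicator intro: ennreal_leI)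
  also have "... < \<infinity>" using fin by (simp add: V_def)
  finally show ?thesis using y by (auto simp: ennreal_mult_less_top)
 qed
 define F where "F y = measure V {y<..<z}" for y
 have int_F: "integrable V (indicator {y<..<z} :: real => real)"
  and lint_F: "(LINT x|V. indicator {y<..<z} x) = F y" if "0 < y" for y
  using Fin[OF that] V_sets[of y z] that by (auto simp: F_def)
 define w where "w y = (LINT x|V. indicator {0<..<z} x * max 0 (x - y))" for y
 have w_le: "(y' - y) * F y' <= w y - w y'" "w y - w y' <= (y' - y) * F y" if "0 < y" "y <= y'" for y y'
 proof -
  have int: "integrable V (%x. indicator {0<..<z} x * max 0 (x - y) - indicator {0<..<z} x * max 0 (x - y'))"
   using that by (intro leb_integrable_diff int_w) auto
  have w: "w y - w y' = (LINT x|V. indicator {0<..<z} x * max 0 (x - y) - indicator {0<..<z} x * max 0 (x - y'))"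
   unfolding w_def using that by (intro leb_integral_diff[symmetric] int_w) auto
  have "(y' - y) * F y' = (LINT x|V. (y' - y) * indicator {y'<..<z} x)"
   using that lint_F[of y'] by simp
  also have "... <= w y - w y'"
   unfolding w using that by (intro integral_mono int integrable_mult_right int_F) (auto split: split_indicator)
  finally show "(y' - y) * F y' <= w y - w y'" .
  have "w y - w y' <= (LINT x|V. (y' - y) * indicator {y<..<z} x)"
   unfolding w using that by (intro integral_mono int integrable_mult_right int_F) (auto split: split_indicator)
  also have "... = (y' - y) * F y" using that lint_F[of y] by simp
  finally show "w y - w y' <= (y' - y) * F y" .
 qed
 have w_convex: "convex_on {0<..} w"
 proof (rule pos_convex_function)
  fix x y :: real assume "x \<in> {0<..}" "y \<in> {0<..}"
  then show "- F x * (y - x) <= w y - w x"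
   using w_le[of x y] w_le[of y x] by (cases "x <= y") (auto simp: algebra_simps)
 qed auto
 have F_tendsto: "(F \<longlongrightarrow> F y) (at_right y)" if y: "0 < y" for y
 proof (rule tendsto_at_right_sequentially[of y "y + 1"])
  fix S :: "nat => real"
  assume S: "!!n. y < S n" "!!n. S n < y + 1" "decseq S" "S \<longlonglongrightarrow> y"
  have un: "(\<Union>n. {S n<..<z}) = {y<..<z}"
  proof (intro set_eqI iffI)
   fix x assume "x \<in> {y<..<z}"
   then have "y < x" "x < z" by auto
   from order_tendstoD(2)[OF S(4) this(1)] obtain n where "S n < x"
    by (auto simp: eventually_sequentially)
   then show "x \<in> (\<Union>n. {S n<..<z})" using \<open>x < z\<close> by auto
  next
   fix x assume "x \<in> (\<Union>n. {S n<..<z})"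
   then show "x \<in> {y<..<z}" using S(1) by (auto intro: less_trans)
  qed
  have "(%n. measure V {S n<..<z}) \<longlonglongrightarrow> measure V (\<Union>n. {S n<..<z})"
  proof (rule Lim_measure_incseq)
   show "range (%n. {S n<..<z}) \<subseteq> sets V"
   proof -
    have "0 <= S n" for n using S(1)[of n] y by simp
    then show ?thesis using V_sets(1) by blast
   qed
   show "incseq (%n. {S n<..<z})"
    using S(3) by (force simp: incseq_def decseq_def intro: le_less_trans)
   show "emeasure V (\<Union>n. {S n<..<z}) \<noteq> \<infinity>" unfolding un using Fin[OF y] by auto
  qed
  then show "(%n. F (S n)) \<longlonglongrightarrow> F y" by (simp add: F_def un)
 qed simp
 have w_deriv: "(w has_vector_derivative - F y) (at_right y)" if y: "0 < y" for y
  unfolding has_real_derivative_iff_has_vector_derivative[symmetric] has_field_derivative_iff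
 proof (rule tendsto_sandwich)
  show "\<forall>\<^sub>F x in at_right y. - F y <= (w x - w y) / (x - y)"
   "\<forall>\<^sub>F x in at_right y. (w x - w y) / (x - y) <= - F x"
   using w_le[OF y] by (auto simp: eventually_at_right_field field_simps intro!: exI[of _ "y+1"])
  show "((%x. - F x) \<longlongrightarrow> - F y) (at_right y)" by (intro tendsto_minus F_tendsto y)
 qed auto
 define D where "D = right_derivative g"
 have D: "D x = right_derivative p x - right_derivative q x"
  "(g has_vector_derivative D x) (at_right x)" if "0 < x" for x
  using right_derivative_diff[OF p q g that] by (simp_all add: D_def)
 \<comment> \<open>The single set \<open>{x<..y}\<close> is already an admissible family in the
   supremum that defines the variation.\<close>
 have FD: "abs (D y - D x) <= F x - F y" if xy: "0 < x" "x <= y" "y < z" for x y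
 proof (cases "x = y")
  case False
  then have "x < y" using xy by simp
  have fin_xy: "emeasure V {x<..y} < \<infinity>"
   using xy by (intro le_less_trans[OF emeasure_mono Fin[OF xy(1)]]) (auto intro!: V_sets)
  have "{x<..<z} = {x<..y} \<union> {y<..<z}" using xy by auto
  then have "F x = measure V {x<..y} + F y"
   unfolding F_def using xy Fin[of y] fin_xy
   by (simp only:) (intro measure_Union, auto intro!: V_sets)
  moreover have "ennreal \<bar>\<nu> {x<..y}\<bar> <= variation \<nu> {x<..y}"
  proof -
   have "{x<..y} \<subseteq> {x..y}" by auto
   then have "{x<..y} \<in> rel_compact_borel" using xy(1) unfolding rel_compact_borel_def mem_Collect_eq
    by (intro conjI exI) auto
   then show ?thesis using variation_upper[of "{{x<..y}}" "{x<..y}" \<nu>] by simp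
  qed
  then have "ennreal \<bar>\<nu> {x<..y}\<bar> <= emeasure V {x<..y}"
   unfolding V_def using xy by (subst emeasure_variation_measure[OF lf]) auto
  then have "abs (\<nu> {x<..y}) <= measure V {x<..y}"
   using fin_xy by (simp add: emeasure_eq_ennreal_measure top.not_eq_extremum)
  moreover have "\<nu> {x<..y} = D y - D x"
   using \<nu> xy(1) \<open>x < y\<close> by (simp add: second_derivative_measure_def D_def)
  ultimately show ?thesis by simp
 qed simp
 define c where "c = z / 2"
 have c: "0 < c" "c < z" using z by (auto simp: c_def)
 define r where "r x = p x + q x" for x
 have r: "convex_on {0<..} r" unfolding r_def by (intro convex_on_add p q)
 have r_deriv: "(r has_vector_derivative right_derivative p x + right_derivative q x) (at_right x)" if "0 < x" for x
  unfolding r_def by (intro has_vector_derivative_add has_right_derivative_convex p q that)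
 \<comment> \<open>Away from \<open>0\<close> the function \<open>p + q\<close> controls
   \<open>g\<close>, but it may blow up at \<open>0\<close>; below \<open>c\<close> it is continued
   by its tangent line, since there \<open>w\<close> takes over.\<close>
 define rc where "rc x = r (max x c) + right_derivative r c * (min x c - c)" for x
 have rc: "convex_on {0<..} rc"
 proof (rule pos_convex_function)
  fix x y :: real assume "x \<in> {0<..}" "y \<in> {0<..}"
  have *: "right_derivative r (max x c) * (max y c - max x c) <= r (max y c) - r (max x c)"
   using convex_pos_support[OF r, of "max x c" "max y c"] c(1) by (simp add: less_max_iff_disj)
  have "right_derivative r (max x c) * (min y c - min x c) <= right_derivative r c * (min y c - min x c)"
  proof (cases "x <= c")
   case False
   then show ?thesis
    using right_derivative_mono_convex[OF r c(1), of x] by (simp add: mult_right_mono_neg)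
  qed simp
  moreover have "right_derivative r (max x c) * (y - x)
   = right_derivative r (max x c) * (max y c - max x c) + right_derivative r (max x c) * (min y c - min x c)"
   by (simp add: algebra_simps max_def min_def)
  ultimately show "right_derivative r (max x c) * (y - x) <= rc y - rc x"
   using * by (simp add: rc_def algebra_simps)
 qed auto
 have rc_deriv: "right_derivative rc x = right_derivative p x + right_derivative q x" if "c <= x" for x
 proof (rule vector_derivative_within)
  have "(r has_vector_derivative right_derivative p x + right_derivative q x) (at_right x)"
   using that c by (intro r_deriv) simp
  then show "(rc has_vector_derivative right_derivative p x + right_derivative q x) (at_right x)"
   unfolding has_real_derivative_iff_has_vector_derivative[symmetric] has_field_derivative_iff
  proof (rule Lim_transform_eventually)
   show "\<forall>\<^sub>F y in at_right x. (r y - r x) / (y - x) = (rc y - rc x) / (y - x)"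
    using that by (auto simp: eventually_at_right_field rc_def intro!: exI[of _ "x+1"])
  qed
 qed simp
 define H where "H x = w x + rc x" for x
 define DH where "DH x = - F x + right_derivative rc x" for x
 have H_deriv: "(H has_vector_derivative DH x) (at_right x)" if "0 < x" for x
  unfolding H_def DH_def by (intro has_vector_derivative_add w_deriv has_right_derivative_convex rc that)
 have F_mono: "F y <= F x" if "0 < x" "x <= y" for x y
  unfolding F_def using that Fin[of x] V_sets[of x z]
  by (intro measure_mono_fmeasurable) (auto simp: fmeasurable_def intro!: V_sets)
 have DH_D: "abs (D y - D x) <= DH y - DH x" if xy: "0 < x" "x <= y" for x y
 proof -
  have near: "abs (D y - D x) <= DH y - DH x" if "0 < x" "x <= y" "y < z" for x y
   using FD[OF that] right_derivative_mono_convex[OF rc that(1,2)] by (simp add: DH_def)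
  have far: "abs (D y - D x) <= DH y - DH x" if "c <= x" "x <= y" for x y
   using that c F_mono[of x y] right_derivative_mono_convex[OF p, of x y] right_derivative_mono_convex[OF q, of x y]
   by (auto simp: DH_def D rc_deriv)
  \<comment> \<open>The two regimes overlap on \<open>[c,z)\<close>, so an interval reaching from
    below \<open>c\<close> to \<open>z\<close> or beyond is split at \<open>c\<close>.\<close>
  consider "y < z" | "c <= x" | "x < c" "z <= y" by linarith
  then show ?thesis
  proof cases
   case 3
   then show ?thesis
    using near[of x c] far[of c y] xy c by linarith
  qed (use near far xy in auto)
 qed
 have H_cont: "continuous_on {0<..} H"
  unfolding H_def by (intro continuous_on_add convex_pos_continuous w_convex rc)
 have g_cont: "continuous_on {0<..} g"
  by (rule continuous_on_eq[OF continuous_on_diff[OF convex_pos_continuous[OF p] convex_pos_continuous[OF q]]])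
   (simp add: g)
 have conv1: "convex_on {0<..} (%x. H x + g x)"
 proof (rule convex_on_right_derivativeI[where D = "%x. DH x + D x"])
  show "DH x + D x <= DH y + D y" if "0 < x" "x <= y" for x y
   using DH_D[OF that] by auto
 qed (auto intro!: continuous_on_add H_cont g_cont has_vector_derivative_add H_deriv D)
 have conv2: "convex_on {0<..} (%x. H x - g x)"
 proof (rule convex_on_right_derivativeI[where D = "%x. DH x - D x"])
  show "DH x - D x <= DH y - D y" if "0 < x" "x <= y" for x y
   using DH_D[OF that] by auto
 qed (auto intro!: continuous_on_diff H_cont g_cont has_vector_derivative_diff H_deriv D)
 have "\<exists>C. \<forall>x\<in>{0<..1}. H x <= C"
 proof -
  have "continuous_on {0..1} rc"
  proof -
   have "continuous_on {0..1} (%x. r (max x c))"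
    by (rule continuous_on_compose2[OF convex_pos_continuous[OF r]]) (use c in \<open>auto intro!: continuous_intros\<close>)
   then show ?thesis unfolding rc_def by (intro continuous_intros)
  qed
  then have "bounded (rc ` {0..1})"
   by (intro compact_imp_bounded compact_continuous_image) auto
  then obtain C where C: "\<forall>x\<in>{0..1}. abs (rc x) <= C" by (auto simp: bounded_iff)
  have "w y <= (LINT x|V. indicator {0<..<z} x * x)" if "0 < y" for y
   unfolding w_def using that by (intro integral_mono int_w int_x) (auto split: split_indicator)
  then show ?thesis
   using C by (intro exI[of _ "(LINT x|V. indicator {0<..<z} x * x) + C"])
    (force simp: H_def abs_le_iff intro!: add_mono)
 qed
 then obtain C where C: "\<forall>x\<in>{0<..1}. H x <= C" ..
 obtain C1 where C1: "\<forall>x\<in>{0<..1}. C1 <= H x + g x" using convex_pos_bounded_below[OF conv1, of 1] by auto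
 obtain C2 where C2: "\<forall>x\<in>{0<..1}. C2 <= H x - g x" using convex_pos_bounded_below[OF conv2, of 1] by auto
 show ?thesis
  unfolding convex_diff_pos_def
 proof (intro exI conjI ballI allI impI)
  show "convex_on {0<..} (%x. (H x + g x) / 2)" "convex_on {0<..} (%x. (H x - g x) / 2)"
   using conv1 conv2 by (auto intro!: convex_on_cdiv)
  \<comment> \<open>Half of \<open>H + g\<close> is \<open>H\<close> minus half of
    \<open>H - g\<close>, so an upper bound of \<open>H\<close> and a lower bound of the other
    convex function suffice.\<close>
  show "(H x + g x) / 2 <= C + max (- C1) (- C2) / 2" if "x \<in> {0<..1}" for x
  proof -
   have "H x <= C" "C2 <= H x - g x" using C C2 that by blast+
   then show ?thesis by (simp add: max_def; linarith)
  qed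
  show "(H x - g x) / 2 <= C + max (- C1) (- C2) / 2" if "x \<in> {0<..1}" for x
  proof -
   have "H x <= C" "C1 <= H x + g x" using C C1 that by blast+
   then show ?thesis by (simp add: max_def; linarith)
  qed
 qed (simp add: field_simps)
qed

section \<open>Extension to the closed half-line\<close>

lemma convex_pos_extend:
 fixes p :: "real => real"
 assumes p: "convex_on {0<..} p" and C: "!!x. x \<in> {0<..1} ==> p x <= C"
 obtains h where "convex_on {0..} h" "continuous_on {0..} h" "!!x. 0 < x ==> h x = p x"
proof -
 \<comment> \<open>The slope of the chord from \<open>x\<close> to \<open>1\<close> is monotone in
   \<open>x\<close>, and the bound on \<open>p\<close> keeps it bounded below. Its limit at
   \<open>0\<close> gives a limit of \<open>p\<close>, and convexity passes to that limit.\<close>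
 define s where "s x = (p 1 - p x) / (1 - x)" for x
 have mono: "s x <= s y" if "0 < x" "x <= y" "y < 1" for x y
  using convex_pos_slope(2)[OF p, of x y 1] that by (cases "x = y") (auto simp: s_def)
 define L where "L = Inf (s ` {0<..<1})"
 have bdd: "bdd_below (s ` {0<..<1})"
 proof (rule bdd_belowI2)
  fix x :: real assume x: "x \<in> {0<..<1}"
  \<comment> \<open>The minimum with \<open>1/2\<close> keeps the denominator \<open>1 - x\<close>
    at least \<open>1/2\<close>; monotonicity then returns to \<open>x\<close>.\<close>
  have "- 2 * abs (p 1 - C) <= s (min x (1/2))"
  proof -
   define y where "y = min x (1/2)"
   have y: "0 < y" "y <= 1/2" using x by (auto simp: y_def)
   have "- abs (p 1 - C) <= p 1 - p y" using C[of y] y by auto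
   moreover have "(- 2 * abs (p 1 - C)) * (1 - y) <= - abs (p 1 - C)"
    using y mult_left_mono[of "1/2" "1 - y" "2 * abs (p 1 - C)"] by simp
   ultimately show ?thesis using y unfolding y_def[symmetric] s_def by (subst le_divide_eq) auto
  qed
  also have "... <= s x" using x by (intro mono) auto
  finally show "- 2 * abs (p 1 - C) <= s x" .
 qed
 have "(s \<longlongrightarrow> L) (at_right 0)"
 proof (rule order_tendstoI)
  fix a assume "a < L"
  have "a < s x" if "0 < x" "x < 1" for x
   using \<open>a < L\<close> cInf_lower[OF _ bdd, of "s x"] that unfolding L_def by force
  then show "\<forall>\<^sub>F x in at_right 0. a < s x" by (auto simp: eventually_at_right_field intro!: exI[of _ 1])
 next
  fix a assume "L < a"
  then obtain y where y: "0 < y" "y < 1" "s y < a"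
   unfolding L_def using cInf_lessD[of "s ` {0<..<1}" a] by auto
  then show "\<forall>\<^sub>F x in at_right 0. s x < a"
   using mono by (auto simp: eventually_at_right_field intro!: exI[of _ y] intro: le_less_trans less_imp_le)
 qed
 then have "((%x. p 1 - (1 - x) * s x) \<longlongrightarrow> p 1 - (1 - 0) * L) (at_right 0)"
  by (intro tendsto_intros)
 then have "(p \<longlongrightarrow> p 1 - (1 - 0) * L) (at_right 0)"
  by (rule Lim_transform_eventually) (auto simp: eventually_at_right_field s_def intro!: exI[of _ 1])
 then have lim: "(p \<longlongrightarrow> p 1 - L) (at_right 0)" by simp
 define h where "h x = (if 0 < x then p x else p 1 - L)" for x
 have h_pos: "h x = p x" if "0 < x" for x using that by (simp add: h_def)
 have lim_h: "(h \<longlongrightarrow> h 0) (at_right 0)"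
 proof (rule Lim_transform_eventually)
  show "(p \<longlongrightarrow> h 0) (at_right 0)" using lim by (simp add: h_def)
 qed (auto simp: eventually_at_right_field h_def intro!: exI[of _ 1])
 have "convex_on {0..} h"
 proof (rule convex_on_linorderI)
  fix t x y :: real assume t: "0 < t" "t < 1" and xy: "x \<in> {0..}" "y \<in> {0..}" "x < y"
  show "h ((1 - t) *\<^sub>R x + t *\<^sub>R y) <= (1 - t) * h x + t * h y"
  proof (cases "x = 0")
   case False
   then have "0 < x" "0 < y" using xy by auto
   moreover have "0 < (1 - t) * x + t * y" using t calculation by (intro add_pos_pos) auto
   ultimately show ?thesis
    using convex_onD[OF p, of t x y] t by (simp add: h_pos)
  next
   case True
   have ty: "0 < t * y" using t xy by simp
   have "isCont p (t * y)"
    using convex_pos_continuous[OF p] ty by (simp add: continuous_on_eq_continuous_at)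
   moreover have "((%e. (1 - t) * e + t * y) \<longlongrightarrow> t * y) (at_right 0)"
    by (rule tendsto_eq_intros refl | simp)+
   ultimately have "((%e. p ((1 - t) * e + t * y)) \<longlongrightarrow> p (t * y)) (at_right 0)"
    by (rule isCont_tendsto_compose)
   moreover have "((%e. (1 - t) * h e + t * p y) \<longlongrightarrow> (1 - t) * h 0 + t * p y) (at_right 0)"
    by (intro tendsto_intros lim_h)
   moreover have "\<forall>\<^sub>F e in at_right 0. p ((1 - t) * e + t * y) <= (1 - t) * h e + t * p y"
    using convex_onD[OF p, of t _ y] t xy
    by (auto simp: eventually_at_right_field h_pos intro!: exI[of _ 1])
   ultimately have "p (t * y) <= (1 - t) * h 0 + t * p y"
    by (intro tendsto_le[of "at_right 0"]) auto
   then show ?thesis using True ty xy by (simp add: h_pos)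
  qed
 qed auto
 moreover have "continuous_on {0..} h"
  unfolding continuous_on_eq_continuous_within
 proof
  fix x :: real assume "x \<in> {0..}"
  show "continuous (at x within {0..}) h"
  proof (cases "x = 0")
   case True
   then show ?thesis using lim_h by (simp add: continuous_within at_within_Ici_at_right)
  next
   case False
   then have "0 < x" using \<open>x \<in> {0..}\<close> by simp
   then have "isCont p x" using convex_pos_continuous[OF p] by (simp add: continuous_on_eq_continuous_at)
   then have "isCont h x"
    using \<open>0 < x\<close> eventually_nhds_in_open[of "{0<..}" x]
    by (subst isCont_cong[of h p]) (auto elim!: eventually_mono simp: h_pos)
   then show ?thesis by (rule continuous_at_imp_continuous_at_within)
  qed
 qed
 ultimately show thesis using h_pos that by blast
qed

lemma convex_diff_pos_extend:
 assumes "convex_diff_pos g"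
 obtains h1 h2 where "convex_on {0..} h1" "continuous_on {0..} h1" "convex_on {0..} h2" "continuous_on {0..} h2"
  "!!x. 0 < x ==> g x = h1 x - h2 x"
proof -
 obtain p q C where p: "convex_on {0<..} p" and q: "convex_on {0<..} q"
  and C: "!!x. x \<in> {0<..1} ==> p x <= C" "!!x. x \<in> {0<..1} ==> q x <= C" and g: "!!x. 0 < x ==> g x = p x - q x"
  using assms unfolding convex_diff_pos_def by blast
 obtain h1 where h1: "convex_on {0..} h1" "continuous_on {0..} h1" "!!x. 0 < x ==> h1 x = p x"
  using convex_pos_extend[OF p C(1)] by metis
 obtain h2 where h2: "convex_on {0..} h2" "continuous_on {0..} h2" "!!x. 0 < x ==> h2 x = q x"
  using convex_pos_extend[OF q C(2)] by metis
 show thesis using that[OF h1(1,2) h2(1,2)] g h1(3) h2(3) by simp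
qed

text \<open>The extensions represent \<open>g\<close> on \<open>(0,\<infinity>)\<close> and
  determine its limit at \<open>0\<close>; continuity of \<open>g\<close> at \<open>0\<close>
  identifies \<open>g 0\<close> with that limit.\<close>

lemma convex_diff_pos_imp_convex_diff:
 assumes "convex_diff_pos g" and cont: "continuous (at 0 within {0..}) g"
 shows "\<exists>h1 h2. convex_on {0..} h1 & continuous (at 0 within {0..}) h1 &
     convex_on {0..} h2 & continuous (at 0 within {0..}) h2 & (\<forall>x\<ge>0. g x = h1 x - h2 x)"
proof -
 obtain h1 h2 where h: "convex_on {0..} h1" "continuous_on {0..} h1" "convex_on {0..} h2" "continuous_on {0..} h2"
  and g: "!!x. 0 < x ==> g x = h1 x - h2 x"
  using convex_diff_pos_extend[OF assms(1)] by metis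
 have c: "continuous (at 0 within {0..}) h1" "continuous (at 0 within {0..}) h2"
  using h by (auto simp: continuous_on_eq_continuous_within)
 then have "((%x. h1 x - h2 x) \<longlongrightarrow> h1 0 - h2 0) (at_right 0)"
  by (intro tendsto_diff) (simp_all add: continuous_within at_within_Ici_at_right)
 then have "(g \<longlongrightarrow> h1 0 - h2 0) (at_right 0)"
  by (rule Lim_transform_eventually) (auto simp: eventually_at_right_field g intro!: exI[of _ 1])
 moreover have "(g \<longlongrightarrow> g 0) (at_right 0)"
  using cont by (simp add: continuous_within at_within_Ici_at_right)
 ultimately have "g 0 = h1 0 - h2 0" by (intro tendsto_unique[of "at_right 0"]) auto
 then have "\<forall>x\<ge>0. g x = h1 x - h2 x" using g by (auto simp: le_less)
 then show ?thesis using h c by blast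
qed

lemma convex_diff_imp_convex_diff_pos:
 assumes h1: "convex_on {0..} h1" and h2: "convex_on {0..} h2" and g: "!!x. 0 <= x ==> g x = h1 x - h2 x"
 shows "convex_diff_pos g"
 unfolding convex_diff_pos_def
proof (intro exI conjI ballI allI impI)
 show "convex_on {0<..} h1" "convex_on {0<..} h2"
  using h1 h2 by (auto intro: convex_on_subset)
 have le: "h x <= max (h 0) (h 1)" if "convex_on {0..} h" "x \<in> {0<..1}" for h :: "real => real" and x
  using convex_on_le_max[of 0 1 h x] convex_on_subset[OF that(1), of "{0..1}"] that(2) by auto
 show "h1 x <= max (max (h1 0) (h1 1)) (max (h2 0) (h2 1))" "h2 x <= max (max (h1 0) (h1 1)) (max (h2 0) (h2 1))"
  if "x \<in> {0<..1}" for x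
  using le[OF h1 that] le[OF h2 that] by auto
qed (simp add: g)

section \<open>Second differences on a lattice\<close>

text \<open>Up to the factor \<open>2\<close>, the Green function of simple random walk on \<open>{0..N}\<close> killed at the end points.\<close>

definition green :: "nat => nat => nat => real" where
 "green N k l = min (real k * (real N - real l)) (real l * (real N - real k)) / real N"

text \<open>Truncated subtraction makes this \<open>f 1 - f 0\<close> at \<open>l = 0\<close>; the
  sums and the walk use it for \<open>l >= 1\<close>.\<close>

definition diff2 :: "(nat => real) => nat => real" where
 "diff2 f l = f (l + 1) - 2 * f l + f (l - 1)"

text \<open>A convex function of \<open>s\<close> with a unit kink at \<open>l\<close>, vanishing on \<open>{K..K+1}\<close>.\<close>

definition kink :: "nat => nat => real => real" where
 "kink K l s = (if l <= K then max 0 (real l - s) else max 0 (s - real l))"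

lemma kink_nonneg: "0 <= kink K l s"
 by (simp add: kink_def)

lemma kink_convex: "convex_on UNIV (kink K l)"
proof (rule convex_onI)
 fix t x y :: real assume t: "0 < t" "t < 1"
 have "max 0 ((1 - t) * u + t * v) <= (1 - t) * max 0 u + t * max 0 v" for u v
 proof -
  have "(1 - t) * u <= (1 - t) * max 0 u" "t * v <= t * max 0 v"
   using t by (auto intro!: mult_left_mono)
  moreover have "0 <= (1 - t) * max 0 u" "0 <= t * max 0 v"
   using t by auto
  ultimately show ?thesis by linarith
 qed
 note m = this
 show "kink K l ((1 - t) *\<^sub>R x + t *\<^sub>R y) <= (1 - t) * kink K l x + t * kink K l y"
  using m[of "real l - x" "real l - y"] m[of "x - real l" "y - real l"]
  by (simp add: kink_def algebra_simps)
qed simp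

lemma kink_affine:
 assumes "0 <= t" "t <= 1"
 shows "kink K l (real k + t) = (1 - t) * kink K l (real k) + t * kink K l (real (k + 1))"
proof -
 consider "l <= k" | "k + 1 <= l" by linarith
 then show ?thesis
 proof cases
  case 1
  then have "real l <= real k" by simp
  then have "max 0 (real l - (real k + t)) = 0" "max 0 (real l - real k) = 0" "max 0 (real l - real (k + 1)) = 0"
   "max 0 (real k + t - real l) = real k + t - real l" "max 0 (real k - real l) = real k - real l"
   "max 0 (real (k + 1) - real l) = real (k + 1) - real l"
   using assms by auto
  then show ?thesis by (simp add: kink_def algebra_simps)
 next
  case 2
  then have "real (k + 1) <= real l" by (simp only: of_nat_le_iff)
  then have "max 0 (real k + t - real l) = 0" "max 0 (real k - real l) = 0" "max 0 (real (k + 1) - real l) = 0"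
   "max 0 (real l - (real k + t)) = real l - (real k + t)" "max 0 (real l - real k) = real l - real k"
   "max 0 (real l - real (k + 1)) = real l - real (k + 1)"
   using assms by auto
  then show ?thesis by (simp add: kink_def algebra_simps)
 qed
qed

lemma kink_second_difference:
 "1 <= k ==> kink K l (real (k + 1)) - 2 * kink K l (real k) + kink K l (real (k - 1)) = (if l = k then 1 else 0)"
 by (auto simp: kink_def max_def of_nat_diff)

text \<open>Two consecutive zeros propagate in both directions through the recursion.\<close>

lemma second_difference_zero:
 fixes e :: "nat => real"
 assumes e: "!!k. 1 <= k ==> k < L ==> e (k + 1) - 2 * e k + e (k - 1) = 0"
  and K: "e K = 0" "e (K + 1) = 0" and "K < L" "k <= L"
 shows "e k = 0"
proof (cases "K <= k")
 case True
 have "K + j + 1 <= L ==> e (K + j) = 0 & e (K + j + 1) = 0" for j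
 proof (induction j)
  case (Suc j)
  then show ?case using e[of "K + j + 1"] by simp
 qed (use K in simp)
 from this[of "k - K - 1"] show ?thesis using True K assms(4,5) by (cases "k = K") auto
next
 case False
 have "j <= K ==> e (K - j) = 0 & e (K - j + 1) = 0" for j
 proof (induction j)
  case (Suc j)
  then show ?case using e[of "K - j"] assms(4) by (simp add: Suc_diff_Suc)
 qed (use K in simp)
 from this[of "K - k"] show ?thesis using False by simp
qed

text \<open>A discrete Taylor formula at \<open>K\<close>: the kinks vanish at \<open>K\<close> and
  \<open>K + 1\<close>, so both sides agree at these two points, and the unit kinks reproduce every
  second difference.\<close>

lemma kink_interpolation:
 assumes K: "K < L" and k: "k <= L"
 shows "f k = f K + (real k - real K) * (f (K + 1) - f K) + (\<Sum>l\<in>{1..<L}. diff2 f l * kink K l (real k))"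
proof -
 define e where "e k = f K + (real k - real K) * (f (K + 1) - f K)
  + (\<Sum>l\<in>{1..<L}. diff2 f l * kink K l (real k)) - f k" for k
 have "e k = 0"
 proof (rule second_difference_zero[OF _ _ _ K k])
  show "e K = 0" by (auto simp: e_def kink_def intro!: sum.neutral)
  show "e (K + 1) = 0" by (auto simp: e_def kink_def intro!: sum.neutral)
  fix k assume k: "1 <= k" "k < L"
  have "(\<Sum>l\<in>{1..<L}. diff2 f l * kink K l (real (k + 1))) - 2 * (\<Sum>l\<in>{1..<L}. diff2 f l * kink K l (real k))
    + (\<Sum>l\<in>{1..<L}. diff2 f l * kink K l (real (k - 1)))
   = (\<Sum>l\<in>{1..<L}. diff2 f l * (kink K l (real (k + 1)) - 2 * kink K l (real k) + kink K l (real (k - 1))))"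
   by (simp only: sum_distrib_left sum_subtractf[symmetric] sum.distrib[symmetric]) (simp add: algebra_simps)
  also have "... = (\<Sum>l\<in>{1..<L}. if l = k then diff2 f k else 0)"
   by (intro sum.cong refl, subst kink_second_difference) (use k in auto)
  also have "... = diff2 f k" using k by simp
  finally show "e (k + 1) - 2 * e k + e (k - 1) = 0"
   using k by (simp add: e_def diff2_def of_nat_diff algebra_simps)
 qed
 then show ?thesis by (simp add: e_def)
qed

section \<open>From uniform Green sums to convex functions\<close>

lemma bounded_real_limsup:
 fixes a :: "nat => real"
 assumes "!!n. abs (a n) <= C"
 obtains L where "!!e. 0 < e ==> \<forall>\<^sub>F n in sequentially. a n < L + e"
  "!!c. \<forall>\<^sub>F n in sequentially. a n <= c ==> L <= c"
proof -
 define l where "l = limsup (%n. ereal (a n))"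
 have "l <= ereal C" unfolding l_def
  by (rule Limsup_bounded) (use assms in \<open>auto simp: abs_le_iff\<close>)
 moreover have "ereal (- C) <= liminf (%n. ereal (a n))"
 proof (rule Liminf_bounded)
  have "- C <= a n" for n using assms[of n] by auto
  then show "\<forall>\<^sub>F n in sequentially. ereal (- C) <= ereal (a n)" by auto
 qed
 then have "ereal (- C) <= l"
  unfolding l_def using Liminf_le_Limsup[of sequentially] order_trans by (metis sequentially_bot)
 ultimately obtain L where L: "l = ereal L" by (cases l) auto
 show thesis
 proof (rule that[of L])
  fix e :: real assume "0 < e"
  then have "limsup (%n. ereal (a n)) < ereal (L + e)" using L by (simp add: l_def)
  then have "\<forall>\<^sub>F n in sequentially. ereal (a n) < ereal (L + e)" by (rule Limsup_lessD)
  then show "\<forall>\<^sub>F n in sequentially. a n < L + e" by simp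
 next
  fix c assume "\<forall>\<^sub>F n in sequentially. a n <= c"
  then have "l <= ereal c" unfolding l_def by (intro Limsup_bounded) auto
  then show "L <= c" using L by simp
 qed
qed

text \<open>\<open>G n\<close> expands the lattice values of \<open>g\<close> into kinks around
  \<open>x0\<close>, and \<open>H n\<close> is the same sum with absolute second differences. For
  each \<open>n\<close> both \<open>H n + G n\<close> and \<open>H n - G n\<close> are convex, and
  \<open>G n\<close> converges to \<open>g\<close>. A pointwise limsup \<open>h\<close> of
  \<open>H n\<close> is enough: in the convexity inequality the values on the right are eventually
  below \<open>h + e\<close>, and an eventual upper bound on the left is an upper bound of
  \<open>h\<close>.\<close>

lemma lattice_bound_imp_convex_diff_pos:
 fixes g :: "real => real"
 assumes x0: "0 < x0" and cont: "continuous_on {0<..} g" and bdd: "!!x. x \<in> {0<..1} ==> abs (g x) <= Cg"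
  and key: "!!M. 2 <= M ==> \<exists>C. \<forall>n.
   (\<Sum>l\<in>{1..<M * 2^n}. green (M * 2^n) (2^n) l * abs (diff2 (%k. g (real k * x0 / 2^n)) l)) <= C"
 shows "convex_diff_pos g"
proof -
 define f where "f n k = g (real k * x0 / 2^n)" for n k :: nat
 define s where "s n y = y * 2^n / x0" for n and y :: real
 \<comment> \<open>Kinks beyond \<open>s n y\<close> vanish at \<open>y\<close>; the margin
   \<open>2\<close> keeps the right lattice neighbour of \<open>y\<close> and the base point
   \<open>2^n\<close> inside the range.\<close>
 define L where "L n y = 2^n + nat \<lceil>s n y\<rceil> + 2" for n y
 define H where "H n y = (\<Sum>l\<in>{1..<L n y}. abs (diff2 (f n) l) * kink (2^n) l (s n y))" for n y
 define G where "G n y = f n (2^n) + (s n y - 2^n) * (f n (2^n + 1) - f n (2^n))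
  + (\<Sum>l\<in>{1..<L n y}. diff2 (f n) l * kink (2^n) l (s n y))" for n y
 have extend: "(\<Sum>l\<in>{1..<L n y}. c l * kink (2^n) l (s n y)) = (\<Sum>l\<in>{1..<L'}. c l * kink (2^n) l (s n y))"
  if "L n y <= L'" for c n y L'
 proof (rule sum.mono_neutral_left)
  show "\<forall>l\<in>{1..<L'} - {1..<L n y}. c l * kink (2^n) l (s n y) = 0"
  proof
   fix l assume l: "l \<in> {1..<L'} - {1..<L n y}"
   then have "2^n < l" "s n y <= real l" by (auto simp: L_def) linarith
   then show "c l * kink (2^n) l (s n y) = 0" by (simp add: kink_def)
  qed
 qed (use that in auto)
 \<comment> \<open>Every kink has the coefficient
   \<open>abs (diff2 (f n) l) + sgm * diff2 (f n) l\<close>, which is nonnegative, and what is left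
   is affine.\<close>
 have HG_convex: "H n z + sgm * G n z <= (1 - t) * (H n x + sgm * G n x) + t * (H n y + sgm * G n y)"
  if t: "0 < t" "t < 1" and z: "z = (1 - t) * x + t * y" and sgm: "abs sgm <= 1" for n x y z t sgm
 proof -
  define L' where "L' = max (L n x) (max (L n y) (L n z))"
  have L': "L n x <= L'" "L n y <= L'" "L n z <= L'" by (auto simp: L'_def)
  define c where "c l = abs (diff2 (f n) l) + sgm * diff2 (f n) l" for l
  have c: "0 <= c l" for l
  proof -
   have "abs (sgm * diff2 (f n) l) <= abs (diff2 (f n) l)"
    using sgm mult_right_mono[of "abs sgm" 1 "abs (diff2 (f n) l)"] by (simp add: abs_mult)
   then show ?thesis unfolding c_def by linarith
  qed
  have sz: "s n z = (1 - t) *\<^sub>R s n x + t *\<^sub>R s n y"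
   using x0 by (simp add: s_def z field_simps)
  define A where "A v = sgm * (f n (2^n) + (v - 2^n) * (f n (2^n + 1) - f n (2^n)))" for v
  have HG: "H n v + sgm * G n v = A (s n v) + (\<Sum>l\<in>{1..<L'}. c l * kink (2^n) l (s n v))"
   if "L n v <= L'" for v
   unfolding H_def G_def extend[OF that] c_def A_def
   by (simp add: sum.distrib sum_distrib_left algebra_simps)
  have "c l * kink (2^n) l (s n z) <= c l * ((1 - t) * kink (2^n) l (s n x) + t * kink (2^n) l (s n y))" for l
   unfolding sz using t by (intro mult_left_mono c convex_onD[OF kink_convex]) auto
  then have "(\<Sum>l\<in>{1..<L'}. c l * kink (2^n) l (s n z))
    <= (\<Sum>l\<in>{1..<L'}. c l * ((1 - t) * kink (2^n) l (s n x) + t * kink (2^n) l (s n y)))"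
   by (rule sum_mono)
  also have "... = (1 - t) * (\<Sum>l\<in>{1..<L'}. c l * kink (2^n) l (s n x)) + t * (\<Sum>l\<in>{1..<L'}. c l * kink (2^n) l (s n y))"
   by (simp add: sum_distrib_left sum.distrib[symmetric] algebra_simps)
  moreover have "A (s n z) = (1 - t) * A (s n x) + t * A (s n y)"
   unfolding A_def sz by (simp add: algebra_simps)
  ultimately show ?thesis
   unfolding HG[OF L'(1)] HG[OF L'(2)] HG[OF L'(3)] by (simp add: algebra_simps)
 qed
 have G_lim: "(%n. G n y) \<longlonglongrightarrow> g y" if y: "0 < y" for y
 proof -
  define k where "k n = nat \<lfloor>s n y\<rfloor>" for n
  define t where "t n = s n y - real (k n)" for n
  have sy: "0 <= s n y" for n using y x0 by (simp add: s_def)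
  have t: "0 <= t n" "t n <= 1" for n
   using sy[of n] by (auto simp: t_def k_def) linarith
  \<comment> \<open>Kinks are affine between lattice points, so \<open>G n\<close> is the linear
    interpolation of \<open>f n\<close> and involves only the two neighbouring lattice
    values.\<close>
  have Geq: "G n y = (1 - t n) * f n (k n) + t n * f n (k n + 1)" for n
  proof -
   have kL: "k n <= L n y" "k n + 1 <= L n y" "2^n < L n y"
    using nat_mono[OF floor_le_ceiling[of "s n y"]] by (auto simp: k_def L_def)
   have "s n y = real (k n) + t n" by (simp add: t_def)
   then have "G n y = f n (2^n) + (real (k n) + t n - 2^n) * (f n (2^n + 1) - f n (2^n))
    + (\<Sum>l\<in>{1..<L n y}. diff2 (f n) l * ((1 - t n) * kink (2^n) l (real (k n)) + t n * kink (2^n) l (real (k n + 1))))"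
    by (simp add: G_def kink_affine[OF t])
   also have "(\<Sum>l\<in>{1..<L n y}. diff2 (f n) l * ((1 - t n) * kink (2^n) l (real (k n)) + t n * kink (2^n) l (real (k n + 1))))
    = (1 - t n) * (\<Sum>l\<in>{1..<L n y}. diff2 (f n) l * kink (2^n) l (real (k n)))
     + t n * (\<Sum>l\<in>{1..<L n y}. diff2 (f n) l * kink (2^n) l (real (k n + 1)))"
    by (simp add: sum_distrib_left sum.distrib[symmetric] algebra_simps)
   also have "f n (2^n) + (real (k n) + t n - 2^n) * (f n (2^n + 1) - f n (2^n)) + ...
    = (1 - t n) * f n (k n) + t n * f n (k n + 1)"
    unfolding kink_interpolation[OF kL(3) kL(1), of "f n"] kink_interpolation[OF kL(3) kL(2), of "f n"]
    by (simp add: algebra_simps)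
   finally show ?thesis .
  qed
  have d0: "(%n. x0 / 2^n) \<longlonglongrightarrow> 0"
   using tendsto_mult_right_zero[OF LIMSEQ_power_zero[of "1/2::real"], of x0] by (simp add: power_divide)
  have kd: "abs (real (k n) * x0 / 2^n - y) <= x0 / 2^n" "abs (real (k n + 1) * x0 / 2^n - y) <= x0 / 2^n" for n
  proof -
   have "y = (real (k n) + t n) * x0 / 2^n" using x0 by (simp add: t_def s_def)
   then have "real (k n) * x0 / 2^n - y = - t n * (x0 / 2^n)" "real (k n + 1) * x0 / 2^n - y = (1 - t n) * (x0 / 2^n)"
    by (simp_all add: field_simps)
   then show "abs (real (k n) * x0 / 2^n - y) <= x0 / 2^n" "abs (real (k n + 1) * x0 / 2^n - y) <= x0 / 2^n"
    using t[of n] x0 by (simp_all add: abs_mult mult_left_le_one_le divide_le_cancel)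
  qed
  have conv: "(%n. g (r n)) \<longlonglongrightarrow> g y" if "!!n. abs (r n - y) <= x0 / 2^n" for r :: "nat => real"
  proof (rule isCont_tendsto_compose[where g = g and f = r])
   show "isCont g y" using cont y by (simp add: continuous_on_eq_continuous_at)
   have "(%n. r n - y) \<longlonglongrightarrow> 0"
    by (rule Lim_null_comparison[OF _ d0]) (use that in auto)
   then show "r \<longlonglongrightarrow> y" using LIM_zero_cancel by blast
  qed
  have "(%n. abs (f n (k n) - g y) + abs (f n (k n + 1) - g y)) \<longlonglongrightarrow> abs (g y - g y) + abs (g y - g y)"
   unfolding f_def by (intro tendsto_intros conv kd)
  then have "(%n. abs (f n (k n) - g y) + abs (f n (k n + 1) - g y)) \<longlonglongrightarrow> 0" by simp
  then have "(%n. G n y - g y) \<longlonglongrightarrow> 0"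
  proof (rule Lim_null_comparison[rotated], intro always_eventually allI)
   fix n
   have "G n y - g y = (1 - t n) * (f n (k n) - g y) + t n * (f n (k n + 1) - g y)"
    unfolding Geq by (simp add: algebra_simps)
   then have "abs (G n y - g y) <= (1 - t n) * abs (f n (k n) - g y) + t n * abs (f n (k n + 1) - g y)"
    using t[of n] by (simp add: abs_mult[symmetric]) (metis abs_mult abs_of_nonneg abs_triangle_ineq diff_ge_0_iff_ge)
   also have "... <= 1 * abs (f n (k n) - g y) + 1 * abs (f n (k n + 1) - g y)"
    using t[of n] by (intro add_mono mult_right_mono) auto
   finally show "norm (G n y - g y) <= abs (f n (k n) - g y) + abs (f n (k n + 1) - g y)" by simp
  qed
  then show ?thesis by (rule LIM_zero_cancel)
 qed
 have H_bdd: "\<exists>C. \<forall>n y. 0 < y & y <= real M * x0 --> H n y <= C" if M: "2 <= M" for M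
 proof -
  obtain C where C: "!!n. (\<Sum>l\<in>{1..<M * 2^n}. green (M * 2^n) (2^n) l * abs (diff2 (f n) l)) <= C"
   using key[OF M] by (auto simp: f_def[abs_def])
  have "H n y <= real M * C" if y: "0 < y" "y <= real M * x0" for n y
  proof -
   define N where "N = M * 2^n"
   have KN: "2 * 2^n <= N" using M by (simp add: N_def)
   have N: "real N = real M * 2^n" by (simp add: N_def)
   have sN: "s n y <= real N" using y x0 by (simp add: s_def N field_simps)
   \<comment> \<open>Multiplied by \<open>M\<close>, the Green function from \<open>2^n\<close> is
     \<open>l * (M - 1)\<close> to the left of \<open>2^n\<close> and \<open>N - l\<close> to the
     right; the kink is at most \<open>l\<close> and \<open>N - l\<close> respectively. The left
     case uses \<open>2 <= M\<close>.\<close>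
   have le_green: "kink (2^n) l (s n y) <= real M * green N (2^n) l" if l: "1 <= l" "l < N" for l
   proof (cases "l <= 2^n")
    case True
    have "real l * (real N - 2^n) <= 2^n * (real N - real l)"
    proof -
     have "real l <= real (2^n)" using True by (simp only: of_nat_le_iff)
     then have "real l * real N <= 2^n * real N" by (intro mult_right_mono) simp_all
     then show ?thesis by (simp add: algebra_simps)
    qed
    then have gr: "green N (2^n) l = real l * (real N - 2^n) / real N"
     by (simp add: green_def min_def)
    have "real M * green N (2^n) l = real l * (real M - 1)"
     unfolding gr N using M by (simp add: field_simps)
    moreover have "real l * 1 <= real l * (real M - 1)" using M by (intro mult_left_mono) auto
    moreover have "0 <= s n y" using y x0 by (simp add: s_def)
    ultimately show ?thesis using True by (simp add: kink_def)
   next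
    case False
    have "2^n * (real N - real l) <= real l * (real N - 2^n)"
    proof -
     have "real (2^n) <= real l" using False by (simp only: of_nat_le_iff)
     then have "2^n * real N <= real l * real N" by (intro mult_right_mono) simp_all
     then show ?thesis by (simp add: algebra_simps)
    qed
    then have gr: "green N (2^n) l = 2^n * (real N - real l) / real N"
     by (simp add: green_def min_def)
    have "real M * green N (2^n) l = real N - real l"
     unfolding gr N using M by (simp add: field_simps)
    then show ?thesis using False sN l by (simp add: kink_def)
   qed
   have "H n y = (\<Sum>l\<in>{1..<max N (L n y)}. abs (diff2 (f n) l) * kink (2^n) l (s n y))"
    unfolding H_def by (rule extend) simp
   also have "... = (\<Sum>l\<in>{1..<N}. abs (diff2 (f n) l) * kink (2^n) l (s n y))"
   proof (rule sum.mono_neutral_right)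
    show "\<forall>l\<in>{1..<max N (L n y)} - {1..<N}. abs (diff2 (f n) l) * kink (2^n) l (s n y) = 0"
    proof
     fix l assume "l \<in> {1..<max N (L n y)} - {1..<N}"
     then have "N <= l" by auto
     then have "real N <= real l" "\<not> l <= 2^n" using KN by (auto simp: not_le intro: less_le_trans[of _ "2 * 2^n"])
     then show "abs (diff2 (f n) l) * kink (2^n) l (s n y) = 0"
      using sN by (simp add: kink_def)
    qed
   qed auto
   also have "... <= (\<Sum>l\<in>{1..<N}. abs (diff2 (f n) l) * (real M * green N (2^n) l))"
    by (intro sum_mono mult_left_mono le_green) auto
   also have "... = real M * (\<Sum>l\<in>{1..<N}. green N (2^n) l * abs (diff2 (f n) l))"
    by (simp add: sum_distrib_left mult_ac)
   also have "... <= real M * C" using C[of n] by (intro mult_left_mono) (auto simp: N_def)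
   finally show ?thesis .
  qed
  then show ?thesis by blast
 qed
 have H_nonneg: "0 <= H n y" for n y
  unfolding H_def by (intro sum_nonneg mult_nonneg_nonneg kink_nonneg) auto
 have "\<exists>h. (\<forall>e>0. \<forall>\<^sub>F n in sequentially. H n y < h + e) & (\<forall>c. (\<forall>\<^sub>F n in sequentially. H n y <= c) --> h <= c)"
  if y: "0 < y" for y
 proof -
  obtain M where M: "y / x0 <= real M" using real_arch_simple by blast
  have "y <= real M * x0" using M x0 by (simp add: pos_divide_le_eq)
  also have "... <= real (max 2 M) * x0" using x0 by (intro mult_right_mono) auto
  finally obtain C where C: "!!n. H n y <= C" using H_bdd[of "max 2 M"] y by auto
  have "abs (H n y) <= C" for n using C[of n] H_nonneg[of n y] by simp
  from bounded_real_limsup[of "%n. H n y", OF this] show ?thesis by metis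
 qed
 then obtain h where h1: "!!y e. 0 < y ==> 0 < e ==> \<forall>\<^sub>F n in sequentially. H n y < h y + e"
  and h2: "!!y c. 0 < y ==> \<forall>\<^sub>F n in sequentially. H n y <= c ==> h y <= c"
  by metis
 have hg_convex: "convex_on {0<..} (%x. h x + sgm * g x)" if sgm: "abs sgm <= 1" for sgm
 proof (rule convex_onI)
  fix t x y :: real assume t: "0 < t" "t < 1" and "x \<in> {0<..}" "y \<in> {0<..}"
  then have xy: "0 < x" "0 < y" by auto
  define z where "z = (1 - t) * x + t * y"
  have z: "0 < z" unfolding z_def using t xy by (intro add_pos_pos) auto
  have "h z + sgm * g z <= (1 - t) * (h x + sgm * g x) + t * (h y + sgm * g y)"
  proof (rule field_le_epsilon)
   fix e :: real assume e: "0 < e"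
   have e3: "0 < e / 3" using e by simp
   have "(%n. (1 - t) * (sgm * G n x) + t * (sgm * G n y) - sgm * G n z) \<longlonglongrightarrow>
     (1 - t) * (sgm * g x) + t * (sgm * g y) - sgm * g z"
    by (intro tendsto_intros G_lim xy z)
   then have ev: "\<forall>\<^sub>F n in sequentially. (1 - t) * (sgm * G n x) + t * (sgm * G n y) - sgm * G n z
     < (1 - t) * (sgm * g x) + t * (sgm * g y) - sgm * g z + e / 3"
    by (rule order_tendstoD) (use e in simp)
   have "h z <= (1 - t) * h x + t * h y + ((1 - t) * (sgm * g x) + t * (sgm * g y) - sgm * g z) + e"
   proof (rule h2[OF z])
    show "\<forall>\<^sub>F n in sequentially. H n z <= (1 - t) * h x + t * h y + ((1 - t) * (sgm * g x) + t * (sgm * g y) - sgm * g z) + e"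
     using ev h1[OF xy(1) e3] h1[OF xy(2) e3]
    proof eventually_elim
     case (elim n)
     have "(1 - t) * H n x <= (1 - t) * (h x + e/3)" "t * H n y <= t * (h y + e/3)"
      using elim t by (auto intro!: mult_left_mono)
     moreover have "(1 - t) * (e/3) + t * (e/3) = e / 3" by (simp flip: distrib_right)
     moreover have "H n z + sgm * G n z <= (1 - t) * (H n x + sgm * G n x) + t * (H n y + sgm * G n y)"
      by (rule HG_convex[OF t z_def sgm])
     ultimately show ?case using elim(1) e unfolding distrib_left by linarith
    qed
   qed
   then show "h z + sgm * g z <= (1 - t) * (h x + sgm * g x) + t * (h y + sgm * g y) + e"
    by (simp add: algebra_simps)
  qed
  then show "h ((1 - t) *\<^sub>R x + t *\<^sub>R y) + sgm * g ((1 - t) *\<^sub>R x + t *\<^sub>R y)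
    <= (1 - t) * (h x + sgm * g x) + t * (h y + sgm * g y)"
   by (simp add: z_def)
 qed simp
 obtain M where M: "1 / x0 <= real M" using real_arch_simple by blast
 have "1 <= real M * x0" using M x0 by (simp add: pos_divide_le_eq)
 also have "... <= real (max 2 M) * x0" using x0 by (intro mult_right_mono) auto
 finally have M1: "1 <= real (max 2 M) * x0" .
 obtain C where C: "!!n y. 0 < y ==> y <= real (max 2 M) * x0 ==> H n y <= C"
  using H_bdd[of "max 2 M"] by auto
 have h_bdd: "h y <= C" if "y \<in> {0<..1}" for y
  using that M1 C by (intro h2) auto
 show ?thesis
  unfolding convex_diff_pos_def
 proof (intro exI conjI ballI allI impI)
  show "convex_on {0<..} (%x. (h x + 1 * g x) / 2)" "convex_on {0<..} (%x. (h x + (-1) * g x) / 2)"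
   by (intro convex_on_cdiv hg_convex; simp)+
  show "(h x + 1 * g x) / 2 <= (C + Cg) / 2" "(h x + (-1) * g x) / 2 <= (C + Cg) / 2" if "x \<in> {0<..1}" for x
   using h_bdd[OF that] bdd[OF that] by (simp_all add: abs_le_iff)
 qed (simp add: field_simps)
qed

section \<open>Martingales and Brownian increments\<close>

context prob_space
begin

text \<open>Cauchy-Schwarz in additive form: integrate
  \<open>2 * abs D * e <= D^2 + e^2\<close>.\<close>

lemma L2_imp_L1:
 fixes D :: "'a => real"
 assumes D: "D \<in> borel_measurable M" and int: "integrable M (%w. (D w)^2)" and e: "0 < e" "(LINT w|M. (D w)^2) <= e^2"
 shows "integrable M D" "(LINT w|M. abs (D w)) <= e"
proof -
 show i: "integrable M D" by (rule square_integrable_imp_integrable[OF D int])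
 have "(LINT w|M. abs (D w)) <= (LINT w|M. ((D w)^2 / e + e) / 2)"
 proof (rule integral_mono)
  fix w
  have "0 <= (abs (D w) - e)^2" by simp
  then have "2 * abs (D w) * e <= (D w)^2 + e * e" by (simp add: power2_diff power2_eq_square algebra_simps)
  then show "abs (D w) <= ((D w)^2 / e + e) / 2" using e by (simp add: field_simps)
 qed (use i int in auto)
 also have "... = ((LINT w|M. (D w)^2) / e + e) / 2" using int by (simp add: prob_space)
 also have "... <= (e^2 / e + e) / 2" using e by (intro divide_right_mono add_right_mono) auto
 also have "... = e" using e by (simp add: power2_eq_square)
 finally show "(LINT w|M. abs (D w)) <= e" .
qed

text \<open>Fatou's lemma in \<open>m\<close> for \<open>abs (Y n - Y m)\<close> turns an
  \<open>L1\<close> Cauchy bound and almost sure convergence into the same bound for the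
  limit.\<close>

lemma L1_limit_le:
 fixes Y :: "nat => 'a => real"
 assumes Y: "!!m. Y m \<in> borel_measurable M" and Z: "Z \<in> borel_measurable M"
  and lim: "AE w in M. (%m. Y m w) \<longlonglongrightarrow> Z w"
  and int: "!!m. n <= m ==> integrable M (%w. Y n w - Y m w)" and le: "!!m. n <= m ==> (LINT w|M. abs (Y n w - Y m w)) <= e"
 shows "integrable M (%w. Y n w - Z w)" "(LINT w|M. abs (Y n w - Z w)) <= e"
proof -
 have e: "0 <= e" using le[OF order_refl] by simp
 have "(\<integral>\<^sup>+w. ennreal \<bar>Y n w - Z w\<bar> \<partial>M) = (\<integral>\<^sup>+w. liminf (%m. ennreal \<bar>Y n w - Y m w\<bar>) \<partial>M)"
 proof (rule nn_integral_cong_AE, use lim in eventually_elim)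
  case (elim w)
  then have "(%m. ennreal \<bar>Y n w - Y m w\<bar>) \<longlonglongrightarrow> ennreal \<bar>Y n w - Z w\<bar>"
   by (intro tendsto_ennrealI tendsto_rabs tendsto_diff tendsto_const)
  then show ?case by (rule lim_imp_Liminf[OF sequentially_bot, symmetric])
 qed
 also have "... <= liminf (%m. \<integral>\<^sup>+w. ennreal \<bar>Y n w - Y m w\<bar> \<partial>M)"
  by (rule nn_integral_liminf) (intro measurable_compose[OF _ measurable_ennreal] borel_measurable_abs borel_measurable_diff Y)
 also have "... <= ennreal e"
 proof (rule Liminf_le)
  show "\<forall>\<^sub>F m in sequentially. (\<integral>\<^sup>+w. ennreal \<bar>Y n w - Y m w\<bar> \<partial>M) <= ennreal e"
   using eventually_ge_at_top[of n]
  proof eventually_elim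
   case (elim m)
   have "(\<integral>\<^sup>+w. ennreal \<bar>Y n w - Y m w\<bar> \<partial>M) = ennreal (LINT w|M. abs (Y n w - Y m w))"
    by (intro nn_integral_eq_integral integrable_abs int elim) simp
   then show ?case using le[OF elim] by (simp add: ennreal_leI)
  qed
 qed simp
 finally have nn: "(\<integral>\<^sup>+w. ennreal \<bar>Y n w - Z w\<bar> \<partial>M) <= ennreal e" .
 show i: "integrable M (%w. Y n w - Z w)"
  by (rule integrableI_bounded[OF borel_measurable_diff[OF Y Z]]) (use le_less_trans[OF nn, of \<infinity>] in simp)
 show "(LINT w|M. abs (Y n w - Z w)) <= e"
  using nn nn_integral_eq_integral[OF integrable_abs[OF i]] e by (simp add: ennreal_le_iff)
qed

end

context filtered_prob_space
begin

lemma space_F: "0 <= t ==> space (F t) = space M"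
 using subalgebra_F[of t] by (simp add: subalgebra_def)

lemma sets_F_subset: "0 <= t ==> sets (F t) \<subseteq> sets M"
 using subalgebra_F[of t] by (simp add: subalgebra_def)

lemma subalgebra_F_mono: "0 <= s ==> s <= t ==> subalgebra (F t) (F s)"
 using mono_F[of s t] space_F[of s] space_F[of t] by (simp add: subalgebra_def)

lemma measurable_F_mono: "f \<in> measurable (F s) N ==> 0 <= s ==> s <= t ==> f \<in> measurable (F t) N"
 using measurable_from_subalg[OF subalgebra_F_mono] by blast

lemma measurable_F: "f \<in> measurable (F t) N ==> 0 <= t ==> f \<in> measurable M N"
 using measurable_from_subalg[OF subalgebra_F] by blast

lemma finite_measure_subalgebra_F: "0 <= t ==> finite_measure_subalgebra M (F t)"
 by (simp add: finite_measure_subalgebra_def finite_measure_subalgebra_axioms_def subalgebra_F finite_measure_axioms)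

lemma integrable_bounded_mult:
 fixes xi Y :: "'a => real"
 assumes "integrable M Y" "xi \<in> borel_measurable M" "!!w. w \<in> space M ==> abs (xi w) <= C"
 shows "integrable M (%w. xi w * Y w)"
proof (rule leb_integrable_bound)
 show "integrable M (%w. C * Y w)" using assms(1) by simp
 show "AE w in M. norm (xi w * Y w) <= norm (C * Y w)"
 proof (intro AE_I2)
  fix w assume "w \<in> space M"
  then have "abs (xi w) <= abs C" using assms(3) abs_ge_self order_trans by blast
  then show "norm (xi w * Y w) <= norm (C * Y w)" by (simp add: abs_mult mult_right_mono)
 qed
qed (use assms in auto)

lemma integrable_bounded:
 fixes xi :: "'a => real"
 assumes "xi \<in> borel_measurable M" "!!w. w \<in> space M ==> abs (xi w) <= C"
 shows "integrable M xi"
 using integrable_bounded_mult[of "%_. 1" xi C] assms by simp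

text \<open>Conditional expectations are confined to this lemma and the next; from here on
  martingales are handled by testing with bounded \<open>F s\<close>-measurable functions.\<close>

lemma martingaleD:
 assumes Y: "martingale M F Y" and st: "0 <= s" "s <= t"
  and xi: "xi \<in> borel_measurable (F s)" "!!w. w \<in> space M ==> abs (xi w) <= C"
 shows "(LINT w|M. xi w * Y t w) = (LINT w|M. xi w * Y s w)"
proof -
 interpret S: finite_measure_subalgebra M "F s" using finite_measure_subalgebra_F st by simp
 have t: "0 <= t" using st by simp
 have int: "integrable M (Y t)" using Y t by (simp add: martingale_def)
 have meas: "xi \<in> borel_measurable M" using measurable_F[OF xi(1) st(1)] .
 have "(LINT w|M. xi w * Y t w) = (LINT w|M. xi w * real_cond_exp M (F s) (Y t) w)"
  using int meas xi by (intro S.real_cond_exp_intg(2)[symmetric] integrable_bounded_mult) auto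
 also have "... = (LINT w|M. xi w * Y s w)"
 proof (rule integral_cong_AE)
  have "AE w in M. real_cond_exp M (F s) (Y t) w = Y s w"
   using Y st by (simp add: martingale_def)
  then show "AE w in M. xi w * real_cond_exp M (F s) (Y t) w = xi w * Y s w" by eventually_elim simp
  have "Y s \<in> borel_measurable M"
   using Y st measurable_F by (auto simp: martingale_def adapted_def)
  then show "(%w. xi w * Y s w) \<in> borel_measurable M" using meas by simp
 qed (use meas in simp)
 finally show ?thesis .
qed

lemma martingaleI:
 assumes "adapted F Y" "!!t. 0 <= t ==> integrable M (Y t)"
  and "!!s t A. 0 <= s ==> s <= t ==> A \<in> sets (F s) ==>
   (LINT w|M. indicator A w * Y t w) = (LINT w|M. indicator A w * Y s w)"
 shows "martingale M F Y"
 unfolding martingale_def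
proof (intro conjI allI impI assms(1,2), (simp; fail))
 fix s t :: real assume st: "0 <= s & s <= t"
 interpret S: finite_measure_subalgebra M "F s" using finite_measure_subalgebra_F st by simp
 show "AE w in M. real_cond_exp M (F s) (Y t) w = Y s w"
 proof (rule S.real_cond_exp_charact)
  show "Y s \<in> borel_measurable (F s)" using assms(1) st by (simp add: adapted_def)
  show "(LINT x:A|M. Y t x) = (LINT x:A|M. Y s x)" if "A \<in> sets (F s)" for A
   using assms(3)[of s t A] st that by (simp add: set_lebesgue_integral_def)
 qed (use assms(2) st in auto)
qed

end

locale brownian = filtered_prob_space M F for M :: "'a measure" and F +
 fixes B :: "real => 'a => real" and x0 :: real
 assumes bm: "brownian_motion M F x0 B" and x0_pos: "0 < x0"
begin

abbreviation "H0 == hitting_time B 0"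
abbreviation "SB == stopped H0 B"

lemma B_adapted: "0 <= t ==> B t \<in> borel_measurable (F t)"
 using bm by (simp add: brownian_motion_def adapted_def)

lemma B_adapted_mono: "0 <= s ==> s <= t ==> B s \<in> borel_measurable (F t)"
 using measurable_F_mono B_adapted by blast

lemma B_measurable: "0 <= t ==> B t \<in> borel_measurable M"
 using B_adapted measurable_F by blast

lemma B_0: "w \<in> space M ==> B 0 w = x0"
 using bm by (simp add: brownian_motion_def)

lemma B_continuous: "w \<in> space M ==> continuous_on {0..} (%t. B t w)"
 using bm by (simp add: brownian_motion_def)

lemma B_increment_distributed:
 assumes "0 <= s" "s < t"
 shows "distributed M lborel (%w. B t w - B s w) (normal_density 0 (sqrt (t - s)))"
 using assms bm by (auto simp: brownian_motion_def)

lemma B_increment_integrable_power: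
 assumes "0 <= s" "s <= t"
 shows "integrable M (%w. (B t w - B s w)^k)"
proof (cases "s = t")
 case False
 then have D: "distributed M lborel (%w. B t w - B s w) (normal_density 0 (sqrt (t - s)))"
  using assms B_increment_distributed by simp
 have "integrable lborel (%x. normal_density 0 (sqrt (t - s)) x * (x - 0)^k)"
  using assms False by (intro integrable_normal_moment) auto
 then show ?thesis
  using distributed_integrable[OF D, of "%x. x^k"] by simp
qed (cases k; simp)

lemma B_increment_integrable: "0 <= s ==> s <= t ==> integrable M (%w. B t w - B s w)"
 using B_increment_integrable_power[of s t 1] by simp

lemma B_increment_expectation:
 assumes "0 <= s" "s <= t"
 shows "(LINT w|M. B t w - B s w) = 0"
proof (cases "s = t")
 case False
 then show ?thesis
  using assms normal_distributed_expectation[OF _ B_increment_distributed[of s t]] by simp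
qed simp

lemma B_increment_second_moment:
 assumes "0 <= s" "s <= t"
 shows "(LINT w|M. (B t w - B s w)^2) = t - s"
proof (cases "s = t")
 case False
 then show ?thesis
  using assms normal_distributed_variance[OF _ B_increment_distributed[of s t]]
   B_increment_expectation[of s t] by simp
qed simp

lemma B_increment_indep:
 assumes st: "0 <= s" "s < t" and xi: "xi \<in> borel_measurable (F s)"
 shows "indep_var borel xi borel (%w. B t w - B s w)"
 unfolding indep_var_eq
proof (intro conjI)
 show "random_variable borel xi" using measurable_F[OF xi st(1)] .
 have [measurable]: "B t \<in> borel_measurable M" "B s \<in> borel_measurable M"
  using B_measurable st by auto
 show "random_variable borel (%w. B t w - B s w)" by simp
 have ind: "indep_set (sets (F s)) (sets (vimage_algebra (space M) (%w. B t w - B s w) borel))"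
  using bm st by (auto simp: brownian_motion_def)
 have 1: "sigma_sets (space M) {xi -` A \<inter> space M |A. A \<in> sets borel} \<subseteq> sets (F s)"
 proof -
  have "{xi -` A \<inter> space M |A. A \<in> sets borel} \<subseteq> sets (F s)"
   using measurable_sets[OF xi] space_F[OF st(1)] by auto
  from sets.sigma_sets_subset[OF this] show ?thesis by (simp add: space_F[OF st(1)])
 qed
 have 2: "sigma_sets (space M) {(%w. B t w - B s w) -` A \<inter> space M |A. A \<in> sets borel}
   = sets (vimage_algebra (space M) (%w. B t w - B s w) borel)"
  by (simp add: sets_vimage_algebra)
 show "indep_set (sigma_sets (space M) {xi -` A \<inter> space M |A. A \<in> sets borel})
   (sigma_sets (space M) {(%w. B t w - B s w) -` A \<inter> space M |A. A \<in> sets borel})"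
  using ind 1 2 unfolding indep_set_def
  by (elim indep_sets_mono_sets) (auto split: bool.split)
qed

lemma B_increment_orthogonal:
 assumes st: "0 <= s" "s <= t" and xi: "xi \<in> borel_measurable (F s)" "integrable M xi"
 shows "integrable M (%w. xi w * (B t w - B s w))"
  and "(LINT w|M. xi w * (B t w - B s w)) = 0"
proof -
 have "integrable M (%w. xi w * (B t w - B s w)) & (LINT w|M. xi w * (B t w - B s w)) = 0"
 proof (cases "s = t")
  case False
  then have "indep_var borel xi borel (%w. B t w - B s w)"
   using B_increment_indep st xi by simp
  from indep_var_lebesgue_integral[OF this xi(2)] indep_var_integrable[OF this xi(2)]
  show ?thesis
   using B_increment_integrable[OF st] B_increment_expectation[OF st] by simp
 qed simp
 then show "integrable M (%w. xi w * (B t w - B s w))" "(LINT w|M. xi w * (B t w - B s w)) = 0"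
  by auto
qed

lemma B_increment_square:
 assumes st: "0 <= s" "s <= t" and xi: "xi \<in> borel_measurable (F s)" "integrable M xi"
 shows "integrable M (%w. xi w * (B t w - B s w)^2)"
  and "(LINT w|M. xi w * (B t w - B s w)^2) = (t - s) * (LINT w|M. xi w)"
proof -
 have "integrable M (%w. xi w * (B t w - B s w)^2) &
   (LINT w|M. xi w * (B t w - B s w)^2) = (t - s) * (LINT w|M. xi w)"
 proof (cases "s = t")
  case False
  then have "indep_var borel xi borel (%w. B t w - B s w)"
   using B_increment_indep st xi by simp
  from indep_var_compose[OF this, of "%x. x" borel "%x. x^2" borel]
  have "indep_var borel xi borel (%w. (B t w - B s w)^2)" by (simp add: o_def)
  from indep_var_lebesgue_integral[OF this xi(2)] indep_var_integrable[OF this xi(2)]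
  show ?thesis
   using B_increment_integrable_power[OF st, of 2] B_increment_second_moment[OF st] by simp
 qed simp
 then show "integrable M (%w. xi w * (B t w - B s w)^2)"
  "(LINT w|M. xi w * (B t w - B s w)^2) = (t - s) * (LINT w|M. xi w)" by auto
qed

lemma B_integrable: "0 <= t ==> integrable M (B t)"
proof -
 assume t: "0 <= t"
 have "integrable M (%w. (B t w - B 0 w) + x0)"
  using B_increment_integrable[of 0 t] t by simp
 then show ?thesis
  by (subst leb_integrable_cong[OF refl, of M "B t" "%w. (B t w - B 0 w) + x0"]) (simp_all add: B_0)
qed

lemma martingale_B: "martingale M F B"
proof (rule martingaleI)
 show "adapted F B" using B_adapted by (simp add: adapted_def)
 fix s t :: real and A assume st: "0 <= s" "s <= t" and A: "A \<in> sets (F s)"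
 have ind: "(indicator A :: 'a => real) \<in> borel_measurable (F s)" using A by simp
 have AM: "A \<in> sets M" using A sets_F_subset[OF st(1)] by auto
 have int: "integrable M (%w. indicator A w * B u w)" if "0 <= u" for u
  using integrable_mult_indicator[OF AM B_integrable[OF that]] by simp
 have "integrable M (indicator A :: 'a => real)" using AM by (simp add: less_top[symmetric])
 then have "(LINT w|M. indicator A w * (B t w - B s w)) = 0"
  using B_increment_orthogonal(2)[OF st ind] by simp
 then show "(LINT w|M. indicator A w * B t w) = (LINT w|M. indicator A w * B s w)"
  using int st by (simp add: right_diff_distrib)
qed (rule B_integrable)

lemma ito_isometry:
 fixes t :: "nat => real" and xi :: "nat => 'a => real"
 assumes t: "0 <= t 0" "mono t"
  and xi: "!!k. xi k \<in> borel_measurable (F (t k))" "!!k w. w \<in> space M ==> abs (xi k w) <= C"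
 shows "integrable M (%w. (\<Sum>k<n. xi k w * (B (t (Suc k)) w - B (t k) w))^2)" (is "integrable M (%w. (?S n w)^2)")
  and "(LINT w|M. (\<Sum>k<n. xi k w * (B (t (Suc k)) w - B (t k) w))^2)
   = (\<Sum>k<n. (t (Suc k) - t k) * (LINT w|M. (xi k w)^2))"
  and "(%w. \<Sum>k<n. xi k w * (B (t (Suc k)) w - B (t k) w)) \<in> borel_measurable (F (t n))"
proof -
 have tn: "0 <= t k" "t k <= t (Suc k)" for k
  using t monoD[OF t(2), of 0 k] monoD[OF t(2), of k "Suc k"] by auto
 have "integrable M (%w. (?S n w)^2) &
   (LINT w|M. (?S n w)^2) = (\<Sum>k<n. (t (Suc k) - t k) * (LINT w|M. (xi k w)^2)) &
   ?S n \<in> borel_measurable (F (t n))"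
 proof (induction n)
  case (Suc n)
  let ?D = "%w. B (t (Suc n)) w - B (t n) w"
  have int: "integrable M (%w. (?S n w)^2)" and Sn: "?S n \<in> borel_measurable (F (t n))"
   using Suc by auto
  have SnM: "?S n \<in> borel_measurable M" using measurable_F[OF Sn] tn by simp
  have xiM: "xi n \<in> borel_measurable M" using measurable_F[OF xi(1)] tn by simp
  have "integrable M (?S n)"
   using square_integrable_imp_integrable[OF SnM int] .
  then have int1: "integrable M (%w. xi n w * ?S n w)"
   by (rule integrable_bounded_mult[OF _ xiM xi(2)])
  have m1: "(%w. xi n w * ?S n w) \<in> borel_measurable (F (t n))" using xi(1) Sn by measurable
  have int2: "integrable M (%w. (xi n w)^2)"
  proof (rule integrable_bounded[where C = "C^2"])
   fix w assume "w \<in> space M"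
   then show "abs ((xi n w)^2) <= C^2" using xi(2)[of w n] by (simp add: abs_le_square_iff[symmetric])
  qed (use xiM in simp)
  have m2: "(%w. (xi n w)^2) \<in> borel_measurable (F (t n))" using xi(1) by simp
  \<comment> \<open>The mixed term pairs the past \<open>xi n * ?S n\<close> with a centred
    increment and vanishes; the square term factorises by independence.\<close>
  note o = B_increment_orthogonal[OF tn m1 int1] B_increment_square[OF tn m2 int2]
  have expand: "(?S (Suc n) w)^2 = ((?S n w)^2 + 2 * (xi n w * ?S n w * ?D w)) + (xi n w)^2 * (?D w)^2" for w
   by (simp add: power2_eq_square algebra_simps)
  have "integrable M (%w. (?S (Suc n) w)^2)"
   unfolding expand by (intro leb_integrable_add integrable_mult_right int o(1,3))
  moreover have "(LINT w|M. (?S (Suc n) w)^2)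
    = (\<Sum>k<Suc n. (t (Suc k) - t k) * (LINT w|M. (xi k w)^2))"
  proof -
   have "(LINT w|M. (?S (Suc n) w)^2)
    = ((LINT w|M. (?S n w)^2) + 2 * (LINT w|M. xi n w * ?S n w * ?D w)) + (LINT w|M. (xi n w)^2 * (?D w)^2)"
    unfolding expand
    by (subst leb_integral_add
      | intro leb_integrable_add integrable_mult_right int o(1,3)
      | simp only: leb_integral_mult_right_zero)+
   then show ?thesis using Suc o by simp
  qed
  moreover have "?S (Suc n) \<in> borel_measurable (F (t (Suc n)))"
  proof -
   have "?S n \<in> borel_measurable (F (t (Suc n)))" "xi n \<in> borel_measurable (F (t (Suc n)))"
    using measurable_F_mono[OF Sn] measurable_F_mono[OF xi(1)] tn by auto
   moreover have "B (t (Suc n)) \<in> borel_measurable (F (t (Suc n)))" "B (t n) \<in> borel_measurable (F (t (Suc n)))"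
    using B_adapted_mono tn by auto
   ultimately show ?thesis unfolding sum.lessThan_Suc by measurable
  qed
  ultimately show ?case by blast
 qed simp
 then show "integrable M (%w. (?S n w)^2)"
  "(LINT w|M. (?S n w)^2) = (\<Sum>k<n. (t (Suc k) - t k) * (LINT w|M. (xi k w)^2))"
  "?S n \<in> borel_measurable (F (t n))" by auto
qed

text \<open>Freezing the integrand once the partial sums have exceeded \<open>l\<close> reduces this maximal inequality to
 the isometry.\<close>

lemma ito_maximal_inequality:
 fixes t :: "nat => real" and xi :: "nat => 'a => real"
 assumes t: "0 <= t 0" "mono t"
  and xi: "!!k. xi k \<in> borel_measurable (F (t k))" "!!k w. w \<in> space M ==> abs (xi k w) <= C"
  and l: "0 < l"
 shows "prob {w\<in>space M. \<exists>m\<le>n. l < abs (\<Sum>k<m. xi k w * (B (t (Suc k)) w - B (t k) w))}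
  <= (\<Sum>k<n. (t (Suc k) - t k) * (LINT w|M. (xi k w)^2)) / l^2"
proof -
 define S where "S n w = (\<Sum>k<n. xi k w * (B (t (Suc k)) w - B (t k) w))" for n w
 define P where "P k w \<longleftrightarrow> (\<forall>m\<le>k. abs (S m w) <= l)" for k w
 define eta where "eta k w = (if P k w then xi k w else 0)" for k w
 define R where "R n w = (\<Sum>k<n. eta k w * (B (t (Suc k)) w - B (t k) w))" for n w
 have tn: "0 <= t k" "j <= k ==> t j <= t k" for j k
  using t monoD[OF t(2), of 0 k] monoD[OF t(2), of j k] by auto
 have Sm: "S m \<in> borel_measurable (F (t k))" if "m <= k" for m k
  using measurable_F_mono[OF ito_isometry(3)[OF t xi] tn(1) tn(2)[OF that]] by (simp add: S_def[abs_def])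
 have Pm: "Measurable.pred (F (t k)) (P k)" for k
 proof -
  have "Measurable.pred (F (t k)) (%w. abs (S m w) <= l)" if "m <= k" for m
   using Sm[OF that] by measurable
  then show ?thesis unfolding P_def[abs_def] by (intro pred_intros_countable pred_intros_imp') auto
 qed
 have etam: "eta k \<in> borel_measurable (F (t k))" for k
  unfolding eta_def using Pm[of k] xi(1)[of k] by measurable
 have etab: "abs (eta k w) <= C" if "w \<in> space M" for k w
  using xi(2)[OF that, of k] by (auto simp: eta_def)
 \<comment> \<open>At the first index \<open>q\<close> where the bound is violated, \<open>R\<close>
   has just reached \<open>S q\<close>; from then on every \<open>eta k\<close> vanishes, so
   \<open>R n\<close> still has this value.\<close>
 have sub: "{w\<in>space M. \<exists>m\<le>n. l < abs (S m w)} \<subseteq> {w\<in>space M. l^2 <= (R n w)^2}"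
 proof safe
  fix w m assume m: "m <= n" "l < abs (S m w)"
  define q where "q = (LEAST m. l < abs (S m w))"
  have q: "l < abs (S q w)" "q <= n"
   unfolding q_def using m LeastI[of "%m. l < abs (S m w)" m] Least_le[of "%m. l < abs (S m w)" m] by auto
  have less: "abs (S j w) <= l" if "j < q" for j
   using not_less_Least[of j "%m. l < abs (S m w)"] that by (simp add: q_def)
  have "R n w = (\<Sum>k<q. eta k w * (B (t (Suc k)) w - B (t k) w))"
   unfolding R_def
  proof (rule sum.mono_neutral_right)
   show "\<forall>k\<in>{..<n} - {..<q}. eta k w * (B (t (Suc k)) w - B (t k) w) = 0"
   proof
    fix k assume "k \<in> {..<n} - {..<q}"
    then have "\<not> P k w" using q by (auto simp: P_def not_le intro!: exI[of _ q])
    then show "eta k w * (B (t (Suc k)) w - B (t k) w) = 0" by (simp add: eta_def)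
   qed
  qed (use q in auto)
  also have "... = S q w"
   unfolding S_def by (intro sum.cong) (auto simp: eta_def P_def less)
  finally have "l <= abs (R n w)" using q by simp
  then show "l^2 <= (R n w)^2" using l by (simp add: abs_le_square_iff[symmetric])
 qed
 have R_square: "integrable M (%w. (R n w)^2)"
  "(LINT w|M. (R n w)^2) = (\<Sum>k<n. (t (Suc k) - t k) * (LINT w|M. (eta k w)^2))"
  unfolding R_def by (rule ito_isometry(1,2)[OF t etam etab]; assumption)+
 have RM: "R n \<in> borel_measurable M"
  unfolding R_def[abs_def] by (rule measurable_F[OF ito_isometry(3)[OF t etam etab] tn(1)])
 have "prob {w\<in>space M. \<exists>m\<le>n. l < abs (S m w)} <= prob {w\<in>space M. l^2 <= (R n w)^2}"
  using RM by (intro finite_measure_mono sub) measurable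
 also have "... <= (LINT w|M. (R n w)^2) / l^2"
  by (rule integral_Markov_inequality_measure[where A = "{}"]) (use R_square(1) l in auto)
 also have "... <= (\<Sum>k<n. (t (Suc k) - t k) * (LINT w|M. (xi k w)^2)) / l^2"
 proof (intro divide_right_mono)
  have "(LINT w|M. (eta k w)^2) <= (LINT w|M. (xi k w)^2)" for k
  proof (rule integral_mono')
   have "xi k \<in> borel_measurable M" using measurable_F[OF xi(1)] tn by simp
   then show "integrable M (%w. (xi k w)^2)"
    using xi(2)[of _ k] order_trans[OF _ abs_ge_self]
    by (intro integrable_bounded[where C = "C^2"]) (auto simp: abs_le_square_iff[symmetric])
  qed (auto simp: eta_def)
  then show "(LINT w|M. (R n w)^2) <= (\<Sum>k<n. (t (Suc k) - t k) * (LINT w|M. (xi k w)^2))"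
   unfolding R_square(2) using tn by (intro sum_mono mult_left_mono) auto
 qed simp
 finally show ?thesis by (simp add: S_def)
qed

end

section \<open>Hitting times and optional stopping on dyadic grids\<close>

lemma real_min_ereal:
 assumes "0 <= T" "0 <= t"
 shows "ereal (real_of_ereal (min (ereal t) T)) = min (ereal t) T"
  and "0 <= real_of_ereal (min (ereal t) T)" "real_of_ereal (min (ereal t) T) <= t"
  and "T <= ereal t ==> real_of_ereal (min (ereal t) T) = real_of_ereal T"
  and "ereal t <= T ==> real_of_ereal (min (ereal t) T) = t"
 using assms by (cases T; auto simp: min_def)+

lemma continuous_on_stopped:
 assumes X: "continuous_on {0..} (%t. X t w)" and T: "0 <= T w"
 shows "continuous_on {0..} (%t. stopped T X t w)"
proof (cases "T w")
 case (real r)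
 then have "continuous_on {0..} (%t. X (min t r) w)"
  using T by (intro continuous_on_compose2[OF X] continuous_intros) auto
 moreover have "stopped T X t w = X (min t r) w" for t
  using real by (simp add: stopped_def min_def)
 ultimately show ?thesis by simp
qed (use X T in \<open>auto simp: stopped_def min_def\<close>)

lemma stopped_const: "T w <= ereal s ==> s <= t ==> stopped T X t w = stopped T X s w"
 unfolding stopped_def by (metis ereal_less_eq(3) min.absorb2 order_trans)

lemma stopped_before: "ereal t <= T w ==> stopped T X t w = X t w"
 by (simp add: stopped_def min_absorb1)

context filtered_prob_space
begin

text \<open>The infimum is attained because the zeros in the compact window
  \<open>{0..t + 1}\<close> form a closed set; the window extends beyond \<open>t\<close> so that it
  contains a zero whenever the infimum is at most \<open>t\<close>.\<close>

lemma hit_zero_le_iff: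
 assumes cont: "continuous_on {0..} (%t. Y t w :: real)" and t: "0 <= t"
 shows "Inf {ereal t |t. 0 <= t & Y t w = 0} <= ereal t \<longleftrightarrow> (\<exists>s\<in>{0..t}. Y s w = 0)"
proof
 assume "\<exists>s\<in>{0..t}. Y s w = 0"
 then obtain s where s: "0 <= s" "s <= t" "Y s w = 0" by auto
 then have "Inf {ereal t |t. 0 <= t & Y t w = 0} <= ereal s" by (intro Inf_lower) auto
 also have "... <= ereal t" using s by simp
 finally show "Inf {ereal t |t. 0 <= t & Y t w = 0} <= ereal t" .
next
 assume inf: "Inf {ereal t |t. 0 <= t & Y t w = 0} <= ereal t"
 define Z where "Z = {s\<in>{0..t+1}. Y s w = 0}"
 have "Inf {ereal t |t. 0 <= t & Y t w = 0} < ereal (t + 1)"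
  using inf by (rule le_less_trans) simp
 then obtain u where u: "0 <= u" "Y u w = 0" "u < t + 1"
  unfolding Inf_less_iff by auto
 have cl: "closed Z"
  unfolding Z_def by (intro continuous_closed_preimage_constant) (auto intro: continuous_on_subset[OF cont])
 have "u \<in> Z" using u by (simp add: Z_def)
 then have "Inf Z \<in> Z" by (intro closed_contains_Inf cl) (auto simp: Z_def intro!: bdd_belowI[of _ 0])
 moreover have "Inf Z <= t"
 proof (rule ccontr)
  assume "\<not> Inf Z <= t"
  then have lt: "t < Inf Z" by simp
  have "ereal (Inf Z) <= Inf {ereal t |t. 0 <= t & Y t w = 0}"
  proof (rule Inf_greatest, clarify)
   fix v assume v: "0 <= v" "Y v w = 0"
   show "ereal (Inf Z) <= ereal v"
   proof (cases "v <= t + 1")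
    case True
    then show ?thesis using v by (auto simp: Z_def intro!: cInf_lower bdd_belowI[of _ 0])
   next
    case False
    have "Inf Z <= u" using \<open>u \<in> Z\<close> by (auto simp: Z_def intro!: cInf_lower bdd_belowI[of _ 0])
    then show ?thesis using False u by simp
   qed
  qed
  also note inf
  finally show False using lt by simp
 qed
 ultimately show "\<exists>s\<in>{0..t}. Y s w = 0" by (auto simp: Z_def)
qed

text \<open>A continuous path has a zero in \<open>{0..t}\<close> iff it takes arbitrarily small
  values at countably many times there: continuity gives one direction, compactness the other. Only
  times up to \<open>t\<close> are inspected, so this is a stopping time of the raw
  filtration.\<close>

lemma hit_zero_stopping_time:
 assumes ad: "adapted F Y" and cont: "!!w. w \<in> space M ==> continuous_on {0..} (%t. Y t w)"
 shows "stopping_time_ext M F (%w. Inf {ereal t |t. 0 <= t & Y t w = 0})"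
 unfolding stopping_time_ext_def
proof (intro conjI ballI allI impI)
 show "0 <= Inf {ereal t |t. 0 <= t & Y t w = 0}" for w by (intro Inf_greatest) auto
next
 fix t :: real assume t: "0 <= t"
 \<comment> \<open>A zero at \<open>s < t\<close> is approximated by rationals to its right; a zero
   at \<open>t\<close> is caught by the point \<open>t\<close> itself.\<close>
 define Q where "Q = insert t (\<rat> \<inter> {0..t})"
 have Q: "countable Q" unfolding Q_def by (auto intro: countable_Int1 countable_rat)
 have "Inf {ereal t |t. 0 <= t & Y t w = 0} <= ereal t \<longleftrightarrow> (\<forall>n. \<exists>q\<in>Q. abs (Y q w) < 1 / real (Suc n))"
  if w: "w \<in> space M" for w
  unfolding hit_zero_le_iff[of Y w, OF cont[OF w] t]
 proof
  assume "\<exists>s\<in>{0..t}. Y s w = 0"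
  then obtain s where s: "0 <= s" "s <= t" "Y s w = 0" by auto
  show "\<forall>n. \<exists>q\<in>Q. abs (Y q w) < 1 / real (Suc n)"
  proof
   fix n
   show "\<exists>q\<in>Q. abs (Y q w) < 1 / real (Suc n)"
   proof (cases "s = t")
    case True
    then show ?thesis using s by (auto simp: Q_def)
   next
    case False
    obtain d where d: "0 < d" "!!u. 0 <= u ==> abs (u - s) < d ==> abs (Y u w - Y s w) < 1 / real (Suc n)"
     using cont[OF w] s(1) unfolding continuous_on_iff dist_real_def
     by (metis atLeast_iff of_nat_0_less_iff zero_less_Suc zero_less_divide_1_iff)
    obtain q where q: "q \<in> \<rat>" "s < q" "q < min t (s + d)"
     using Rats_dense_in_real[of s "min t (s + d)"] False s d by auto
    then show ?thesis using d(2)[of q] s by (intro bexI[of _ q]) (auto simp: Q_def)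
   qed
  qed
 next
  assume "\<forall>n. \<exists>q\<in>Q. abs (Y q w) < 1 / real (Suc n)"
  then obtain q where q: "!!n. q n \<in> Q" "!!n. abs (Y (q n) w) < 1 / real (Suc n)" by metis
  have "q n \<in> {0..t}" for n using q(1)[of n] t by (auto simp: Q_def)
  then obtain l r where lr: "l \<in> {0..t}" "strict_mono r" "(q \<circ> r) \<longlonglongrightarrow> l"
   using compact_Icc[of 0 t] unfolding compact_def by metis
  have "((%t. Y t w) \<longlongrightarrow> Y l w) (at l within {0..})"
   using cont[OF w] lr(1) by (auto simp: continuous_on)
  then have "(%n. Y (q (r n)) w) \<longlonglongrightarrow> Y l w"
   using continuous_on_tendsto_compose[OF cont[OF w] lr(3)[unfolded o_def]] lr(1) \<open>!!n. q n \<in> {0..t}\<close> by auto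
  moreover have "(%n. Y (q (r n)) w) \<longlonglongrightarrow> 0"
  proof (rule Lim_null_comparison)
   show "\<forall>\<^sub>F n in sequentially. norm (Y (q (r n)) w) <= 1 / real (Suc (r n))"
    using less_imp_le[OF q(2)] by (intro always_eventually allI) (simp only: real_norm_def)
   show "(%n. 1 / real (Suc (r n))) \<longlonglongrightarrow> 0"
    using LIMSEQ_subseq_LIMSEQ[OF lim_1_over_n[THEN LIMSEQ_Suc] lr(2)] by (simp add: o_def)
  qed
  ultimately have "Y l w = 0" by (rule LIMSEQ_unique)
  then show "\<exists>s\<in>{0..t}. Y s w = 0" using lr(1) by auto
 qed
 then show "Measurable.pred (F t) (%w. Inf {ereal t |t. 0 <= t & Y t w = 0} <= ereal t)"
 proof (subst measurable_cong)
  have "Y q \<in> borel_measurable (F t)" if "q \<in> Q" for q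
   using that t ad measurable_F_mono[of "Y q" q borel t] by (auto simp: Q_def adapted_def)
  then show "Measurable.pred (F t) (%w. \<forall>n. \<exists>q\<in>Q. abs (Y q w) < 1 / real (Suc n))"
   using Q by (intro pred_intros_countable pred_intros_countable_bounded) (auto intro!: borel_measurable_less)
 qed (simp add: space_F t)
qed

text \<open>Discretisation of a random time from above on the grid with mesh \<open>2^-m\<close>, capped at the horizon \<open>N\<close>.\<close>

definition grid_index :: "('a => ereal) => nat => nat => 'a => nat" where
 "grid_index T N m w = (LEAST k. N * 2^m <= k \<or> T w <= ereal (real k / 2^m))"

definition grid_time :: "('a => ereal) => nat => nat => 'a => real" where
 "grid_time T N m w = real (grid_index T N m w) / 2^m"

lemma grid_index_le_iff: "grid_index T N m w <= k \<longleftrightarrow> N * 2^m <= k \<or> T w <= ereal (real k / 2^m)"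
proof
 let ?P = "%k. N * 2^m <= k \<or> T w <= ereal (real k / 2^m)"
 assume "?P k"
 then show "grid_index T N m w <= k" unfolding grid_index_def by (rule Least_le)
next
 let ?P = "%k. N * 2^m <= k \<or> T w <= ereal (real k / 2^m)"
 assume le: "grid_index T N m w <= k"
 have least: "?P (grid_index T N m w)" unfolding grid_index_def by (rule LeastI[of _ "N * 2^m"]) simp
 have mono: "ereal (real (grid_index T N m w) / 2^m) <= ereal (real k / 2^m)"
  using le by (simp add: divide_right_mono)
 show "?P k"
  using least
 proof
  assume "N * 2^m <= grid_index T N m w"
  then show ?thesis using le by (auto intro: order_trans)
 next
  assume "T w <= ereal (real (grid_index T N m w) / 2^m)"
  then show ?thesis using mono by (auto intro: order_trans)
 qed
qed

lemma grid_index_le: "grid_index T N m w <= N * 2^m"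
 by (simp add: grid_index_le_iff)

lemma grid_time_nonneg: "0 <= grid_time T N m w"
 by (simp add: grid_time_def)

lemma grid_time_ge: "min (ereal (real N)) (T w) <= ereal (grid_time T N m w)"
proof -
 have "N * 2^m <= grid_index T N m w \<or> T w <= ereal (real (grid_index T N m w) / 2^m)"
  using grid_index_le_iff[of T N m w "grid_index T N m w"] by simp
 moreover have "ereal (real N) <= ereal (grid_time T N m w)" if "N * 2^m <= grid_index T N m w"
  using that unfolding grid_time_def by (simp add: le_divide_eq flip: of_nat_le_iff[where 'a = real])
 ultimately show ?thesis by (auto simp: grid_time_def min_le_iff_disj)
qed

lemma grid_time_less:
 assumes "0 <= T w"
 shows "grid_time T N m w <= real_of_ereal (min (ereal (real N)) (T w)) + 1 / 2^m"
proof (cases "grid_index T N m w")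
 case 0
 then show ?thesis using real_min_ereal(2)[OF assms, of "real N"] by (simp add: grid_time_def)
next
 case (Suc k)
 then have "\<not> grid_index T N m w <= k" by simp
 then have k: "k < N * 2^m" "ereal (real k / 2^m) < T w" by (auto simp: grid_index_le_iff not_le)
 have "real k < real N * 2^m" using k(1) by (simp flip: of_nat_less_iff[where 'a = real])
 then have "real k / 2^m < real N" by (simp add: divide_less_eq)
 with k(2) have "ereal (real k / 2^m) <= min (ereal (real N)) (T w)" by simp
 then have "real k / 2^m <= real_of_ereal (min (ereal (real N)) (T w))"
  using real_min_ereal(1)[OF assms, of "real N"] by (metis ereal_less_eq(3) of_nat_0_le_iff)
 then show ?thesis by (simp add: grid_time_def Suc add_divide_distrib)
qed

lemma grid_time_tendsto:
 assumes "0 <= T w"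
 shows "(%m. grid_time T N m w) \<longlonglongrightarrow> real_of_ereal (min (ereal (real N)) (T w))"
proof (rule tendsto_sandwich[where f = "%_. real_of_ereal (min (ereal (real N)) (T w))"
   and h = "%m. real_of_ereal (min (ereal (real N)) (T w)) + 1 / 2^m"])
 have "(%m. (1/2::real)^m) \<longlonglongrightarrow> 0" by (intro LIMSEQ_power_zero) simp
 then have "(%m. real_of_ereal (min (ereal (real N)) (T w)) + (1/2)^m) \<longlonglongrightarrow> real_of_ereal (min (ereal (real N)) (T w)) + 0"
  by (rule tendsto_add[OF tendsto_const])
 then show "(%m. real_of_ereal (min (ereal (real N)) (T w)) + 1/2^m) \<longlonglongrightarrow> real_of_ereal (min (ereal (real N)) (T w))"
  by (simp add: power_one_over)
 have "real_of_ereal (min (ereal (real N)) (T w)) <= grid_time T N m w" for m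
  using grid_time_ge[of N T w m] real_min_ereal(1)[OF assms, of "real N"]
  by (metis ereal_less_eq(3) of_nat_0_le_iff)
 then show "\<forall>\<^sub>F m in sequentially. real_of_ereal (min (ereal (real N)) (T w)) <= grid_time T N m w" by simp
 show "\<forall>\<^sub>F m in sequentially. grid_time T N m w <= real_of_ereal (min (ereal (real N)) (T w)) + 1 / 2^m"
  using grid_time_less[of T w, OF assms] by simp
qed simp

definition grid_stop :: "nat => nat => ('a => nat) => bool" where
 "grid_stop m K \<rho> \<longleftrightarrow> (\<forall>w. \<rho> w <= K) & (\<forall>k. Measurable.pred (F (real k / 2^m)) (%w. \<rho> w <= k))"

lemma grid_stop_grid_index:
 assumes "stopping_time_ext M F T"
 shows "grid_stop m (N * 2^m) (grid_index T N m)"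
 unfolding grid_stop_def
proof (intro conjI allI)
 fix k
 have "Measurable.pred (F (real k / 2^m)) (%w. T w <= ereal (real k / 2^m))"
  using assms by (simp add: stopping_time_ext_def)
 then show "Measurable.pred (F (real k / 2^m)) (%w. grid_index T N m w <= k)"
  unfolding grid_index_le_iff by (cases "N * 2^m <= k") simp_all
qed (rule grid_index_le)

lemma grid_stop_eq:
 assumes "grid_stop m K \<rho>"
 shows "Measurable.pred (F (real k / 2^m)) (%w. \<rho> w = k)"
proof -
 have "Measurable.pred (F (real k / 2^m)) (%w. \<rho> w <= j)" if "j <= k" for j
  using assms that unfolding grid_stop_def
  by (intro measurable_F_mono[of "%w. \<rho> w <= j" "real j / 2^m" _ "real k / 2^m"]) (simp_all add: divide_right_mono)
 moreover have "\<rho> w = k \<longleftrightarrow> \<rho> w <= k & (k = 0 \<or> \<not> \<rho> w <= k - 1)" for w by auto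
 ultimately show ?thesis by (simp only:) (intro pred_intros_logic; simp)
qed

text \<open>The sigma-algebra of the past at the random grid time \<open>\<rho> / 2^m\<close>; the
  generating family turns out to be a sigma-algebra itself.\<close>

definition grid_sigma :: "nat => ('a => nat) => 'a measure" where
 "grid_sigma m \<rho> = sigma (space M) {E \<in> sets M. \<forall>k. {w\<in>E. \<rho> w = k} \<in> sets (F (real k / 2^m))}"

lemma space_grid_sigma [simp]: "space (grid_sigma m \<rho>) = space M"
 unfolding grid_sigma_def using sets.sets_into_space by (intro space_measure_of) auto

lemma sets_grid_sigma:
 assumes "grid_stop m K \<rho>"
 shows "sets (grid_sigma m \<rho>) = {E \<in> sets M. \<forall>k. {w\<in>E. \<rho> w = k} \<in> sets (F (real k / 2^m))}"
  (is "_ = ?S")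
proof -
 have eq: "{w\<in>space M. \<rho> w = k} \<in> sets (F (real k / 2^m))" for k
  using grid_stop_eq[OF assms, of k] space_F[of "real k / 2^m"] by (simp add: Measurable.pred_def)
 have "sigma_algebra (space M) ?S"
  unfolding sigma_algebra_iff2
 proof (intro conjI ballI allI impI)
  show "?S \<subseteq> Pow (space M)" using sets.sets_into_space by auto
  show "{} \<in> ?S" by simp
 next
  fix E assume E: "E \<in> ?S"
  have "{w\<in>space M - E. \<rho> w = k} = {w\<in>space M. \<rho> w = k} - {w\<in>E. \<rho> w = k}" for k by auto
  then show "space M - E \<in> ?S" using E eq by auto
 next
  fix A :: "nat => 'a set" assume A: "range A \<subseteq> ?S"
  then have Ai: "A i \<in> sets M" "{w\<in>A i. \<rho> w = k} \<in> sets (F (real k / 2^m))" for i k by auto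
  have "{w\<in>\<Union>(range A). \<rho> w = k} = (\<Union>i. {w\<in>A i. \<rho> w = k})" for k by auto
  moreover have "(\<Union>i. {w\<in>A i. \<rho> w = k}) \<in> sets (F (real k / 2^m))" for k
   using Ai(2) by (intro sets.countable_UN) auto
  moreover have "\<Union>(range A) \<in> sets M" using Ai(1) by (intro sets.countable_UN) auto
  ultimately show "\<Union>(range A) \<in> ?S" by simp
 qed
 then show ?thesis unfolding grid_sigma_def by (rule sigma_algebra.sets_measure_of_eq)
qed

lemma measurable_grid_sigmaI:
 fixes f :: "'a => 'b::topological_space"
 assumes \<rho>: "grid_stop m K \<rho>"
  and f: "!!k. k <= K ==> f' k \<in> borel_measurable (F (real k / 2^m))"
  and eq: "!!k w. w \<in> space M ==> \<rho> w = k ==> f w = f' k w"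
 shows "f \<in> borel_measurable (grid_sigma m \<rho>)"
proof (rule measurableI)
 fix A :: "'b set" assume A: "A \<in> sets borel"
 have le: "\<rho> w <= K" for w using \<rho> by (simp add: grid_stop_def)
 have k: "{w\<in>f -` A \<inter> space M. \<rho> w = k} \<in> sets (F (real k / 2^m))" for k
 proof (cases "k <= K")
  case True
  have "{w\<in>f -` A \<inter> space M. \<rho> w = k} = (f' k -` A \<inter> space (F (real k / 2^m))) \<inter> {w\<in>space (F (real k / 2^m)). \<rho> w = k}"
   using eq by (auto simp: space_F)
  also have "... \<in> sets (F (real k / 2^m))"
   using grid_stop_eq[OF \<rho>, of k] measurable_sets[OF f[OF True] A] by (auto simp: Measurable.pred_def)
  finally show ?thesis .
 next
  case False
  then have "{w\<in>f -` A \<inter> space M. \<rho> w = k} = {}" using le[of _] by auto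
  then show ?thesis by (simp only: sets.empty_sets)
 qed
 have "f -` A \<inter> space M = (\<Union>k. {w\<in>f -` A \<inter> space M. \<rho> w = k})" by auto
 also have "... \<in> sets M"
 proof -
  have "{w\<in>f -` A \<inter> space M. \<rho> w = k} \<in> sets M" for k
   using k[of k] sets_F_subset[of "real k / 2^m"] by auto
  then show ?thesis by (intro sets.countable_UN) auto
 qed
 finally show "f -` A \<inter> space (grid_sigma m \<rho>) \<in> sets (grid_sigma m \<rho>)"
  using k by (simp add: sets_grid_sigma[OF \<rho>])
qed simp

lemma measurable_grid_sigmaD:
 fixes f :: "'a => real"
 assumes \<rho>: "grid_stop m K \<rho>" and f: "f \<in> borel_measurable (grid_sigma m \<rho>)"
 shows "f \<in> borel_measurable M"
  and "(%w. if \<rho> w = k then f w else 0) \<in> borel_measurable (F (real k / 2^m))"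
  and "(%w. if \<rho> w <= k then f w else 0) \<in> borel_measurable (F (real k / 2^m))"
proof -
 have sub: "subalgebra M (grid_sigma m \<rho>)" by (auto simp: subalgebra_def sets_grid_sigma[OF \<rho>])
 show "f \<in> borel_measurable M" by (rule measurable_from_subalg[OF sub f])
 have "(%w. if \<rho> w = j then f w else 0) \<in> borel_measurable (F (real j / 2^m))" for j
 proof (rule measurableI)
  fix A :: "real set" assume A: "A \<in> sets borel"
  have f1: "{w\<in>f -` A \<inter> space M. \<rho> w = j} \<in> sets (F (real j / 2^m))"
   using measurable_sets[OF f A] by (simp add: sets_grid_sigma[OF \<rho>])
  have e: "{w\<in>space (F (real j / 2^m)). \<rho> w = j} \<in> sets (F (real j / 2^m))"
   using grid_stop_eq[OF \<rho>, of j] by (simp add: Measurable.pred_def)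
  have "(%w. if \<rho> w = j then f w else 0) -` A \<inter> space (F (real j / 2^m))
   = {w\<in>f -` A \<inter> space M. \<rho> w = j} \<union>
    (if 0 \<in> A then space (F (real j / 2^m)) - {w\<in>space (F (real j / 2^m)). \<rho> w = j} else {})"
   by (auto simp: space_F split: if_splits)
  also have "... \<in> sets (F (real j / 2^m))" using f1 e by auto
  finally show "(%w. if \<rho> w = j then f w else 0) -` A \<inter> space (F (real j / 2^m)) \<in> sets (F (real j / 2^m))" .
 qed simp
 note one = this
 then show "(%w. if \<rho> w = k then f w else 0) \<in> borel_measurable (F (real k / 2^m))" .
 have "(%w. if \<rho> w <= k then f w else 0) = (%w. \<Sum>j\<le>k. if \<rho> w = j then f w else 0)"
  by (auto simp: fun_eq_iff)
 moreover have "(%w. if \<rho> w = j then f w else 0) \<in> borel_measurable (F (real k / 2^m))" if "j <= k" for j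
  by (rule measurable_F_mono[OF one[of j]]) (use that in \<open>auto simp: divide_right_mono\<close>)
 ultimately show "(%w. if \<rho> w <= k then f w else 0) \<in> borel_measurable (F (real k / 2^m))"
  by (simp only:) (rule borel_measurable_sum, simp)
qed

lemma grid_sigma_mono:
 assumes \<rho>: "grid_stop m K \<rho>" and \<rho>': "grid_stop m K' \<rho>'" and le: "!!w. w \<in> space M ==> \<rho> w <= \<rho>' w"
 shows "subalgebra (grid_sigma m \<rho>') (grid_sigma m \<rho>)"
 unfolding subalgebra_def
proof (intro conjI subsetI)
 fix E assume E: "E \<in> sets (grid_sigma m \<rho>)"
 have EM: "E \<subseteq> space M" using E sets.sets_into_space by force
 have "{w\<in>E. \<rho>' w = k} \<in> sets (F (real k / 2^m))" for k
 proof -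
  have "{w\<in>E. \<rho> w = j} \<in> sets (F (real k / 2^m))" if "j <= k" for j
   using E mono_F[of "real j / 2^m" "real k / 2^m"] that
   by (auto simp: sets_grid_sigma[OF \<rho>] divide_right_mono)
  moreover have "{w\<in>E. \<rho>' w = k} = (\<Union>j\<le>k. {w\<in>E. \<rho> w = j}) \<inter> {w\<in>space (F (real k / 2^m)). \<rho>' w = k}"
   using EM le by (auto simp: space_F)
  ultimately show ?thesis
   using grid_stop_eq[OF \<rho>', of k] by (auto simp: Measurable.pred_def)
 qed
 then show "E \<in> sets (grid_sigma m \<rho>')" using E by (simp add: sets_grid_sigma[OF \<rho>] sets_grid_sigma[OF \<rho>'])
qed simp

lemma measurable_grid_sigma_adapted:
 assumes \<rho>: "grid_stop m K \<rho>" and A: "adapted F A"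
 shows "(%w. A (real (\<rho> w) / 2^m) w) \<in> borel_measurable (grid_sigma m \<rho>)"
 by (rule measurable_grid_sigmaI[OF \<rho>, where f' = "%k. A (real k / 2^m)"]) (use A in \<open>auto simp: adapted_def\<close>)

lemma grid_optional_stopping:
 assumes Y: "martingale M F Y" and \<rho>: "grid_stop m K \<rho>" and \<rho>': "grid_stop m K \<rho>'"
  and le: "!!w. w \<in> space M ==> \<rho> w <= \<rho>' w"
  and xi: "xi \<in> borel_measurable (grid_sigma m \<rho>)" "!!w. w \<in> space M ==> abs (xi w) <= C"
 shows "integrable M (%w. xi w * (Y (real (\<rho>' w) / 2^m) w - Y (real (\<rho> w) / 2^m) w))"
  and "(LINT w|M. xi w * (Y (real (\<rho>' w) / 2^m) w - Y (real (\<rho> w) / 2^m) w)) = 0"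
proof -
 let ?t = "%k::nat. real k / 2^m"
 \<comment> \<open>This is \<open>xi\<close> for \<open>\<rho> <= k < \<rho>'\<close> and
   \<open>0\<close> otherwise, and both parts are known at time \<open>k / 2^m\<close>. The
   resulting martingale transform telescopes to the increment between the two times.\<close>
 define eta where "eta k w = (if \<rho> w <= k then xi w else 0) - (if \<rho>' w <= k then xi w else 0)" for k w
 have xi': "xi \<in> borel_measurable (grid_sigma m \<rho>')"
  by (rule measurable_from_subalg[OF grid_sigma_mono[OF \<rho> \<rho>' le] xi(1)])
 have etam: "eta k \<in> borel_measurable (F (?t k))" for k
  unfolding eta_def by (intro borel_measurable_diff measurable_grid_sigmaD(3)[OF \<rho> xi(1)] measurable_grid_sigmaD(3)[OF \<rho>' xi'])
 have etab: "abs (eta k w) <= abs C" if "w \<in> space M" for k w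
  using xi(2)[OF that] le[OF that] by (auto simp: eta_def)
 have int: "integrable M (%w. eta k w * Y s w)" if "0 <= s" for k s
  using Y that measurable_F[OF etam, of k] etab by (intro integrable_bounded_mult) (auto simp: martingale_def)
 have sum_eq: "xi w * (Y (?t (\<rho>' w)) w - Y (?t (\<rho> w)) w)
   = (\<Sum>k<K. eta k w * Y (?t (Suc k)) w - eta k w * Y (?t k) w)" if w: "w \<in> space M" for w
 proof -
  have K: "\<rho>' w <= K" using \<rho>' by (simp add: grid_stop_def)
  have "(\<Sum>k<K. eta k w * Y (?t (Suc k)) w - eta k w * Y (?t k) w)
   = (\<Sum>k\<in>{\<rho> w..<\<rho>' w}. xi w * (Y (?t (Suc k)) w - Y (?t k) w))"
   by (rule sum.mono_neutral_cong_right) (use le[OF w] K in \<open>auto simp: eta_def algebra_simps\<close>)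
  also have "... = xi w * (Y (?t (\<rho>' w)) w - Y (?t (\<rho> w)) w)"
   using sum_Suc_diff'[OF le[OF w], of "%k. Y (?t k) w"] by (simp add: sum_distrib_left[symmetric])
  finally show ?thesis by simp
 qed
 have zero: "(LINT w|M. eta k w * Y (?t (Suc k)) w) = (LINT w|M. eta k w * Y (?t k) w)" for k
  by (rule martingaleD[OF Y _ _ etam etab]) (auto simp: divide_right_mono)
 have I: "integrable M (%w. \<Sum>k<K. eta k w * Y (?t (Suc k)) w - eta k w * Y (?t k) w)"
  by (intro leb_integrable_sum leb_integrable_diff int) auto
 then show "integrable M (%w. xi w * (Y (?t (\<rho>' w)) w - Y (?t (\<rho> w)) w))"
  by (subst leb_integrable_cong[OF refl sum_eq])
 have "(LINT w|M. xi w * (Y (?t (\<rho>' w)) w - Y (?t (\<rho> w)) w))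
   = (LINT w|M. (\<Sum>k<K. eta k w * Y (?t (Suc k)) w - eta k w * Y (?t k) w))"
  by (rule leb_integral_cong[OF refl sum_eq])
 also have "... = (\<Sum>k<K. LINT w|M. eta k w * Y (?t (Suc k)) w - eta k w * Y (?t k) w)"
  by (intro leb_integral_sum leb_integrable_diff int) simp_all
 also have "... = 0"
 proof (intro sum.neutral ballI)
  show "(LINT w|M. eta k w * Y (?t (Suc k)) w - eta k w * Y (?t k) w) = 0" for k
   using zero[of k] int[of "?t (Suc k)" k] int[of "?t k" k] by (subst leb_integral_diff) auto
 qed
 finally show "(LINT w|M. xi w * (Y (?t (\<rho>' w)) w - Y (?t (\<rho> w)) w)) = 0" .
qed

text \<open>The submartingale inequality for \<open>abs Y\<close>, obtained from the martingale by
  multiplying the weight with the sign of \<open>Y\<close> at the earlier time. It later transfers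
  \<open>Y\<close> from a random last step to the fixed horizon.\<close>

lemma grid_stopped_abs_le:
 assumes Y: "martingale M F Y" and \<rho>: "grid_stop m K \<rho>"
  and xi: "xi \<in> borel_measurable (grid_sigma m \<rho>)" "!!w. w \<in> space M ==> 0 <= xi w & xi w <= C"
 shows "integrable M (%w. xi w * abs (Y (real (\<rho> w) / 2^m) w))"
  and "(LINT w|M. xi w * abs (Y (real (\<rho> w) / 2^m) w)) <= (LINT w|M. xi w * abs (Y (real K / 2^m) w))"
proof -
 have Yad: "adapted F Y" using Y by (simp add: martingale_def)
 have K: "grid_stop m K (%_. K)" by (simp add: grid_stop_def)
 let ?Z = "%w. Y (real (\<rho> w) / 2^m) w"
 have Z [measurable]: "?Z \<in> borel_measurable (grid_sigma m \<rho>)"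
  by (rule measurable_grid_sigma_adapted[OF \<rho> Yad])
 have [measurable]: "xi \<in> borel_measurable (grid_sigma m \<rho>)" by fact
 define zeta where "zeta w = xi w * sgn (?Z w)" for w
 have zeta: "zeta \<in> borel_measurable (grid_sigma m \<rho>)" unfolding zeta_def by measurable
 have zetab: "abs (zeta w) <= C" "abs (zeta w) <= xi w" if "w \<in> space M" for w
  using xi(2)[OF that] by (auto simp: zeta_def sgn_if)
 have le: "\<rho> w <= K" for w using \<rho> by (simp add: grid_stop_def)
 note o = grid_optional_stopping[OF Y \<rho> K le zeta zetab(1)]
 have YK: "integrable M (Y (real K / 2^m))" using Y by (simp add: martingale_def)
 have zetaM: "zeta \<in> borel_measurable M" and xiM: "xi \<in> borel_measurable M"
  using measurable_grid_sigmaD(1)[OF \<rho> zeta] measurable_grid_sigmaD(1)[OF \<rho> xi(1)] .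
 have i1: "integrable M (%w. zeta w * Y (real K / 2^m) w)"
  by (rule integrable_bounded_mult[OF YK zetaM zetab(1)])
 have i2: "integrable M (%w. xi w * abs (Y (real K / 2^m) w))"
  by (rule integrable_bounded_mult[where C = C]) (use YK xiM xi(2) in auto)
 have eq: "xi w * abs (?Z w) = zeta w * Y (real K / 2^m) w - zeta w * (Y (real K / 2^m) w - ?Z w)" for w
 proof -
  have "abs z = sgn z * z" for z :: real by (simp add: sgn_if)
  then show ?thesis by (simp add: zeta_def right_diff_distrib)
 qed
 show "integrable M (%w. xi w * abs (?Z w))"
  unfolding eq by (intro leb_integrable_diff i1 o(1))
 have "(LINT w|M. xi w * abs (?Z w)) = (LINT w|M. zeta w * Y (real K / 2^m) w)"
  unfolding eq using i1 o by (subst leb_integral_diff) auto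
 also have "... <= (LINT w|M. xi w * abs (Y (real K / 2^m) w))"
 proof (rule integral_mono[OF i1 i2])
  fix w assume w: "w \<in> space M"
  have "zeta w * Y (real K / 2^m) w <= abs (zeta w) * abs (Y (real K / 2^m) w)" by (metis abs_ge_self abs_mult)
  also have "... <= xi w * abs (Y (real K / 2^m) w)" using zetab(2)[OF w] by (intro mult_right_mono) auto
  finally show "zeta w * Y (real K / 2^m) w <= xi w * abs (Y (real K / 2^m) w)" .
 qed
 finally show "(LINT w|M. xi w * abs (?Z w)) <= (LINT w|M. xi w * abs (Y (real K / 2^m) w))" .
qed

lemma stopping_time_ext_nonneg: "stopping_time_ext M F T ==> w \<in> space M ==> 0 <= T w"
 by (simp add: stopping_time_ext_def)

lemma stopped_measurable:
 assumes ad: "adapted F X" and cont: "!!w. w \<in> space M ==> continuous_on {0..} (%t. X t w)"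
  and T: "stopping_time_ext M F T" and t: "0 <= t"
 shows "stopped T X t \<in> borel_measurable (F t)"
proof -
 define N where "N = nat \<lceil>t\<rceil>"
 have N: "t <= real N" unfolding N_def by (rule real_nat_ceiling_ge)
 \<comment> \<open>The grid time lies above the stopping time and may exceed \<open>t\<close>;
   cutting it at \<open>t\<close> keeps the approximation \<open>F t\<close>-measurable.\<close>
 define Z where "Z m w = X (min t (grid_time T N m w)) w" for m w
 show ?thesis
 proof (rule borel_measurable_LIMSEQ_real)
  fix w assume "w \<in> space (F t)"
  then have w: "w \<in> space M" using t by (simp add: space_F)
  have T0: "0 <= T w" using stopping_time_ext_nonneg[OF T w] .
  have eq: "min t (real_of_ereal (min (ereal (real N)) (T w))) = real_of_ereal (min (ereal t) (T w))"
   using T0 N by (cases "T w") (auto simp: min_def)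
  have "(%m. min t (grid_time T N m w)) \<longlonglongrightarrow> min t (real_of_ereal (min (ereal (real N)) (T w)))"
   by (intro tendsto_min tendsto_const grid_time_tendsto T0)
  then have "(%m. X (min t (grid_time T N m w)) w) \<longlonglongrightarrow> X (min t (real_of_ereal (min (ereal (real N)) (T w)))) w"
   by (rule continuous_on_tendsto_compose[OF cont[OF w]])
    (use t grid_time_nonneg real_min_ereal(2)[OF T0, of "real N"] in auto)
  then show "(%m. Z m w) \<longlonglongrightarrow> stopped T X t w"
   by (simp add: Z_def stopped_def eq)
 next
  fix m
  define K where "K = nat \<lfloor>t * 2^m\<rfloor>"
  have K: "real k / 2^m <= t \<longleftrightarrow> k <= K" for k
   using t by (auto simp: K_def divide_le_eq le_nat_floor intro: order_trans[OF _ of_nat_floor])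
    (metis of_nat_floor of_nat_le_iff order_trans mult_nonneg_nonneg zero_le_numeral zero_le_power)
  have gs: "grid_stop m (N * 2^m) (grid_index T N m)" by (rule grid_stop_grid_index[OF T])
  have Zeq: "Z m = (%w. (\<Sum>k\<le>K. if grid_index T N m w = k then X (real k / 2^m) w else 0)
    + (if grid_index T N m w <= K then 0 else X t w))"
  proof
   fix w
   show "Z m w = (\<Sum>k\<le>K. if grid_index T N m w = k then X (real k / 2^m) w else 0)
    + (if grid_index T N m w <= K then 0 else X t w)"
    using K[of "grid_index T N m w"] by (auto simp: Z_def grid_time_def min_def)
  qed
  have K_t: "real K / 2^m <= t" using K by simp
  have "(%w. if grid_index T N m w = k then X (real k / 2^m) w else 0) \<in> borel_measurable (F t)" if "k <= K" for k
  proof (rule measurable_F_mono[where s = "real k / 2^m"])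
   have [measurable]: "X (real k / 2^m) \<in> borel_measurable (F (real k / 2^m))"
    using ad by (simp add: adapted_def)
   note [measurable] = grid_stop_eq[OF gs, of k]
   show "(%w. if grid_index T N m w = k then X (real k / 2^m) w else 0) \<in> borel_measurable (F (real k / 2^m))"
    by measurable
  qed (use K that in auto)
  moreover have "(%w. if grid_index T N m w <= K then 0 else X t w) \<in> borel_measurable (F t)"
  proof -
   have "Measurable.pred (F (real K / 2^m)) (%w. grid_index T N m w <= K)"
    using gs by (simp add: grid_stop_def)
   then have [measurable]: "Measurable.pred (F t) (%w. grid_index T N m w <= K)"
    by (rule measurable_F_mono) (use K_t in auto)
   have [measurable]: "X t \<in> borel_measurable (F t)" using ad t by (simp add: adapted_def)
   show ?thesis by measurable
  qed
  ultimately show "Z m \<in> borel_measurable (F t)"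
   unfolding Zeq by (intro borel_measurable_add borel_measurable_sum) auto
 qed
qed

text \<open>If the grid index \<open>k\<close> of \<open>T'\<close> is below the cap, then
  \<open>T\<close> has occurred by time \<open>k / 2^m\<close> and the stopped value is already
  frozen; at the cap the grid time is \<open>N\<close> itself. Thus values at exact random times are
  known at the later grid time.\<close>

lemma stopped_measurable_grid_sigma:
 assumes ad: "adapted F X" and cont: "!!w. w \<in> space M ==> continuous_on {0..} (%t. X t w)"
  and T: "stopping_time_ext M F T" and T': "stopping_time_ext M F T'"
  and le: "!!w. w \<in> space M ==> T w <= T' w"
 shows "stopped T X (real N) \<in> borel_measurable (grid_sigma m (grid_index T' N m))"
proof (rule measurable_grid_sigmaI[OF grid_stop_grid_index[OF T']])
 show "stopped T X (real k / 2^m) \<in> borel_measurable (F (real k / 2^m))" for k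
  by (rule stopped_measurable[OF ad cont T]) auto
 fix k w assume w: "w \<in> space M" and k: "grid_index T' N m w = k"
 show "stopped T X (real N) w = stopped T X (real k / 2^m) w"
 proof (cases "N * 2^m <= k")
  case True
  then have "k = N * 2^m" using grid_index_le[of T' N m w] k by simp
  then show ?thesis by simp
 next
  case False
  then have "T' w <= ereal (real k / 2^m)" using grid_index_le_iff[of T' N m w k] k by simp
  then have "T w <= ereal (real k / 2^m)" using le[OF w] order_trans by blast
  moreover have "real k / 2^m <= real N"
   using False by (simp add: divide_le_eq flip: of_nat_le_iff[where 'a = real])
  ultimately show ?thesis by (rule stopped_const)
 qed
qed

end

section \<open>Brownian motion at grid times and approximate optional stopping\<close>

context brownian
begin

lemma adapted_B: "adapted F B"
 using B_adapted by (simp add: adapted_def)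

lemma B_grid_measurable:
 assumes T: "stopping_time_ext M F T"
 shows "(%w. B (grid_time T N m w) w) \<in> borel_measurable M"
 using measurable_grid_sigmaD(1)[OF grid_stop_grid_index[OF T]
   measurable_grid_sigma_adapted[OF grid_stop_grid_index[OF T] adapted_B]]
 by (simp add: grid_time_def)

text \<open>The difference of the two sampled values is a stochastic sum on the fine grid whose
  integrand indicates the cells between both grid times. These cells have total length at most
  \<open>1 / 2^m\<close>, and the isometry bounds the second moment.\<close>

lemma B_grid_square_diff:
 assumes T: "stopping_time_ext M F T" and mn: "m <= n"
 shows "integrable M (%w. (B (grid_time T N m w) w - B (grid_time T N n w) w)^2)"
  and "(LINT w|M. (B (grid_time T N m w) w - B (grid_time T N n w) w)^2) <= 1 / 2^m"
proof -
 \<comment> \<open>Index \<open>i\<close> of the coarse grid is index \<open>c * i\<close> of the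
   fine grid.\<close>
 define c :: nat where "c = 2^(n - m)"
 have c: "2^n = c * 2^m" using mn by (simp add: c_def flip: power_add)
 have cr: "(2::real)^n = real c * 2^m" using c by (metis of_nat_mult of_nat_numeral of_nat_power)
 have c0: "0 < c" by (simp add: c_def)
 let ?i = "grid_index T N m" and ?j = "grid_index T N n"
 define t where "t k = real k / 2^n" for k
 have t: "0 <= t 0" "mono t" by (auto simp: t_def mono_def divide_right_mono)
 have ti: "t (c * k) = real k / 2^m" for k using c0 by (simp add: t_def cr)
 have ji: "?j w <= c * ?i w" for w
 proof -
  have "N * 2^m <= ?i w \<or> T w <= ereal (real (?i w) / 2^m)"
   using grid_index_le_iff[of T N m w "?i w"] by simp
  then have "N * 2^n <= c * ?i w \<or> T w <= ereal (t (c * ?i w))"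
   unfolding ti c using c0 by (auto simp: mult.left_commute)
  then show ?thesis by (simp add: grid_index_le_iff t_def)
 qed
 have iN: "c * ?i w <= N * 2^n" for w
  using grid_index_le[of T N m w] unfolding c by (simp add: mult.left_commute)
 define xi :: "nat => 'a => real" where "xi k w = (if ?j w <= k then 1 else 0) - (if ?i w <= k div c then 1 else 0)" for k w
 have div: "?i w <= k div c \<longleftrightarrow> c * ?i w <= k" for k w
  using c0 by (simp add: less_eq_div_iff_mult_less_eq mult.commute)
 have xi01: "xi k w = (if ?j w <= k & k < c * ?i w then 1 else 0)" for k w
  using ji[of w] by (auto simp: xi_def div)
 have xim: "xi k \<in> borel_measurable (F (t k))" for k
 proof -
  have [measurable]: "Measurable.pred (F (t k)) (%w. ?j w <= k)"
   using grid_stop_grid_index[OF T, of n N] by (simp add: grid_stop_def t_def)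
  have [measurable]: "Measurable.pred (F (t k)) (%w. ?i w <= k div c)"
  proof (rule measurable_F_mono)
   show "Measurable.pred (F (real (k div c) / 2^m)) (%w. ?i w <= k div c)"
    using grid_stop_grid_index[OF T, of m N] by (simp add: grid_stop_def)
   show "real (k div c) / 2^m <= t k"
    unfolding ti[symmetric] using monoD[OF t(2), of "c * (k div c)" k] by simp
  qed simp
  show ?thesis unfolding xi_def by measurable
 qed
 have xib: "abs (xi k w) <= 1" for k w by (simp add: xi01)
 have sumB: "(\<Sum>k<N * 2^n. xi k w * (B (t (Suc k)) w - B (t k) w))
   = B (grid_time T N m w) w - B (grid_time T N n w) w" for w
 proof -
  have "(\<Sum>k<N * 2^n. xi k w * (B (t (Suc k)) w - B (t k) w))
    = (\<Sum>k\<in>{?j w..<c * ?i w}. B (t (Suc k)) w - B (t k) w)"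
   by (rule sum.mono_neutral_cong_right) (use iN[of w] in \<open>auto simp: xi01\<close>)
  also have "... = B (t (c * ?i w)) w - B (t (?j w)) w"
   using sum_Suc_diff'[OF ji, of "%k. B (t k) w"] by simp
  finally show ?thesis by (simp add: ti grid_time_def) (simp add: t_def)
 qed
 note iso = ito_isometry(1,2)[OF t xim xib, of "N * 2^n", unfolded sumB]
 show "integrable M (%w. (B (grid_time T N m w) w - B (grid_time T N n w) w)^2)" by (rule iso(1))
 have tdiff: "t (Suc k) - t k = 1 / 2^n" for k by (simp add: t_def diff_divide_distrib[symmetric])
 have xiint: "integrable M (%w. (xi k w)^2)" for k
 proof (rule integrable_bounded[where C = 1])
  have "xi k \<in> borel_measurable M" by (rule measurable_F[OF xim]) (simp add: t_def)
  then show "(%w. (xi k w)^2) \<in> borel_measurable M" by simp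
 qed (simp add: xi01)
 have "(\<Sum>k<N * 2^n. (t (Suc k) - t k) * (LINT w|M. (xi k w)^2))
   = (LINT w|M. (\<Sum>k<N * 2^n. (1 / 2^n) * (xi k w)^2))"
  using xiint by (subst leb_integral_sum) (simp_all add: tdiff)
 also have "... <= (LINT w|M. 1 / 2^m)"
 proof (rule integral_mono)
  fix w assume "w \<in> space M"
  have T0: "0 <= T w" using stopping_time_ext_nonneg[OF T] \<open>w \<in> space M\<close> by simp
  have "(\<Sum>k<N * 2^n. (1 / 2^n) * (xi k w)^2) = (\<Sum>k\<in>{?j w..<c * ?i w}. 1 / 2^n)"
   by (rule sum.mono_neutral_cong_right) (use iN[of w] in \<open>auto simp: xi01\<close>)
  also have "... = t (c * ?i w) - t (?j w)"
   using ji[of w] by (simp add: t_def of_nat_diff diff_divide_distrib)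
  also have "... = grid_time T N m w - grid_time T N n w" by (simp add: ti grid_time_def) (simp add: t_def)
  also have "... <= 1 / 2^m"
  proof -
   have "ereal (real_of_ereal (min (ereal (real N)) (T w))) <= ereal (grid_time T N n w)"
    using grid_time_ge[of N T w n] real_min_ereal(1)[OF T0, of "real N"] by simp
   then show ?thesis using grid_time_less[of T w N m, OF T0] by simp
  qed
  finally show "(\<Sum>k<N * 2^n. (1 / 2^n) * (xi k w)^2) <= 1 / 2^m" .
 qed (use xiint in \<open>auto intro!: leb_integrable_sum\<close>)
 also have "... = 1 / 2^m" by (simp add: prob_space)
 finally show "(LINT w|M. (B (grid_time T N m w) w - B (grid_time T N n w) w)^2) <= 1 / 2^m"
  unfolding iso(2) .
qed

lemma stopped_B_measurable: "stopping_time_ext M F T ==> 0 <= t ==> stopped T B t \<in> borel_measurable (F t)"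
 by (rule stopped_measurable[OF adapted_B B_continuous])

lemma stopped_B_measurable': "stopping_time_ext M F T ==> 0 <= t ==> stopped T B t \<in> borel_measurable M"
 using measurable_F stopped_B_measurable by blast

lemma B_grid_tendsto:
 assumes T: "stopping_time_ext M F T" and w: "w \<in> space M"
 shows "(%m. B (grid_time T N m w) w) \<longlonglongrightarrow> stopped T B (real N) w"
proof -
 have T0: "0 <= T w" using stopping_time_ext_nonneg[OF T w] .
 show ?thesis
  unfolding stopped_def
  by (rule continuous_on_tendsto_compose[OF B_continuous[OF w] grid_time_tendsto[of T w, OF T0]])
   (use grid_time_nonneg real_min_ereal(2)[OF T0, of "real N"] in auto)
qed

lemma B_grid_stopped:
 assumes T: "stopping_time_ext M F T"
 shows "integrable M (%w. B (grid_time T N m w) w - stopped T B (real N) w)"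
  and "(LINT w|M. abs (B (grid_time T N m w) w - stopped T B (real N) w)) <= sqrt (1 / 2^m)"
proof -
 let ?Y = "%n w. B (grid_time T N n w) w"
 note d = L2_imp_L1[OF borel_measurable_diff[OF B_grid_measurable[OF T] B_grid_measurable[OF T]] B_grid_square_diff(1)[OF T], of m _ "sqrt (1 / 2^m)"]
 have "integrable M (%w. ?Y m w - ?Y n w)" "(LINT w|M. abs (?Y m w - ?Y n w)) <= sqrt (1 / 2^m)" if "m <= n" for n
  by (rule d[OF that]; use B_grid_square_diff(2)[OF T that] in simp)+
 note L = L1_limit_le[where Y = ?Y and n = m, OF B_grid_measurable[OF T] stopped_B_measurable'[OF T of_nat_0_le_iff] AE_I2[OF B_grid_tendsto[OF T]] this]
 show "integrable M (%w. B (grid_time T N m w) w - stopped T B (real N) w)"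
  "(LINT w|M. abs (B (grid_time T N m w) w - stopped T B (real N) w)) <= sqrt (1 / 2^m)"
  by (rule L; assumption)+
qed

text \<open>The weight \<open>xi\<close> is known only at the grid time, which may lie after
  \<open>T\<close>. Optional stopping is therefore exact between the grid times of \<open>T\<close>
  and \<open>T'\<close>, and moving each end back to the exact time costs
  \<open>C * sqrt (1 / 2^m)\<close>.\<close>

lemma stopped_B_optional_stopping:
 assumes T: "stopping_time_ext M F T" and T': "stopping_time_ext M F T'"
  and le: "!!w. w \<in> space M ==> T w <= T' w"
  and xi: "xi \<in> borel_measurable (grid_sigma m (grid_index T N m))" "!!w. w \<in> space M ==> abs (xi w) <= C"
 shows "abs (LINT w|M. xi w * (stopped T' B (real N) w - stopped T B (real N) w)) <= 2 * C * sqrt (1 / 2^m)"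
proof -
 have C: "0 <= C" using xi(2) not_empty abs_ge_zero order_trans by blast
 let ?D = "%T w. B (grid_time T N m w) w - stopped T B (real N) w"
 have gs: "grid_stop m (N * 2^m) (grid_index T N m)" "grid_stop m (N * 2^m) (grid_index T' N m)"
  by (rule grid_stop_grid_index, fact)+
 have idx: "grid_index T N m w <= grid_index T' N m w" if "w \<in> space M" for w
  using grid_index_le_iff[of T' N m w "grid_index T' N m w"] le[OF that]
  by (auto simp: grid_index_le_iff[of T N m w])
 have xiM: "xi \<in> borel_measurable M" by (rule measurable_grid_sigmaD(1)[OF gs(1) xi(1)])
 have D: "integrable M (?D S)" if "stopping_time_ext M F S" for S by (rule B_grid_stopped(1)[OF that])
 have xiD: "integrable M (%w. xi w * ?D S w)" "abs (LINT w|M. xi w * ?D S w) <= C * sqrt (1 / 2^m)"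
  if "stopping_time_ext M F S" for S
 proof -
  show i: "integrable M (%w. xi w * ?D S w)" by (rule integrable_bounded_mult[OF D[OF that] xiM xi(2)])
  have "abs (LINT w|M. xi w * ?D S w) <= (LINT w|M. abs (xi w * ?D S w))"
   by (rule integral_abs_bound)
  also have "... <= (LINT w|M. C * abs (?D S w))"
  proof (rule integral_mono)
   fix w assume "w \<in> space M"
   then show "abs (xi w * ?D S w) <= C * abs (?D S w)"
    unfolding abs_mult using xi(2) by (intro mult_right_mono) auto
  qed (use i D[OF that] in auto)
  also have "... <= C * sqrt (1 / 2^m)"
   using B_grid_stopped(2)[OF that, of N m] C by (simp add: mult_left_mono)
  finally show "abs (LINT w|M. xi w * ?D S w) <= C * sqrt (1 / 2^m)" .
 qed
 have o: "integrable M (%w. xi w * (B (grid_time T' N m w) w - B (grid_time T N m w) w))"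
  "(LINT w|M. xi w * (B (grid_time T' N m w) w - B (grid_time T N m w) w)) = 0"
  unfolding grid_time_def by (rule grid_optional_stopping[OF martingale_B gs idx xi]; assumption)+
 have "(LINT w|M. xi w * (stopped T' B (real N) w - stopped T B (real N) w))
   = (LINT w|M. xi w * (B (grid_time T' N m w) w - B (grid_time T N m w) w) - xi w * ?D T' w + xi w * ?D T w)"
  by (intro leb_integral_cong) (auto simp: algebra_simps)
 also have "... = - (LINT w|M. xi w * ?D T' w) + (LINT w|M. xi w * ?D T w)"
  using o xiD(1)[OF T] xiD(1)[OF T'] by (simp del: right_diff_distrib)
 finally show ?thesis using xiD(2)[OF T] xiD(2)[OF T'] by linarith
qed

section \<open>The random walk embedded in Brownian motion\<close>

lemma B_bounded_prob:
 assumes t: "0 < t" and C: "0 <= C"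
 shows "prob {w\<in>space M. abs (B t w - x0) <= C} <= 2 * C / sqrt (2 * pi * t)"
proof -
 let ?c = "1 / sqrt (2 * pi * t)"
 have D: "distributed M lborel (%w. B t w - B 0 w) (normal_density 0 (sqrt (t - 0)))"
  by (rule B_increment_distributed) (use t in auto)
 have eq: "{w\<in>space M. abs (B t w - x0) <= C} = (%w. B t w - B 0 w) -` {-C..C} \<inter> space M"
  using B_0 by auto
 have "emeasure M {w\<in>space M. abs (B t w - x0) <= C} = (\<integral>\<^sup>+x. ennreal (normal_density 0 (sqrt t) x) * indicator {-C..C} x \<partial>lborel)"
  unfolding eq using distributed_emeasure[OF D, of "{-C..C}"] by simp
 also have "... <= (\<integral>\<^sup>+x. ennreal ?c * indicator {-C..C} x \<partial>lborel)"
 proof (intro nn_integral_mono mult_right_mono ennreal_leI)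
  show "normal_density 0 (sqrt t) x <= ?c" for x
   using t unfolding normal_density_def by (simp add: divide_right_mono)
 qed simp
 also have "... = ennreal ?c * emeasure lborel {-C..C}" by (simp add: nn_integral_cmult_indicator)
 also have "emeasure lborel {-C..C} = ennreal (C - - C)" using C by (intro emeasure_lborel_Icc) simp
 also have "ennreal ?c * ennreal (C - - C) = ennreal (?c * (C - - C))"
  using C t by (intro ennreal_mult[symmetric]) auto
 finally show ?thesis
  using C t by (simp add: emeasure_eq_measure ennreal_le_iff)
qed

text \<open>The density at time \<open>t\<close> is at most \<open>1 / sqrt (2 * pi * t)\<close>, so
  staying within a fixed bound at all times \<open>Suc n\<close> has probability \<open>0\<close>.
  This makes the stopping times of the walk finite.\<close>

lemma AE_B_unbounded: "AE w in M. \<forall>C. \<exists>t\<ge>0. C < abs (B t w)"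
proof -
 have "AE w in M. \<exists>n::nat. real k < abs (B (real (Suc n)) w - x0)" for k
 proof -
  define N where "N = {w\<in>space M. \<forall>n::nat. abs (B (real (Suc n)) w - x0) <= real k}"
  have [measurable]: "B (real (Suc n)) \<in> borel_measurable M" for n by (rule B_measurable) simp
  have N: "N \<in> sets M" unfolding N_def by measurable
  have "prob N <= 2 * real k / sqrt (2 * pi * real (Suc n))" for n
  proof -
   have "prob N <= prob {w\<in>space M. abs (B (real (Suc n)) w - x0) <= real k}"
   proof (rule finite_measure_mono)
    show "{w\<in>space M. abs (B (real (Suc n)) w - x0) <= real k} \<in> sets M" by measurable
   qed (auto simp: N_def)
   also have "... <= 2 * real k / sqrt (2 * pi * real (Suc n))" by (rule B_bounded_prob) auto
   finally show ?thesis .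
  qed
  moreover have "(%n. 2 * real k / sqrt (2 * pi * real (Suc n))) \<longlonglongrightarrow> 0"
  proof (rule tendsto_divide_0[OF tendsto_const] filterlim_at_top_imp_at_infinity)+
   have "filterlim (%n. 2 * pi * real (Suc n)) at_top sequentially"
    by (intro filterlim_tendsto_pos_mult_at_top[OF tendsto_const]
      filterlim_compose[OF filterlim_real_sequentially filterlim_Suc]) simp
   then show "filterlim (%n. sqrt (2 * pi * real (Suc n))) at_top sequentially"
    by (rule filterlim_compose[OF sqrt_at_top])
  qed
  ultimately have "prob N <= 0" by (intro LIMSEQ_le_const) auto
  then have "prob N = 0" using measure_nonneg[of M N] by simp
  then have "N \<in> null_sets M" using N by (simp add: emeasure_eq_measure null_sets_def)
  then show ?thesis
   by (rule AE_I') (auto simp: N_def not_less)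
 qed
 then have "AE w in M. \<forall>k. \<exists>n::nat. real k < abs (B (real (Suc n)) w - x0)"
  by (simp add: AE_all_countable)
 then show ?thesis
 proof eventually_elim
  case (elim w)
  show ?case
  proof
   fix C
   obtain k where "C + abs x0 <= real k" using real_arch_simple by blast
   moreover obtain n where "real k < abs (B (real (Suc n)) w - x0)" using elim by blast
   ultimately have "C < abs (B (real (Suc n)) w)" by linarith
   then show "\<exists>t\<ge>0. C < abs (B t w)" by (intro exI[of _ "real (Suc n)"]) auto
  qed
 qed
qed

text \<open>\<open>max 0 (d - |y|) = 0\<close> encodes \<open>d \<le> |y|\<close> as the hitting of \<open>0\<close> by a nonnegative continuous process.\<close>

primrec hit_seq :: "real => nat => 'a => ereal" where
 "hit_seq d 0 = (%w. 0)"
| "hit_seq d (Suc j) = (%w. Inf {ereal t |t. 0 <= t & max 0 (d - abs (B t w - stopped (hit_seq d j) B t w)) = 0})"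

declare hit_seq.simps(2) [simp del]

text \<open>Where the hitting time is infinite, a null set, \<open>real_of_ereal\<close> yields
  \<open>0\<close> and the walk is back at its start.\<close>

definition walk :: "real => nat => 'a => real" where
 "walk d j w = B (real_of_ereal (hit_seq d j w)) w"

lemma hit_seq_nonneg: "0 <= hit_seq d j w"
 by (cases j) (auto simp: hit_seq.simps(2) intro!: Inf_greatest)

lemma continuous_on_hit_distance:
 "w \<in> space M ==> continuous_on {0..} (%t. B t w - stopped (hit_seq d j) B t w)"
 by (intro continuous_intros B_continuous continuous_on_stopped[where X = B] hit_seq_nonneg)

lemma hit_seq_stopping_time: "stopping_time_ext M F (hit_seq d j)"
proof (induction j)
 case 0
 show ?case by (simp add: stopping_time_ext_def)
next
 case (Suc j)
 show ?case
  unfolding hit_seq.simps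
 proof (rule hit_zero_stopping_time)
  show "adapted F (%t w. max 0 (d - abs (B t w - stopped (hit_seq d j) B t w)))"
   unfolding adapted_def
  proof (intro allI impI)
   fix t :: real assume t: "0 <= t"
   have [measurable]: "B t \<in> borel_measurable (F t)" "stopped (hit_seq d j) B t \<in> borel_measurable (F t)"
    using B_adapted[OF t] stopped_B_measurable[OF Suc t] .
   show "(%w. max 0 (d - abs (B t w - stopped (hit_seq d j) B t w))) \<in> borel_measurable (F t)" by measurable
  qed
  show "continuous_on {0..} (%t. max 0 (d - abs (B t w - stopped (hit_seq d j) B t w)))" if "w \<in> space M" for w
   by (intro continuous_on_hit_distance[OF that] continuous_on_max continuous_on_diff continuous_on_rabs continuous_on_const)
 qed
qed

lemma hit_seq_Suc_le_iff:
 assumes w: "w \<in> space M" and t: "0 <= t"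
 shows "hit_seq d (Suc j) w <= ereal t \<longleftrightarrow> (\<exists>s\<in>{0..t}. d <= abs (B s w - stopped (hit_seq d j) B s w))"
proof -
 have "hit_seq d (Suc j) w <= ereal t \<longleftrightarrow> (\<exists>s\<in>{0..t}. max 0 (d - abs (B s w - stopped (hit_seq d j) B s w)) = 0)"
  unfolding hit_seq.simps
  by (intro hit_zero_le_iff[where Y = "%t w. max 0 (d - abs (B t w - stopped (hit_seq d j) B t w))"] t
    continuous_on_hit_distance[OF w] continuous_on_max continuous_on_diff continuous_on_rabs continuous_on_const)
 also have "... \<longleftrightarrow> (\<exists>s\<in>{0..t}. d <= abs (B s w - stopped (hit_seq d j) B s w))"
  by (intro bex_cong refl) (auto simp: max_def)
 finally show ?thesis .
qed

lemma hit_seq_less_Suc: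
 assumes d: "0 < d" and w: "w \<in> space M" and s: "d <= abs (B s w - stopped (hit_seq d j) B s w)"
 shows "hit_seq d j w < ereal s"
proof (rule ccontr)
 assume "\<not> hit_seq d j w < ereal s"
 then have "stopped (hit_seq d j) B s w = B s w" by (intro stopped_before) simp
 then show False using s d by simp
qed

lemma hit_seq_mono_Suc:
 assumes d: "0 < d" and w: "w \<in> space M"
 shows "hit_seq d j w <= hit_seq d (Suc j) w"
 unfolding hit_seq.simps
proof (rule Inf_greatest, clarify)
 fix t assume "0 <= t" "max 0 (d - abs (B t w - stopped (hit_seq d j) B t w)) = 0"
 then have "d <= abs (B t w - stopped (hit_seq d j) B t w)" by (simp add: max_def split: if_splits)
 from hit_seq_less_Suc[OF d w this] show "hit_seq d j w <= ereal t" by simp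
qed

lemma hit_seq_mono:
 assumes d: "0 < d" and w: "w \<in> space M" and "i <= j"
 shows "hit_seq d i w <= hit_seq d j w"
 using assms(3) by (rule lift_Suc_mono_le[of "%j. hit_seq d j w", OF hit_seq_mono_Suc[OF d w]])

lemma stopped_hit_seq:
 assumes "hit_seq d j w <= ereal t"
 shows "stopped (hit_seq d j) B t w = walk d j w"
 using assms by (simp add: stopped_def walk_def min_absorb2)

lemma hit_seq_distance:
 assumes d: "0 < d" and w: "w \<in> space M" and t: "0 <= t"
 shows "ereal t < hit_seq d (Suc j) w ==> abs (B t w - stopped (hit_seq d j) B t w) < d"
  and "ereal t <= hit_seq d (Suc j) w ==> abs (B t w - stopped (hit_seq d j) B t w) <= d"
proof -
 let ?f = "%t. abs (B t w - stopped (hit_seq d j) B t w)"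
 have less: "?f s < d" if "0 <= s" "ereal s < hit_seq d (Suc j) w" for s
  using hit_seq_Suc_le_iff[OF w that(1), of d j] that by (meson atLeastAtMost_iff linorder_not_less order_refl)
 then show "ereal t < hit_seq d (Suc j) w ==> ?f t < d" using t by simp
 assume le: "ereal t <= hit_seq d (Suc j) w"
 show "?f t <= d"
 proof (rule ccontr)
  assume "\<not> ?f t <= d"
  then have gt: "d < ?f t" by simp
  have "?f 0 = 0" using hit_seq_nonneg[of d j w] by (simp add: stopped_before zero_ereal_def[symmetric])
  moreover have "continuous_on {0..t} ?f"
   by (intro continuous_on_rabs continuous_on_subset[OF continuous_on_hit_distance[OF w]]) auto
  ultimately obtain s where s: "0 <= s" "s <= t" "?f s = d"
   using IVT'[of ?f 0 d t] gt d t by auto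
  then have "s < t" using gt by (cases "s = t") auto
  then have "ereal s < hit_seq d (Suc j) w" using le by (meson ereal_less_eq(3) less_le_trans ereal_less(2) less_ereal.simps(1))
  then show False using less[OF s(1)] s by simp
 qed
qed

lemma walk_step:
 assumes d: "0 < d" and w: "w \<in> space M" and fin: "hit_seq d (Suc j) w < \<infinity>"
 shows "abs (walk d (Suc j) w - walk d j w) = d" "hit_seq d j w < hit_seq d (Suc j) w"
proof -
 obtain t where t: "hit_seq d (Suc j) w = ereal t" "0 <= t"
  using fin hit_seq_nonneg[of d "Suc j" w] by (cases "hit_seq d (Suc j) w") auto
 then obtain s where s: "0 <= s" "s <= t" "d <= abs (B s w - stopped (hit_seq d j) B s w)"
  using hit_seq_Suc_le_iff[OF w t(2), of d j] by auto
 have "\<not> ereal s < hit_seq d (Suc j) w"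
  using hit_seq_distance(1)[OF d w s(1)] s by force
 then have st: "s = t" using s t by simp
 have "hit_seq d j w < ereal t" using hit_seq_less_Suc[OF d w s(3)] st by simp
 then show "hit_seq d j w < hit_seq d (Suc j) w" using t by simp
 have "stopped (hit_seq d j) B t w = walk d j w" using \<open>hit_seq d j w < ereal t\<close> by (intro stopped_hit_seq) simp
 moreover have "walk d (Suc j) w = B t w" using t by (simp add: walk_def)
 ultimately show "abs (walk d (Suc j) w - walk d j w) = d"
  using s st hit_seq_distance(2)[OF d w t(2), of j] t(1) by force
qed

lemma walk_between:
 assumes d: "0 < d" and w: "w \<in> space M" and t: "0 <= t" and "hit_seq d j w <= ereal t"
 shows "ereal t < hit_seq d (Suc j) w ==> abs (B t w - walk d j w) < d"
  and "ereal t <= hit_seq d (Suc j) w ==> abs (B t w - walk d j w) <= d"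
 using hit_seq_distance[OF d w t, of j] stopped_hit_seq[OF assms(4)] by auto

text \<open>The bound covers steps that are never completed as well, and so provides the dominating
  constant in later limits.\<close>

lemma stopped_hit_seq_distance:
 assumes d: "0 < d" and w: "w \<in> space M" and t: "0 <= t"
 shows "abs (stopped (hit_seq d (Suc j)) B t w - stopped (hit_seq d j) B t w) <= d"
proof (cases "ereal t <= hit_seq d (Suc j) w")
 case True
 then show ?thesis using hit_seq_distance(2)[OF d w t True] by (simp add: stopped_before)
next
 case False
 then have le: "hit_seq d (Suc j) w <= ereal t" by simp
 then have "hit_seq d (Suc j) w < \<infinity>" by (rule le_less_trans) simp
 moreover have "hit_seq d j w <= ereal t" using hit_seq_mono_Suc[OF d w] le order_trans by blast
 ultimately show ?thesis using walk_step[OF d w] le by (simp add: stopped_hit_seq)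
qed

lemma walk_0: "w \<in> space M ==> walk d 0 w = x0"
 by (simp add: walk_def B_0)

text \<open>An unbounded path leaves every \<open>d\<close>-neighbourhood of the last walk
  position.\<close>

lemma AE_hit_seq_finite:
 assumes d: "0 < d"
 shows "AE w in M. \<forall>j. hit_seq d j w < \<infinity>"
 using AE_B_unbounded AE_space
proof eventually_elim
 case (elim w)
 have "hit_seq d j w < \<infinity>" for j
 proof (induction j)
  case (Suc j)
  show ?case
  proof (rule ccontr)
   assume "\<not> hit_seq d (Suc j) w < \<infinity>"
   then have inf: "hit_seq d (Suc j) w = \<infinity>" by simp
   obtain r where r: "hit_seq d j w = ereal r" "0 <= r"
    using Suc hit_seq_nonneg[of d j w] by (cases "hit_seq d j w") auto
   have "compact ((%t. B t w) ` {0..r})"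
    using B_continuous[OF elim(2)] by (intro compact_continuous_image) (auto intro: continuous_on_subset)
   then obtain C where C: "!!t. t \<in> {0..r} ==> abs (B t w) <= C"
    using compact_imp_bounded bounded_iff by (metis imageI real_norm_def)
   obtain t where t: "0 <= t" "max C (abs (walk d j w) + d) < abs (B t w)" using elim(1) by blast
   then have "r <= t" using C[of t] by (cases "t <= r") auto
   then have "abs (B t w - walk d j w) < d"
    using walk_between(1)[OF d elim(2) t(1), of j] r inf by simp
   then show False using t by linarith
  qed
 qed simp
 then show ?case by blast
qed

text \<open>Generated by the walk alone, not by the Brownian past up to \<open>hit_seq d j\<close>:
  the functionals in question depend only on the walk, and sigma-algebras at continuous stopping
  times are avoided.\<close>

definition walk_sigma :: "real => nat => 'a measure" where
 "walk_sigma d j = sigma (space M) {walk d i -` A \<inter> space M |i A. i <= j & A \<in> sets borel}"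

lemma space_walk_sigma [simp]: "space (walk_sigma d j) = space M"
 by (simp add: walk_sigma_def space_measure_of_conv)

lemma sets_walk_sigma: "sets (walk_sigma d j) = sigma_sets (space M) {walk d i -` A \<inter> space M |i A. i <= j & A \<in> sets borel}"
 unfolding walk_sigma_def by (rule sets_measure_of) auto

lemma walk_measurable: "i <= j ==> walk d i \<in> borel_measurable (walk_sigma d j)"
 by (rule measurableI) (auto simp: sets_walk_sigma intro!: sigma_sets.Basic)

lemma walk_M: "walk d j \<in> borel_measurable M"
proof (rule borel_measurable_LIMSEQ_real)
 let ?f = "%N w. if hit_seq d j w <= ereal (real N) then stopped (hit_seq d j) B (real N) w else B 0 w"
 fix N :: nat
 have "Measurable.pred (F (real N)) (%w. hit_seq d j w <= ereal (real N))"
  using hit_seq_stopping_time by (simp add: stopping_time_ext_def)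
 then have "Measurable.pred M (%w. hit_seq d j w <= ereal (real N))" by (rule measurable_F) simp
 then show "?f N \<in> borel_measurable M"
  by (intro measurable_If predE stopped_B_measurable' hit_seq_stopping_time B_measurable) auto
next
 fix w assume "w \<in> space M"
 show "(%N. if hit_seq d j w <= ereal (real N) then stopped (hit_seq d j) B (real N) w else B 0 w) \<longlonglongrightarrow> walk d j w"
 proof (cases "hit_seq d j w")
  case (real t)
  have "\<forall>\<^sub>F N in sequentially. walk d j w = (if hit_seq d j w <= ereal (real N) then stopped (hit_seq d j) B (real N) w else B 0 w)"
   using eventually_ge_at_top[of "nat \<lceil>t\<rceil>"]
  proof eventually_elim
   case (elim N)
   then have "t <= real N" by linarith
   then have le: "hit_seq d j w <= ereal (real N)" using real by simp
   show ?case using stopped_hit_seq[OF le] le by simp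
  qed
  then show ?thesis by (rule Lim_transform_eventually[OF tendsto_const])
 next
  case PInf
  then show ?thesis by (simp add: walk_def)
 next
  case MInf
  then show ?thesis using hit_seq_nonneg[of d j w] by simp
 qed
qed

lemma subalgebra_walk_sigma: "subalgebra M (walk_sigma d j)"
proof -
 have "sigma_sets (space M) {walk d i -` A \<inter> space M |i A. i <= j & A \<in> sets borel} \<subseteq> sets M"
  by (rule sets.sigma_sets_subset) (use measurable_sets[OF walk_M] in blast)
 then show ?thesis by (simp add: subalgebra_def sets_walk_sigma)
qed

lemma walk_sigma_M: "f \<in> borel_measurable (walk_sigma d j) ==> f \<in> borel_measurable M" for f :: "'a => real"
 by (rule measurable_from_subalg[OF subalgebra_walk_sigma])

text \<open>Where \<open>hit_seq d j\<close> is at most \<open>N\<close>, the walk up to step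
  \<open>j\<close> consists of stopped Brownian values at horizon \<open>N\<close>, which are known
  at the grid time. Elsewhere the grid is capped too early, hence the truncation.\<close>

lemma walk_sigma_grid_sigma:
 fixes f :: "'a => real"
 assumes d: "0 < d" and f: "f \<in> borel_measurable (walk_sigma d j)"
 shows "(%w. if hit_seq d j w <= ereal (real N) then f w else 0) \<in> borel_measurable (grid_sigma m (grid_index (hit_seq d j) N m))"
proof -
 let ?T = "hit_seq d j" and ?G = "grid_sigma m (grid_index (hit_seq d j) N m)"
 define H where "H = {w\<in>space M. ?T w <= ereal (real N)}"
 have "(%w. if ?T w <= ereal (real N) then 1 else 0 :: real) \<in> borel_measurable ?G"
 proof (rule measurable_grid_sigmaI[OF grid_stop_grid_index[OF hit_seq_stopping_time]])
  fix k
  have "Measurable.pred (F (real k / 2^m)) (%w. ?T w <= ereal (real k / 2^m))"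
   using hit_seq_stopping_time by (simp add: stopping_time_ext_def)
  then show "(%w. if ?T w <= ereal (real k / 2^m) then 1 else 0 :: real) \<in> borel_measurable (F (real k / 2^m))"
   by (intro measurable_If predE) auto
 next
  fix k w assume k: "grid_index ?T N m w = k"
  show "(if ?T w <= ereal (real N) then 1 else 0 :: real) = (if ?T w <= ereal (real k / 2^m) then 1 else 0)"
  proof (cases "N * 2^m <= k")
   case True
   then have "k = N * 2^m" using grid_index_le[of ?T N m w] k by simp
   then show ?thesis by simp
  next
   case False
   then have T: "?T w <= ereal (real k / 2^m)" using grid_index_le_iff[of ?T N m w k] k by simp
   have "real k / 2^m <= real N" using False by (simp add: divide_le_eq flip: of_nat_le_iff[where 'a = real])
   then have "?T w <= ereal (real N)" using T by (meson ereal_less_eq(3) order_trans)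
   then show ?thesis using T by simp
  qed
 qed
 note ind = measurable_sets[OF this, of "{1}"]
 have "(%w. if ?T w <= ereal (real N) then 1 else 0 :: real) -` {1} \<inter> space ?G = H"
  by (auto simp: H_def split: if_splits)
 with ind have H: "H \<in> sets ?G" by simp
 \<comment> \<open>The induction over generated sets runs on their traces on \<open>H\<close>, since
   only these are known at the grid time.\<close>
 have "E \<inter> H \<in> sets ?G" if "E \<in> sets (walk_sigma d j)" for E
  using that unfolding sets_walk_sigma
 proof induction
  case (Basic E)
  then obtain i A where E: "E = walk d i -` A \<inter> space M" "i <= j" "A \<in> sets borel" by blast
  have "walk d i w = stopped (hit_seq d i) B (real N) w" if "w \<in> H" for w
   using that hit_seq_mono[OF d _ E(2), of w] by (auto simp: H_def intro!: stopped_hit_seq[symmetric] intro: order_trans)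
  then have "E \<inter> H = (stopped (hit_seq d i) B (real N) -` A \<inter> space ?G) \<inter> H" by (auto simp: E(1) H_def)
  also have "... \<in> sets ?G"
   by (intro sets.Int measurable_sets[OF stopped_measurable_grid_sigma[OF adapted_B B_continuous] E(3)] H
     hit_seq_stopping_time hit_seq_mono[OF d _ E(2)])
  finally show ?case .
 next
  case (Compl E)
  have "(space M - E) \<inter> H = H - E \<inter> H" by (auto simp: H_def)
  then show ?case using Compl H by simp
 next
  case (Union E)
  have "(\<Union>i. E i \<inter> H) \<in> sets ?G" using Union by (intro sets.countable_UN) auto
  then show ?case by (simp only: Int_UN_distrib2 UN_extend_simps)
 qed simp
 note W = this
 show ?thesis
 proof (rule measurableI)
  fix A :: "real set" assume A: "A \<in> sets borel"
  have "(%w. if ?T w <= ereal (real N) then f w else 0) -` A \<inter> space ?G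
   = (f -` A \<inter> space (walk_sigma d j)) \<inter> H \<union> (if 0 \<in> A then space ?G - H else {})"
   by (auto simp: H_def split: if_splits)
  also have "... \<in> sets ?G" using W[OF measurable_sets[OF f A]] sets.compl_sets[OF H] by auto
  finally show "(%w. if ?T w <= ereal (real N) then f w else 0) -` A \<inter> space ?G \<in> sets ?G" .
 qed simp
qed

text \<open>The truncated weight is known at the grid time for every mesh, so with \<open>N\<close>
  fixed the error of approximate optional stopping vanishes as \<open>m\<close> grows. Then
  \<open>N\<close> tends to infinity under the bound \<open>C * d\<close>.\<close>

lemma walk_orthogonal:
 assumes d: "0 < d" and f: "f \<in> borel_measurable (walk_sigma d j)"
  and C: "!!w. w \<in> space M ==> abs (f w) <= C"
 shows "integrable M (%w. f w * (walk d (Suc j) w - walk d j w))"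
  and "(LINT w|M. f w * (walk d (Suc j) w - walk d j w)) = 0"
proof -
 have C0: "0 <= C" using C not_empty abs_ge_zero order_trans by blast
 let ?T = "hit_seq d j" and ?T' = "hit_seq d (Suc j)"
 define xi where "xi N w = (if ?T w <= ereal (real N) then f w else 0)" for N w
 define Z where "Z N w = xi N w * (stopped ?T' B (real N) w - stopped ?T B (real N) w)" for N w
 have xim: "xi N \<in> borel_measurable (grid_sigma m (grid_index ?T N m))" for N m
  unfolding xi_def by (rule walk_sigma_grid_sigma[OF d f])
 have xib: "abs (xi N w) <= C" if "w \<in> space M" for N w using C[OF that] C0 by (simp add: xi_def)
 have zero: "(LINT w|M. Z N w) = 0" for N
 proof -
  have "abs (LINT w|M. Z N w) <= 2 * C * sqrt (1 / 2^m)" for m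
   unfolding Z_def using hit_seq_mono_Suc[OF d]
   by (intro stopped_B_optional_stopping hit_seq_stopping_time xim xib)
  moreover have "(%m. 2 * C * sqrt (1 / 2^m)) \<longlonglongrightarrow> 2 * C * sqrt 0"
  proof (intro tendsto_mult tendsto_const tendsto_real_sqrt)
   show "(%m. 1 / 2^m :: real) \<longlonglongrightarrow> 0"
    using LIMSEQ_power_zero[of "1/2::real"] by (simp add: power_one_over)
  qed
  ultimately have "abs (LINT w|M. Z N w) <= 0" by (intro LIMSEQ_le_const[of _ 0]) auto
  then show ?thesis by simp
 qed
 have fM: "f \<in> borel_measurable M" by (rule walk_sigma_M[OF f])
 have ZM: "Z N \<in> borel_measurable M" for N
 proof -
  have "xi N \<in> borel_measurable M"
   by (rule measurable_grid_sigmaD(1)[OF grid_stop_grid_index[OF hit_seq_stopping_time] xim[of N 0]])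
  moreover have "stopped ?T' B (real N) \<in> borel_measurable M" "stopped ?T B (real N) \<in> borel_measurable M"
   by (intro stopped_B_measurable' hit_seq_stopping_time of_nat_0_le_iff)+
  ultimately show ?thesis unfolding Z_def by measurable
 qed
 have lim: "AE w in M. (%N. Z N w) \<longlonglongrightarrow> f w * (walk d (Suc j) w - walk d j w)"
  using AE_hit_seq_finite[OF d] AE_space
 proof eventually_elim
  case (elim w)
  obtain r where r: "?T' w = ereal r" using elim(1) hit_seq_nonneg[of d "Suc j" w]
   by (metis ereal_cases ereal_infty_less(1) ereal_less_eq(2) MInfty_neq_PInfty(1) ereal_0_le_uminus_iff less_irrefl not_MInfty_nonneg)
  obtain n0 :: nat where "r <= real n0" using real_arch_simple by blast
  then have "\<forall>n\<ge>n0. r <= real n" by (meson of_nat_le_iff order_trans)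
  then have "\<forall>\<^sub>F N in sequentially. r <= real N" by (auto simp: eventually_sequentially)
  then have "\<forall>\<^sub>F N in sequentially. f w * (walk d (Suc j) w - walk d j w) = Z N w"
  proof eventually_elim
   case (elim N)
   then have le: "?T' w <= ereal (real N)" using r by simp
   then have "?T w <= ereal (real N)" using hit_seq_mono_Suc[OF d \<open>w \<in> space M\<close>] order_trans by blast
   then show ?case using le by (simp add: Z_def xi_def stopped_hit_seq)
  qed
  then show ?case by (rule Lim_transform_eventually[OF tendsto_const])
 qed
 have dom: "AE w in M. norm (Z N w) <= C * d" for N
 proof (rule AE_I2)
  fix w assume w: "w \<in> space M"
  have "abs (Z N w) <= C * d"
   unfolding Z_def abs_mult using xib[OF w] stopped_hit_seq_distance[OF d w] C0
   by (intro mult_mono) auto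
  then show "norm (Z N w) <= C * d" by simp
 qed
 have limM: "(%w. f w * (walk d (Suc j) w - walk d j w)) \<in> borel_measurable M"
  by (intro borel_measurable_times borel_measurable_diff fM walk_M)
 have int: "integrable M (%_. C * d)" by simp
 show "integrable M (%w. f w * (walk d (Suc j) w - walk d j w))"
  by (rule integrable_dominated_convergence[OF limM ZM int lim dom])
 have "(%N. LINT w|M. Z N w) \<longlonglongrightarrow> (LINT w|M. f w * (walk d (Suc j) w - walk d j w))"
  by (rule integral_dominated_convergence[OF limM ZM int lim dom])
 then show "(LINT w|M. f w * (walk d (Suc j) w - walk d j w)) = 0"
  unfolding zero by (simp add: LIMSEQ_const_iff)
qed

section \<open>The killed walk and its occupation sums\<close>

definition pos :: "real => nat => 'a => nat" where
 "pos d j w = nat \<lfloor>walk d j w / d\<rfloor>"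

definition alive :: "real => nat => nat => 'a => real" where
 "alive d N j w = (if \<forall>i\<le>j. 0 < walk d i w & walk d i w < real N * d then 1 else 0)"

definition occupation :: "real => nat => (nat => real) => nat => 'a => real" where
 "occupation d N q J w = (\<Sum>j<J. alive d N j w * q (pos d j w))"

lemma alive_Suc:
 "alive d N (Suc j) w = alive d N j w * (if 0 < walk d (Suc j) w & walk d (Suc j) w < real N * d then 1 else 0)"
 by (auto simp: alive_def le_Suc_eq)

lemma alive_01: "alive d N j w = 0 \<or> alive d N j w = 1"
 by (simp add: alive_def)

context
 fixes K :: nat and N :: nat and d :: real
 assumes K: "1 <= K" and KN: "K < N" and d_def: "d = x0 / real K"
begin

lemma d_pos: "0 < d"
 using K x0_pos by (simp add: d_def)

lemma walk_lattice:
 assumes w: "w \<in> space M" and fin: "!!j. hit_seq d j w < \<infinity>"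
 shows "\<exists>k::int. walk d j w = of_int k * d"
proof (induction j)
 case 0
 have "walk d 0 w = of_int (int K) * d"
  using K walk_0[OF w] by (simp add: d_def)
 then show ?case by blast
next
 case (Suc j)
 then obtain k :: int where k: "walk d j w = of_int k * d" by blast
 have "walk d (Suc j) w = of_int (k + 1) * d \<or> walk d (Suc j) w = of_int (k - 1) * d"
  using walk_step(1)[OF d_pos w fin, of j] k by (auto simp: algebra_simps abs_if split: if_splits)
 then show ?case by blast
qed

lemma walk_pos:
 assumes w: "w \<in> space M" and fin: "!!j. hit_seq d j w < \<infinity>" and nonneg: "0 <= walk d j w"
 shows "walk d j w = real (pos d j w) * d"
proof -
 obtain k :: int where k: "walk d j w = of_int k * d" using walk_lattice[OF w fin] by blast
 then have "0 <= k" using nonneg d_pos by (simp add: zero_le_mult_iff)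
 then show ?thesis using k d_pos by (simp add: pos_def)
qed

lemma alive_pos:
 assumes w: "w \<in> space M" and fin: "!!j. hit_seq d j w < \<infinity>" and al: "alive d N j w = 1"
 shows "walk d j w = real (pos d j w) * d" "1 <= pos d j w" "pos d j w < N"
  "walk d (Suc j) w = real (pos d (Suc j) w) * d"
  "pos d (Suc j) w = pos d j w + 1 \<or> pos d (Suc j) w = pos d j w - 1"
proof -
 have wk: "0 < walk d j w" "walk d j w < real N * d"
  using al by (auto simp: alive_def split: if_splits)
 show eq: "walk d j w = real (pos d j w) * d"
  using walk_pos[OF w fin] wk by simp
 then show p1: "1 <= pos d j w" using wk d_pos by (simp add: zero_less_mult_iff)
 show "pos d j w < N" using wk eq d_pos by simp
 have step: "abs (walk d (Suc j) w - walk d j w) = d" by (rule walk_step(1)[OF d_pos w fin])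
 have "d <= walk d j w" using eq p1 d_pos by simp
 then have "0 <= walk d (Suc j) w" using step by linarith
 then show eq': "walk d (Suc j) w = real (pos d (Suc j) w) * d" using walk_pos[OF w fin] by simp
 have "abs ((real (pos d (Suc j) w) - real (pos d j w)) * d) = d"
  using step eq eq' by (simp add: algebra_simps)
 then have "abs (real (pos d (Suc j) w) - real (pos d j w)) = 1"
  using d_pos by (simp add: abs_mult)
 then show "pos d (Suc j) w = pos d j w + 1 \<or> pos d (Suc j) w = pos d j w - 1"
  using p1 by linarith
qed

lemma pos_measurable [measurable]: "i <= j ==> pos d i \<in> measurable (walk_sigma d j) (count_space UNIV)"
 using walk_measurable[of i j d] unfolding pos_def by measurable

lemma alive_measurable: "i <= j ==> alive d N i \<in> borel_measurable (walk_sigma d j)"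
proof -
 assume ij: "i <= j"
 have "Measurable.pred (walk_sigma d j) (%w. k <= i --> 0 < walk d k w & walk d k w < real N * d)" for k
 proof (cases "k <= i")
  case True
  have [measurable]: "walk d k \<in> borel_measurable (walk_sigma d j)"
   by (rule walk_measurable) (use True ij in simp)
  show ?thesis by measurable
 qed simp
 then have "Measurable.pred (walk_sigma d j) (%w. \<forall>k\<le>i. 0 < walk d k w & walk d k w < real N * d)"
  by (rule pred_intros_countable(1))
 then show ?thesis unfolding alive_def[abs_def]
  by (intro measurable_If borel_measurable_const predE)
qed

lemma function_pos_measurable:
 fixes phi :: "nat => real"
 shows "i <= j ==> (%w. phi (pos d i w)) \<in> borel_measurable (walk_sigma d j)"
 using pos_measurable[of i j] by measurable

lemma finite_range_bound: "\<exists>C\<ge>0. \<forall>k\<le>L. abs ((phi :: nat => real) k) <= C"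
 by (intro exI[of _ "\<Sum>k\<le>L. abs (phi k)"] conjI allI impI)
  (auto intro!: sum_nonneg member_le_sum[where f = "%k. abs (phi k)"])

text \<open>Truncating \<open>phi\<close> outside the lattice interval makes the integrands bounded for every outcome, including the
 null set on which the walk leaves the lattice.\<close>

lemma walk_generator:
 fixes phi :: "nat => real"
 assumes G: "G \<in> borel_measurable (walk_sigma d j)" "!!w. w \<in> space M ==> abs (G w) <= C"
  and phi: "phi 0 = 0" "!!k. N <= k ==> phi k = 0"
 shows "(LINT w|M. G w * (alive d N (Suc j) w * phi (pos d (Suc j) w)))
   = (LINT w|M. G w * (alive d N j w * (phi (pos d j w) + diff2 phi (pos d j w) / 2)))"
proof -
 \<comment> \<open>With this symmetric difference quotient, a step from \<open>k\<close> to a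
   neighbour changes \<open>phi\<close> by exactly half the second difference plus
   \<open>c k\<close> times the step of the walk.\<close>
 define c where "c k = (phi (k + 1) - phi (k - 1)) / (2 * d)" for k
 define H where "H w = G w * alive d N j w * c (pos d j w)" for w
 obtain C1 where C1: "0 <= C1" "!!k. k <= N + 1 ==> abs (c k) <= C1" using finite_range_bound[of "N + 1" c] by blast
 have c: "abs (c k) <= C1" for k using C1 phi by (cases "k <= N + 1") (auto simp: c_def)
 obtain C2 where C2: "0 <= C2" "!!k. k <= N + 1 ==> abs (phi k + diff2 phi k / 2) <= C2"
  using finite_range_bound[of "N + 1" "%k. phi k + diff2 phi k / 2"] by blast
 have c2: "abs (phi k + diff2 phi k / 2) <= C2" for k using C2 phi by (cases "k <= N + 1") (auto simp: diff2_def)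
 have C0: "0 <= C" using G(2) not_empty abs_ge_zero order_trans by blast
 have a: "abs (alive d N j w) <= 1" for w using alive_01[of d N j w] by auto
 have Hm: "H \<in> borel_measurable (walk_sigma d j)"
  unfolding H_def using alive_measurable[of j j] function_pos_measurable[of j j c] G(1) by measurable
 have Hb: "abs (H w) <= C * 1 * C1" if "w \<in> space M" for w
  unfolding H_def abs_mult by (intro mult_mono) (use G(2)[OF that] a c C0 C1 in auto)
 note orth = walk_orthogonal[OF d_pos Hm Hb]
 have m2: "(%w. G w * (alive d N j w * (phi (pos d j w) + diff2 phi (pos d j w) / 2))) \<in> borel_measurable M"
  using alive_measurable[of j j] function_pos_measurable[of j j "%k. phi k + diff2 phi k / 2"] G(1)
  by (intro walk_sigma_M borel_measurable_times) auto
 have i2: "integrable M (%w. G w * (alive d N j w * (phi (pos d j w) + diff2 phi (pos d j w) / 2)))"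
 proof (rule integrable_bounded[OF m2])
  fix w assume "w \<in> space M"
  then show "abs (G w * (alive d N j w * (phi (pos d j w) + diff2 phi (pos d j w) / 2))) <= C * (1 * C2)"
   unfolding abs_mult by (intro mult_mono) (use G(2) a c2 C0 C2 in auto)
 qed
 have m1: "(%w. G w * (alive d N (Suc j) w * phi (pos d (Suc j) w))) \<in> borel_measurable M"
  using walk_sigma_M[OF G(1)] walk_sigma_M[OF alive_measurable[of "Suc j" "Suc j"]]
   walk_sigma_M[OF function_pos_measurable[of "Suc j" "Suc j" phi]] by auto
 have "(LINT w|M. G w * (alive d N (Suc j) w * phi (pos d (Suc j) w)))
   = (LINT w|M. G w * (alive d N j w * (phi (pos d j w) + diff2 phi (pos d j w) / 2))
     + H w * (walk d (Suc j) w - walk d j w))"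
 proof (rule integral_cong_AE)
  show "(%w. G w * (alive d N j w * (phi (pos d j w) + diff2 phi (pos d j w) / 2))
     + H w * (walk d (Suc j) w - walk d j w)) \<in> borel_measurable M"
   using m2 borel_measurable_integrable[OF orth(1)] by (rule borel_measurable_add)
  show "AE w in M. G w * (alive d N (Suc j) w * phi (pos d (Suc j) w))
    = G w * (alive d N j w * (phi (pos d j w) + diff2 phi (pos d j w) / 2))
     + H w * (walk d (Suc j) w - walk d j w)"
   using AE_hit_seq_finite[OF d_pos] AE_space
  proof eventually_elim
   case (elim w)
   show ?case
   proof (cases "alive d N j w = 1")
    case False
    then have "alive d N j w = 0" using alive_01 by blast
    then show ?thesis by (simp add: H_def alive_Suc)
   next
    case True
    define k where "k = pos d j w"
    define k' where "k' = pos d (Suc j) w"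
    have k: "walk d j w = real k * d" "1 <= k" "k < N" "walk d (Suc j) w = real k' * d" "k' = k + 1 \<or> k' = k - 1"
     using alive_pos[OF elim(2) _ True] elim(1) by (auto simp: k_def k'_def)
    \<comment> \<open>The killing indicator at the new position drops out because \<open>phi\<close>
      vanishes at \<open>0\<close> and from \<open>N\<close> on.\<close>
    have a1: "alive d N (Suc j) w * phi k' = phi k'"
     using True k phi d_pos by (cases "k' = 0"; cases "N <= k'") (auto simp: alive_Suc)
    have a2: "phi k' = phi k + diff2 phi k / 2 + c k * (real k' * d - real k * d)"
     using k d_pos by (auto simp: c_def diff2_def of_nat_diff field_simps)
    show ?thesis
     unfolding H_def k_def[symmetric] k'_def[symmetric] True k(1,4) a1
     by (subst a2) (simp add: algebra_simps)
   qed
  qed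
 qed (rule m1)
 also have "... = (LINT w|M. G w * (alive d N j w * (phi (pos d j w) + diff2 phi (pos d j w) / 2)))
   + (LINT w|M. H w * (walk d (Suc j) w - walk d j w))"
  by (rule leb_integral_add[OF i2 orth(1)])
 also have "(LINT w|M. H w * (walk d (Suc j) w - walk d j w)) = 0" by (rule orth(2))
 finally show ?thesis by simp
qed

lemma alive_0: "w \<in> space M ==> alive d N 0 w = 1"
 using walk_0[of w d] x0_pos K KN by (simp add: alive_def d_def field_simps)

lemma pos_0: "w \<in> space M ==> pos d 0 w = K"
 using walk_0[of w d] x0_pos K by (simp add: pos_def d_def)

lemma occupation_measurable: "occupation d N q J \<in> borel_measurable (walk_sigma d (J - 1))"
 unfolding occupation_def[abs_def]
 by (intro borel_measurable_sum borel_measurable_times alive_measurable function_pos_measurable) auto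

lemma occupation_measurable':
 assumes "J <= Suc j"
 shows "occupation d N q J \<in> borel_measurable (walk_sigma d j)"
 unfolding occupation_def[abs_def] using assms
 by (intro borel_measurable_sum borel_measurable_times alive_measurable function_pos_measurable) auto

lemma occupation_bounds:
 assumes q: "!!k. 0 <= q k" "!!k. q k <= Cq"
 shows "0 <= occupation d N q J w" "occupation d N q J w <= real J * Cq"
proof -
 have a: "0 <= alive d N j w" "alive d N j w <= 1" for j using alive_01[of d N j w] by auto
 show "0 <= occupation d N q J w"
  unfolding occupation_def using a q by (intro sum_nonneg mult_nonneg_nonneg) auto
 have "alive d N j w * q (pos d j w) <= 1 * Cq" for j
  by (intro mult_mono a q) auto
 then have "occupation d N q J w <= (\<Sum>j<J. Cq)"
  unfolding occupation_def by (intro sum_mono) simp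
 then show "occupation d N q J w <= real J * Cq" by simp
qed

lemma integrable_function_pos:
 fixes G :: "'a => real" and phi :: "nat => real"
 assumes G: "G \<in> borel_measurable M" "!!w. w \<in> space M ==> abs (G w) <= C"
  and phi: "!!k. abs (phi k) <= D"
 shows "integrable M (%w. G w * (alive d N j w * phi (pos d j w)))"
proof (rule integrable_bounded)
 show "(%w. G w * (alive d N j w * phi (pos d j w))) \<in> borel_measurable M"
  using G(1) walk_sigma_M[OF alive_measurable[of j j]] walk_sigma_M[OF function_pos_measurable[of j j phi]] by auto
 fix w assume w: "w \<in> space M"
 have "0 <= C" using G(2)[OF w] by linarith
 moreover have "abs (alive d N j w) <= 1" using alive_01[of d N j w] by auto
 ultimately show "abs (G w * (alive d N j w * phi (pos d j w))) <= C * (1 * D)"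
  unfolding abs_mult using G(2)[OF w] phi by (intro mult_mono) auto
qed

context
 fixes u q :: "nat => real" and U :: real
 assumes u: "u 0 = 0" "!!k. N <= k ==> u k = 0" "!!k. 0 <= u k" "!!k. u k <= U"
  and q: "!!k. 0 <= q k" and uq: "!!k. 1 <= k ==> k < N ==> diff2 u k = - 2 * q k"
  and q0: "!!k. k = 0 \<or> N <= k ==> q k = 0"
begin

lemma q_bounded: "\<exists>Cq. \<forall>k. q k <= Cq"
proof -
 obtain C where "0 <= C" "\<forall>k\<le>N. abs (q k) <= C" using finite_range_bound[of N q] by blast
 then have "q k <= C" for k using q0[of k] by (cases "k <= N") (auto simp: abs_le_iff)
 then show ?thesis by blast
qed

lemma alive_generator:
 assumes "w \<in> space M" "!!j. hit_seq d j w < \<infinity>"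
 shows "alive d N j w * (u (pos d j w) + diff2 u (pos d j w) / 2) = alive d N j w * (u (pos d j w) - q (pos d j w))"
 using alive_pos(2,3)[OF assms, of j] uq[of "pos d j w"] alive_01[of d N j w] by auto

lemma u_step:
 assumes G: "G \<in> borel_measurable (walk_sigma d j)" "!!w. w \<in> space M ==> abs (G w) <= C"
 shows "(LINT w|M. G w * (alive d N (Suc j) w * u (pos d (Suc j) w)))
   = (LINT w|M. G w * (alive d N j w * (u (pos d j w) - q (pos d j w))))"
proof -
 have "(LINT w|M. G w * (alive d N (Suc j) w * u (pos d (Suc j) w)))
   = (LINT w|M. G w * (alive d N j w * (u (pos d j w) + diff2 u (pos d j w) / 2)))"
  by (rule walk_generator[where G = G and C = C and phi = u, OF G u(1,2)])
 also have "... = (LINT w|M. G w * (alive d N j w * (u (pos d j w) - q (pos d j w))))"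
 proof (rule integral_cong_AE)
  show "(%w. G w * (alive d N j w * (u (pos d j w) + diff2 u (pos d j w) / 2))) \<in> borel_measurable M"
   "(%w. G w * (alive d N j w * (u (pos d j w) - q (pos d j w)))) \<in> borel_measurable M"
   using alive_measurable[of j j] function_pos_measurable[of j j "%k. u k + diff2 u k / 2"]
    function_pos_measurable[of j j "%k. u k - q k"] G(1)
   by (auto intro!: walk_sigma_M borel_measurable_times)
  show "AE w in M. G w * (alive d N j w * (u (pos d j w) + diff2 u (pos d j w) / 2))
    = G w * (alive d N j w * (u (pos d j w) - q (pos d j w)))"
   using AE_hit_seq_finite[OF d_pos] AE_space by eventually_elim (simp add: alive_generator)
 qed
 finally show ?thesis .
qed

text \<open>Dynkin's formula: half the second difference of \<open>u\<close> is \<open>- q\<close>,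
  so \<open>u\<close> along the walk decreases on average by the occupation gained. Hence
  \<open>u K\<close> is the expected total occupation once the survivors have disappeared.\<close>

lemma occupation_expectation:
 "(LINT w|M. occupation d N q J w) + (LINT w|M. alive d N J w * u (pos d J w)) = u K"
proof (induction J)
 case 0
 have "(LINT w|M. alive d N 0 w * u (pos d 0 w)) = (LINT w|M. u K)"
  by (intro leb_integral_cong) (auto simp: alive_0 pos_0)
 then show ?case by (simp add: occupation_def prob_space)
next
 case (Suc J)
 obtain Cq where Cq: "!!k. q k <= Cq" using q_bounded by blast
 have ub: "abs (u k) <= U" and qb: "abs (q k) <= Cq" for k using u q Cq by (auto simp: abs_le_iff intro: order_trans)
 have iu: "integrable M (%w. alive d N J w * u (pos d J w))"
  using integrable_function_pos[of "%_. 1" 1 u U J] ub by simp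
 have iq: "integrable M (%w. alive d N J w * q (pos d J w))"
  using integrable_function_pos[of "%_. 1" 1 q Cq J] qb by simp
 have iQ: "integrable M (occupation d N q J)"
  using occupation_bounds[of q Cq J] q Cq walk_sigma_M[OF occupation_measurable]
  by (intro integrable_bounded[where C = "real J * Cq"]) auto
 have "(LINT w|M. alive d N (Suc J) w * u (pos d (Suc J) w))
   = (LINT w|M. alive d N J w * u (pos d J w)) - (LINT w|M. alive d N J w * q (pos d J w))"
  using u_step[of "%_. 1" J 1] iu iq by (simp add: right_diff_distrib)
 moreover have "(LINT w|M. occupation d N q (Suc J) w)
   = (LINT w|M. occupation d N q J w) + (LINT w|M. alive d N J w * q (pos d J w))"
 proof -
  have "occupation d N q (Suc J) w = occupation d N q J w + alive d N J w * q (pos d J w)" for w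
   by (simp add: occupation_def)
  then show ?thesis using iQ iq by simp
 qed
 ultimately show ?case using Suc by simp
qed

text \<open>A second moment bound of Kac type. The cross term in the square of the new occupation
  cancels against the decrease of \<open>u\<close> weighted by the occupation; the extra summand
  with \<open>u\<close> is there to make the induction close. What remains of each step is at most
  \<open>2 * U\<close> times the new occupation.\<close>

lemma occupation_second_moment:
 "(LINT w|M. (occupation d N q J w)^2) + 2 * (LINT w|M. occupation d N q J w * (alive d N J w * u (pos d J w)))
  <= 2 * U * (LINT w|M. occupation d N q J w)"
proof (induction J)
 case 0
 show ?case by (simp add: occupation_def)
next
 case (Suc J)
 obtain Cq where Cq: "!!k. q k <= Cq" using q_bounded by blast
 define Q where "Q J w = occupation d N q J w" for J w
 define A where "A w = alive d N J w" for w
 define u' where "u' w = u (pos d J w)" for w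
 define q' where "q' w = q (pos d J w)" for w
 have AA: "0 <= A w" for w using alive_01[of d N J w] by (auto simp: A_def)
 have ub: "abs (u k) <= U" and qb: "abs (q k) <= Cq" for k using u q Cq by (auto simp: abs_le_iff intro: order_trans)
 have Qm: "Q J \<in> borel_measurable M" for J unfolding Q_def by (rule walk_sigma_M[OF occupation_measurable])
 have Qb: "abs (Q J w) <= real J * Cq" for J w
  using occupation_bounds[of q Cq J w] q Cq by (simp add: Q_def)
 have iQ: "integrable M (Q J)" for J
  by (rule integrable_bounded[OF Qm Qb])
 have iQ2: "integrable M (%w. (Q J w)^2)"
 proof (rule integrable_bounded)
  show "abs ((Q J w)^2) <= (real J * Cq)^2" for w
   using Qb[of J w] abs_ge_self[of "real J * Cq"] by (simp add: abs_le_square_iff[symmetric])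
 qed (use Qm in simp)
 have ia: "integrable M (%w. G w * (A w * phi (pos d J w)))"
  if "G \<in> borel_measurable M" "!!w. abs (G w) <= C" "!!k. abs (phi k) <= D" for G C D and phi :: "nat => real"
  unfolding A_def using that by (intro integrable_function_pos[where C = C and D = D])
 have qq: "abs (q k * q k) <= Cq * Cq" "abs (q k * u k) <= Cq * U" for k
  unfolding abs_mult by (intro mult_mono qb ub abs_ge_zero order_trans[OF abs_ge_zero qb])+
 have i1: "integrable M (%w. Q J w * (A w * u' w))" unfolding u'_def by (rule ia[OF Qm Qb ub])
 have i2: "integrable M (%w. Q J w * (A w * q' w))" unfolding q'_def by (rule ia[OF Qm Qb qb])
 have i3: "integrable M (%w. A w * (q' w * u' w))"
  using ia[of "%_. 1" 1 "%k. q k * u k" "Cq * U"] qq by (simp add: q'_def u'_def)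
 have i4: "integrable M (%w. A w * (q' w * q' w))"
  using ia[of "%_. 1" 1 "%k. q k * q k" "Cq * Cq"] qq by (simp add: q'_def)
 have i5: "integrable M (%w. A w * q' w)"
  using ia[of "%_. 1" 1 q Cq] qb by (simp add: q'_def)
 have QS: "Q (Suc J) w = Q J w + A w * q' w" for w by (simp add: Q_def occupation_def A_def q'_def)
 have "(LINT w|M. Q (Suc J) w * (alive d N (Suc J) w * u (pos d (Suc J) w)))
   = (LINT w|M. Q (Suc J) w * (A w * (u' w - q' w)))"
  unfolding A_def u'_def q'_def
  by (rule u_step[where C = "real (Suc J) * Cq"]) (use Qb[of "Suc J"] in \<open>auto simp: Q_def occupation_measurable'\<close>)
 also have "... = (LINT w|M. Q J w * (A w * u' w) - Q J w * (A w * q' w) + A w * (q' w * u' w) - A w * (q' w * q' w))"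
 proof (intro leb_integral_cong refl)
  fix w
  have "A w = 0 \<or> A w = 1" using alive_01 by (simp add: A_def)
  then show "Q (Suc J) w * (A w * (u' w - q' w))
    = Q J w * (A w * u' w) - Q J w * (A w * q' w) + A w * (q' w * u' w) - A w * (q' w * q' w)"
   unfolding QS by (elim disjE) (simp_all add: algebra_simps)
 qed
 also have "... = (LINT w|M. Q J w * (A w * u' w)) - (LINT w|M. Q J w * (A w * q' w))
   + (LINT w|M. A w * (q' w * u' w)) - (LINT w|M. A w * (q' w * q' w))"
  by (simp only: i1 i2 i3 i4 leb_integral_add leb_integral_diff
    leb_integrable_add leb_integrable_diff)
 finally have e1: "(LINT w|M. Q (Suc J) w * (alive d N (Suc J) w * u (pos d (Suc J) w))) = ..." .
 have "(LINT w|M. (Q (Suc J) w)^2) = (LINT w|M. (Q J w)^2 + 2 * (Q J w * (A w * q' w)) + A w * (q' w * q' w))"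
 proof (intro leb_integral_cong refl)
  fix w
  have "A w = 0 \<or> A w = 1" using alive_01 by (simp add: A_def)
  then have "(A w * q' w)^2 = A w * (q' w * q' w)"
   by (elim disjE) (simp_all add: power2_eq_square)
  then show "(Q (Suc J) w)^2 = (Q J w)^2 + 2 * (Q J w * (A w * q' w)) + A w * (q' w * q' w)"
   by (simp add: QS power2_sum)
 qed
 also have "... = (LINT w|M. (Q J w)^2) + 2 * (LINT w|M. Q J w * (A w * q' w)) + (LINT w|M. A w * (q' w * q' w))"
  by (simp only: iQ2 i2 i4 leb_integral_add leb_integrable_add
    integrable_mult_right leb_integral_mult_right_zero)
 finally have e2: "(LINT w|M. (Q (Suc J) w)^2) = ..." .
 have e3: "(LINT w|M. Q (Suc J) w) = (LINT w|M. Q J w) + (LINT w|M. A w * q' w)"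
  using iQ[of J] i5 by (simp add: QS)
 have e4: "(LINT w|M. A w * (q' w * u' w)) <= U * (LINT w|M. A w * q' w)"
 proof -
  have "(LINT w|M. A w * (q' w * u' w)) <= (LINT w|M. U * (A w * q' w))"
  proof (rule integral_mono[OF i3])
   show "A w * (q' w * u' w) <= U * (A w * q' w)" for w
    using mult_left_mono[OF u(4)[of "pos d J w"], of "A w * q' w"] AA[of w] q[of "pos d J w"]
    by (simp add: u'_def q'_def mult_ac)
  qed (use i5 in simp)
  then show ?thesis by simp
 qed
 have e5: "0 <= (LINT w|M. A w * (q' w * q' w))"
  using AA by (intro leb_integral_nonneg) simp
 have IH: "(LINT w|M. (Q J w)^2) + 2 * (LINT w|M. Q J w * (A w * u' w)) <= 2 * U * (LINT w|M. Q J w)"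
  using Suc by (simp add: Q_def A_def u'_def)
 show ?case
  using IH e1 e2 e3 e4 e5 unfolding Q_def[symmetric] by (simp add: algebra_simps)
qed

end

text \<open>The quadratic \<open>v\<close> is the potential of the constant \<open>1\<close>, so
  \<open>v K\<close> bounds the expected lifetime and the survival probabilities are
  summable.\<close>

lemma alive_expectation_tendsto: "(%J. LINT w|M. alive d N J w) \<longlonglongrightarrow> 0"
proof -
 define v where "v k = (if k <= N then real k * (real N - real k) else 0)" for k
 define q1 where "q1 k = (if 1 <= k & k < N then 1 else 0 :: real)" for k
 obtain C where C: "0 <= C" "!!k. k <= N ==> abs (v k) <= C" using finite_range_bound[of N v] by blast
 have v: "v 0 = 0" "!!k. N <= k ==> v k = 0" "!!k. 0 <= v k" "!!k. v k <= C"
  using C by (auto simp: v_def) (meson C(2) abs_ge_self order_trans)?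
 have vq: "diff2 v k = - 2 * q1 k" if "1 <= k" "k < N" for k
 proof -
  have "k - 1 <= N" "k <= N" "k + 1 <= N" using that by auto
  then show ?thesis using that by (simp add: diff2_def v_def q1_def of_nat_diff algebra_simps)
 qed
 have e: "(LINT w|M. occupation d N q1 J w) + (LINT w|M. alive d N J w * v (pos d J w)) = v K" for J
  by (rule occupation_expectation[where U = C]) (use v vq in \<open>auto simp: q1_def\<close>)
 have nn: "0 <= (LINT w|M. alive d N J w * v (pos d J w))" for J
  using v(3) by (intro leb_integral_nonneg mult_nonneg_nonneg) (auto simp: alive_def)
 have ia: "integrable M (alive d N j)" for j
  using walk_sigma_M[OF alive_measurable[of j j]] by (intro integrable_bounded[where C = 1]) (auto simp: alive_def)
 have "(LINT w|M. alive d N j w * q1 (pos d j w)) = (LINT w|M. alive d N j w)" for j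
 proof (rule integral_cong_AE)
  show "AE w in M. alive d N j w * q1 (pos d j w) = alive d N j w"
   using AE_hit_seq_finite[OF d_pos] AE_space
  proof eventually_elim
   case (elim w)
   then show ?case using alive_pos(2,3)[OF elim(2), of j] alive_01[of d N j w] by (auto simp: q1_def)
  qed
 qed (use walk_sigma_M[OF alive_measurable[of j j]] walk_sigma_M[OF function_pos_measurable[of j j q1]] in auto)
 moreover have "(LINT w|M. occupation d N q1 J w) = (\<Sum>j<J. LINT w|M. alive d N j w * q1 (pos d j w))" for J
  unfolding occupation_def
  by (rule leb_integral_sum)
   (use integrable_function_pos[where G = "%_. 1" and C = 1 and phi = q1 and D = 1] in \<open>simp add: q1_def\<close>)
 ultimately have "(\<Sum>j<J. LINT w|M. alive d N j w) <= v K" for J using e[of J] nn[of J] by simp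
 then have "summable (%j. LINT w|M. alive d N j w)"
  by (intro summableI_nonneg_bounded) (auto intro!: leb_integral_nonneg simp: alive_def)
 then show ?thesis by (rule summable_LIMSEQ_zero)
qed

end

end

section \<open>Green function estimates and crossing arguments for single paths\<close>

lemma green_diff2:
 assumes "1 <= k" "k < N" "l <= N"
 shows "diff2 (%k. green N k l) k = (if k = l then -1 else 0)"
proof -
 have N: "0 < real N" using assms by simp
 have lo: "green N i l = real i * (real N - real l) / real N" if "i <= l" for i
 proof -
  have "real i * real N <= real l * real N" using that by (intro mult_right_mono) auto
  then show ?thesis by (simp add: green_def min_def algebra_simps)
 qed
 have hi: "green N i l = real l * (real N - real i) / real N" if "l <= i" for i
 proof -
  have "real l * real N <= real i * real N" using that by (intro mult_right_mono) auto
  then show ?thesis by (simp add: green_def min_def algebra_simps)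
 qed
 consider "k < l" | "k = l" | "l < k" by linarith
 then show ?thesis
 proof cases
  case 1
  then show ?thesis using assms N by (simp add: diff2_def lo of_nat_diff field_simps)
 next
  case 2
  then have "diff2 (%k. green N k l) k = (real l * (real N - real (l + 1)) - 2 * (real l * (real N - real l))
    + real (l - 1) * (real N - real l)) / real N"
   unfolding diff2_def using hi[of "l + 1"] lo[of l] lo[of "l - 1"]
   by (simp add: add_divide_distrib diff_divide_distrib)
  also have "... = -1" using 2 assms N by (simp add: of_nat_diff field_simps)
  finally show ?thesis using 2 by simp
 next
  case 3
  then have "green N (k - 1) l = real l * (real N - real (k - 1)) / real N" by (intro hi) simp
  then show ?thesis using 3 assms N by (simp add: diff2_def hi of_nat_diff field_simps)
 qed
qed

lemma green_nonneg: "k <= N ==> l <= N ==> 0 <= green N k l"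
 by (simp add: green_def)

lemma green_le:
 assumes "k <= N" "l <= N"
 shows "green N k l <= real l * (real N - real l) / real N"
proof (cases "k <= l")
 case True
 then have "real k * (real N - real l) <= real l * (real N - real l)" using assms by (intro mult_right_mono) auto
 then show ?thesis by (simp add: green_def divide_right_mono min_le_iff_disj)
next
 case False
 then have "real l * (real N - real k) <= real l * (real N - real l)" by (intro mult_left_mono) auto
 then show ?thesis by (simp add: green_def divide_right_mono min_le_iff_disj)
qed

text \<open>The start \<open>K\<close> is the fraction \<open>1 / M\<close> of the interval, so the
  Green function from there is at least \<open>1 / M\<close> of its maximum over all starting
  points, uniformly in the mesh.\<close>

lemma green_lower:
 assumes M: "2 <= M" and N: "N = M * K" and l: "l <= N"
 shows "real l * (real N - real l) / real N <= real M * green N K l"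
proof -
 have rN: "real N = real M * real K" by (simp add: N)
 have "real l * (real N - real l) <= real M * (real K * (real N - real l))"
 proof -
  have "real l * (real N - real l) <= real N * (real N - real l)" using l by (intro mult_right_mono) auto
  then show ?thesis by (simp add: rN mult.assoc)
 qed
 moreover have "real l * (real N - real l) <= real M * (real l * (real N - real K))"
 proof -
  have "real N - real l <= real N" by simp
  also have "... <= (real M - 1) * real N" using M by (simp add: mult_right_mono[of 1 "real M - 1" "real N", simplified])
  also have "... = real M * (real N - real K)" by (simp add: rN algebra_simps)
  finally have "real l * (real N - real l) <= real l * (real M * (real N - real K))" by (intro mult_left_mono) auto
  then show ?thesis by (simp add: mult.left_commute)
 qed
 ultimately have "real l * (real N - real l) <= real M * min (real K * (real N - real l)) (real l * (real N - real K))"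
  by (simp add: min_def)
 then show ?thesis by (simp add: green_def divide_right_mono)
qed

text \<open>After its last visit to \<open>y\<close> the path stays below \<open>y\<close> and,
  being continuous, takes all values just below \<open>y\<close> at times just after that visit.
  Right continuity of the composition at that time thus becomes left continuity of \<open>g\<close>
  at \<open>y\<close>.\<close>

lemma crossing_imp_left_continuous:
 fixes g f :: "real => real"
 assumes ab: "a <= b" and f: "continuous_on {a..b} f" and y: "y <= f a" "f b < y"
  and X: "!!t. a <= t ==> t < b ==> ((%t. g (f t)) \<longlongrightarrow> g (f t)) (at_right t)"
 shows "(g \<longlongrightarrow> g y) (at_left y)"
proof -
 define Z where "Z = {r\<in>{a..b}. f r = y}"
 have "Z \<noteq> {}" using IVT2'[of f b y a] f y ab by (auto simp: Z_def)
 moreover have "closed Z" unfolding Z_def by (intro continuous_closed_preimage_constant f) auto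
 moreover have bdd: "bdd_above Z" by (auto simp: Z_def intro!: bdd_aboveI[of _ b])
 ultimately have S: "Sup Z \<in> Z" by (intro closed_contains_Sup)
 define t where "t = Sup Z"
 have t: "a <= t" "t <= b" "f t = y" using S by (auto simp: Z_def t_def)
 have tb: "t < b" using t y by (cases "t = b") auto
 have below: "f r < y" if r: "t < r" "r <= b" for r
 proof (rule ccontr)
  assume "\<not> f r < y"
  then obtain s where s: "r <= s" "s <= b" "f s = y"
   using IVT2'[of f b y r] y r t continuous_on_subset[OF f, of "{r..b}"] by auto
  then have "s \<in> Z" using r t by (auto simp: Z_def)
  then have "s <= t" unfolding t_def using bdd by (rule cSup_upper)
  then show False using s r by simp
 qed
 show ?thesis
 proof (rule tendstoI)
  fix e :: real assume "0 < e"
  then have "\<forall>\<^sub>F r in at_right t. dist (g (f r)) (g y) < e"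
   using X[OF t(1) tb] t(3) by (auto dest: tendstoD)
  then obtain c where c: "t < c" "!!r. t < r ==> r < c ==> dist (g (f r)) (g y) < e"
   by (auto simp: eventually_at_right_field)
  define r1 where "r1 = min b ((t + c) / 2)"
  have r1: "t < r1" "r1 <= b" "r1 < c" using tb c(1) by (auto simp: r1_def min_def)
  have "dist (g z) (g y) < e" if z: "f r1 < z" "z < y" for z
  proof -
   obtain r where r: "t <= r" "r <= r1" "f r = z"
    using IVT2'[of f r1 z t] z t r1 continuous_on_subset[OF f, of "{t..r1}"] by auto
   then have "r \<noteq> t" using t z by auto
   then show ?thesis using c(2)[of r] r r1 by auto
  qed
  then show "\<forall>\<^sub>F z in at_left y. dist (g z) (g y) < e"
   using below[OF r1(1,2)] by (auto simp: eventually_at_left_field intro!: exI[of _ "f r1"])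
 qed
qed

text \<open>Reflection of both the path and the argument of \<open>g\<close> reduces this to the
  previous case.\<close>

lemma crossing_imp_right_continuous:
 fixes g f :: "real => real"
 assumes ab: "a <= b" and f: "continuous_on {a..b} f" and y: "f a <= y" "y < f b"
  and X: "!!t. a <= t ==> t < b ==> ((%t. g (f t)) \<longlongrightarrow> g (f t)) (at_right t)"
 shows "(g \<longlongrightarrow> g y) (at_right y)"
proof -
 have "((%x. g (- x)) \<longlongrightarrow> g (- (- y))) (at_left (- y))"
  using crossing_imp_left_continuous[of a b "%t. - f t" "- y" "%x. g (- x)"] assms
  by (auto intro!: continuous_intros)
 then show ?thesis unfolding at_right_minus[of y] filterlim_filtermap by simp
qed

text \<open>Just before it reaches \<open>0\<close> the path takes all small positive values, so a
  left limit in time is a right limit in space.\<close>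

lemma hitting_imp_right_limit:
 fixes g f :: "real => real"
 assumes ab: "a < b" and f: "continuous_on {a..b} f" and pos: "!!t. a <= t ==> t < b ==> 0 < f t" and zero: "f b = 0"
  and X: "((%t. g (f t)) \<longlongrightarrow> l) (at_left b)"
 shows "(g \<longlongrightarrow> l) (at_right 0)"
proof (rule tendstoI)
 fix e :: real assume "0 < e"
 then have "\<forall>\<^sub>F r in at_left b. dist (g (f r)) l < e" using X by (auto dest: tendstoD)
 then obtain c where c: "c < b" "!!r. c < r ==> r < b ==> dist (g (f r)) l < e"
  by (auto simp: eventually_at_left_field)
 define r1 where "r1 = max a ((b + c) / 2)"
 have r1: "a <= r1" "r1 < b" "c < r1" using ab c(1) by (auto simp: r1_def max_def)
 have "dist (g z) l < e" if z: "0 < z" "z < f r1" for z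
 proof -
  obtain r where r: "r1 <= r" "r <= b" "f r = z"
   using IVT2'[of f b z r1] z zero r1 continuous_on_subset[OF f, of "{r1..b}"] by auto
  then have "r \<noteq> b" using zero z by auto
  then show ?thesis using c(2)[of r] r r1 by auto
 qed
 then show "\<forall>\<^sub>F z in at_right 0. dist (g z) l < e"
  using pos[OF r1(1,2)] by (auto simp: eventually_at_right_field intro!: exI[of _ "f r1"])
qed

section \<open>The Green sum bound, and what cadlag paths say about \<open>g\<close>\<close>

context brownian
begin

text \<open>The potential \<open>u\<close> of \<open>q\<close> has the Green sum as its value at
  \<open>K\<close>. The expected occupation tends to \<open>u K\<close> as \<open>J\<close> grows,
  and the part collected on \<open>Gm\<close> is at most \<open>C\<close>. Off \<open>Gm\<close>, a
  truncation at a level of order \<open>m * U\<close> is paid for by the small probability, and the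
  excess by the second moment; both are comparable to \<open>u K\<close> because
  \<open>U <= m * u K\<close>.\<close>

lemma green_bound:
 fixes f :: "nat => real"
 assumes K: "1 <= K" and Mm: "2 <= m" and N: "N = m * K" and d: "d = x0 / real K"
  and G: "Gm \<in> sets M" "prob (space M - Gm) <= 1 / (8 * (real m)^2)"
  and C: "!!J. (LINT w|M. indicator Gm w * occupation d N (%k. if 1 <= k & k < N then \<bar>diff2 f k\<bar> / 2 else 0) J w) <= C"
 shows "(\<Sum>l\<in>{1..<N}. green N K l * abs (diff2 f l)) <= 2 * C"
proof -
 have KN: "K < N" using K Mm N by simp
 define a where "a l = abs (diff2 f l)" for l
 define q where "q k = (if 1 <= k & k < N then a k / 2 else 0)" for k
 define u where "u k = (if k <= N then \<Sum>l\<in>{1..<N}. green N k l * a l else 0)" for k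
 define U where "U = (\<Sum>l\<in>{1..<N}. real l * (real N - real l) / real N * a l)"
 have a0: "0 <= a l" for l by (simp add: a_def)
 have U0: "0 <= U" unfolding U_def using a0 by (intro sum_nonneg mult_nonneg_nonneg) auto
 have u0: "u 0 = 0" by (auto simp: u_def green_def min_def intro!: sum.neutral)
 have uN: "u k = 0" if "N <= k" for k
  using that by (auto simp: u_def green_def min_def mult_le_0_iff intro!: sum.neutral)
 have un: "0 <= u k" for k
  unfolding u_def using a0 green_nonneg by (auto intro!: sum_nonneg mult_nonneg_nonneg)
 have uU: "u k <= U" for k
 proof (cases "k <= N")
  case True
  then show ?thesis unfolding u_def U_def by (simp only: if_True) (intro sum_mono mult_right_mono green_le a0; simp)
 next
  case False
  then show ?thesis using U0 by (simp add: u_def)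
 qed
 have UuK: "U <= real m * u K"
 proof -
  have "U <= (\<Sum>l\<in>{1..<N}. (real m * green N K l) * a l)"
   unfolding U_def by (intro sum_mono mult_right_mono green_lower[OF Mm N] a0) auto
  also have "... = real m * u K" using KN by (simp add: u_def sum_distrib_left mult.assoc)
  finally show ?thesis .
 qed
 have uq: "diff2 u k = - 2 * q k" if k: "1 <= k" "k < N" for k
 proof -
  have "diff2 u k = (\<Sum>l\<in>{1..<N}. diff2 (%k. green N k l) k * a l)"
   using k by (simp add: diff2_def u_def sum_distrib_left sum_subtractf[symmetric] sum.distrib[symmetric] algebra_simps)
  also have "... = (\<Sum>l\<in>{1..<N}. if l = k then - a k else 0)"
   using k by (intro sum.cong refl) (auto simp: green_diff2)
  also have "... = - 2 * q k" using k by (simp add: q_def)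
  finally show ?thesis .
 qed
 have q0: "0 <= q k" and qz: "k = 0 \<or> N <= k ==> q k = 0" for k using a0 by (auto simp: q_def)
 define Q where "Q J w = occupation d N q J w" for J w
 have E1: "(LINT w|M. Q J w) + (LINT w|M. alive d N J w * u (pos d J w)) = u K" for J
  unfolding Q_def by (rule occupation_expectation[OF K KN d, of u U q]) (use u0 uN un uU q0 uq qz in auto)
 have E2: "(LINT w|M. (Q J w)^2) + 2 * (LINT w|M. Q J w * (alive d N J w * u (pos d J w))) <= 2 * U * (LINT w|M. Q J w)" for J
  unfolding Q_def by (rule occupation_second_moment[OF K KN d, of u U q]) (use u0 uN un uU q0 uq qz in auto)
 obtain Cq where Cq: "!!k. q k <= Cq"
  using q_bounded[OF K KN d, of u U q] u0 uN un uU q0 uq qz by auto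
 have Qm: "Q J \<in> borel_measurable M" for J
  unfolding Q_def[abs_def] by (rule walk_sigma_M[OF occupation_measurable[OF K KN d]])
 have Qn: "0 <= Q J w" "Q J w <= real J * Cq" for J w
  unfolding Q_def using occupation_bounds[OF K KN d, of q Cq J w] q0 Cq by auto
 have al: "0 <= alive d N J w" "alive d N J w <= 1" for J w using alive_01[of d N J w] by auto
 have alm: "alive d N J \<in> borel_measurable M" for J
  by (rule walk_sigma_M[OF alive_measurable[OF K KN d order_refl]])
 have ial: "integrable M (alive d N J)" for J
  by (rule integrable_bounded[OF alm, of J 1]) (use al in auto)
 have iau: "integrable M (%w. alive d N J w * u (pos d J w))" for J
  using integrable_function_pos[OF K KN d, where G = "%_. 1" and C = 1 and phi = u and D = U and j = J] un uU by simp
 have iQ: "integrable M (Q J)" for J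
  by (rule integrable_bounded[OF Qm, of J "real J * Cq"]) (use Qn in auto)
 have iQ2: "integrable M (%w. (Q J w)^2)" for J
  by (rule integrable_bounded[where C = "(real J * Cq)^2"]) (use Qm Qn in \<open>auto intro!: power_mono\<close>)
 have EQle: "(LINT w|M. Q J w) <= u K" for J
 proof -
  have "0 <= (LINT w|M. alive d N J w * u (pos d J w))"
   using al un by (intro leb_integral_nonneg mult_nonneg_nonneg) auto
  then show ?thesis using E1[of J] by simp
 qed
 have EQge: "u K - U * (LINT w|M. alive d N J w) <= (LINT w|M. Q J w)" for J
 proof -
  have "(LINT w|M. alive d N J w * u (pos d J w)) <= (LINT w|M. alive d N J w * U)"
   using al uU ial by (intro integral_mono iau mult_left_mono) auto
  then show ?thesis using E1[of J] by (simp add: mult.commute)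
 qed
 have EQ2: "(LINT w|M. (Q J w)^2) <= 2 * U * u K" for J
 proof -
  have "0 <= (LINT w|M. Q J w * (alive d N J w * u (pos d J w)))"
   using al un Qn by (intro leb_integral_nonneg mult_nonneg_nonneg) auto
  moreover have "2 * U * (LINT w|M. Q J w) <= 2 * U * u K" using EQle U0 by (intro mult_left_mono) auto
  ultimately show ?thesis using E2[of J] by linarith
 qed
 have main: "u K / 2 <= C + U * (LINT w|M. alive d N J w)" for J
 proof (cases "U = 0")
  case True
  then have "u K = 0" using uU[of K] un[of K] by simp
  then show ?thesis using C[of 0] True by (simp add: occupation_def)
 next
  case False
  then have Upos: "0 < U" using U0 by simp
  have m0: "0 < real m" using Mm by simp
  define I :: "'a => real" where "I = indicator (space M - Gm)"
  have Im: "I \<in> borel_measurable M" using G(1) by (simp add: I_def)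
  have iI: "integrable M I" using Im by (intro integrable_bounded[where C = 1]) (auto simp: I_def split: split_indicator)
  have EI: "(LINT w|M. I w) = prob (space M - Gm)" unfolding I_def using G(1) by simp
  \<comment> \<open>From \<open>0 <= (Q - c/2)^2\<close> with \<open>c = 8 * m * U\<close>. The two
    losses are then at most \<open>u K / 4\<close> and \<open>u K / 8\<close>, which leaves more
    than half of \<open>u K\<close> for \<open>Gm\<close>.\<close>
  have young: "Q J w - I w * (2 * real m * U) - (Q J w)^2 / (8 * real m * U) <= indicator Gm w * Q J w"
   if "w \<in> space M" for w
  proof -
   define c where "c = 8 * real m * U"
   have c: "0 < c" using m0 Upos by (simp add: c_def)
   have "Q J w <= c / 4 + (Q J w)^2 / c"
   proof -
    have "Q J w * c <= c^2 / 4 + (Q J w)^2"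
     using zero_le_power2[of "Q J w - c / 2"] by (simp add: power2_diff power_divide)
    then show ?thesis using c by (simp add: field_simps power2_eq_square)
   qed
   moreover have "0 <= (Q J w)^2 / c" using c by simp
   moreover have "2 * real m * U = c / 4" by (simp add: c_def)
   ultimately show ?thesis
    using that unfolding I_def c_def[symmetric] by (auto split: split_indicator)
  qed
  have iL: "integrable M (%w. Q J w - I w * (2 * real m * U) - (Q J w)^2 / (8 * real m * U))"
   using iQ[of J] iI iQ2[of J] by (intro leb_integrable_diff integrable_mult_left integrable_divide_zero) auto
  have "(LINT w|M. Q J w) - prob (space M - Gm) * (2 * real m * U) - (LINT w|M. (Q J w)^2) / (8 * real m * U)
    = (LINT w|M. Q J w - I w * (2 * real m * U) - (Q J w)^2 / (8 * real m * U))"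
   using iQ[of J] iI iQ2[of J] EI by simp
  also have "... <= (LINT w|M. indicator Gm w * Q J w)"
   using G(1) iQ[of J] by (intro integral_mono iL young) (auto intro: integrable_mult_indicator[of Gm M "Q J", simplified])
  also have "... <= C" unfolding Q_def q_def[abs_def] a_def using C[of J] by simp
  finally have ineq: "(LINT w|M. Q J w) <= C + prob (space M - Gm) * (2 * real m * U) + (LINT w|M. (Q J w)^2) / (8 * real m * U)" by simp
  have t1: "prob (space M - Gm) * (2 * real m * U) <= u K / 4"
  proof -
   have "prob (space M - Gm) * (2 * real m * U) <= 1 / (8 * (real m)^2) * (2 * real m * (real m * u K))"
    using G(2) UuK m0 U0 by (intro mult_mono) auto
   also have "... = u K / 4" using m0 by (simp add: power2_eq_square field_simps)
   finally show ?thesis .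
  qed
  have t2: "(LINT w|M. (Q J w)^2) / (8 * real m * U) <= u K / 8"
  proof -
   have "(LINT w|M. (Q J w)^2) / (8 * real m * U) <= 2 * U * u K / (8 * real m * U)"
    using EQ2 m0 Upos by (intro divide_right_mono) auto
   also have "... = u K / (4 * real m)" using Upos by simp
   also have "... <= u K / 8" using un[of K] Mm by (intro divide_left_mono) auto
   finally show ?thesis .
  qed
  show ?thesis using ineq t1 t2 EQge[of J] un[of K] by linarith
 qed
 have "(%J. C + U * (LINT w|M. alive d N J w)) \<longlonglongrightarrow> C + U * 0"
  by (intro tendsto_intros alive_expectation_tendsto[OF K KN d])
 then have "u K / 2 <= C + U * 0"
  by (rule LIMSEQ_le_const) (use main in auto)
 then show ?thesis using KN by (simp add: u_def a_def)
qed

text \<open>Each step is \<open>d\<close> or \<open>- d\<close> and orthogonal to the past. On the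
  pattern so far, \<open>s J / d\<close> times the next step is twice the indicator of the longer
  pattern minus that of the shorter one, so the probability halves.\<close>

lemma walk_path_prob:
 assumes d: "0 < d" and s: "!!j. s j = 1 \<or> s j = (-1::real)"
 shows "{w\<in>space M. \<forall>j<J. walk d (Suc j) w - walk d j w = s j * d} \<in> sets (walk_sigma d J)"
  and "prob {w\<in>space M. \<forall>j<J. walk d (Suc j) w - walk d j w = s j * d} = (1/2)^J"
proof -
 define E where "E J = {w\<in>space M. \<forall>j<J. walk d (Suc j) w - walk d j w = s j * d}" for J
 have Em: "E J \<in> sets (walk_sigma d J)" for J
 proof -
  have "Measurable.pred (walk_sigma d J) (%w. j < J --> walk d (Suc j) w - walk d j w = s j * d)" for j
  proof (cases "j < J")
   case True
   then have [measurable]: "walk d (Suc j) \<in> borel_measurable (walk_sigma d J)"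
    "walk d j \<in> borel_measurable (walk_sigma d J)"
    by (intro walk_measurable; simp)+
   show ?thesis by measurable
  qed simp
  then have "Measurable.pred (walk_sigma d J) (%w. \<forall>j<J. walk d (Suc j) w - walk d j w = s j * d)"
   by (rule pred_intros_countable(1))
  from predE[OF this] show ?thesis unfolding E_def space_walk_sigma .
 qed
 show "{w\<in>space M. \<forall>j<J. walk d (Suc j) w - walk d j w = s j * d} \<in> sets (walk_sigma d J)"
  using Em[of J] unfolding E_def .
 have EM: "E J \<in> sets M" for J
  using Em[of J] subalgebra_walk_sigma by (auto simp: subalgebra_def)
 have "prob (E J) = (1/2)^J"
 proof (induction J)
  case 0
  show ?case by (simp add: E_def prob_space)
 next
  case (Suc J)
  let ?I = "indicator (E J) :: 'a => real"
  have orth: "(LINT w|M. (s J / d * ?I w) * (walk d (Suc J) w - walk d J w)) = 0"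
  proof (rule walk_orthogonal(2)[OF d])
   show "(%w. s J / d * ?I w) \<in> borel_measurable (walk_sigma d J)"
    using Em[of J] by (intro borel_measurable_times borel_measurable_indicator) auto
   show "abs (s J / d * ?I w) <= 1 / d" for w
    using d s[of J] by (auto simp: abs_mult split: split_indicator)
  qed
  have iE: "integrable M (indicator (E n) :: 'a => real)" for n
   using EM by (simp add: less_top[symmetric])
  have "AE w in M. (s J / d * ?I w) * (walk d (Suc J) w - walk d J w) = 2 * indicator (E (Suc J)) w - ?I w"
   using AE_hit_seq_finite[OF d] AE_space
  proof eventually_elim
   case (elim w)
   have step: "walk d (Suc J) w - walk d J w = d \<or> walk d (Suc J) w - walk d J w = - d"
    using walk_step(1)[OF d elim(2), of J] elim(1) by (auto simp: abs_if split: if_splits)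
   have ES: "w \<in> E (Suc J) \<longleftrightarrow> w \<in> E J & walk d (Suc J) w - walk d J w = s J * d"
    using elim(2) by (auto simp: E_def less_Suc_eq)
   show ?case
    using step s[of J] d by (cases "w \<in> E J") (auto simp: ES indicator_def)
  qed
  then have "(LINT w|M. (s J / d * ?I w) * (walk d (Suc J) w - walk d J w)) = (LINT w|M. 2 * indicator (E (Suc J)) w - ?I w)"
  proof (rule integral_cong_AE[rotated 2])
   show "(%w. (s J / d * ?I w) * (walk d (Suc J) w - walk d J w)) \<in> borel_measurable M"
    using EM[of J] by (intro borel_measurable_times borel_measurable_diff borel_measurable_indicator walk_M) auto
  qed (use EM in auto)
  also have "... = 2 * prob (E (Suc J)) - prob (E J)"
   using iE[of J] iE[of "Suc J"] EM by simp
  finally have "prob (E (Suc J)) = prob (E J) / 2" using orth by simp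
  then show ?case using Suc by simp
 qed
 then show "prob {w\<in>space M. \<forall>j<J. walk d (Suc j) w - walk d j w = s j * d} = (1/2)^J"
  by (simp add: E_def)
qed

text \<open>A pattern of positive probability meets every almost sure property, so an outcome with a
  prescribed walk can be picked.\<close>

lemma walk_path_exists:
 assumes d: "0 < d" and s: "!!j. s j = 1 \<or> s j = (-1::real)" and P: "AE w in M. P w"
 obtains w where "w \<in> space M" "P w" "!!j. hit_seq d j w < \<infinity>" "!!j. j <= J ==> walk d j w = x0 + (\<Sum>i<j. s i) * d"
proof -
 define E where "E = {w\<in>space M. \<forall>j<J. walk d (Suc j) w - walk d j w = s j * d}"
 have EM: "E \<in> sets M"
 proof (rule subsetD)
  show "E \<in> sets (walk_sigma d J)"
   unfolding E_def by (rule walk_path_prob(1)[where s = s, OF d s])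
  show "sets (walk_sigma d J) \<subseteq> sets M"
   using subalgebra_walk_sigma[of d J] by (simp only: subalgebra_def)
 qed
 have pE: "prob E = (1/2)^J" unfolding E_def by (rule walk_path_prob(2)[where s = s, OF d s])
 have "\<exists>w\<in>E. P w & (\<forall>j. hit_seq d j w < \<infinity>)"
 proof (rule ccontr)
  assume no: "\<not> (\<exists>w\<in>E. P w & (\<forall>j. hit_seq d j w < \<infinity>))"
  have "AE w in M. w \<notin> E"
   using P AE_hit_seq_finite[OF d] by eventually_elim (use no in blast)
  then have "prob E = 0" using EM by (simp add: prob_eq_0)
  then show False using pE by simp
 qed
 then obtain w where w: "w \<in> E" "P w" "\<forall>j. hit_seq d j w < \<infinity>" by blast
 have "j <= J ==> walk d j w = x0 + (\<Sum>i<j. s i) * d" for j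
 proof (induction j)
  case 0
  then show ?case using w(1) by (simp add: E_def walk_0)
 next
  case (Suc j)
  then have "j < J" by simp
  then have "walk d (Suc j) w - walk d j w = s j * d" using w(1) unfolding E_def by blast
  then show ?case using Suc by (simp add: algebra_simps)
 qed
 then show thesis using w that[of w] by (auto simp: E_def)
qed

lemma real_hit_seq:
 assumes d: "0 < d" and w: "w \<in> space M" and fin: "!!j. hit_seq d j w < \<infinity>"
 obtains h where "!!j. hit_seq d j w = ereal (h j)" "!!j. 0 <= h j" "!!j. h j < h (Suc j)" "!!j. walk d j w = B (h j) w" "h 0 = 0"
proof
 show *: "hit_seq d j w = ereal (real_of_ereal (hit_seq d j w))" for j
  using hit_seq_nonneg[of d j w] fin[of j] by (cases "hit_seq d j w") auto
 show "0 <= real_of_ereal (hit_seq d j w)" for j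
  using hit_seq_nonneg by (rule real_of_ereal_pos)
 show "real_of_ereal (hit_seq d j w) < real_of_ereal (hit_seq d (Suc j) w)" for j
  using walk_step(2)[OF d w fin, of j] *[of j] *[of "Suc j"] by (metis less_ereal.simps(1))
qed (auto simp: walk_def)

lemma B_near_walk:
 assumes d: "0 < d" and w: "w \<in> space M" and h: "!!j. hit_seq d j w = ereal (h j)" "h 0 = 0"
  and t: "0 <= t" "t < h J"
 obtains j where "j < J" "h j <= t" "t < h (Suc j)" "abs (B t w - walk d j w) < d"
proof -
 define k where "k = (LEAST k. t < h k)"
 have k: "t < h k" "k <= J" unfolding k_def using t LeastI[of "%k. t < h k" J] Least_le[of "%k. t < h k" J] by auto
 have "k \<noteq> 0" using k t h by (intro notI) auto
 then obtain j where j: "k = Suc j" by (cases k) auto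
 then have "h j <= t" using not_less_Least[of j "%k. t < h k"] by (simp add: k_def)
 moreover have "abs (B t w - walk d j w) < d"
  using walk_between(1)[OF d w t(1), of j] h k j \<open>h j <= t\<close> by simp
 ultimately show thesis using that[of j] k j by simp
qed

lemma stopped_hitting_time_before:
 assumes "!!s. 0 <= s ==> s < t ==> B s w \<noteq> 0"
 shows "ereal t <= H0 w" "SB t w = B t w"
proof -
 show *: "ereal t <= H0 w"
  unfolding hitting_time_def using assms by (intro Inf_greatest) (auto simp: not_less[symmetric])
 show "SB t w = B t w" by (rule stopped_before[where T = H0 and X = B, OF *])
qed

text \<open>One outcome with cadlag composition is driven above \<open>y\<close>, down below
  \<open>y\<close> without touching \<open>0\<close>, and up again. The down-crossing gives the left
  limit of \<open>g\<close> at \<open>y\<close> and the up-crossing the right limit.\<close>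

lemma cadlag_stopped_imp_continuous:
 assumes cad: "AE w in M. cadlag (%t. g (SB t w))"
 shows "continuous_on {0<..} g"
 unfolding continuous_on_eq_continuous_within
proof
 fix y :: real assume "y \<in> {0<..}"
 then have y: "0 < y" by simp
 obtain K where K: "x0 / y < real K" using reals_Archimedean2 by blast
 have K0: "0 < real K" using K x0_pos y by (smt (verit) divide_pos_pos)
 define d where "d = x0 / real K"
 have d: "0 < d" "d < y" using K0 K x0_pos y by (auto simp: d_def field_simps)
 have Kd: "x0 = real K * d" using K0 by (simp add: d_def)
 obtain a where a: "y / d < real a" using reals_Archimedean2 by blast
 have ad: "y < real a * d" using a d by (simp add: field_simps)
 define r where "r = K + a - 1"
 have K1: "1 <= K" using K0 by simp
 \<comment> \<open>The first \<open>a\<close> steps up reach \<open>x0 + a * d\<close>, which is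
   above \<open>y\<close>; the \<open>r\<close> steps down end at \<open>d\<close>, which is below
   \<open>y\<close> and still a full step above \<open>0\<close>; \<open>r\<close> steps up return
   above \<open>y\<close>.\<close>
 define s :: "nat => real" where "s j = (if a <= j & j < a + r then -1 else 1)" for j
 have s: "s j = 1 \<or> s j = -1" for j by (simp add: s_def)
 obtain w where w: "w \<in> space M" "cadlag (%t. g (SB t w))" "!!j. hit_seq d j w < \<infinity>"
  and wk: "!!j. j <= a + r + r ==> walk d j w = x0 + (\<Sum>i<j. s i) * d"
  by (rule walk_path_exists[where s = s and J = "a + r + r", OF d(1) s cad]) blast
 have S: "(\<Sum>i<j. s i) = (if j <= a then real j else if j <= a + r then 2 * real a - real j else real j - 2 * real r)" for j
 proof (induction j)
  case (Suc j)
  then show ?case by (auto simp: s_def)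
 qed simp
 obtain h where h: "!!j. hit_seq d j w = ereal (h j)" "!!j. 0 <= h j" "!!j. h j < h (Suc j)" "!!j. walk d j w = B (h j) w" "h 0 = 0"
  using real_hit_seq[OF d(1) w(1,3)] by blast
 have mono: "h i <= h j" if "i <= j" for i j by (rule lift_Suc_mono_le[of h, OF less_imp_le[OF h(3)] that])
 have wd: "d <= walk d j w" if "j <= a + r + r" for j
 proof -
  have "1 <= real K + (\<Sum>i<j. s i)"
   unfolding S using that K1 by (auto simp: r_def of_nat_diff)
  then have "1 * d <= (real K + (\<Sum>i<j. s i)) * d" using d by (intro mult_right_mono) auto
  then show ?thesis using wk[OF that] Kd by (simp add: algebra_simps)
 qed
 have Bpos: "0 < B t w" if t: "0 <= t" "t < h (a + r + r)" for t
 proof -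
  obtain j where "j < a + r + r" "abs (B t w - walk d j w) < d"
   using B_near_walk[OF d(1) w(1) h(1,5) t] by blast
  then show ?thesis using wd[of j] by simp
 qed
 have eq: "SB t w = B t w" if "t <= h (a + r + r)" for t
  using that Bpos by (intro stopped_hitting_time_before(2)) force
 have X: "((%t. g (B t w)) \<longlongrightarrow> g (B t w)) (at_right t)" if "0 <= t" "t < h (a + r + r)" for t
 proof -
  have "((%t. g (SB t w)) \<longlongrightarrow> g (SB t w)) (at_right t)"
   using w(2) that by (simp add: cadlag_def)
  then have "((%t. g (SB t w)) \<longlongrightarrow> g (B t w)) (at_right t)"
   using eq[of t] that by simp
  then show ?thesis
   by (rule Lim_transform_eventually)
    (use that eq in \<open>auto simp: eventually_at_right_field intro!: exI[of _ "h (a + r + r)"]\<close>)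
 qed
 have w1: "y < B (h a) w"
  using wk[of a] h(4)[of a] ad x0_pos by (simp add: S)
 have w2: "B (h (a + r)) w < y"
 proof -
  have "walk d (a + r) w = x0 + (real a - real r) * d" using wk[of "a + r"] by (cases "r = 0") (simp_all add: S)
  also have "... = d" using Kd K1 by (simp add: r_def of_nat_diff algebra_simps)
  finally show ?thesis using d h(4) by simp
 qed
 have w3: "y < B (h (a + r + r)) w"
 proof -
  have "walk d (a + r + r) w = x0 + real a * d" using wk[of "a + r + r"] by (cases "r = 0") (simp_all add: S)
  then show ?thesis using ad x0_pos h(4) by simp
 qed
 have cont: "continuous_on {h i..h j} (%t. B t w)" for i j
  using h(2)[of i] by (intro continuous_on_subset[OF B_continuous[OF w(1)]]) auto
 have "(g \<longlongrightarrow> g y) (at_left y)"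
  by (rule crossing_imp_left_continuous[where f = "%t. B t w" and g = g and y = y, OF _ cont[of a "a + r"]])
   (use mono[of a "a + r"] mono[of "a + r" "a + r + r"] w1 w2 h(2)[of a] in \<open>simp_all add: X\<close>)
 moreover have "(g \<longlongrightarrow> g y) (at_right y)"
  by (rule crossing_imp_right_continuous[where f = "%t. B t w" and g = g and y = y, OF _ cont[of "a + r" "a + r + r"]])
   (use mono[of "a + r" "a + r + r"] w2 w3 h(2)[of "a + r"] in \<open>simp_all add: X\<close>)
 ultimately have "isCont g y" by (simp add: isCont_def filterlim_split_at)
 then show "continuous (at y within {0<..}) g" by (rule continuous_at_imp_continuous_at_within)
qed

text \<open>With mesh \<open>x0\<close> a single step down takes the walk to \<open>0\<close>, and
  the path is positive until then.\<close>

lemma cadlag_stopped_imp_right_limit: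
 assumes cad: "AE w in M. cadlag (%t. g (SB t w))"
 shows "\<exists>l. (g \<longlongrightarrow> l) (at_right 0)"
proof -
 obtain w where w: "w \<in> space M" "cadlag (%t. g (SB t w))" "!!j. hit_seq x0 j w < \<infinity>"
  and wk: "!!j. j <= 1 ==> walk x0 j w = x0 + (\<Sum>i<j. (-1)) * x0"
  by (rule walk_path_exists[where s = "%_. -1" and J = 1, OF x0_pos _ cad]) auto
 obtain h where h: "!!j. hit_seq x0 j w = ereal (h j)" "!!j. 0 <= h j" "!!j. h j < h (Suc j)" "!!j. walk x0 j w = B (h j) w" "h 0 = 0"
  using real_hit_seq[OF x0_pos w(1,3)] by blast
 have Bpos: "0 < B t w" if t: "0 <= t" "t < h 1" for t
 proof -
  obtain j where "j < 1" "abs (B t w - walk x0 j w) < x0"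
   using B_near_walk[OF x0_pos w(1) h(1,5) t] by blast
  then show ?thesis using walk_0[OF w(1), of x0] by simp
 qed
 have h1: "0 < h 1" using h(3)[of 0] h(5) by simp
 obtain l where "((%t. g (SB t w)) \<longlongrightarrow> l) (at_left (h 1))"
  using w(2) h1 by (auto simp: cadlag_def)
 then have X: "((%t. g (B t w)) \<longlongrightarrow> l) (at_left (h 1))"
 proof (rule Lim_transform_eventually)
  have "SB t w = B t w" if "0 < t" "t < h 1" for t
   using that Bpos by (intro stopped_hitting_time_before(2)) force
  then show "\<forall>\<^sub>F t in at_left (h 1). g (SB t w) = g (B t w)"
   using h1 by (auto simp: eventually_at_left_field intro!: exI[of _ 0])
 qed
 have "(g \<longlongrightarrow> l) (at_right 0)"
 proof (rule hitting_imp_right_limit[where f = "%t. B t w" and g = g and a = 0 and b = "h 1"])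
  show "continuous_on {0..h 1} (%t. B t w)"
   by (intro continuous_on_subset[OF B_continuous[OF w(1)]]) auto
  show "B (h 1) w = 0" using wk[of 1] h(4)[of 1] by simp
 qed (use Bpos h1 X in auto)
 then show ?thesis by blast
qed

lemma cadlag_stopped_imp_bounded:
 assumes cad: "AE w in M. cadlag (%t. g (SB t w))"
 shows "\<exists>C. \<forall>x\<in>{0..b}. abs (g x) <= C"
proof -
 obtain l where l: "(g \<longlongrightarrow> l) (at_right 0)" using cadlag_stopped_imp_right_limit[OF cad] by blast
 then have "\<forall>\<^sub>F x in at_right 0. dist (g x) l < 1" by (rule tendstoD) simp
 then obtain c where c: "0 < c" "!!x. 0 < x ==> x < c ==> abs (g x - l) < 1"
  by (auto simp: eventually_at_right_field dist_real_def)
 have "bounded (g ` {c..b})"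
  using cadlag_stopped_imp_continuous[OF cad] c(1)
  by (intro compact_imp_bounded compact_continuous_image) (auto intro: continuous_on_subset)
 then obtain C where C: "\<forall>x\<in>{c..b}. abs (g x) <= C" by (auto simp: bounded_iff)
 show ?thesis
 proof (intro exI ballI)
  fix x assume x: "x \<in> {0..b}"
  consider "x = 0" | "0 < x" "x < c" | "c <= x" using x by fastforce
  then show "abs (g x) <= abs (g 0) + (abs l + 1) + abs C"
  proof cases
   case 2
   then show ?thesis using c(2)[OF 2] by linarith
  next
   case 3
   then have "abs (g x) <= C" using C x by auto
   then show ?thesis by linarith
  qed auto
 qed
qed

lemma hitting_time_0_stopping: "stopping_time_ext M F H0"
 using hit_zero_stopping_time[OF adapted_B B_continuous] by (simp add: hitting_time_def[abs_def])

lemma hitting_time_nonneg: "0 <= H0 w"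
 unfolding hitting_time_def by (intro Inf_greatest) auto

lemma stopped_0_measurable: "0 <= t ==> SB t \<in> borel_measurable (F t)"
 by (rule stopped_B_measurable[OF hitting_time_0_stopping])

lemma continuous_stopped_0: "w \<in> space M ==> continuous_on {0..} (%t. SB t w)"
 by (rule continuous_on_stopped[where X = B, OF B_continuous hitting_time_nonneg])

lemma hitting_time_attained:
 assumes w: "w \<in> space M" and t: "H0 w <= ereal t" "0 <= t"
 shows "SB t w = 0"
proof -
 obtain r where r: "H0 w = ereal r" "0 <= r"
  using t(1) hitting_time_nonneg[of w] by (cases "H0 w") auto
 then obtain u where u: "u \<in> {0..r}" "B u w = 0"
  using hit_zero_le_iff[where Y = B, OF B_continuous[OF w] r(2)] by (auto simp: hitting_time_def)
 have "H0 w <= ereal u" unfolding hitting_time_def using u by (intro Inf_lower) auto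
 then have "u = r" using r u by simp
 then show ?thesis using r u t by (simp add: stopped_def min_absorb2)
qed

lemma B_pos_before_hitting:
 assumes w: "w \<in> space M" and t: "ereal t < H0 w" "0 <= t"
 shows "0 < B t w"
proof (rule ccontr)
 assume "\<not> 0 < B t w"
 then obtain u where u: "0 <= u" "u <= t" "B u w = 0"
  using IVT2'[of "%t. B t w" t 0 0] t x0_pos B_0[OF w] continuous_on_subset[OF B_continuous[OF w], of "{0..t}"] by auto
 have "H0 w <= ereal u" unfolding hitting_time_def using u by (intro Inf_lower) auto
 also have "... <= ereal t" using u by simp
 finally show False using t by simp
qed

lemma stopped_0_nonneg: "w \<in> space M ==> 0 <= t ==> 0 <= SB t w"
 using hitting_time_attained[of w t] B_pos_before_hitting[of w t] stopped_before[of t H0 w B]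
 by (cases "H0 w <= ereal t") (auto simp: not_le)

end

section \<open>Occupation bound from the semimartingale decomposition\<close>

text \<open>Here \<open>m * x0\<close> is the upper end for the walk, \<open>2^p\<close> fixes its
  mesh, \<open>t0\<close> is a time horizon, \<open>T\<close> a localising time and
  \<open>Vb\<close> a bound for the sampled variation of \<open>A\<close>. The decomposition is
  available only before \<open>T\<close>.\<close>

locale walk_semimartingale = brownian +
 fixes g :: "real => real" and Kg Vb :: real and m p t0 :: nat and T :: "'a => ereal"
  and Y A :: "real => 'a => real"
 assumes m: "2 <= m"
  and g_measurable: "g \<in> borel_measurable borel"
  and g_continuous: "continuous_on {0<..} g"
  and g_bounded: "!!x. 0 <= x ==> x <= 2 * real m * x0 ==> abs (g x) <= Kg"
  and T: "stopping_time_ext M F T" and Y: "martingale M F Y" and A: "adapted F A"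
  and decomposition: "AE w in M. A 0 w = 0 &
   (\<forall>t\<ge>0. ereal t < T w --> g (SB t w) = g x0 + Y t w + A t w)"
  and Vb: "0 <= Vb"
begin

definition d :: real where "d = x0 / real (2^p)"
definition N :: nat where "N = m * 2^p"
definition b :: real where "b = real m * x0"
definition f :: "nat => real" where "f k = g (real k * d)"
definition q :: "nat => real" where "q k = (if 1 <= k & k < N then \<bar>diff2 f k\<bar> / 2 else 0)"
definition slope :: "nat => real" where
 "slope k = (if 1 <= k & k < N then (f (k + 1) - f (k - 1)) / (2 * d) else 0)"

text \<open>The process is capped beyond the interval \<open>(0,b)\<close> so that it is bounded.\<close>

definition X :: "real => 'a => real" where "X t w = g (min (SB t w) (2 * b))"

abbreviation idx :: "nat => nat => 'a => nat" where "idx r j \<equiv> grid_index (hit_seq d j) t0 r"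
abbreviation rho :: "nat => nat => 'a => real" where "rho r j \<equiv> grid_time (hit_seq d j) t0 r"
abbreviation W :: "nat => 'a => real" where "W j \<equiv> stopped (hit_seq d j) B (real t0)"
abbreviation s :: "nat => 'a => real" where "s j w \<equiv> real_of_ereal (min (ereal (real t0)) (hit_seq d j w))"

text \<open>The grid counterpart of \<open>alive\<close>. Every condition is known at the grid time
  of step \<open>j\<close>, which makes this a valid weight for optional stopping; the bound by
  \<open>2 * b\<close> at grid times ensures that the cap in \<open>X\<close> is not active.\<close>

definition live :: "nat => nat => 'a => bool" where
 "live r j w \<longleftrightarrow> idx r j w < t0 * 2^r & ereal (rho r j w) < T w &
  (\<forall>i\<le>j. 0 < W i w & W i w < b) & (\<forall>i\<le>j. B (rho r i w) w <= 2 * b) &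
  (\<Sum>i<j. abs (A (rho r (Suc i) w) w - A (rho r i w) w)) <= Vb"

abbreviation l :: "nat => nat => 'a => real" where "l r j w \<equiv> of_bool (live r j w)"

definition cell :: "nat => 'a => nat" where "cell j w = nat \<lfloor>W j w / d\<rfloor>"
definition sign :: "nat => nat => 'a => real" where "sign r j w = l r j w * sgn (diff2 f (cell j w))"

lemma d_gt_0: "0 < d"
 using x0_pos by (simp add: d_def)

lemma N_d: "real N * d = b"
 by (simp add: N_def d_def b_def)

lemma pN: "1 <= (2::nat)^p" "(2::nat)^p < N"
 using m by (auto simp: N_def)

lemma b_pos: "0 < b" "x0 <= b"
 using x0_pos m by (auto simp: b_def mult_le_cancel_right1)

lemma g_bounded_b: "0 <= x ==> x <= 2 * b ==> abs (g x) <= Kg"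
 using g_bounded[of x] by (simp add: b_def mult.assoc)

lemma Kg_nonneg: "0 <= Kg"
 using g_bounded_b[of 0] b_pos by (meson abs_ge_zero order_refl order_trans mult_nonneg_nonneg less_imp_le zero_le_numeral)

lemma f_bounded: "k <= N ==> abs (f k) <= Kg"
proof -
 assume "k <= N"
 then have "real k * d <= b" unfolding N_d[symmetric] using d_gt_0 by (intro mult_right_mono) auto
 then show ?thesis unfolding f_def using d_gt_0 b_pos by (intro g_bounded_b) auto
qed

lemma q_bounds: "0 <= q k" "q k <= 2 * Kg"
proof -
 show "0 <= q k" by (simp add: q_def)
 show "q k <= 2 * Kg"
  using f_bounded[of "k + 1"] f_bounded[of k] f_bounded[of "k - 1"] Kg_nonneg
  by (auto simp: q_def diff2_def) linarith
qed

lemma slope_bound: "abs (slope k) <= Kg / d"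
proof -
 have "abs (f (k + 1) - f (k - 1)) <= 2 * Kg" if "1 <= k" "k < N"
  using f_bounded[of "k + 1"] f_bounded[of "k - 1"] that by linarith
 then have "abs (f (k + 1) - f (k - 1)) / (2 * d) <= 2 * Kg / (2 * d)" if "1 <= k" "k < N"
  using that d_gt_0 by (intro divide_right_mono) auto
 then show ?thesis using d_gt_0 Kg_nonneg by (auto simp: slope_def abs_divide abs_mult)
qed

lemma X_bounded: "w \<in> space M ==> 0 <= t ==> abs (X t w) <= Kg"
 unfolding X_def using stopped_0_nonneg[of w t] b_pos by (intro g_bounded_b) auto

lemma X_adapted: "adapted F X"
 unfolding adapted_def X_def[abs_def]
proof (intro allI impI)
 fix t :: real assume t: "0 <= t"
 have [measurable]: "SB t \<in> borel_measurable (F t)" by (rule stopped_0_measurable[OF t])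
 have [measurable]: "g \<in> borel_measurable borel" by (rule g_measurable)
 show "(%w. g (min (SB t w) (2 * b))) \<in> borel_measurable (F t)" by measurable
qed

text \<open>Right continuity survives a jump of \<open>g\<close> at \<open>0\<close>, since the
  stopped path is constant from the hitting time on. This is why times are approximated from
  above.\<close>

lemma X_right_continuous:
 assumes w: "w \<in> space M" and u: "u \<longlonglongrightarrow> t" "!!n. t <= u n" "0 <= t"
 shows "(%n. X (u n) w) \<longlonglongrightarrow> X t w"
proof (cases "H0 w <= ereal t")
 case True
 then have "X (u n) w = X t w" for n
  unfolding X_def using stopped_const[of H0, OF True u(2)] by simp
 then show ?thesis by simp
next
 case False
 let ?S = "%t. SB t w"
 have "?S t = B t w" using False by (intro stopped_before) simp
 then have pos: "0 < min (?S t) (2 * b)" using B_pos_before_hitting[OF w, of t] False u(3) b_pos by simp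
 have "(%n. ?S (u n)) \<longlonglongrightarrow> ?S t"
  by (rule continuous_on_tendsto_compose[OF continuous_stopped_0[OF w] u(1)])
   (use u order_trans[OF u(3) u(2)] in auto)
 then have "(%n. min (?S (u n)) (2 * b)) \<longlonglongrightarrow> min (?S t) (2 * b)" by (intro tendsto_min tendsto_const)
 moreover have "isCont g (min (?S t) (2 * b))"
  using g_continuous pos by (simp add: continuous_on_eq_continuous_at)
 ultimately show ?thesis unfolding X_def by (intro isCont_tendsto_compose[where g = g])
qed

lemma rho_ge: "s j w <= rho r j w"
 using grid_time_ge[of t0 "hit_seq d j" w r] real_min_ereal(1)[OF hit_seq_nonneg, of "real t0" d j w]
 by (metis ereal_less_eq(3) of_nat_0_le_iff)

lemma s_nonneg: "0 <= s j w"
 by (rule real_min_ereal(2)[OF hit_seq_nonneg]) simp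

lemma X_rho_tendsto:
 assumes w: "w \<in> space M"
 shows "(%r. X (rho r j w) w) \<longlonglongrightarrow> X (s j w) w"
 by (rule X_right_continuous[OF w grid_time_tendsto[of "hit_seq d j", OF hit_seq_nonneg] rho_ge s_nonneg])

lemma grid_stop_idx: "grid_stop r (t0 * 2^r) (idx r j)"
 by (rule grid_stop_grid_index[OF hit_seq_stopping_time])

lemma idx_mono:
 assumes w: "w \<in> space M" and ij: "i <= j"
 shows "idx r i w <= idx r j w"
 using grid_index_le_iff[of "hit_seq d j" t0 r w "idx r j w"] hit_seq_mono[OF d_gt_0 w ij]
 by (auto simp: grid_index_le_iff[of "hit_seq d i"] intro: order_trans)

lemma rho_mono: "w \<in> space M ==> i <= j ==> rho r i w <= rho r j w"
 using idx_mono by (simp add: grid_time_def divide_right_mono)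

lemma rho_0: "rho r 0 w = 0"
 using grid_index_le_iff[of "hit_seq d 0" t0 r w 0] by (simp add: grid_time_def zero_ereal_def[symmetric])

lemma measurable_grid_sigma_mono:
 fixes xi :: "'a => real"
 assumes ij: "i <= j" and xi: "xi \<in> borel_measurable (grid_sigma r (idx r i))"
 shows "xi \<in> borel_measurable (grid_sigma r (idx r j))"
 by (rule measurable_from_subalg[OF grid_sigma_mono[OF grid_stop_idx grid_stop_idx] xi]) (rule idx_mono[OF _ ij])

lemma grid_sigma_adapted:
 assumes ij: "i <= j" and Z: "adapted F Z"
 shows "(%w. Z (rho r i w) w) \<in> borel_measurable (grid_sigma r (idx r j))"
 unfolding grid_time_def
 by (rule measurable_grid_sigma_mono[OF ij measurable_grid_sigma_adapted[OF grid_stop_idx Z]])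

lemma W_grid_sigma: "i <= j ==> W i \<in> borel_measurable (grid_sigma r (idx r j))"
 by (rule measurable_grid_sigma_mono[OF _
    stopped_measurable_grid_sigma[OF adapted_B B_continuous hit_seq_stopping_time hit_seq_stopping_time order_refl]])

lemma live_grid_sigma: "l r j \<in> borel_measurable (grid_sigma r (idx r j))"
proof -
 let ?G = "grid_sigma r (idx r j)"
 define i1 :: "'a => real" where "i1 w = (if idx r j w < t0 * 2^r then 1 else 0)" for w
 define i2 :: "'a => real" where "i2 w = (if ereal (rho r j w) < T w then 1 else 0)" for w
 have i1: "i1 \<in> borel_measurable ?G"
  by (rule measurable_grid_sigmaI[OF grid_stop_idx, where f' = "%k _. if k < t0 * 2^r then 1 else 0"])
   (auto simp: i1_def)
 have i2: "i2 \<in> borel_measurable ?G"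
 proof (rule measurable_grid_sigmaI[OF grid_stop_idx])
  fix k :: nat
  have [measurable]: "Measurable.pred (F (real k / 2^r)) (%w. T w <= ereal (real k / 2^r))"
   using T by (simp add: stopping_time_ext_def)
  show "(%w. if T w <= ereal (real k / 2^r) then 0 else 1 :: real) \<in> borel_measurable (F (real k / 2^r))"
   by measurable
 qed (auto simp: i2_def grid_time_def)
 have p1: "Measurable.pred ?G (%w. i1 w = 1)" "Measurable.pred ?G (%w. i2 w = 1)"
  using i1 i2 by measurable
 have p2: "Measurable.pred ?G (%w. \<forall>i\<le>j. 0 < W i w & W i w < b)"
 proof (rule pred_intros_countable(1))
  fix i
  show "Measurable.pred ?G (%w. i <= j --> 0 < W i w & W i w < b)"
  proof (cases "i <= j")
   case True
   have [measurable]: "W i \<in> borel_measurable ?G" by (rule W_grid_sigma[OF True])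
   show ?thesis by measurable
  qed simp
 qed
 have p3: "Measurable.pred ?G (%w. \<forall>i\<le>j. B (rho r i w) w <= 2 * b)"
 proof (rule pred_intros_countable(1))
  fix i
  show "Measurable.pred ?G (%w. i <= j --> B (rho r i w) w <= 2 * b)"
  proof (cases "i <= j")
   case True
   have [measurable]: "(%w. B (rho r i w) w) \<in> borel_measurable ?G" by (rule grid_sigma_adapted[OF True adapted_B])
   show ?thesis by measurable
  qed simp
 qed
 have sm: "(%w. \<Sum>i<j. abs (A (rho r (Suc i) w) w - A (rho r i w) w)) \<in> borel_measurable ?G"
  by (intro borel_measurable_sum borel_measurable_abs borel_measurable_diff grid_sigma_adapted A) auto
 have p4: "Measurable.pred ?G (%w. (\<Sum>i<j. abs (A (rho r (Suc i) w) w - A (rho r i w) w)) <= Vb)"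
  using sm by measurable
 have "live r j = (%w. i1 w = 1 & i2 w = 1 & (\<forall>i\<le>j. 0 < W i w & W i w < b) &
   (\<forall>i\<le>j. B (rho r i w) w <= 2 * b) & (\<Sum>i<j. abs (A (rho r (Suc i) w) w - A (rho r i w) w)) <= Vb)"
  by (auto simp: live_def i1_def i2_def fun_eq_iff)
 then have "Measurable.pred ?G (live r j)"
  by (simp only:) (intro pred_intros_logic(3) p1 p2 p3 p4)
 then show ?thesis unfolding of_bool_def by (intro measurable_If borel_measurable_const predE)
qed

declare hit_seq.simps(1) [simp del]

lemma live_Suc: "w \<in> space M ==> live r (Suc j) w ==> live r j w"
proof -
 assume w: "w \<in> space M" and lv: "live r (Suc j) w"
 have "idx r j w <= idx r (Suc j) w" by (rule idx_mono[OF w]) simp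
 moreover have "ereal (rho r j w) <= ereal (rho r (Suc j) w)" using rho_mono[OF w, of j "Suc j" r] by simp
 moreover have "(\<Sum>i<j. abs (A (rho r (Suc i) w) w - A (rho r i w) w)) <= (\<Sum>i<Suc j. abs (A (rho r (Suc i) w) w - A (rho r i w) w))"
  by simp
 moreover have "idx r (Suc j) w < t0 * 2^r" "ereal (rho r (Suc j) w) < T w"
  "\<forall>i\<le>Suc j. 0 < W i w & W i w < b" "\<forall>i\<le>Suc j. B (rho r i w) w <= 2 * b"
  "(\<Sum>i<Suc j. abs (A (rho r (Suc i) w) w - A (rho r i w) w)) <= Vb"
  using lv unfolding live_def by blast+
 ultimately show ?thesis
  unfolding live_def by (meson le_less_trans order_trans le_SucI)
qed

lemma l_diff: "w \<in> space M ==> 0 <= l r j w - l r (Suc j) w" "w \<in> space M ==> l r j w - l r (Suc j) w <= 1"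
 using live_Suc[of w r j] by auto

lemma abs_A_rho_le:
 assumes "A 0 w = 0"
 shows "abs (A (rho r j w) w) <= (\<Sum>i<j. abs (A (rho r (Suc i) w) w - A (rho r i w) w))"
 by (induction j) (use assms in \<open>auto simp: rho_0\<close>)

lemma sum_live_variation:
 assumes w: "w \<in> space M"
 shows "(\<Sum>j<J. l r (Suc j) w * abs (A (rho r (Suc j) w) w - A (rho r j w) w)) <= Vb"
proof (induction J)
 case (Suc J)
 show ?case
 proof (cases "live r (Suc J) w")
  case True
  have "(\<Sum>j<Suc J. l r (Suc j) w * abs (A (rho r (Suc j) w) w - A (rho r j w) w))
    <= (\<Sum>j<Suc J. abs (A (rho r (Suc j) w) w - A (rho r j w) w))"
   by (intro sum_mono) auto
  also have "... <= Vb" using True by (simp add: live_def)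
  finally show ?thesis .
 next
  case False
  then show ?thesis using Suc by simp
 qed
qed (use Vb in simp)

lemma sum_l_diff:
 assumes w: "w \<in> space M"
 shows "(\<Sum>j<J. l r j w - l r (Suc j) w) <= 1"
proof -
 have "(\<Sum>j<J. l r j w - l r (Suc j) w) = l r 0 w - l r J w"
  by (induction J) simp_all
 moreover have "l r 0 w <= 1" "0 <= l r J w" by simp_all
 ultimately show ?thesis by linarith
qed

lemma X_eq_before:
 assumes w: "w \<in> space M" and t: "0 <= t" "B t w <= 2 * b"
 shows "X t w = g (SB t w)"
proof -
 have "SB t w <= 2 * b"
  using hitting_time_attained[OF w, of t] stopped_before[of t H0 w B] t b_pos
  by (cases "H0 w <= ereal t") (auto simp: not_le)
 then show ?thesis by (simp add: X_def min_absorb1)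
qed

text \<open>On the last live step only the crude bound is available; there the increment of the martingale is kept.\<close>

lemma remainder_bound:
 "AE w in M. \<forall>j. sign r j w * ((X (rho r (Suc j) w) w - X (rho r j w) w) - (Y (rho r (Suc j) w) w - Y (rho r j w) w))
  <= l r (Suc j) w * abs (A (rho r (Suc j) w) w - A (rho r j w) w)
   + (l r j w - l r (Suc j) w) * (4 * Kg + Vb + abs (Y (rho r (Suc j) w) w))"
 using decomposition AE_space
proof eventually_elim
 case (elim w)
 note w = elim(2)
 have A0: "A 0 w = 0" using elim by simp
 have dec: "X (rho r j w) w = g x0 + Y (rho r j w) w + A (rho r j w) w" if "live r j w" for j
 proof -
  have "X (rho r j w) w = g (SB (rho r j w) w)"
   using that by (intro X_eq_before[OF w] grid_time_nonneg) (auto simp: live_def)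
  then show ?thesis using elim(1) that grid_time_nonneg by (auto simp: live_def)
 qed
 show ?case
 proof
  fix j
  let ?D = "(X (rho r (Suc j) w) w - X (rho r j w) w) - (Y (rho r (Suc j) w) w - Y (rho r j w) w)"
  have sg: "sign r j w * ?D <= l r j w * abs (?D)"
   by (auto simp: sign_def sgn_if)
  consider "\<not> live r j w" | "live r j w" "live r (Suc j) w" | "live r j w" "\<not> live r (Suc j) w" by blast
  then show "sign r j w * ?D <= l r (Suc j) w * abs (A (rho r (Suc j) w) w - A (rho r j w) w)
   + (l r j w - l r (Suc j) w) * (4 * Kg + Vb + abs (Y (rho r (Suc j) w) w))"
  proof cases
   case 1
   then have "\<not> live r (Suc j) w" using live_Suc[OF w] by blast
   then show ?thesis using 1 sg by simp
  next
   case 2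
   then have "?D = A (rho r (Suc j) w) w - A (rho r j w) w" using dec by simp
   then show ?thesis using 2 sg by simp
  next
   case 3
   have "abs (A (rho r j w) w) <= Vb" using abs_A_rho_le[OF A0, where r = r and j = j] 3(1) by (simp add: live_def)
   moreover have "abs (g x0) <= Kg" using b_pos x0_pos by (intro g_bounded_b) auto
   moreover have "abs (X (rho r j w) w) <= Kg" "abs (X (rho r (Suc j) w) w) <= Kg"
    by (intro X_bounded[OF w] grid_time_nonneg)+
   ultimately have "abs (?D) <= 4 * Kg + Vb + abs (Y (rho r (Suc j) w) w)"
    using dec[OF 3(1)] by linarith
   then show ?thesis using 3 sg by simp
  qed
 qed
qed

lemma sign_bound: "abs (sign r j w) <= 1"
 by (simp add: sign_def sgn_if)

lemma cell_function_grid_sigma: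
 fixes phi :: "nat => real"
 shows "(%w. phi (cell j w)) \<in> borel_measurable (grid_sigma r (idx r j))"
proof -
 have [measurable]: "W j \<in> borel_measurable (grid_sigma r (idx r j))" by (rule W_grid_sigma) simp
 show ?thesis unfolding cell_def by measurable
qed

lemma sign_grid_sigma: "sign r j \<in> borel_measurable (grid_sigma r (idx r j))"
 unfolding sign_def[abs_def] by (intro borel_measurable_times live_grid_sigma cell_function_grid_sigma)

lemma grid_sigma_M: "xi \<in> borel_measurable (grid_sigma r (idx r j)) ==> xi \<in> borel_measurable M"
 for xi :: "'a => real"
 by (rule measurable_grid_sigmaD(1)[OF grid_stop_idx])

lemma X_rho_measurable: "(%w. X (rho r j w) w) \<in> borel_measurable M"
 by (rule grid_sigma_M[OF grid_sigma_adapted[OF order_refl X_adapted]])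

text \<open>One \<open>Vb\<close> covers the variation over the steps that stay live;
  \<open>4 * Kg + Vb\<close> and the expected size of \<open>Y\<close> cover the single step on
  which \<open>live\<close> ends.\<close>

definition C1 :: real where "C1 = 4 * Kg + 2 * Vb + (LINT w|M. abs (Y (real t0) w))"

text \<open>The increments of \<open>Y\<close> have mean zero against \<open>sign\<close>, so only
  the remainder counts. On the random last live step \<open>Y\<close> is compared with its value at
  the horizon through the submartingale inequality, with weights that add up to at most 1.\<close>

lemma expectation_sum_le_C1:
 "(LINT w|M. (\<Sum>j<J. sign r j w * (X (rho r (Suc j) w) w - X (rho r j w) w))) <= C1"
proof -
 let ?dX = "%j w. X (rho r (Suc j) w) w - X (rho r j w) w"
 let ?dY = "%j w. Y (rho r (Suc j) w) w - Y (rho r j w) w"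
 have o: "integrable M (%w. sign r j w * ?dY j w)" "(LINT w|M. sign r j w * ?dY j w) = 0" for j
  unfolding grid_time_def
  by (rule grid_optional_stopping[OF Y grid_stop_idx grid_stop_idx idx_mono[OF _ le_SucI[OF order_refl]] sign_grid_sigma sign_bound]; assumption)+
 have iX: "integrable M (%w. sign r j w * ?dX j w)" for j
 proof (rule integrable_bounded)
  show "(%w. sign r j w * ?dX j w) \<in> borel_measurable M"
   by (intro borel_measurable_times borel_measurable_diff X_rho_measurable grid_sigma_M[OF sign_grid_sigma])
  fix w assume w: "w \<in> space M"
  have "abs (?dX j w) <= 2 * Kg"
   using X_bounded[OF w, of "rho r (Suc j) w"] X_bounded[OF w, of "rho r j w"] by (simp add: grid_time_nonneg)
  then show "abs (sign r j w * ?dX j w) <= 1 * (2 * Kg)"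
   unfolding abs_mult by (intro mult_mono sign_bound) auto
 qed
 \<comment> \<open>The indicator that \<open>j\<close> is the last live step, known only at the grid
   time of \<open>Suc j\<close>; the value \<open>0\<close> off the space gives bounds for every
   \<open>w\<close>.\<close>
 define xi where "xi j w = (if w \<in> space M then l r j w - l r (Suc j) w else 0)" for j w
 have xim: "xi j \<in> borel_measurable (grid_sigma r (idx r (Suc j)))" for j
 proof -
  have "(%w. l r j w - l r (Suc j) w) \<in> borel_measurable (grid_sigma r (idx r (Suc j)))"
   by (intro borel_measurable_diff live_grid_sigma measurable_grid_sigma_mono[OF _ live_grid_sigma]) simp
  then show ?thesis by (rule measurable_cong[THEN iffD1, rotated]) (simp add: xi_def)
 qed
 have xi01: "0 <= xi j w & xi j w <= 1" for j w using l_diff[of w r j] by (simp add: xi_def)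
 have iY: "integrable M (%w. xi j w * abs (Y (rho r (Suc j) w) w))"
  and EY: "(LINT w|M. xi j w * abs (Y (rho r (Suc j) w) w)) <= (LINT w|M. xi j w * abs (Y (real t0) w))" for j
  using grid_stopped_abs_le[OF Y grid_stop_idx[of r "Suc j"] xim, of 1] xi01 by (simp_all add: grid_time_def)
 have iYt: "integrable M (Y (real t0))" using Y by (simp add: martingale_def)
 have ixiY: "integrable M (%w. xi j w * abs (Y (real t0) w))" for j
  by (rule integrable_bounded_mult[where C = 1]) (use iYt grid_sigma_M[OF xim] xi01 in auto)
 have "(LINT w|M. (\<Sum>j<J. sign r j w * ?dX j w)) = (LINT w|M. (\<Sum>j<J. sign r j w * (?dX j w - ?dY j w)))"
 proof -
  have "(LINT w|M. sign r j w * (?dX j w - ?dY j w)) = (LINT w|M. sign r j w * ?dX j w)" for j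
   using iX[of j] o[of j] by (simp only: right_diff_distrib[of "sign r j _" "?dX j _" "?dY j _"]) simp
  moreover have "integrable M (%w. sign r j w * (?dX j w - ?dY j w))" for j
   using iX[of j] o(1)[of j] by (simp only: right_diff_distrib[of "sign r j _" "?dX j _" "?dY j _"]) simp
  ultimately show ?thesis using iX by (simp add: leb_integral_sum)
 qed
 also have "... <= (LINT w|M. 4 * Kg + 2 * Vb + (\<Sum>j<J. xi j w * abs (Y (rho r (Suc j) w) w)))"
 proof (rule integral_mono_AE)
  show "integrable M (%w. \<Sum>j<J. sign r j w * (?dX j w - ?dY j w))"
  proof (rule leb_integrable_sum)
   fix j
   have "(%w. sign r j w * (?dX j w - ?dY j w)) = (%w. sign r j w * ?dX j w - sign r j w * ?dY j w)"
    by (simp add: fun_eq_iff right_diff_distrib)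
   then show "integrable M (%w. sign r j w * (?dX j w - ?dY j w))"
    by (simp only:) (rule leb_integrable_diff[OF iX o(1)])
  qed
  show "integrable M (%w. 4 * Kg + 2 * Vb + (\<Sum>j<J. xi j w * abs (Y (rho r (Suc j) w) w)))"
   using iY by (intro leb_integrable_add leb_integrable_sum) auto
  show "AE w in M. (\<Sum>j<J. sign r j w * (?dX j w - ?dY j w))
    <= 4 * Kg + 2 * Vb + (\<Sum>j<J. xi j w * abs (Y (rho r (Suc j) w) w))"
   using remainder_bound[of r] AE_space
  proof eventually_elim
   case (elim w)
   note w = elim(2)
   have "(\<Sum>j<J. sign r j w * (?dX j w - ?dY j w))
     <= (\<Sum>j<J. l r (Suc j) w * abs (A (rho r (Suc j) w) w - A (rho r j w) w)
      + (l r j w - l r (Suc j) w) * (4 * Kg + Vb + abs (Y (rho r (Suc j) w) w)))"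
    using elim(1) by (intro sum_mono) blast
   also have "... = (\<Sum>j<J. l r (Suc j) w * abs (A (rho r (Suc j) w) w - A (rho r j w) w))
     + (4 * Kg + Vb) * (\<Sum>j<J. l r j w - l r (Suc j) w)
     + (\<Sum>j<J. xi j w * abs (Y (rho r (Suc j) w) w))"
   proof -
    have "l r (Suc j) w * abs (A (rho r (Suc j) w) w - A (rho r j w) w)
      + (l r j w - l r (Suc j) w) * (4 * Kg + Vb + abs (Y (rho r (Suc j) w) w))
     = l r (Suc j) w * abs (A (rho r (Suc j) w) w - A (rho r j w) w)
      + (4 * Kg + Vb) * (l r j w - l r (Suc j) w) + xi j w * abs (Y (rho r (Suc j) w) w)" for j
     using w by (simp add: xi_def algebra_simps)
    then show ?thesis by (simp only: sum.distrib sum_distrib_left)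
   qed
   also have "... <= Vb + (4 * Kg + Vb) * 1 + (\<Sum>j<J. xi j w * abs (Y (rho r (Suc j) w) w))"
    using sum_live_variation[OF w] sum_l_diff[OF w] Kg_nonneg Vb
    by (intro add_mono mult_left_mono) auto
   finally show ?case by simp
  qed
 qed
 also have "... = 4 * Kg + 2 * Vb + (\<Sum>j<J. LINT w|M. xi j w * abs (Y (rho r (Suc j) w) w))"
  using iY by (simp add: leb_integral_sum prob_space)
 also have "... <= 4 * Kg + 2 * Vb + (\<Sum>j<J. LINT w|M. xi j w * abs (Y (real t0) w))"
  using EY by (intro add_left_mono sum_mono)
 also have "(\<Sum>j<J. LINT w|M. xi j w * abs (Y (real t0) w)) = (LINT w|M. (\<Sum>j<J. xi j w * abs (Y (real t0) w)))"
  using ixiY by (simp add: leb_integral_sum)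
 also have "... <= (LINT w|M. abs (Y (real t0) w))"
 proof (rule integral_mono)
  show "integrable M (%w. \<Sum>j<J. xi j w * abs (Y (real t0) w))" using ixiY by (intro leb_integrable_sum)
  fix w assume w: "w \<in> space M"
  have "(\<Sum>j<J. xi j w * abs (Y (real t0) w)) = (\<Sum>j<J. xi j w) * abs (Y (real t0) w)" by (simp add: sum_distrib_right)
  also have "... <= 1 * abs (Y (real t0) w)"
   using sum_l_diff[OF w, where J = J and r = r] w by (intro mult_right_mono) (simp_all add: xi_def)
  finally show "(\<Sum>j<J. xi j w * abs (Y (real t0) w)) <= abs (Y (real t0) w)" by simp
 qed (use iYt in simp)
 finally show ?thesis by (simp add: C1_def)
qed

lemma live_props:
 assumes w: "w \<in> space M" and lv: "live r j w"
 shows "hit_seq d j w <= ereal (rho r j w)" "rho r j w < real t0" "i <= j ==> W i w = walk d i w"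
  "ereal (s j w) = hit_seq d j w" "s j w < real t0" "alive d N j w = 1"
proof -
 have i: "idx r j w < t0 * 2^r" using lv by (simp add: live_def)
 then show le: "hit_seq d j w <= ereal (rho r j w)"
  using grid_index_le_iff[of "hit_seq d j" t0 r w "idx r j w"] by (simp add: grid_time_def)
 have "real (idx r j w) < real t0 * 2^r" using i by (simp flip: of_nat_less_iff[where 'a = real])
 then show lt: "rho r j w < real t0" by (simp add: grid_time_def divide_less_eq)
 have "ereal (rho r j w) <= ereal (real t0)" using lt by simp
 with le have jt: "hit_seq d j w <= ereal (real t0)" by (rule order_trans)
 show Ww: "W i w = walk d i w" if "i <= j" for i
  by (rule stopped_hit_seq[OF order_trans[OF hit_seq_mono[OF d_gt_0 w that] jt]])
 show "ereal (s j w) = hit_seq d j w"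
  using real_min_ereal(1)[OF hit_seq_nonneg, of "real t0" d j w] jt by (simp add: min_absorb2)
 then have "ereal (s j w) <= ereal (rho r j w)" using le by simp
 then show "s j w < real t0" using lt by simp
 show "alive d N j w = 1"
  using lv Ww unfolding alive_def N_d by (auto simp: live_def)
qed

lemma cell_live:
 assumes w: "w \<in> space M" and lv: "live r j w"
 shows "cell j w = pos d j w"
 using live_props(3)[OF assms order_refl] by (simp add: cell_def pos_def)

text \<open>Until the next step is completed the path stays within \<open>d\<close> of walk
  positions that are at least \<open>d\<close>.\<close>

lemma B_pos_alive:
 assumes w: "w \<in> space M" and fin: "!!j. hit_seq d j w < \<infinity>" and al: "alive d N j w = 1"
  and t: "0 <= t" "ereal t < hit_seq d (Suc j) w"
 shows "0 < B t w"
proof -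
 obtain h where h: "!!j. hit_seq d j w = ereal (h j)" "!!j. 0 <= h j" "!!j. h j < h (Suc j)" "!!j. walk d j w = B (h j) w" "h 0 = 0"
  using real_hit_seq[OF d_gt_0 w fin] by blast
 obtain i where i: "i < Suc j" "abs (B t w - walk d i w) < d"
  using B_near_walk[OF d_gt_0 w h(1,5) t(1), of "Suc j"] t(2) h(1) by auto
 have ai: "alive d N i w = 1" using al i(1) by (auto simp: alive_def split: if_splits)
 have "walk d i w = real (pos d i w) * d" "1 <= pos d i w"
  by (rule alive_pos[OF pN d_def w fin ai])+
 then have "1 * d <= walk d i w" using d_gt_0 by (simp add: mult_right_mono)
 then show ?thesis using i(2) by simp
qed

lemma W_eq: "W j w = B (s j w) w"
 by (simp add: stopped_def)

text \<open>Up to the end of a live step \<open>0\<close> is not reached before that end, and the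
  walk moves by at most \<open>d <= b\<close>; so neither stopping nor the cap changes the
  value.\<close>

lemma X_s_Suc:
 assumes w: "w \<in> space M" and fin: "!!j. hit_seq d j w < \<infinity>" and lv: "live r j w"
 shows "X (s (Suc j) w) w = g (W (Suc j) w)" "X (s j w) w = g (W j w)"
proof -
 have al: "alive d N j w = 1" by (rule live_props(6)[OF w lv])
 have sS: "ereal (s (Suc j) w) <= hit_seq d (Suc j) w"
  using real_min_ereal(1)[OF hit_seq_nonneg, of "real t0" d "Suc j" w] by simp
 have pos: "0 < B u w" if "0 <= u" "u < s (Suc j) w" for u
 proof (rule B_pos_alive[OF w fin al that(1)])
  have "ereal u < ereal (s (Suc j) w)" using that by simp
  then show "ereal u < hit_seq d (Suc j) w" using sS by (rule less_le_trans)
 qed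
 have le: "s j w <= s (Suc j) w"
 proof -
  have "min (ereal (real t0)) (hit_seq d j w) <= min (ereal (real t0)) (hit_seq d (Suc j) w)"
   by (rule min.mono[OF order_refl hit_seq_mono_Suc[OF d_gt_0 w]])
  then show ?thesis
   using real_min_ereal(1)[OF hit_seq_nonneg, of "real t0" d _ w] by (metis ereal_less_eq(3) of_nat_0_le_iff)
 qed
 have st: "SB u w = B u w" if "u <= s (Suc j) w" for u
  using that pos by (intro stopped_hitting_time_before(2)) force
 have Wj: "W j w < b" using lv by (simp add: live_def)
 have "abs (W (Suc j) w - W j w) <= d" by (rule stopped_hit_seq_distance[OF d_gt_0 w]) simp
 moreover have "d <= b" using N_d pN d_gt_0 by (metis One_nat_def Suc_leI le_trans less_imp_le mult_le_cancel_right1 of_nat_1 of_nat_le_iff not_less)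
 ultimately have "W (Suc j) w <= 2 * b" using Wj by linarith
 then show "X (s (Suc j) w) w = g (W (Suc j) w)" "X (s j w) w = g (W j w)"
  using Wj b_pos st[OF order_refl] st[OF le] by (simp_all add: X_def W_eq min_absorb1)
qed

text \<open>On a completed step this is an exact discrete Ito expansion multiplied by the sign of
  the second difference. A step cut off by the horizon ends \<open>live\<close> and is charged
  \<open>5 * Kg\<close>: \<open>2 * Kg\<close> for \<open>q\<close>, \<open>Kg\<close> for the
  gradient term and \<open>2 * Kg\<close> for the increment of \<open>X\<close>.\<close>

lemma step_lower_bound:
 assumes w: "w \<in> space M" and fin: "!!j. hit_seq d j w < \<infinity>"
 shows "l r j w * q (cell j w) + sign r j w * slope (cell j w) * (W (Suc j) w - W j w)
   - 5 * Kg * (l r j w - l r (Suc j) w) <= sign r j w * (X (s (Suc j) w) w - X (s j w) w)"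
proof (cases "live r j w")
 case False
 then show ?thesis using live_Suc[OF w, of r j] by (auto simp: sign_def)
next
 case lv: True
 have dd: "d = x0 / real (2 ^ p)" by (rule d_def)
 define k where "k = cell j w"
 have k: "walk d j w = real k * d" "1 <= k" "k < N"
  using alive_pos(1-3)[OF pN dd w fin live_props(6)[OF w lv]] by (simp_all add: k_def cell_live[OF w lv])
 have Wj: "W j w = real k * d" using live_props(3)[OF w lv order_refl] k by simp
 note X = X_s_Suc[OF w fin lv]
 define sgm where "sgm = sgn (diff2 f k)"
 have sgm: "sign r j w = sgm" "sgm * diff2 f k = abs (diff2 f k)" "abs sgm <= 1"
  using lv by (auto simp: sign_def sgm_def k_def sgn_if)
 have qk: "q k = abs (diff2 f k) / 2" and sk: "slope k = (f (k + 1) - f (k - 1)) / (2 * d)"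
  using k by (simp_all add: q_def slope_def)
 show ?thesis
 proof (cases "hit_seq d (Suc j) w <= ereal (real t0)")
  case True
  have "walk d (Suc j) w = real (pos d (Suc j) w) * d" "pos d (Suc j) w = k + 1 \<or> pos d (Suc j) w = k - 1"
   using alive_pos(4,5)[OF pN dd w fin live_props(6)[OF w lv]] by (simp_all add: k_def cell_live[OF w lv])
  then obtain k' where k': "W (Suc j) w = real k' * d" "k' = k + 1 \<or> k' = k - 1"
   using stopped_hit_seq[OF True] by metis
  have gk: "g (W j w) = f k" "g (W (Suc j) w) = f k'" using Wj k' by (simp_all add: f_def)
  have e: "f k' - f k = diff2 f k / 2 + slope k * (real k' * d - real k * d)"
   using k' k d_gt_0 by (auto simp: sk diff2_def of_nat_diff field_simps)
  have "sgm * (f k' - f k) = (sgm * diff2 f k) / 2 + sgm * slope k * (real k' * d - real k * d)"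
   unfolding e by (simp add: algebra_simps)
  then have "sgm * (f k' - f k) = q k + sgm * slope k * (W (Suc j) w - W j w)"
   unfolding sgm(2) by (simp only: k'(1) Wj qk)
  moreover have "0 <= 5 * Kg * (l r j w - l r (Suc j) w)" using Kg_nonneg l_diff[OF w] by (intro mult_nonneg_nonneg) auto
  ultimately show ?thesis using lv by (simp add: X gk sgm(1) k_def[symmetric])
 next
  case False
  have nl: "\<not> live r (Suc j) w"
  proof
   assume "live r (Suc j) w"
   from live_props(1,2)[OF w this] have "hit_seq d (Suc j) w <= ereal (real t0)"
    by (meson ereal_less_eq(3) less_imp_le order_trans)
   then show False using False by simp
  qed
  have "abs (sign r j w * (X (s (Suc j) w) w - X (s j w) w)) <= 1 * (2 * Kg)"
   unfolding abs_mult using X_bounded[OF w s_nonneg[where j = "Suc j" and w = w]] X_bounded[OF w s_nonneg[where j = j and w = w]]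
   by (intro mult_mono sign_bound) auto
  moreover have "abs (sign r j w * slope (cell j w) * (W (Suc j) w - W j w)) <= 1 * (Kg / d) * d"
   unfolding abs_mult using d_gt_0 Kg_nonneg
   by (intro mult_mono sign_bound slope_bound stopped_hit_seq_distance[OF d_gt_0 w]) auto
  moreover have "q (cell j w) <= 2 * Kg" by (rule q_bounds)
  ultimately show ?thesis using lv nl d_gt_0 by (simp add: abs_le_iff)
 qed
qed

lemma X_s_measurable: "(%w. X (s j w) w) \<in> borel_measurable M"
 by (rule borel_measurable_LIMSEQ_real[OF X_rho_tendsto X_rho_measurable])

lemma X_discretisation_error:
 shows "integrable M (%w. abs (X (rho r j w) w - X (s j w) w))"
  and "(%r. LINT w|M. abs (X (rho r j w) w - X (s j w) w)) \<longlonglongrightarrow> 0"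
proof -
 let ?D = "%r w. abs (X (rho r j w) w - X (s j w) w)"
 have D: "?D r \<in> borel_measurable M" for r
  by (intro borel_measurable_abs borel_measurable_diff X_rho_measurable X_s_measurable)
 have le: "?D r w <= 2 * Kg" if "w \<in> space M" for r w
  using X_bounded[OF that grid_time_nonneg[of "hit_seq d j" t0 r w]] X_bounded[OF that s_nonneg[where j = j and w = w]]
  by linarith
 show "integrable M (?D r)" by (rule integrable_bounded[OF D, of r "2 * Kg"]) (use le in simp)
 have "(%r. LINT w|M. ?D r w) \<longlonglongrightarrow> (LINT w|M. 0)"
 proof (rule integral_dominated_convergence[where w = "%_. 2 * Kg"])
  show "AE w in M. (%r. ?D r w) \<longlonglongrightarrow> 0"
  proof (rule AE_I2)
   fix w assume "w \<in> space M"
   from X_rho_tendsto[OF this, of j]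
   have "(%r. ?D r w) \<longlonglongrightarrow> abs (X (s j w) w - X (s j w) w)" by (intro tendsto_rabs tendsto_diff tendsto_const)
   then show "(%r. ?D r w) \<longlonglongrightarrow> 0" by simp
  qed
  show "AE w in M. norm (?D r w) <= 2 * Kg" for r using le by (intro AE_I2) simp
 qed (use D in auto)
 then show "(%r. LINT w|M. ?D r w) \<longlonglongrightarrow> 0" by simp
qed

text \<open>The cost of replacing exact times by grid times, at both ends of each increment of
  \<open>X\<close> and in the gradient term; it vanishes as \<open>r\<close> grows with mesh and
  \<open>J\<close> fixed.\<close>

definition err :: "nat => nat => real" where
 "err J r = (\<Sum>j<J. (LINT w|M. abs (X (rho r (Suc j) w) w - X (s (Suc j) w) w))
   + (LINT w|M. abs (X (rho r j w) w - X (s j w) w)) + 2 * (Kg / d) * sqrt (1 / 2^r))"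

lemma err_tendsto: "(%r. err J r) \<longlonglongrightarrow> 0"
proof -
 have "(%r. 1 / 2^r :: real) \<longlonglongrightarrow> 0"
  using LIMSEQ_power_zero[of "1/2::real"] by (simp add: power_one_over)
 from tendsto_real_sqrt[OF this]
 have "(%r. sqrt (1 / 2^r)) \<longlonglongrightarrow> 0" by simp
 then have "(%r. err J r) \<longlonglongrightarrow> (\<Sum>j<J. 0 + 0 + 2 * (Kg / d) * 0)"
  unfolding err_def by (intro tendsto_sum tendsto_add tendsto_mult tendsto_const X_discretisation_error(2))
 then show ?thesis by simp
qed

text \<open>Summing the pathwise lower bounds: the gradient terms have mean zero up to the optional
  stopping error, the increments of \<open>X\<close> contribute at most \<open>C1\<close>, and
  \<open>live\<close> ends at most once.\<close>

lemma live_occupation_bound: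
 "integrable M (%w. \<Sum>j<J. l r j w * q (cell j w))"
 "(LINT w|M. (\<Sum>j<J. l r j w * q (cell j w))) <= C1 + 5 * Kg + err J r"
proof -
 define P where "P j w = l r j w * q (cell j w)" for j w
 define R where "R j w = sign r j w * slope (cell j w) * (W (Suc j) w - W j w)" for j w
 define U where "U j w = sign r j w * (X (rho r (Suc j) w) w - X (rho r j w) w)" for j w
 define E1 where "E1 j w = abs (X (rho r j w) w - X (s j w) w)" for j w
 have iP: "integrable M (P j)" for j
 proof (rule integrable_bounded)
  show "P j \<in> borel_measurable M"
   unfolding P_def[abs_def]
   by (intro borel_measurable_times grid_sigma_M[OF live_grid_sigma] grid_sigma_M[OF cell_function_grid_sigma])
  show "abs (P j w) <= 2 * Kg" for w
   using q_bounds[of "cell j w"] Kg_nonneg by (auto simp: P_def)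
 qed
 then show iPS: "integrable M (%w. \<Sum>j<J. l r j w * q (cell j w))"
  unfolding P_def by (intro leb_integrable_sum)
 have Wm: "W j \<in> borel_measurable M" for j by (rule stopped_B_measurable'[OF hit_seq_stopping_time]) simp
 have xib: "abs (sign r j w * slope (cell j w)) <= 1 * (Kg / d)" for j w
  unfolding abs_mult by (intro mult_mono sign_bound slope_bound) auto
 have iR: "integrable M (R j)" for j
 proof (rule integrable_bounded)
  show "R j \<in> borel_measurable M"
   unfolding R_def[abs_def]
   by (intro borel_measurable_times borel_measurable_diff Wm grid_sigma_M[OF sign_grid_sigma] grid_sigma_M[OF cell_function_grid_sigma])
  fix w assume w: "w \<in> space M"
  show "abs (R j w) <= 1 * (Kg / d) * d"
   unfolding R_def abs_mult[of "_ * _"] using xib Kg_nonneg d_gt_0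
   by (intro mult_mono stopped_hit_seq_distance[OF d_gt_0 w]) auto
 qed
 have ER: "abs (LINT w|M. R j w) <= 2 * (1 * (Kg / d)) * sqrt (1 / 2^r)" for j
  unfolding R_def
 proof (rule stopped_B_optional_stopping[OF hit_seq_stopping_time hit_seq_stopping_time])
  show "hit_seq d j w <= hit_seq d (Suc j) w" if "w \<in> space M" for w
   using that by (rule hit_seq_mono_Suc[OF d_gt_0])
  show "(%w. sign r j w * slope (cell j w)) \<in> borel_measurable (grid_sigma r (idx r j))"
   by (intro borel_measurable_times sign_grid_sigma cell_function_grid_sigma)
  show "abs (sign r j w * slope (cell j w)) <= 1 * (Kg / d)" for w by (rule xib)
 qed
 have iU: "integrable M (U j)" for j
 proof (rule integrable_bounded)
  show "U j \<in> borel_measurable M"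
   unfolding U_def[abs_def]
   by (intro borel_measurable_times borel_measurable_diff X_rho_measurable grid_sigma_M[OF sign_grid_sigma])
  fix w assume w: "w \<in> space M"
  have "abs (X (rho r (Suc j) w) w - X (rho r j w) w) <= 2 * Kg"
   using X_bounded[OF w, of "rho r (Suc j) w"] X_bounded[OF w, of "rho r j w"] by (simp add: grid_time_nonneg)
  then show "abs (U j w) <= 1 * (2 * Kg)"
   unfolding U_def abs_mult by (intro mult_mono sign_bound) auto
 qed
 have iE: "integrable M (E1 j)" for j unfolding E1_def by (rule X_discretisation_error(1))
 have "(LINT w|M. (\<Sum>j<J. P j w)) <= (LINT w|M. 5 * Kg + (\<Sum>j<J. U j w) + (\<Sum>j<J. E1 (Suc j) w + E1 j w) - (\<Sum>j<J. R j w))"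
 proof (rule integral_mono_AE)
  show "integrable M (%w. \<Sum>j<J. P j w)" using iP by (intro leb_integrable_sum)
  show "integrable M (%w. 5 * Kg + (\<Sum>j<J. U j w) + (\<Sum>j<J. E1 (Suc j) w + E1 j w) - (\<Sum>j<J. R j w))"
   by (intro leb_integrable_diff leb_integrable_add leb_integrable_sum iU iE iR) simp
  show "AE w in M. (\<Sum>j<J. P j w) <= 5 * Kg + (\<Sum>j<J. U j w) + (\<Sum>j<J. E1 (Suc j) w + E1 j w) - (\<Sum>j<J. R j w)"
   using AE_hit_seq_finite[OF d_gt_0] AE_space
  proof eventually_elim
   case (elim w)
   note w = elim(2)
   have "P j w <= 5 * Kg * (l r j w - l r (Suc j) w) + U j w + (E1 (Suc j) w + E1 j w) - R j w" for j
   proof -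
    let ?a = "X (rho r (Suc j) w) w - X (rho r j w) w" and ?b = "X (s (Suc j) w) w - X (s j w) w"
    have "sign r j w * (?b - ?a) <= abs (sign r j w) * abs (?b - ?a)" by (metis abs_ge_self abs_mult)
    also have "... <= 1 * abs (?b - ?a)" by (intro mult_right_mono sign_bound) simp
    also have "... <= E1 (Suc j) w + E1 j w" unfolding E1_def by (smt (verit))
    finally have "sign r j w * ?b <= U j w + (E1 (Suc j) w + E1 j w)"
     by (simp add: U_def right_diff_distrib)
    then show ?thesis
     using step_lower_bound[OF w, of r j] elim(1) unfolding P_def R_def by simp
   qed
   then have "(\<Sum>j<J. P j w) <= (\<Sum>j<J. 5 * Kg * (l r j w - l r (Suc j) w) + U j w + (E1 (Suc j) w + E1 j w) - R j w)"
    by (intro sum_mono)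
   also have "... = 5 * Kg * (\<Sum>j<J. l r j w - l r (Suc j) w) + (\<Sum>j<J. U j w) + (\<Sum>j<J. E1 (Suc j) w + E1 j w) - (\<Sum>j<J. R j w)"
    by (simp only: sum.distrib sum_subtractf sum_distrib_left right_diff_distrib)
   also have "... <= 5 * Kg * 1 + (\<Sum>j<J. U j w) + (\<Sum>j<J. E1 (Suc j) w + E1 j w) - (\<Sum>j<J. R j w)"
    using sum_l_diff[OF w, where J = J and r = r] Kg_nonneg
    by (intro add_right_mono diff_right_mono mult_left_mono) auto
   finally show ?case by simp
  qed
 qed
 also have "... = 5 * Kg + (LINT w|M. (\<Sum>j<J. U j w))
   + (\<Sum>j<J. (LINT w|M. E1 (Suc j) w) + (LINT w|M. E1 j w)) - (\<Sum>j<J. LINT w|M. R j w)"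
  using iU iE iR by (simp add: leb_integral_sum prob_space)
 also have "... <= 5 * Kg + C1 + (\<Sum>j<J. (LINT w|M. E1 (Suc j) w) + (LINT w|M. E1 j w)) + (\<Sum>j<J. 2 * (Kg / d) * sqrt (1 / 2^r))"
 proof -
  have "(LINT w|M. (\<Sum>j<J. U j w)) <= C1" unfolding U_def by (rule expectation_sum_le_C1)
  moreover have "(\<Sum>j<J. - (LINT w|M. R j w)) <= (\<Sum>j<J. 2 * (Kg / d) * sqrt (1 / 2^r))"
  proof (rule sum_mono)
   show "- (LINT w|M. R j w) <= 2 * (Kg / d) * sqrt (1 / 2^r)" for j using ER[of j] by linarith
  qed
  ultimately show ?thesis by (simp add: sum_negf)
 qed
 also have "... = C1 + 5 * Kg + err J r"
  unfolding err_def E1_def by (simp only: sum.distrib)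
 finally show "(LINT w|M. (\<Sum>j<J. l r j w * q (cell j w))) <= C1 + 5 * Kg + err J r"
  by (simp add: P_def)
qed

text \<open>The grid times of successive steps are increasing grid points, so the triangle
  inequality refines them to the full grid.\<close>

lemma variation_grid_le:
 assumes w: "w \<in> space M"
  and V: "(\<Sum>k<t0 * 2^r. abs (A (real (Suc k) / 2^r) w - A (real k / 2^r) w)) <= Vb"
 shows "(\<Sum>i<j. abs (A (rho r (Suc i) w) w - A (rho r i w) w)) <= Vb"
proof -
 let ?a = "%k. A (real k / 2^r) w"
 have "(\<Sum>i<j. abs (?a (idx r (Suc i) w) - ?a (idx r i w))) <= (\<Sum>k<idx r j w. abs (?a (Suc k) - ?a k))"
 proof (induction j)
  case (Suc j)
  have le: "idx r j w <= idx r (Suc j) w" by (rule idx_mono[OF w]) simp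
  have "abs (?a (idx r (Suc j) w) - ?a (idx r j w)) = abs (\<Sum>k\<in>{idx r j w..<idx r (Suc j) w}. ?a (Suc k) - ?a k)"
   using sum_Suc_diff'[OF le, of ?a] by simp
  also have "... <= (\<Sum>k\<in>{idx r j w..<idx r (Suc j) w}. abs (?a (Suc k) - ?a k))" by (rule sum_abs)
  finally have "(\<Sum>i<Suc j. abs (?a (idx r (Suc i) w) - ?a (idx r i w)))
   <= (\<Sum>k<idx r j w. abs (?a (Suc k) - ?a k)) + (\<Sum>k\<in>{idx r j w..<idx r (Suc j) w}. abs (?a (Suc k) - ?a k))"
   using Suc by simp
  also have "... = (\<Sum>k<idx r (Suc j) w. abs (?a (Suc k) - ?a k))"
   using le by (simp add: lessThan_atLeast0 sum.atLeastLessThan_concat)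
  finally show ?case .
 qed simp
 also have "... <= (\<Sum>k<t0 * 2^r. abs (?a (Suc k) - ?a k))"
  using grid_index_le[of "hit_seq d j" t0 r w] by (intro sum_mono2) auto
 also have "... <= Vb" by (rule V)
 finally show ?thesis by (simp add: grid_time_def)
qed

text \<open>The path leaves the interval before \<open>t0\<close>, so a step at which the walk is
  still alive was reached strictly before \<open>t0\<close>. The other conditions are implied by the
  event or are finitely many strict inequalities in the limit, hence hold on fine grids.\<close>

lemma alive_eventually_live:
 assumes w: "w \<in> space M" and fin: "!!j. hit_seq d j w < \<infinity>" and al: "alive d N j w = 1"
  and T0: "ereal (real t0) < T w"
  and V: "!!r. (\<Sum>k<t0 * 2^r. abs (A (real (Suc k) / 2^r) w - A (real k / 2^r) w)) <= Vb"
  and ex: "0 <= t" "t < real t0" "b < abs (B t w)"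
 shows "\<forall>\<^sub>F r in sequentially. live r j w" "cell j w = pos d j w"
proof -
 obtain h where h: "!!j. hit_seq d j w = ereal (h j)" "!!j. 0 <= h j" "!!j. h j < h (Suc j)" "!!j. walk d j w = B (h j) w" "h 0 = 0"
  using real_hit_seq[OF d_gt_0 w fin] by blast
 have hj: "h j <= t"
 proof (rule ccontr)
  assume "\<not> h j <= t"
  then obtain i where i: "i < j" "abs (B t w - walk d i w) < d"
   using B_near_walk[OF d_gt_0 w h(1,5) ex(1), of j] by auto
  have ai: "alive d N i w = 1" using al i(1) by (auto simp: alive_def split: if_splits)
  have wk: "walk d i w = real (pos d i w) * d" "1 <= pos d i w" "pos d i w < N"
   by (rule alive_pos[OF pN d_def w fin ai])+
  have "1 * d <= walk d i w" unfolding wk(1) using wk(2) d_gt_0 by (intro mult_right_mono) auto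
  moreover have "real (pos d i w + 1) * d <= b"
   unfolding N_d[symmetric] using wk(3) d_gt_0 by (intro mult_right_mono) auto
  then have "walk d i w + d <= b" unfolding wk(1) by (simp add: algebra_simps)
  ultimately have "abs (B t w) <= b" using i(2) by linarith
  then show False using ex(3) by simp
 qed
 have hi: "h i <= h j" if "i <= j" for i by (rule lift_Suc_mono_le[of h, OF less_imp_le[OF h(3)] that])
 have Ww: "W i w = walk d i w" if "i <= j" for i
  using hi[OF that] hj ex(2) h(1) by (intro stopped_hit_seq) simp
 then show "cell j w = pos d j w" by (simp add: cell_def pos_def)
 have Wb: "0 < W i w & W i w < b" if "i <= j" for i
  using al that Ww[OF that] unfolding alive_def N_d by (auto split: if_splits)
 have sj: "s j w = h j" using hj ex(2) h(1) by (simp add: min_def)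
 have "(%r. rho r j w) \<longlonglongrightarrow> s j w" by (rule grid_time_tendsto[of "hit_seq d j", OF hit_seq_nonneg])
 then have e1: "\<forall>\<^sub>F r in sequentially. rho r j w < real t0"
  by (rule order_tendstoD) (use sj hj ex(2) in simp)
 have e2: "\<forall>\<^sub>F r in sequentially. \<forall>i\<in>{..j}. B (rho r i w) w < 2 * b"
 proof (rule eventually_ball_finite[OF _ ballI])
  fix i assume "i \<in> {..j}"
  then have "W i w < 2 * b" using Wb[of i] b_pos by auto
  then show "\<forall>\<^sub>F r in sequentially. B (rho r i w) w < 2 * b"
   by (rule order_tendstoD(2)[OF B_grid_tendsto[OF hit_seq_stopping_time w]])
 qed simp
 show "\<forall>\<^sub>F r in sequentially. live r j w"
  using e1 e2
 proof eventually_elim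
  case (elim r)
  have "real (idx r j w) < real t0 * 2^r" using elim(1) by (simp add: grid_time_def divide_less_eq)
  then have "idx r j w < t0 * 2^r" by (simp flip: of_nat_less_iff[where 'a = real])
  moreover have "ereal (rho r j w) < T w" using elim(1) T0 by (meson ereal_less_eq(3) le_less_trans less_imp_le)
  moreover have "\<forall>i\<le>j. B (rho r i w) w <= 2 * b" using elim(2) by (auto intro: less_imp_le)
  ultimately show ?case unfolding live_def using Wb variation_grid_le[OF w V] by blast
 qed
qed

text \<open>Letting \<open>r\<close> tend to infinity replaces \<open>live\<close> by
  \<open>alive\<close> on \<open>Gm\<close>. The bound depends neither on the mesh nor on
  \<open>J\<close>.\<close>

lemma occupation_bound:
 assumes Gm: "Gm \<in> sets M"
  and G: "!!w. w \<in> Gm ==> ereal (real t0) < T w"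
   "!!w r. w \<in> Gm ==> (\<Sum>k<t0 * 2^r. abs (A (real (Suc k) / 2^r) w - A (real k / 2^r) w)) <= Vb"
   "!!w. w \<in> Gm ==> \<exists>t\<ge>0. t < real t0 & b < abs (B t w)"
 shows "(LINT w|M. indicator Gm w * occupation d N q J w) <= C1 + 5 * Kg"
proof -
 define Z where "Z r w = indicator Gm w * (\<Sum>j<J. alive d N j w * (l r j w * q (cell j w)))" for r w
 have al: "0 <= alive d N j w" "alive d N j w <= 1" for j w using alive_01[of d N j w] by auto
 have t0: "0 <= l r j w * q (cell j w)" "l r j w * q (cell j w) <= 2 * Kg" for r j w
  using q_bounds[of "cell j w"] Kg_nonneg by auto
 have t1: "0 <= alive d N j w * (l r j w * q (cell j w))"
  "alive d N j w * (l r j w * q (cell j w)) <= l r j w * q (cell j w)" for r j w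
  by (rule mult_nonneg_nonneg[OF al(1) t0(1)], rule mult_left_le_one_le[OF t0(1) al])
 have alm: "alive d N j \<in> borel_measurable M" for j
  by (rule walk_sigma_M[OF alive_measurable[OF pN d_def order_refl]])
 have lm: "(%w. l r j w * q (cell j w)) \<in> borel_measurable M" for r j
  by (intro borel_measurable_times grid_sigma_M[OF live_grid_sigma] grid_sigma_M[OF cell_function_grid_sigma])
 have Zm: "Z r \<in> borel_measurable M" for r
  unfolding Z_def[abs_def]
  by (intro borel_measurable_times borel_measurable_indicator Gm borel_measurable_sum alm lm)
 have Z_le: "Z r w <= (\<Sum>j<J. l r j w * q (cell j w))" "0 <= Z r w" for r w
 proof -
  have "(\<Sum>j<J. alive d N j w * (l r j w * q (cell j w))) <= (\<Sum>j<J. l r j w * q (cell j w))"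
   by (intro sum_mono t1)
  moreover have "0 <= (\<Sum>j<J. l r j w * q (cell j w))" by (intro sum_nonneg t0)
  moreover have "0 <= (\<Sum>j<J. alive d N j w * (l r j w * q (cell j w)))" by (intro sum_nonneg t1)
  ultimately show "Z r w <= (\<Sum>j<J. l r j w * q (cell j w))" "0 <= Z r w"
   by (simp_all add: Z_def split: split_indicator)
 qed
 have Zb: "Z r w <= real J * (2 * Kg)" for r w
 proof -
  have "(\<Sum>j<J. l r j w * q (cell j w)) <= (\<Sum>j<J. 2 * Kg)" by (intro sum_mono t0)
  then show ?thesis using Z_le(1)[of r w] by simp
 qed
 have EZ: "(LINT w|M. Z r w) <= C1 + 5 * Kg + err J r" for r
 proof -
  have "(LINT w|M. Z r w) <= (LINT w|M. (\<Sum>j<J. l r j w * q (cell j w)))"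
  proof (rule integral_mono[OF _ live_occupation_bound(1)])
   show "integrable M (Z r)" by (rule integrable_bounded[OF Zm, of r "real J * (2 * Kg)"]) (use Z_le(2) Zb in auto)
  qed (rule Z_le)
  also note live_occupation_bound(2)
  finally show ?thesis .
 qed
 have om: "(%w. indicator Gm w * occupation d N q J w) \<in> borel_measurable M"
  by (intro borel_measurable_times borel_measurable_indicator Gm walk_sigma_M[OF occupation_measurable[OF pN d_def]])
 have lim: "AE w in M. (%r. Z r w) \<longlonglongrightarrow> indicator Gm w * occupation d N q J w"
  using AE_hit_seq_finite[OF d_gt_0] AE_space
 proof eventually_elim
  case (elim w)
  show ?case
  proof (cases "w \<in> Gm")
   case False
   then show ?thesis by (simp add: Z_def)
  next
   case True
   obtain t where t: "0 <= t" "t < real t0" "b < abs (B t w)" using G(3)[OF True] by blast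
   have "(%r. alive d N j w * (l r j w * q (cell j w))) \<longlonglongrightarrow> alive d N j w * q (pos d j w)" for j
   proof (cases "alive d N j w = 1")
    case a: True
    note ev = alive_eventually_live[OF elim(2) _ a G(1)[OF True] G(2)[OF True] t]
    have "\<forall>\<^sub>F r in sequentially. alive d N j w * q (pos d j w) = alive d N j w * (l r j w * q (cell j w))"
     using ev(1) ev(2) elim(1) by (auto elim!: eventually_mono)
    then show ?thesis by (rule Lim_transform_eventually[OF tendsto_const])
   next
    case False
    then have "alive d N j w = 0" using alive_01 by blast
    then show ?thesis by simp
   qed
   then show ?thesis unfolding Z_def occupation_def by (rule tendsto_mult[OF tendsto_const tendsto_sum])
  qed
 qed
 have "(%r. LINT w|M. Z r w) \<longlonglongrightarrow> (LINT w|M. indicator Gm w * occupation d N q J w)"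
  by (rule integral_dominated_convergence[where w = "%_. real J * (2 * Kg)"])
   (use om Zm lim Z_le(2) Zb in auto)
 moreover have "(%r. C1 + 5 * Kg + err J r) \<longlonglongrightarrow> C1 + 5 * Kg + 0"
  by (intro tendsto_add tendsto_const err_tendsto)
 ultimately have "(LINT w|M. indicator Gm w * occupation d N q J w) <= C1 + 5 * Kg + 0"
  by (rule LIMSEQ_le) (use EZ in auto)
 then show ?thesis by simp
qed

end

section \<open>From the semimartingale property to the lattice bound\<close>

lemma cadlag_cong:
 assumes eq: "!!t. 0 <= t ==> f t = h t" and f: "cadlag f"
 shows "cadlag h"
 unfolding cadlag_def
proof (intro conjI allI impI)
 fix t :: real assume t: "0 <= t"
 have "\<forall>\<^sub>F s in at_right t. f s = h s"
  using eventually_at_right_less[of t] by eventually_elim (use t eq in auto)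
 moreover have "(f \<longlongrightarrow> h t) (at_right t)" using f t unfolding cadlag_def eq[OF t, symmetric] by blast
 ultimately show "(h \<longlongrightarrow> h t) (at_right t)" by (rule Lim_transform_eventually[rotated])
next
 fix t :: real assume t: "0 < t"
 have "\<forall>\<^sub>F s in at_left t. f s = h s"
  using t eq by (auto simp: eventually_at_left_field intro!: exI[of _ 0])
 moreover from f t obtain l where "(f \<longlongrightarrow> l) (at_left t)" by (auto simp: cadlag_def)
 ultimately have "(h \<longlongrightarrow> l) (at_left t)" by (rule Lim_transform_eventually[rotated])
 then show "\<exists>l. (h \<longlongrightarrow> l) (at_left t)" ..
qed

lemma cadlag_add:
 assumes "cadlag f" "cadlag h"
 shows "cadlag (%t. f t + h t)"
proof -
 have "\<exists>l. ((%t. f t + h t) \<longlongrightarrow> l) (at_left t)" if "0 < t" for t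
 proof -
  obtain l l' where "(f \<longlongrightarrow> l) (at_left t)" "(h \<longlongrightarrow> l') (at_left t)"
   using assms \<open>0 < t\<close> unfolding cadlag_def by blast
  then show ?thesis by (blast intro: tendsto_add)
 qed
 then show ?thesis using assms unfolding cadlag_def by (auto intro: tendsto_add)
qed

lemma cadlag_const: "cadlag (%_. c)"
 unfolding cadlag_def by auto

lemma (in prob_space) incseq_exhaustion:
 assumes G: "!!n. G n \<in> sets M" "incseq G" and ae: "AE w in M. \<exists>n. w \<in> G n" and e: "0 < e"
 obtains n :: nat where "prob (space M - G n) <= e"
proof -
 have "prob (\<Union>n. G n) = 1"
  using ae G(1) by (subst prob_eq_1) auto
 then have "(%n. prob (G n)) \<longlonglongrightarrow> 1"
  using finite_Lim_measure_incseq[of G] G by auto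
 then have "\<forall>\<^sub>F n in sequentially. 1 - e < prob (G n)" by (rule order_tendstoD) (use e in simp)
 then obtain n where "1 - e < prob (G n)" by (auto simp: eventually_sequentially)
 then show ?thesis using prob_compl[OF G(1)[of n]] that[of n] by simp
qed

context brownian
begin

lemma stopped_0_0: "w \<in> space M ==> SB 0 w = x0"
 using stopped_before[of 0 H0 w B] hitting_time_nonneg[of w] B_0[of w]
 by (simp add: zero_ereal_def[symmetric])

lemma large_before_event:
 assumes "0 < e"
 obtains t0 :: nat and G where "G \<in> sets M" "prob (space M - G) <= e"
  "!!w. w \<in> G ==> \<exists>t\<ge>0. t < real t0 & b < abs (B t w)"
proof -
 \<comment> \<open>By right continuity of the path rational times suffice, which keeps the event
   measurable.\<close>
 define G where "G n = (\<Union>q\<in>{q\<in>\<rat>. 0 <= q & q < real n}. {w\<in>space M. b < abs (B q w)})" for n :: nat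
 have "countable {q\<in>\<rat>. 0 <= q & q < real n}" for n
  by (rule countable_subset[OF _ countable_rat]) auto
 moreover have "{w\<in>space M. b < abs (B q w)} \<in> sets M" if "0 <= q" for q
  using B_measurable[OF that] by measurable
 ultimately have G: "G n \<in> sets M" for n unfolding G_def by (intro sets.countable_UN') auto
 have inc: "incseq G"
  unfolding incseq_def G_def by (intro allI impI UN_mono) auto
 have ae: "AE w in M. \<exists>n. w \<in> G n"
  using AE_B_unbounded AE_space
 proof eventually_elim
  case (elim w)
  then obtain t where t: "0 <= t" "b < abs (B t w)" by blast
  have "((%s. B s w) \<longlongrightarrow> B t w) (at t within {0..})"
   using B_continuous[OF elim(2)] t(1) by (auto simp: continuous_on_def)
  then have "((%s. B s w) \<longlongrightarrow> B t w) (at_right t)" by (rule tendsto_within_subset) (use t in auto)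
  from order_tendstoD(1)[OF tendsto_rabs[OF this] t(2)]
  obtain c where c: "t < c" "!!s. t < s ==> s < c ==> b < abs (B s w)"
   by (auto simp: eventually_at_right_field)
  obtain q where q: "q \<in> \<rat>" "t < q" "q < c" using Rats_dense_in_real[OF c(1)] by blast
  obtain n :: nat where "q < real n" using reals_Archimedean2 by blast
  then have "w \<in> G n" using q c(2)[of q] t(1) elim(2) by (auto simp: G_def intro!: bexI[of _ q])
  then show ?case ..
 qed
 obtain n where "prob (space M - G n) <= e" by (rule incseq_exhaustion[OF G inc ae assms])
 then show ?thesis using that[OF G, of n n] by (fastforce simp: G_def)
qed

lemma localised_event:
 assumes T: "!!n. stopping_time_ext M F (T n)" and lim: "AE w in M. (%n. T n w) \<longlonglongrightarrow> \<infinity>" and e: "0 < e" "0 <= t"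
 obtains n :: nat and G where "G \<in> sets M" "prob (space M - G) <= e" "!!w. w \<in> G ==> ereal t < T n w"
proof -
 \<comment> \<open>Asking for all later \<open>j\<close> makes the events increasing, also for
   outcomes where the sequence \<open>T\<close> fails to be monotone.\<close>
 define G where "G n = {w\<in>space M. \<forall>j\<ge>n. ereal t < T j w}" for n :: nat
 have P: "Measurable.pred M (%w. ereal t < T j w)" for j
 proof -
  have "Measurable.pred (F t) (%w. T j w <= ereal t)" using T e by (simp add: stopping_time_ext_def)
  then have "Measurable.pred M (%w. T j w <= ereal t)" by (rule measurable_F[OF _ e(2)])
  then have "Measurable.pred M (%w. \<not> T j w <= ereal t)" by (rule pred_intros_logic)
  then show ?thesis by (simp add: not_le)
 qed
 have "Measurable.pred M (%w. \<forall>j. n <= j --> ereal t < T j w)" for n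
  by (intro pred_intros_countable(1) pred_intros_logic P) simp
 then have G: "G n \<in> sets M" for n unfolding G_def by (rule predE)
 have inc: "incseq G" by (auto simp: incseq_def G_def)
 have ae: "AE w in M. \<exists>n. w \<in> G n"
  using lim AE_space
 proof eventually_elim
  case (elim w)
  then have "\<forall>\<^sub>F j in sequentially. ereal t < T j w" by (intro order_tendstoD) auto
  then show ?case using elim(2) by (auto simp: G_def eventually_sequentially)
 qed
 obtain n where "prob (space M - G n) <= e" by (rule incseq_exhaustion[OF G inc ae e(1)])
 then show ?thesis using that[OF G, of n n] by (simp add: G_def)
qed

text \<open>Dyadic partitions make the event measurable and still bound every sum along grid
  times.\<close>

lemma bounded_variation_event:
 assumes A: "adapted F A" and fv: "AE w in M. finite_variation_on 0 (real t0) (%s. A s w)" and e: "0 < e"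
 obtains v :: nat and G where "G \<in> sets M" "prob (space M - G) <= e"
  "!!w r. w \<in> G ==> (\<Sum>k<t0 * 2^r. abs (A (real (Suc k) / 2^r) w - A (real k / 2^r) w)) <= real v"
proof -
 define G where "G v = {w\<in>space M. \<forall>r. (\<Sum>k<t0 * 2^r. abs (A (real (Suc k) / 2^r) w - A (real k / 2^r) w)) <= real v}" for v
 have Am: "A s \<in> borel_measurable M" if "0 <= s" for s
  using A that by (intro measurable_F[OF _ that]) (simp add: adapted_def)
 have "(%w. \<Sum>k<t0 * 2^r. abs (A (real (Suc k) / 2^r) w - A (real k / 2^r) w)) \<in> borel_measurable M" for r
  by (intro borel_measurable_sum borel_measurable_abs borel_measurable_diff Am) auto
 then have "Measurable.pred M (%w. (\<Sum>k<t0 * 2^r. abs (A (real (Suc k) / 2^r) w - A (real k / 2^r) w)) <= real v)" for r v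
  by measurable
 then have G: "G v \<in> sets M" for v unfolding G_def by (intro predE pred_intros_countable(1))
 have inc: "incseq G" by (auto simp: incseq_def G_def intro: order_trans)
 have ae: "AE w in M. \<exists>v. w \<in> G v"
  using fv AE_space
 proof eventually_elim
  case (elim w)
  then obtain K where K: "!!n p. mono p ==> p ` {..n} \<subseteq> {0..real t0} ==> (\<Sum>i<n. abs (A (p (Suc i)) w - A (p i) w)) <= K"
   unfolding finite_variation_on_def by blast
  obtain v :: nat where v: "K <= real v" using real_arch_simple by blast
  have "(\<Sum>k<t0 * 2^r. abs (A (real (Suc k) / 2^r) w - A (real k / 2^r) w)) <= real v" for r
  proof -
   have "real k / 2^r <= real t0" if "k <= t0 * 2^r" for k
    using that by (simp add: divide_le_eq) (metis of_nat_le_iff of_nat_mult of_nat_numeral of_nat_power)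
   then have "(%k. real k / 2^r) ` {..t0 * 2^r} \<subseteq> {0..real t0}" by auto
   moreover have "mono (%k. real k / 2^r)" by (intro monoI divide_right_mono) auto
   ultimately show ?thesis using order_trans[OF K v] by blast
  qed
  then show ?case using elim(2) by (auto simp: G_def)
 qed
 obtain v where "prob (space M - G v) <= e" by (rule incseq_exhaustion[OF G inc ae e])
 then show ?thesis using that[OF G, of v v] by (simp add: G_def)
qed

lemma semimartingale_imp_convex_diff_pos_borel:
 assumes g: "g \<in> borel_measurable borel"
  and semi: "semimartingale M F (%t w. g (SB t w))"
 shows "convex_diff_pos g"
proof -
 let ?X = "%t w. g (SB t w)"
 obtain L A where L: "local_martingale M F L" and A: "finite_variation_process M F A"
  and dec: "AE w in M. L 0 w = 0 & A 0 w = 0 & (\<forall>t\<ge>0. ?X t w = ?X 0 w + L t w + A t w)"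
  using semi unfolding semimartingale_def by blast
 have Aad: "adapted F A" using A by (simp add: finite_variation_process_def)
 obtain T :: "nat => 'a => ereal" where T: "!!n. stopping_time_ext M F (T n)"
  and Tlim: "AE w in M. incseq (%n. T n w) & (%n. T n w) \<longlonglongrightarrow> \<infinity>"
  and Y: "!!n. martingale M F (%t w. stopped (T n) L t w - L 0 w)"
  using L unfolding local_martingale_def by blast
 have "AE w in M. cadlag (%t. L t w)"
  using L unfolding local_martingale_def by (elim conjE)
 moreover have fv: "AE w in M. cadlag (%t. A t w) & (\<forall>t\<ge>0. finite_variation_on 0 t (%s. A s w))"
  using A unfolding finite_variation_process_def by (elim conjE)
 ultimately have cad: "AE w in M. cadlag (%t. ?X t w)"
  using dec
 proof eventually_elim
  case (elim w)
  have "?X 0 w + L t w + A t w = ?X t w" if t: "0 <= t" for t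
   by (rule sym) (use elim(3) t in blast)
  then show ?case
   by (rule cadlag_cong[OF _ cadlag_add[OF cadlag_add[OF cadlag_const elim(1)] conjunct1[OF elim(2)]]])
 qed
 have gc: "continuous_on {0<..} g" by (rule cadlag_stopped_imp_continuous[OF cad])
 obtain Cg where Cg: "!!x. x \<in> {0<..1} ==> abs (g x) <= Cg"
  using cadlag_stopped_imp_bounded[OF cad, of 1] by force
 have key: "\<exists>C. \<forall>n. (\<Sum>l\<in>{1..<m * 2^n}. green (m * 2^n) (2^n) l * abs (diff2 (%k. g (real k * x0 / 2^n)) l)) <= C"
  if m: "2 <= m" for m :: nat
 proof -
  obtain Kg where Kg: "!!x. 0 <= x ==> x <= 2 * real m * x0 ==> abs (g x) <= Kg"
   using cadlag_stopped_imp_bounded[OF cad, of "2 * real m * x0"] by force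
  \<comment> \<open>Three exceptional events of this size add up to the \<open>1 / (8 * m^2)\<close>
    that the second moment argument allows. The horizon is chosen first, then the localising index
    and the variation bound; none of them depends on the mesh.\<close>
  define e where "e = 1 / (24 * (real m)^2)"
  have e: "0 < e" using m by (simp add: e_def)
  obtain t0 :: nat and G1 where G1: "G1 \<in> sets M" "prob (space M - G1) <= e"
   "!!w. w \<in> G1 ==> \<exists>t\<ge>0. t < real t0 & real m * x0 < abs (B t w)"
   by (rule large_before_event[OF e, where b = "real m * x0"]) blast
  obtain n :: nat and G2 where G2: "G2 \<in> sets M" "prob (space M - G2) <= e"
   "!!w. w \<in> G2 ==> ereal (real t0) < T n w"
   by (rule localised_event[where T = T and t = "real t0", OF T _ e]) (use Tlim in auto)
  have "AE w in M. finite_variation_on 0 (real t0) (%s. A s w)"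
   using fv by eventually_elim simp
  then obtain v :: nat and G3 where G3: "G3 \<in> sets M" "prob (space M - G3) <= e"
   "!!w r. w \<in> G3 ==> (\<Sum>k<t0 * 2^r. abs (A (real (Suc k) / 2^r) w - A (real k / 2^r) w)) <= real v"
   by (rule bounded_variation_event[OF Aad _ e]) blast
  define Gm where "Gm = G1 \<inter> G2 \<inter> G3"
  have Gm: "Gm \<in> sets M" using G1 G2 G3 by (auto simp: Gm_def)
  have "prob (space M - Gm) <= prob ((space M - G1) \<union> (space M - G2) \<union> (space M - G3))"
   using G1 G2 G3 by (intro finite_measure_mono) (auto simp: Gm_def)
  also have "... <= prob (space M - G1) + prob (space M - G2) + prob (space M - G3)"
   using measure_Un_le[of "(space M - G1) \<union> (space M - G2)" M "space M - G3"]
    measure_Un_le[of "space M - G1" M "space M - G2"] G1(1) G2(1) G3(1) by auto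
  also have "... <= e + e + e" by (intro add_mono G1 G2 G3)
  also have "... = 1 / (8 * (real m)^2)" by (simp add: e_def)
  finally have P: "prob (space M - Gm) <= 1 / (8 * (real m)^2)" .
  define Y' where "Y' = (%t w. stopped (T n) L t w - L 0 w)"
  have dec': "AE w in M. A 0 w = 0 & (\<forall>t\<ge>0. ereal t < T n w --> ?X t w = g x0 + Y' t w + A t w)"
   using dec AE_space
  proof eventually_elim
   case (elim w)
   have "?X t w = g x0 + Y' t w + A t w" if t: "0 <= t" "ereal t < T n w" for t
   proof -
    have "?X t w = ?X 0 w + L t w + A t w" using elim(1) t(1) by blast
    also have "?X 0 w = g x0" by (simp only: stopped_0_0[OF elim(2)])
    also have "L t w = Y' t w"
     using elim(1) stopped_before[where T = "T n" and X = L, OF less_imp_le[OF t(2)]] by (simp add: Y'_def)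
    finally show ?thesis .
   qed
   then show ?case using elim(1) by blast
  qed
  have Y': "martingale M F Y'" unfolding Y'_def by (rule Y)
  define C where "C = 2 * (4 * Kg + 2 * real v + (LINT w|M. abs (Y' (real t0) w)) + 5 * Kg)"
  have "(\<Sum>l\<in>{1..<m * 2^p}. green (m * 2^p) (2^p) l * abs (diff2 (%k. g (real k * x0 / 2^p)) l)) <= C" for p
  proof -
   interpret ws: walk_semimartingale M F B x0 g Kg "real v" m p t0 "T n" Y' A
    by unfold_locales (use m g gc Kg T Y' Aad dec' in auto)
   have "(LINT w|M. indicator Gm w * occupation ws.d ws.N ws.q J w) <= ws.C1 + 5 * Kg" for J
    by (rule ws.occupation_bound[OF Gm]) (use G1(3) G2(3) G3(3) in \<open>auto simp: Gm_def ws.b_def\<close>)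
   then have *: "(LINT w|M. indicator Gm w * occupation ws.d ws.N (%k. if 1 <= k & k < ws.N then \<bar>diff2 ws.f k\<bar> / 2 else 0) J w) <= ws.C1 + 5 * Kg" for J
    unfolding ws.q_def[abs_def] .
   have "(\<Sum>l\<in>{1..<ws.N}. green ws.N (2^p) l * abs (diff2 ws.f l)) <= 2 * (ws.C1 + 5 * Kg)"
    by (rule green_bound[OF _ m ws.N_def ws.d_def Gm P *]) simp
   moreover have "ws.f = (%k. g (real k * x0 / 2^p))" by (simp add: ws.f_def[abs_def] ws.d_def)
   ultimately show ?thesis by (simp add: ws.N_def ws.C1_def C_def)
  qed
  then show ?thesis by blast
 qed
 show ?thesis by (rule lattice_bound_imp_convex_diff_pos[OF x0_pos gc Cg key])
qed

lemma semimartingale_imp_convex_diff_pos: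
 assumes g: "g \<in> borel_measurable (restrict_space borel {0..})"
  and semi: "semimartingale M F (%t w. g (SB t w))"
 shows "convex_diff_pos g"
proof -
 \<comment> \<open>Extension by \<open>0\<close> to negative arguments, which the stopped path never
   takes, gives a Borel function on the whole line.\<close>
 define g0 where "g0 x = indicator {0..} x * g x" for x :: real
 have "(%x. indicator {0..} x *\<^sub>R g x) \<in> borel_measurable borel"
  using g by (subst (asm) borel_measurable_restrict_space_iff) auto
 then have g0: "g0 \<in> borel_measurable borel" by (simp add: g0_def[abs_def])
 have eq: "g0 (SB t w) = g (SB t w)" if "w \<in> space M" "0 <= t" for t w
  using stopped_0_nonneg[OF that] by (simp add: g0_def)
 obtain L A where "local_martingale M F L" "finite_variation_process M F A"
  and dec: "AE w in M. L 0 w = 0 & A 0 w = 0 &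
   (\<forall>t\<ge>0. g (SB t w) = g (SB 0 w) + L t w + A t w)"
  using semi unfolding semimartingale_def by blast
 moreover have "AE w in M. L 0 w = 0 & A 0 w = 0 &
   (\<forall>t\<ge>0. g0 (SB t w) = g0 (SB 0 w) + L t w + A t w)"
  using dec AE_space
 proof eventually_elim
  case (elim w)
  have "g0 (SB t w) = g0 (SB 0 w) + L t w + A t w" if t: "0 <= t" for t
   unfolding eq[OF elim(2) t] eq[OF elim(2) order_refl] using elim(1) t by blast
  then show ?case using elim(1) by blast
 qed
 moreover have "adapted F (%t w. g0 (SB t w))"
  unfolding adapted_def by (intro allI impI measurable_compose[OF stopped_0_measurable g0])
 ultimately have "semimartingale M F (%t w. g0 (SB t w))"
  unfolding semimartingale_def by (intro conjI exI)
 from semimartingale_imp_convex_diff_pos_borel[OF g0 this]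
 obtain u v where uv: "convex_on {0<..} u" "convex_on {0<..} v" "\<exists>C. \<forall>x\<in>{0<..1}. u x <= C & v x <= C"
  "\<forall>x>0. g0 x = u x - v x"
  unfolding convex_diff_pos_def by blast
 have "g x = u x - v x" if "0 < x" for x using uv(4)[rule_format, OF that] that by (simp add: g0_def)
 then show ?thesis unfolding convex_diff_pos_def using uv(1-3) by blast
qed

end

section \<open>Ito sums\<close>

definition left_grid :: "nat => real => real" where
 "left_grid n s = real (nat \<lfloor>s * 2^n\<rfloor>) / 2^n"

lemma left_grid_bounds:
 assumes "0 <= s"
 shows "0 <= left_grid n s" "left_grid n s <= s" "s < left_grid n s + 1 / 2^n"
proof -
 have "real (nat \<lfloor>s * 2^n\<rfloor>) <= s * 2^n" "s * 2^n < real (nat \<lfloor>s * 2^n\<rfloor>) + 1"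
  using assms by (auto simp: of_nat_nat)
 then show "left_grid n s <= s" "s < left_grid n s + 1 / 2^n"
  by (simp_all add: left_grid_def field_simps)
qed (simp add: left_grid_def)

lemma left_grid_tendsto:
 assumes "0 <= s"
 shows "(%n. left_grid n s) \<longlonglongrightarrow> s"
proof (rule tendsto_sandwich)
 have "(%n. s - (1/2)^n) \<longlonglongrightarrow> s - 0" by (intro tendsto_intros) auto
 then show "(%n. s - (1/2)^n) \<longlonglongrightarrow> s" by simp
 show "\<forall>\<^sub>F n in sequentially. s - (1/2)^n <= left_grid n s"
  using left_grid_bounds(3)[OF assms] by (intro always_eventually allI) (simp add: power_one_over less_imp_le algebra_simps)
 show "\<forall>\<^sub>F n in sequentially. left_grid n s <= s" using left_grid_bounds(2)[OF assms] by simp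
qed simp

lemma left_grid_dyadic:
 assumes "n <= m"
 shows "left_grid n (real i / 2^m) = real (i div 2^(m - n)) / 2^n"
proof -
 have "real i / 2^m * 2^n = real i / 2^(m - n)" using assms by (simp add: power_diff field_simps)
 then have "nat \<lfloor>real i / 2^m * 2^n\<rfloor> = i div 2^(m - n)"
  using floor_divide_of_nat_eq[of i "2^(m - n)", where 'a = real] by (simp add: nat_int)
 then show ?thesis by (simp add: left_grid_def)
qed

lemma left_grid_cell:
 assumes "n <= m" "0 <= s"
 shows "left_grid n s = left_grid n (real (nat \<lfloor>s * 2^m\<rfloor>) / 2^m)"
proof -
 have *: "\<lfloor>s * 2^n\<rfloor> = \<lfloor>s * 2^m\<rfloor> div 2^(m - n)"
 proof -
  have "(2::real)^m = 2^n * 2^(m - n)" using assms by (simp flip: power_add)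
  then have "s * 2^n = s * 2^m / real_of_int (2^(m - n))" by simp
  then show ?thesis using floor_divide_real_eq_div[of "2^(m - n)" "s * 2^m"] by simp
 qed
 have "int (nat \<lfloor>s * 2^m\<rfloor>) = \<lfloor>s * 2^m\<rfloor>" using assms by simp
 then have "int (nat \<lfloor>s * 2^m\<rfloor> div 2^(m - n)) = \<lfloor>s * 2^n\<rfloor>" by (simp add: * zdiv_int)
 then have "nat \<lfloor>s * 2^n\<rfloor> = nat \<lfloor>s * 2^m\<rfloor> div 2^(m - n)" by linarith
 then show ?thesis unfolding left_grid_dyadic[OF assms(1)] by (simp add: left_grid_def)
qed

lemma min_max_increment:
 fixes b :: "real => real"
 assumes "s <= t" "u <= v"
 shows "(b (min t v) - b (min t u)) - (b (min s v) - b (min s u)) = b (min t (max s v)) - b (min t (max s u))"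
 using assms by (auto simp: min_def max_def)

context brownian
begin

text \<open>Left-point sums whose last cell is cut at \<open>t\<close>; this makes them continuous
  in \<open>t\<close> and martingales at all real times.\<close>

definition ito_sum :: "(real => 'a => real) => nat => real => 'a => real" where
 "ito_sum eta n t w = (\<Sum>i<nat \<lceil>t * 2^n\<rceil>. eta (real i / 2^n) w * (B (min t (real (Suc i) / 2^n)) w - B (min t (real i / 2^n)) w))"

lemma ito_sum_eq:
 assumes K: "t * 2^n <= real K"
 shows "ito_sum eta n t w = (\<Sum>i<K. eta (real i / 2^n) w * (B (min t (real (Suc i) / 2^n)) w - B (min t (real i / 2^n)) w))"
 unfolding ito_sum_def
proof (rule sum.mono_neutral_left)
 show "{..<nat \<lceil>t * 2^n\<rceil>} \<subseteq> {..<K}" using K by (auto simp: ceiling_le_iff)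
 have "min t (real (Suc i) / 2^n) = min t (real i / 2^n)" if "nat \<lceil>t * 2^n\<rceil> <= i" for i
 proof -
  have "t * 2^n <= real i" using that by linarith
  then have "t <= real i / 2^n" by (simp add: le_divide_eq)
  moreover have "real i / 2^n <= real (Suc i) / 2^n" by (intro divide_right_mono) auto
  ultimately show ?thesis by simp
 qed
 then show "\<forall>i\<in>{..<K} - {..<nat \<lceil>t * 2^n\<rceil>}. eta (real i / 2^n) w * (B (min t (real (Suc i) / 2^n)) w - B (min t (real i / 2^n)) w) = 0"
  by auto
qed simp

lemma ito_sum_increment:
 assumes st: "s <= t" and K: "t * 2^n <= real K"
 shows "ito_sum eta n t w - ito_sum eta n s w = (\<Sum>i<K. eta (real i / 2^n) w *
  (B (min t (max s (real (Suc i) / 2^n))) w - B (min t (max s (real i / 2^n))) w))"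
proof -
 have "s * 2^n <= t * 2^n" using st by simp
 then have s: "s * 2^n <= real K" using K by linarith
 have le: "real i / 2^n <= real (Suc i) / 2^n" for i by (intro divide_right_mono) auto
 show ?thesis
  unfolding ito_sum_eq[OF K] ito_sum_eq[OF s] sum_subtractf[symmetric] right_diff_distrib[symmetric]
   min_max_increment[OF st le, where b = "%t. B t w"] ..
qed

lemma ito_sum_0: "ito_sum eta n 0 w = 0"
 by (simp add: ito_sum_def)

lemma ito_sum_cong_before:
 assumes "!!s. 0 <= s ==> s < t ==> eta s w = eta' s w"
 shows "ito_sum eta n t w = ito_sum eta' n t w"
 unfolding ito_sum_def
proof (rule sum.cong)
 fix i assume "i \<in> {..<nat \<lceil>t * 2^n\<rceil>}"
 then have "real i < t * 2^n" by (simp add: less_ceiling_iff zless_nat_eq_int_zless)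
 then have "real i / 2^n < t" by (simp add: divide_less_eq)
 then have "eta (real i / 2^n) w = eta' (real i / 2^n) w" by (intro assms) auto
 then show "eta (real i / 2^n) w * (B (min t (real (Suc i) / 2^n)) w - B (min t (real i / 2^n)) w)
  = eta' (real i / 2^n) w * (B (min t (real (Suc i) / 2^n)) w - B (min t (real i / 2^n)) w)" by simp
qed simp

lemma ito_sum_continuous:
 assumes w: "w \<in> space M"
 shows "continuous_on {0..} (%t. ito_sum eta n t w)"
 unfolding continuous_on_eq_continuous_within
proof
 fix t :: real assume t: "t \<in> {0..}"
 obtain K :: nat where K: "(t + 1) * 2^n <= real K" using real_arch_simple by blast
 have le: "s * 2^n <= real K" if "s <= t + 1" for s
 proof -
  have "s * 2^n <= (t + 1) * 2^n" using that by simp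
  then show ?thesis using K by linarith
 qed
 have c: "continuous_on {0..} (%s. B (min s u) w)" if "0 <= u" for u
  by (rule continuous_on_compose2[OF B_continuous[OF w]]) (use that in \<open>auto intro!: continuous_intros\<close>)
 have "continuous_on {0..} (%s. \<Sum>i<K. eta (real i / 2^n) w * (B (min s (real (Suc i) / 2^n)) w - B (min s (real i / 2^n)) w))"
  by (intro continuous_on_sum continuous_on_mult continuous_on_const continuous_on_diff c) auto
 then have "continuous_on {0..t + 1} (%s. \<Sum>i<K. eta (real i / 2^n) w * (B (min s (real (Suc i) / 2^n)) w - B (min s (real i / 2^n)) w))"
  by (rule continuous_on_subset) auto
 then have "continuous_on {0..t + 1} (%s. ito_sum eta n s w)"
  by (rule continuous_on_eq) (use ito_sum_eq[OF le] in auto)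
 then have "continuous (at t within {0..t + 1}) (%s. ito_sum eta n s w)"
  using t by (auto simp: continuous_on_eq_continuous_within)
 moreover have "at t within {0..t + 1} = at t within {0..}"
  by (rule at_within_nhd[of t "{..<t + 1}"]) auto
 ultimately show "continuous (at t within {0..}) (%s. ito_sum eta n s w)" by (simp add: continuous_within)
qed

text \<open>On a finer grid a coarse sum is the sum with the integrand sampled at
  \<open>left_grid n\<close>, so two levels become sums over one grid and can be subtracted.\<close>

lemma ito_sum_dyadic:
 assumes nm: "n <= m"
 shows "ito_sum eta n (real j / 2^m) w =
  (\<Sum>i<j. eta (left_grid n (real i / 2^m)) w * (B (real (Suc i) / 2^m) w - B (real i / 2^m) w))"
proof (induction j)
 case 0
 then show ?case by (simp add: ito_sum_0)
next
 case (Suc j)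
 let ?s = "real j / 2^m" and ?t = "real (Suc j) / 2^m"
 \<comment> \<open>The coarse cell that contains the fine cell from \<open>j\<close> to
   \<open>Suc j\<close>; the other coarse cells contribute nothing to this increment.\<close>
 define i0 where "i0 = j div 2^(m - n)"
 have "(2::real)^m = 2^n * 2^(m - n)" using nm by (simp flip: power_add)
 then have gi: "real i / 2^n = real (i * 2^(m - n)) / 2^m" for i by simp
 have lo: "real (Suc i) / 2^n <= ?s" if "i < i0" for i
 proof -
  have "Suc i * 2^(m - n) <= i0 * 2^(m - n)" using that by (intro mult_right_mono) auto
  also have "... <= j" unfolding i0_def by (rule div_times_less_eq_dividend)
  finally show ?thesis unfolding gi by (intro divide_right_mono iffD2[OF of_nat_le_iff]) auto
 qed
 have hi: "?t <= real i / 2^n" if "i0 < i" for i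
 proof -
  have "Suc j <= Suc i0 * 2^(m - n)"
   unfolding i0_def by (metis Suc_leI dividend_less_div_times mult_Suc zero_less_numeral zero_less_power add.commute)
  also have "... <= i * 2^(m - n)" using that by (intro mult_right_mono) auto
  finally show ?thesis unfolding gi by (intro divide_right_mono iffD2[OF of_nat_le_iff]) auto
 qed
 have le: "?s <= ?t" by (intro divide_right_mono) auto
 have ile: "real i / 2^n <= real (Suc i) / 2^n" for i by (intro divide_right_mono) auto
 obtain K :: nat where K: "max (?t * 2^n) (real (Suc i0)) <= real K" using real_arch_simple by blast
 have i0K: "i0 < K" using K by simp
 have at: "real i0 / 2^n <= ?s" "?t <= real (Suc i0) / 2^n"
 proof -
  show "real i0 / 2^n <= ?s"
   unfolding gi i0_def by (intro divide_right_mono) (auto simp del: of_nat_mult simp: div_times_less_eq_dividend)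
  show "?t <= real (Suc i0) / 2^n" by (rule hi) simp
 qed
 have "ito_sum eta n ?t w - ito_sum eta n ?s w = (\<Sum>i<K. eta (real i / 2^n) w *
  (B (min ?t (max ?s (real (Suc i) / 2^n))) w - B (min ?t (max ?s (real i / 2^n))) w))"
  by (rule ito_sum_increment[OF le]) (use K in simp)
 also have "... = (\<Sum>i<K. if i = i0 then eta (real i0 / 2^n) w * (B ?t w - B ?s w) else 0)"
 proof (rule sum.cong)
  fix i
  consider "i < i0" | "i = i0" | "i0 < i" by linarith
  then show "eta (real i / 2^n) w * (B (min ?t (max ?s (real (Suc i) / 2^n))) w - B (min ?t (max ?s (real i / 2^n))) w)
   = (if i = i0 then eta (real i0 / 2^n) w * (B ?t w - B ?s w) else 0)"
  proof cases
   case 1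
   have "max ?s (real (Suc i) / 2^n) = max ?s (real i / 2^n)" using lo[OF 1] ile[of i] by linarith
   then show ?thesis using 1 by simp
  next
   case 2
   have "min ?t (max ?s (real (Suc i0) / 2^n)) = ?t" "min ?t (max ?s (real i0 / 2^n)) = ?s" using at le by linarith+
   then show ?thesis using 2 by simp
  next
   case 3
   have "min ?t (max ?s (real (Suc i) / 2^n)) = min ?t (max ?s (real i / 2^n))" using hi[OF 3] ile[of i] by linarith
   then show ?thesis using 3 by simp
  qed
 qed simp
 also have "... = eta (real i0 / 2^n) w * (B ?t w - B ?s w)" using i0K by simp
 finally show ?case using Suc by (simp add: left_grid_dyadic[OF nm] i0_def)
qed

context
 fixes eta :: "real => 'a => real" and C :: real
 assumes eta: "adapted F eta" and C: "!!t w. w \<in> space M ==> abs (eta t w) <= C"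
begin

lemma integrand_measurable: "0 <= s ==> s <= t ==> eta s \<in> borel_measurable (F t)"
 using eta by (auto simp: adapted_def intro: measurable_F_mono)

lemma ito_sum_martingale: "martingale M F (ito_sum eta n)"
proof (rule martingaleI)
 have m: "eta (real i / 2^n) \<in> borel_measurable (F t)" if "real i / 2^n <= t" for i t
  by (rule integrand_measurable) (use that in auto)
 have dt: "real i / 2^n <= t" if "i < nat \<lceil>t * 2^n\<rceil>" for i t
 proof -
  have "real i <= t * 2^n" using that by linarith
  then show ?thesis by (simp add: divide_le_eq)
 qed
 show "adapted F (ito_sum eta n)"
  unfolding adapted_def ito_sum_def[abs_def]
  by (intro allI impI borel_measurable_sum borel_measurable_times borel_measurable_diff m B_adapted_mono) (auto intro: dt)
 have iterm: "integrable M (%w. xi w * (eta (real i / 2^n) w * (B (min t (max s (real (Suc i) / 2^n))) w - B (min t (max s (real i / 2^n))) w)))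
   & (LINT w|M. xi w * (eta (real i / 2^n) w * (B (min t (max s (real (Suc i) / 2^n))) w - B (min t (max s (real i / 2^n))) w))) = 0"
  if st: "0 <= s" "s <= t" and xi: "xi \<in> borel_measurable (F s)" "!!w. w \<in> space M ==> abs (xi w) <= 1" for s t xi i
 proof (cases "real i / 2^n <= t")
  case True
  let ?u = "min t (max s (real i / 2^n))" and ?v = "min t (max s (real (Suc i) / 2^n))"
  have ile: "real i / 2^n <= real (Suc i) / 2^n" by (intro divide_right_mono) auto
  have u: "0 <= ?u" "?u <= ?v" "s <= ?u" "real i / 2^n <= ?u" using st True ile by linarith+
  have X: "(%w. xi w * eta (real i / 2^n) w) \<in> borel_measurable (F ?u)"
   by (intro borel_measurable_times m u measurable_F_mono[OF xi(1)] st)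
  have bd: "abs (xi w * eta (real i / 2^n) w) <= 1 * C" if "w \<in> space M" for w
   unfolding abs_mult by (intro mult_mono xi C that) auto
  have iX: "integrable M (%w. xi w * eta (real i / 2^n) w)"
   by (rule integrable_bounded[OF measurable_F[OF X u(1)] bd])
  show ?thesis using B_increment_orthogonal[OF u(1,2) X iX] by (simp only: mult.assoc)
 next
  case False
  moreover have "real i / 2^n <= real (Suc i) / 2^n" by (intro divide_right_mono) auto
  ultimately have "min t (max s (real (Suc i) / 2^n)) = t" "min t (max s (real i / 2^n)) = t" by linarith+
  then show ?thesis by simp
 qed
 have inc: "integrable M (%w. xi w * (ito_sum eta n t w - ito_sum eta n s w)) & (LINT w|M. xi w * (ito_sum eta n t w - ito_sum eta n s w)) = 0"
  if st: "0 <= s" "s <= t" and xi: "xi \<in> borel_measurable (F s)" "!!w. w \<in> space M ==> abs (xi w) <= 1" for s t xi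
 proof -
  obtain K :: nat where K: "t * 2^n <= real K" using real_arch_simple by blast
  note it = iterm[OF st xi]
  show ?thesis
   unfolding ito_sum_increment[OF st(2) K] sum_distrib_left
   using it by (auto simp: leb_integral_sum intro!: leb_integrable_sum)
 qed
 show int: "integrable M (ito_sum eta n t)" if "0 <= t" for t
  using inc[of 0 t "%_. 1"] that by (simp add: ito_sum_0)
 fix s t A assume st: "0 <= s" "s <= t" and A: "A \<in> sets (F s)"
 have A': "(indicator A :: 'a => real) \<in> borel_measurable (F s)" using A by (rule borel_measurable_indicator)
 have i: "integrable M (%w. indicator A w * ito_sum eta n r w)" if "0 <= r" for r
  by (rule integrable_bounded_mult[OF int[OF that] measurable_F[OF A' st(1)], of 1]) (auto split: split_indicator)
 have "(LINT w|M. indicator A w * (ito_sum eta n t w - ito_sum eta n s w)) = 0"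
  using inc[OF st A'] by (auto split: split_indicator)
 then show "(LINT w|M. indicator A w * ito_sum eta n t w) = (LINT w|M. indicator A w * ito_sum eta n s w)"
  using i[OF st(1)] i[OF order_trans[OF st]] by (simp add: right_diff_distrib)
qed

end

end

section \<open>Convergence of the Ito sums\<close>

lemma left_grid_measurable_function:
 fixes G :: "real => real => real"
 shows "(%s. G (left_grid n s) (left_grid n' s)) \<in> borel_measurable borel"
proof -
 \<comment> \<open>Since \<open>left_grid\<close> takes countably many values on Borel cells, any
   function of it is Borel; joint measurability of the integrand in time and outcome is thereby
   avoided.\<close>
 have f: "(%s::real. nat \<lfloor>s * 2^k\<rfloor>) \<in> measurable borel (count_space UNIV)" for k :: nat by measurable
 have "(%s. (%i. G (real i / 2^n) (left_grid n' s)) (nat \<lfloor>s * 2^n\<rfloor>)) \<in> borel_measurable borel"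
 proof (rule measurable_compose_countable[OF _ f])
  fix i :: nat
  have "(%s::real. (%j s. G (real i / 2^n) (real j / 2^n')) (nat \<lfloor>s * 2^n'\<rfloor>) s) \<in> borel_measurable borel"
   by (rule measurable_compose_countable[OF _ f]) simp
  then show "(%s. G (real i / 2^n) (left_grid n' s)) \<in> borel_measurable borel"
   by (simp add: left_grid_def[abs_def])
 qed
 then show ?thesis by (simp add: left_grid_def[abs_def])
qed

lemma ennreal_tendsto_0I:
 fixes f :: "nat => ennreal"
 assumes "!!e. 0 < e ==> \<forall>\<^sub>F n in sequentially. f n <= ennreal e"
 shows "f \<longlonglongrightarrow> 0"
proof (rule order_tendstoI)
 fix a :: ennreal assume "0 < a"
 then obtain b where b: "0 < b" "b < a" using dense by blast
 then have "b \<noteq> top" by auto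
 then obtain e where e: "b = ennreal e" "0 < e" using b(1) by (cases b) auto
 show "\<forall>\<^sub>F n in sequentially. f n < a"
  using assms[OF e(2)] by eventually_elim (use b e in auto)
qed simp

context brownian
begin

context
 fixes eta :: "real => 'a => real" and C :: real
 assumes eta: "adapted F eta" and C: "!!t w. w \<in> space M ==> abs (eta t w) <= C"
begin

lemma integrand_M: "0 <= s ==> eta s \<in> borel_measurable M"
 using eta by (auto simp: adapted_def intro: measurable_F)

lemma integrand_diff_bound: "w \<in> space M ==> abs (eta s w - eta t w) <= 2 * C"
 using C[of w s] C[of w t] by linarith

lemma integrand_diff_square_bound: "w \<in> space M ==> (eta s w - eta t w)^2 <= 4 * C^2"
 using power_mono[OF integrand_diff_bound abs_ge_zero, of w s t 2] by simp

lemma integrable_integrand_diff_square: "0 <= s ==> 0 <= t ==> integrable M (%w. (eta s w - eta t w)^2)"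
 by (rule integrable_bounded[where C = "4 * C^2"])
  (auto intro!: borel_measurable_power borel_measurable_diff integrand_M integrand_diff_square_bound)

lemma ito_sum_gap:
 assumes nm: "n <= m" "n' <= m"
 shows "integrable M (%w. (ito_sum eta n (real H) w - ito_sum eta n' (real H) w)^2)"
  and "(LINT w|M. (ito_sum eta n (real H) w - ito_sum eta n' (real H) w)^2)
   = (\<Sum>i<H * 2^m. 1 / 2^m * (LINT w|M. (eta (left_grid n (real i / 2^m)) w - eta (left_grid n' (real i / 2^m)) w)^2))"
  and "0 < l ==> prob {w\<in>space M. \<exists>j\<le>H * 2^m. l < abs (ito_sum eta n (real j / 2^m) w - ito_sum eta n' (real j / 2^m) w)}
   <= (\<Sum>i<H * 2^m. 1 / 2^m * (LINT w|M. (eta (left_grid n (real i / 2^m)) w - eta (left_grid n' (real i / 2^m)) w)^2)) / l^2"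
proof -
 define t where "t k = real k / 2^m" for k :: nat
 define xi where "xi k w = eta (left_grid n (t k)) w - eta (left_grid n' (t k)) w" for k w
 have t: "0 <= t 0" "mono t" by (auto simp: t_def intro!: monoI divide_right_mono)
 have dt: "t (Suc k) - t k = 1 / 2^m" for k by (simp add: t_def diff_divide_distrib[symmetric])
 have tn: "0 <= t k" for k by (simp add: t_def)
 have xim: "xi k \<in> borel_measurable (F (t k))" for k
  unfolding xi_def[abs_def]
  by (intro borel_measurable_diff integrand_measurable[OF eta C] left_grid_bounds tn)
 have xib: "abs (xi k w) <= 2 * C" if "w \<in> space M" for k w
  unfolding xi_def by (rule integrand_diff_bound[OF that])
 have S: "ito_sum eta n (real j / 2^m) w - ito_sum eta n' (real j / 2^m) w = (\<Sum>k<j. xi k w * (B (t (Suc k)) w - B (t k) w))" for j w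
  unfolding ito_sum_dyadic[OF nm(1)] ito_sum_dyadic[OF nm(2)] sum_subtractf[symmetric] left_diff_distrib[symmetric]
  by (simp add: xi_def t_def)
 have H: "real H = real (H * 2^m) / 2^m" by simp
 have int: "integrable M (%w. (\<Sum>k<H * 2^m. xi k w * (B (t (Suc k)) w - B (t k) w))^2)"
  by (rule ito_isometry(1)[where C = "2 * C", OF t xim]) (rule xib)
 then show "integrable M (%w. (ito_sum eta n (real H) w - ito_sum eta n' (real H) w)^2)"
  unfolding H S .
 have "(LINT w|M. (\<Sum>k<H * 2^m. xi k w * (B (t (Suc k)) w - B (t k) w))^2)
   = (\<Sum>k<H * 2^m. (t (Suc k) - t k) * (LINT w|M. (xi k w)^2))"
  by (rule ito_isometry(2)[where C = "2 * C", OF t xim]) (rule xib)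
 then show "(LINT w|M. (ito_sum eta n (real H) w - ito_sum eta n' (real H) w)^2)
   = (\<Sum>i<H * 2^m. 1 / 2^m * (LINT w|M. (eta (left_grid n (real i / 2^m)) w - eta (left_grid n' (real i / 2^m)) w)^2))"
  unfolding H S dt by (simp only: xi_def t_def)
 assume l: "0 < l"
 show "prob {w\<in>space M. \<exists>j\<le>H * 2^m. l < abs (ito_sum eta n (real j / 2^m) w - ito_sum eta n' (real j / 2^m) w)}
   <= (\<Sum>i<H * 2^m. 1 / 2^m * (LINT w|M. (eta (left_grid n (real i / 2^m)) w - eta (left_grid n' (real i / 2^m)) w)^2)) / l^2"
 proof -
  have "prob {w\<in>space M. \<exists>j\<le>H * 2^m. l < abs (\<Sum>k<j. xi k w * (B (t (Suc k)) w - B (t k) w))}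
   <= (\<Sum>k<H * 2^m. (t (Suc k) - t k) * (LINT w|M. (xi k w)^2)) / l^2"
   by (rule ito_maximal_inequality[where C = "2 * C", OF t xim xib l])
  then show ?thesis unfolding S dt by (simp only: xi_def t_def)
 qed
qed

text \<open>The sums are integrals in \<open>s\<close> of the mean squared distance between the
  integrands at \<open>left_grid n s\<close> and \<open>left_grid n' s\<close>. The supremum over
  \<open>n'\<close> is \<open>phi n\<close>, which tends to \<open>0\<close> by dominated
  convergence, first in \<open>w\<close>, then in \<open>s\<close>; this makes the bound uniform in
  \<open>n'\<close> and \<open>m\<close>.\<close>

lemma integrand_gap_small:
 assumes LC: "!!s. 0 < s ==> AE w in M. (%n. eta (left_grid n s) w) \<longlonglongrightarrow> eta s w" and e: "0 < e"
 shows "\<exists>n0. \<forall>n\<ge>n0. \<forall>n'\<ge>n. \<forall>m\<ge>n'.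
  (\<Sum>i<H * 2^m. 1 / 2^m * (LINT w|M. (eta (left_grid n (real i / 2^m)) w - eta (left_grid n' (real i / 2^m)) w)^2)) <= e"
proof -
 define G where "G s t = (LINT w|M. (eta s w - eta t w)^2)" for s t
 define phi where "phi n s = (SUP n'\<in>{n..}. ennreal (G (left_grid n s) (left_grid n' s)))" for n s
 have G0: "0 <= G s t" for s t by (simp add: G_def)
 have Gb: "G s t <= 4 * C^2" if "0 <= s" "0 <= t" for s t
  unfolding G_def using integrand_diff_square_bound
  by (intro integral_le_const integrable_integrand_diff_square that AE_I2)
 have phim: "phi n \<in> borel_measurable borel" for n
  unfolding phi_def[abs_def]
  by (intro borel_measurable_SUP measurable_compose[OF left_grid_measurable_function measurable_ennreal]) auto
 have lim: "(%n. phi n s) \<longlonglongrightarrow> 0" if s: "0 < s" for s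
 proof -
  have l0: "0 <= left_grid n s" for n using s left_grid_bounds(1)[of s n] by simp
  have "(%n. G (left_grid n s) s) \<longlonglongrightarrow> (LINT w|M. 0)"
   unfolding G_def
  proof (rule integral_dominated_convergence[where w = "%_. 4 * C^2"])
   show "AE w in M. (%n. (eta (left_grid n s) w - eta s w)^2) \<longlonglongrightarrow> 0"
    using LC[OF s]
   proof eventually_elim
    case (elim w)
    have "(%n. (eta (left_grid n s) w - eta s w)^2) \<longlonglongrightarrow> (eta s w - eta s w)^2" by (intro tendsto_intros elim)
    then show ?case by simp
   qed
   show "AE w in M. norm ((eta (left_grid n s) w - eta s w)^2) <= 4 * C^2" for n
    using integrand_diff_square_bound by (intro AE_I2) simp
   show "(%w. (eta (left_grid n s) w - eta s w)^2) \<in> borel_measurable M" for n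
    by (rule borel_measurable_integrable[OF integrable_integrand_diff_square[OF l0]]) (use s in simp)
  qed auto
  then have a: "(%n. G (left_grid n s) s) \<longlonglongrightarrow> 0" by simp
  show ?thesis
  proof (rule ennreal_tendsto_0I)
   fix e :: real assume e: "0 < e"
   from a have "\<forall>\<^sub>F n in sequentially. G (left_grid n s) s < e / 4" by (rule order_tendstoD) (use e in simp)
   then obtain n0 where n0: "!!n. n0 <= n ==> G (left_grid n s) s < e / 4" by (auto simp: eventually_sequentially)
   have "phi n s <= ennreal e" if n: "n0 <= n" for n
    unfolding phi_def
   proof (intro SUP_least ennreal_leI)
    fix n' assume "n' \<in> {n..}"
    then have n': "n0 <= n'" using n by simp
    have "G (left_grid n s) (left_grid n' s) <= (LINT w|M. 2 * (eta (left_grid n s) w - eta s w)^2 + 2 * (eta (left_grid n' s) w - eta s w)^2)"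
     unfolding G_def
    proof (rule integral_mono)
     fix w
     let ?a = "eta (left_grid n s) w - eta s w" and ?b = "eta (left_grid n' s) w - eta s w"
     have "0 <= (?a + ?b)^2" by simp
     then show "(eta (left_grid n s) w - eta (left_grid n' s) w)^2 <= 2 * ?a^2 + 2 * ?b^2"
      by (simp add: power2_eq_square algebra_simps)
    qed (use s l0 integrable_integrand_diff_square in auto)
    also have "... = 2 * G (left_grid n s) s + 2 * G (left_grid n' s) s"
     unfolding G_def using s l0 integrable_integrand_diff_square by simp
    also have "... <= e" using n0[OF n] n0[OF n'] by simp
    finally show "G (left_grid n s) (left_grid n' s) <= e" .
   qed
   then show "\<forall>\<^sub>F n in sequentially. phi n s <= ennreal e" unfolding eventually_sequentially by blast
  qed
 qed
 \<comment> \<open>The left-limit hypothesis concerns \<open>s > 0\<close>; this open interval and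
   the open cells \<open>J i\<close> below leave out only null sets.\<close>
 let ?I = "indicator {0<..<real H} :: real => ennreal"
 have "(%n. \<integral>\<^sup>+s. phi n s * ?I s \<partial>lborel) \<longlonglongrightarrow> (\<integral>\<^sup>+s. 0 \<partial>(lborel :: real measure))"
 proof (rule nn_integral_dominated_convergence[where w = "%s. ennreal (4 * C^2) * ?I s"])
  show "(%s. phi n s * ?I s) \<in> borel_measurable lborel" for n using phim by measurable
  show "AE s in lborel. phi n s * ?I s <= ennreal (4 * C^2) * ?I s" for n
  proof (intro AE_I2 mult_right_mono)
   fix s :: real
   show "phi n s <= ennreal (4 * C^2)"
    unfolding phi_def by (intro SUP_least ennreal_leI Gb) (auto simp: left_grid_def)
  qed simp
  show "(\<integral>\<^sup>+s. ennreal (4 * C^2) * ?I s \<partial>lborel) < \<infinity>"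
   by (subst nn_integral_cmult_indicator) (auto simp: ennreal_mult_less_top)
  show "AE s in lborel. (%n. phi n s * ?I s) \<longlonglongrightarrow> 0"
  proof (rule AE_I2)
   fix s :: real
   show "(%n. phi n s * ?I s) \<longlonglongrightarrow> 0"
    by (cases "s \<in> {0<..<real H}") (use lim[of s] in auto)
  qed
 qed auto
 then have "(%n. \<integral>\<^sup>+s. phi n s * ?I s \<partial>lborel) \<longlonglongrightarrow> 0" by simp
 then have "\<forall>\<^sub>F n in sequentially. (\<integral>\<^sup>+s. phi n s * ?I s \<partial>lborel) < ennreal e" by (rule order_tendstoD) (use e in simp)
 then obtain n0 where n0: "!!n. n0 <= n ==> (\<integral>\<^sup>+s. phi n s * ?I s \<partial>lborel) < ennreal e" by (auto simp: eventually_sequentially)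
 have "(\<Sum>i<H * 2^m. 1 / 2^m * G (left_grid n (real i / 2^m)) (left_grid n' (real i / 2^m))) <= e"
  if n: "n0 <= n" and nn: "n <= n'" and nm: "n' <= m" for n n' m
 proof -
  define c where "c i = ennreal (G (left_grid n (real i / 2^m)) (left_grid n' (real i / 2^m)))" for i :: nat
  define J where "J i = {real i / 2^m <..< real (Suc i) / 2^m}" for i :: nat
  have Jm: "emeasure lborel (J i) = ennreal (1 / 2^m)" for i
  proof -
   have "real i / 2^m <= real (Suc i) / 2^m" by (intro divide_right_mono) auto
   then show ?thesis by (simp add: J_def diff_divide_distrib[symmetric])
  qed
  have Ji: "i = nat \<lfloor>s * 2^m\<rfloor>" if "s \<in> J i" for i s
  proof -
   have "real i < s * 2^m" "s * 2^m < real i + 1" using that by (auto simp: J_def divide_less_eq less_divide_eq)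
   then have "\<lfloor>s * 2^m\<rfloor> = int i" by (intro floor_unique) auto
   then show ?thesis by simp
  qed
  have "ennreal (\<Sum>i<H * 2^m. 1 / 2^m * G (left_grid n (real i / 2^m)) (left_grid n' (real i / 2^m)))
   = (\<Sum>i<H * 2^m. c i * emeasure lborel (J i))"
  proof (subst sum_ennreal[symmetric])
   show "(\<Sum>i<H * 2^m. ennreal (1 / 2^m * G (left_grid n (real i / 2^m)) (left_grid n' (real i / 2^m))))
    = (\<Sum>i<H * 2^m. c i * emeasure lborel (J i))"
    unfolding c_def Jm by (intro sum.cong refl) (subst mult.commute, rule ennreal_mult'', simp)
  qed (use G0 in simp)
  also have "... = (\<Sum>i<H * 2^m. \<integral>\<^sup>+s. c i * indicator (J i) s \<partial>lborel)"
   by (intro sum.cong refl nn_integral_cmult_indicator[symmetric]) (simp add: J_def)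
  also have "... = (\<integral>\<^sup>+s. (\<Sum>i<H * 2^m. c i * indicator (J i) s) \<partial>lborel)"
   by (intro nn_integral_sum[symmetric]) (simp add: J_def)
  also have "... <= (\<integral>\<^sup>+s. phi n s * ?I s \<partial>lborel)"
  proof (rule nn_integral_mono)
   fix s :: real
   show "(\<Sum>i<H * 2^m. c i * indicator (J i) s) <= phi n s * ?I s"
   proof (cases "\<exists>i<H * 2^m. s \<in> J i")
    case False
    then show ?thesis by (subst sum.neutral) auto
   next
    case True
    then obtain i where i: "i < H * 2^m" "s \<in> J i" by blast
    have "0 <= real i / 2^m" by simp
    then have s0: "0 < s" using i(2) unfolding J_def by (simp only: greaterThanLessThan_iff) linarith
    have "real (Suc i) <= real (H * 2^m)" using i(1) by (intro of_nat_mono) simp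
    then have "real (Suc i) / 2^m <= real H" by (simp add: divide_le_eq)
    then have sH: "s < real H" using i(2) unfolding J_def by (simp only: greaterThanLessThan_iff) linarith
    have "(\<Sum>k<H * 2^m. c k * indicator (J k) s) = (\<Sum>k<H * 2^m. if k = i then c i else 0)"
    proof (intro sum.cong refl)
     fix k
     show "c k * indicator (J k) s = (if k = i then c i else 0)"
     proof (cases "k = i")
      case False
      then have "s \<notin> J k" using Ji[OF i(2)] Ji[of s k] by metis
      then show ?thesis using False by simp
     qed (use i(2) in simp)
    qed
    also have "... = c i" using i(1) by simp
    also have "c i = ennreal (G (left_grid n s) (left_grid n' s))"
     unfolding c_def Ji[OF i(2)] using left_grid_cell[of n m s] left_grid_cell[of n' m s] nn nm s0 by simp
    also have "... <= phi n s" unfolding phi_def using nn by (intro SUP_upper) simp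
    finally show ?thesis using s0 sH by simp
   qed
  qed
  also have "... < ennreal e" by (rule n0[OF n])
  finally show ?thesis using e by (simp add: ennreal_less_iff less_imp_le sum_nonneg G0)
 qed
 then show ?thesis unfolding G_def by blast
qed

text \<open>Testing with the sign at time \<open>t\<close>, the martingale property moves the
  comparison to the horizon \<open>H\<close>, where the isometry applies.\<close>

lemma ito_sum_L1_gap:
 assumes nm: "n <= m" "n' <= m" and t: "0 <= t" "t <= real H" and e: "0 < e"
  and gap: "(\<Sum>i<H * 2^m. 1 / 2^m * (LINT w|M. (eta (left_grid n (real i / 2^m)) w - eta (left_grid n' (real i / 2^m)) w)^2)) <= e^2"
 shows "(LINT w|M. abs (ito_sum eta n t w - ito_sum eta n' t w)) <= e"
proof -
 let ?Y = "%t w. ito_sum eta n t w - ito_sum eta n' t w"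
 have mart: "martingale M F (ito_sum eta k)" for k by (rule ito_sum_martingale[OF eta C])
 have int: "integrable M (ito_sum eta k s)" if "0 <= s" for k s using mart that by (simp add: martingale_def)
 have meas: "?Y t \<in> borel_measurable (F t)"
  using mart t by (intro borel_measurable_diff) (simp_all add: martingale_def adapted_def)
 define xi where "xi w = sgn (?Y t w)" for w
 have xi: "xi \<in> borel_measurable (F t)" unfolding xi_def[abs_def] by (rule measurable_compose[OF meas borel_measurable_sgn])
 have xib: "abs (xi w) <= 1" for w by (simp add: xi_def sgn_if)
 have i: "integrable M (%w. xi w * ito_sum eta k s w)" if "0 <= s" for k s
  by (rule integrable_bounded_mult[OF int[OF that] measurable_F[OF xi t(1)] xib])
 have "(LINT w|M. abs (?Y t w)) = (LINT w|M. xi w * ito_sum eta n t w - xi w * ito_sum eta n' t w)"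
  by (intro leb_integral_cong refl) (auto simp: xi_def sgn_if algebra_simps)
 also have "... = (LINT w|M. xi w * ito_sum eta n (real H) w - xi w * ito_sum eta n' (real H) w)"
  using i[OF t(1)] i[of "real H"] martingaleD[OF mart t xi xib] by simp
 also have "... <= (LINT w|M. abs (?Y (real H) w))"
 proof (rule integral_mono)
  show "integrable M (%w. xi w * ito_sum eta n (real H) w - xi w * ito_sum eta n' (real H) w)"
   by (intro leb_integrable_diff i) auto
  show "integrable M (%w. abs (?Y (real H) w))" using int[of "real H"] by simp
  fix w
  have "xi w * ito_sum eta n (real H) w - xi w * ito_sum eta n' (real H) w <= abs (xi w) * abs (?Y (real H) w)"
   by (metis abs_ge_self abs_mult right_diff_distrib)
  also have "... <= 1 * abs (?Y (real H) w)" by (intro mult_right_mono xib) simp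
  finally show "xi w * ito_sum eta n (real H) w - xi w * ito_sum eta n' (real H) w <= abs (?Y (real H) w)" by simp
 qed
 also have "... <= e"
  using gap ito_sum_gap(1,2)[OF nm, of H] int[of "real H"]
  by (intro L2_imp_L1(2)[OF _ _ e] borel_measurable_diff borel_measurable_integrable) auto
 finally show ?thesis .
qed

lemma ito_sum_L1_cauchy:
 assumes LC: "!!s. 0 < s ==> AE w in M. (%n. eta (left_grid n s) w) \<longlonglongrightarrow> eta s w" and e: "0 < e" and t: "0 <= t"
 shows "\<exists>n0. \<forall>n\<ge>n0. \<forall>n'\<ge>n. (LINT w|M. abs (ito_sum eta n t w - ito_sum eta n' t w)) <= e"
proof -
 obtain H :: nat where H: "t <= real H" using real_arch_simple by blast
 have "0 < e^2" using e by simp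
 from integrand_gap_small[OF LC this, of H] obtain n0 where n0: "!!n n'. n0 <= n ==> n <= n' ==>
  (\<Sum>i<H * 2^n'. 1 / 2^n' * (LINT w|M. (eta (left_grid n (real i / 2^n')) w - eta (left_grid n' (real i / 2^n')) w)^2)) <= e^2"
  by blast
 show ?thesis
  by (intro exI[of _ n0] allI impI ito_sum_L1_gap[OF _ _ t H e n0]) auto
qed

text \<open>By continuity of the sums, a violation at a real time shows at a dyadic time of some
  level; the dyadic events increase with the level, and each obeys the discrete maximal inequality
  once the level is fine enough.\<close>

lemma ito_sum_maximal:
 assumes l: "0 < l" and gap: "!!m. m >= max n n' ==>
  (\<Sum>i<H * 2^m. 1 / 2^m * (LINT w|M. (eta (left_grid n (real i / 2^m)) w - eta (left_grid n' (real i / 2^m)) w)^2)) <= e"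
 shows "{w\<in>space M. \<exists>t\<in>{0..real H}. l < abs (ito_sum eta n t w - ito_sum eta n' t w)} \<in> sets M"
  and "prob {w\<in>space M. \<exists>t\<in>{0..real H}. l < abs (ito_sum eta n t w - ito_sum eta n' t w)} <= e / l^2"
proof -
 define E where "E m = {w\<in>space M. \<exists>j\<le>H * 2^m. l < abs (ito_sum eta n (real j / 2^m) w - ito_sum eta n' (real j / 2^m) w)}" for m
 have im: "ito_sum eta k s \<in> borel_measurable M" if "0 <= s" for k s
  using ito_sum_martingale[OF eta C, of k] that by (simp add: martingale_def borel_measurable_integrable)
 have E: "E m \<in> sets M" for m
 proof -
  have "(%w. abs (ito_sum eta n (real j / 2^m) w - ito_sum eta n' (real j / 2^m) w)) \<in> borel_measurable M" for j
   by (intro borel_measurable_abs borel_measurable_diff im) auto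
  then have "Measurable.pred M (%w. l < abs (ito_sum eta n (real j / 2^m) w - ito_sum eta n' (real j / 2^m) w))" for j
   by measurable
  then have "Measurable.pred M (%w. \<exists>j. j <= H * 2^m & l < abs (ito_sum eta n (real j / 2^m) w - ito_sum eta n' (real j / 2^m) w))"
   by (intro pred_intros_countable(2) pred_intros_logic(3)) auto
  then show ?thesis unfolding E_def by (rule predE)
 qed
 have eq: "{w\<in>space M. \<exists>t\<in>{0..real H}. l < abs (ito_sum eta n t w - ito_sum eta n' t w)} = (\<Union>m. E m)"
 proof (intro set_eqI iffI)
  fix w assume "w \<in> (\<Union>m. E m)"
  then obtain m j where mj: "w \<in> space M" "j <= H * 2^m" "l < abs (ito_sum eta n (real j / 2^m) w - ito_sum eta n' (real j / 2^m) w)"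
   by (auto simp: E_def)
  have "real j <= real (H * 2^m)" using mj(2) by (rule of_nat_mono)
  then have "real j / 2^m <= real H" by (simp add: divide_le_eq)
  then show "w \<in> {w\<in>space M. \<exists>t\<in>{0..real H}. l < abs (ito_sum eta n t w - ito_sum eta n' t w)}" using mj by auto
 next
  fix w assume "w \<in> {w\<in>space M. \<exists>t\<in>{0..real H}. l < abs (ito_sum eta n t w - ito_sum eta n' t w)}"
  then obtain t where t: "w \<in> space M" "0 <= t" "t <= real H" "l < abs (ito_sum eta n t w - ito_sum eta n' t w)" by auto
  have "continuous_on {0..} (%t. abs (ito_sum eta n t w - ito_sum eta n' t w))"
   by (intro continuous_on_rabs continuous_on_diff ito_sum_continuous t)
  then have "(%m. abs (ito_sum eta n (left_grid m t) w - ito_sum eta n' (left_grid m t) w)) \<longlonglongrightarrow> abs (ito_sum eta n t w - ito_sum eta n' t w)"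
   by (rule continuous_on_tendsto_compose[OF _ left_grid_tendsto[OF t(2)]]) (use t(2) in \<open>auto simp: left_grid_def\<close>)
  then have "\<forall>\<^sub>F m in sequentially. l < abs (ito_sum eta n (left_grid m t) w - ito_sum eta n' (left_grid m t) w)"
   by (rule order_tendstoD(1)) (rule t(4))
  then obtain m where m: "l < abs (ito_sum eta n (left_grid m t) w - ito_sum eta n' (left_grid m t) w)"
   by (auto simp: eventually_sequentially)
  have "t * 2^m <= real H * 2^m" using t(3) by simp
  then have "\<lfloor>t * 2^m\<rfloor> <= \<lfloor>real_of_int (int (H * 2^m))\<rfloor>" by (intro floor_mono) simp
  then have "nat \<lfloor>t * 2^m\<rfloor> <= H * 2^m" unfolding floor_of_int by (simp only: nat_le_iff)
  then have "w \<in> E m" using m t(1) by (auto simp: E_def left_grid_def)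
  then show "w \<in> (\<Union>m. E m)" by blast
 qed
 show "{w\<in>space M. \<exists>t\<in>{0..real H}. l < abs (ito_sum eta n t w - ito_sum eta n' t w)} \<in> sets M"
  unfolding eq using E by blast
 have inc: "incseq E"
 proof (rule incseq_SucI, rule subsetI)
  fix m w assume "w \<in> E m"
  then obtain j where "w \<in> space M" "j <= H * 2^m" "l < abs (ito_sum eta n (real j / 2^m) w - ito_sum eta n' (real j / 2^m) w)"
   by (auto simp: E_def)
  moreover have "real j / 2^m = real (2 * j) / 2^Suc m" by simp
  ultimately show "w \<in> E (Suc m)" unfolding E_def by (intro CollectI conjI exI[of _ "2 * j"]) (auto simp del: of_nat_mult)
 qed
 have "(%m. prob (E m)) \<longlonglongrightarrow> prob (\<Union>m. E m)" by (rule finite_Lim_measure_incseq) (use E inc in auto)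
 moreover have "prob (E m) <= e / l^2" if "max n n' <= m" for m
 proof -
  have "prob (E m) <= (\<Sum>i<H * 2^m. 1 / 2^m * (LINT w|M. (eta (left_grid n (real i / 2^m)) w - eta (left_grid n' (real i / 2^m)) w)^2)) / l^2"
   unfolding E_def using that l by (intro ito_sum_gap(3)) auto
  also have "... <= e / l^2" using gap[OF that] by (intro divide_right_mono) auto
  finally show ?thesis .
 qed
 ultimately show "prob {w\<in>space M. \<exists>t\<in>{0..real H}. l < abs (ito_sum eta n t w - ito_sum eta n' t w)} <= e / l^2"
  unfolding eq by (intro LIMSEQ_le_const2[OF _ exI[of _ "max n n'"]]) auto
qed

end

end

lemma geometric_increments_uniformly_convergent:
 fixes f :: "nat => real => real"
 assumes "\<forall>\<^sub>F k in sequentially. \<forall>t\<in>S. abs (f k t - f (Suc k) t) <= (1/2)^k"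
 shows "uniformly_convergent_on S f"
proof (rule Cauchy_uniformly_convergent, rule uniformly_Cauchy_onI')
 fix e :: real assume e: "0 < e"
 obtain K where K: "!!k t. K <= k ==> t \<in> S ==> abs (f k t - f (Suc k) t) <= (1/2)^k"
  using assms by (auto simp: eventually_sequentially)
 have tele: "abs (f n t - f (n + j) t) <= 2 * (1/2)^n - 2 * (1/2)^(n + j)" if "K <= n" "t \<in> S" for n j t
 proof (induction j)
  case (Suc j)
  then show ?case using K[of "n + j" t] that by (simp add: abs_le_iff)
 qed simp
 have "(%n. 2 * (1/2)^n :: real) \<longlonglongrightarrow> 2 * 0" by (intro tendsto_intros) auto
 then have "\<forall>\<^sub>F n in sequentially. 2 * (1/2)^n < e" by (rule order_tendstoD) (use e in simp)
 then obtain N where N: "!!n. N <= n ==> 2 * (1/2)^n < e" by (auto simp: eventually_sequentially)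
 show "\<exists>M. \<forall>t\<in>S. \<forall>m\<ge>M. \<forall>n>m. dist (f m t) (f n t) < e"
 proof (intro exI ballI allI impI)
  fix t m n assume h: "t \<in> S" "max K N <= m" "m < n"
  then obtain j where j: "n = m + j" using less_imp_add_positive by blast
  have "abs (f m t - f n t) <= 2 * (1/2)^m - 2 * (1/2)^n" unfolding j by (rule tele) (use h in auto)
  also have "... < e" using N[of m] h by (smt (verit) max.boundedE zero_le_power half_gt_zero_iff)
  finally show "dist (f m t) (f n t) < e" by (simp add: dist_real_def)
 qed
qed

context brownian
begin

text \<open>One subsequence has to serve all integrands \<open>eta q\<close>. The level
  \<open>r k\<close> is fine enough for every \<open>q <= k\<close>, so for each \<open>q\<close>
  all but finitely many steps are controlled, and Borel-Cantelli gives locally uniform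
  convergence.\<close>

lemma ito_sums_converge:
 fixes eta :: "nat => real => 'a => real" and C :: "nat => real"
 assumes eta: "!!q. adapted F (eta q)" and C: "!!q t w. w \<in> space M ==> abs (eta q t w) <= C q"
  and LC: "!!q s. 0 < s ==> AE w in M. (%n. eta q (left_grid n s) w) \<longlonglongrightarrow> eta q s w"
 obtains r :: "nat => nat" where "strict_mono r"
  "AE w in M. \<forall>q H. uniformly_convergent_on {0..real H} (%n t. ito_sum (eta q) (r n) t w)"
proof -
 define gap where "gap q n n' m H = (\<Sum>i<H * 2^m. 1 / 2^m *
  (LINT w|M. (eta q (left_grid n (real i / 2^m)) w - eta q (left_grid n' (real i / 2^m)) w)^2))" for q n n' m H
 \<comment> \<open>Divided by the square of the threshold \<open>(1/2)^k\<close>, the gap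
   \<open>(1/8)^k\<close> leaves the summable \<open>(1/2)^k\<close>.\<close>
 have "\<exists>n0. \<forall>n\<ge>n0. \<forall>n'\<ge>n. \<forall>m\<ge>n'. gap q n n' m k <= (1/8)^k" for q k
  unfolding gap_def by (rule integrand_gap_small[OF eta C LC]) auto
 then obtain \<rho> where \<rho>: "!!q k n n' m. \<rho> q k <= n ==> n <= n' ==> n' <= m ==> gap q n n' m k <= (1/8)^k" by metis
 \<comment> \<open>The nested sums force strict growth and domination of \<open>\<rho> q k\<close>
   for all \<open>q <= k\<close> at once.\<close>
 define r where "r k = (\<Sum>i\<le>k. Suc (\<Sum>q\<le>i. \<rho> q i))" for k
 have r: "strict_mono r" by (rule strict_monoI_Suc) (simp add: r_def)
 have r_ge: "\<rho> q k <= r k" if "q <= k" for q k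
 proof -
  have "\<rho> q k <= (\<Sum>q\<le>k. \<rho> q k)" using that by (intro member_le_sum) auto
  also have "... <= Suc (\<Sum>q\<le>k. \<rho> q k)" by simp
  also have "... <= r k" unfolding r_def by (rule member_le_sum[where f = "%i. Suc (\<Sum>q\<le>i. \<rho> q i)"]) auto
  finally show ?thesis .
 qed
 define E where "E q k = {w\<in>space M. \<exists>t\<in>{0..real k}. (1/2)^k < abs (ito_sum (eta q) (r k) t w - ito_sum (eta q) (r (Suc k)) t w)}" for q k
 have g: "gap q (r k) (r (Suc k)) m k <= (1/8)^k" if "q <= k" "max (r k) (r (Suc k)) <= m" for q k m
 proof (rule \<rho>[OF r_ge[OF that(1)]])
  show "r k <= r (Suc k)" using r by (simp add: strict_mono_less_eq)
  show "r (Suc k) <= m" using that by simp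
 qed
 have E: "E q k \<in> sets M" "prob (E q k) <= (1/2)^k" if "q <= k" for q k
 proof -
  have p: "0 < (1/2::real)^k" by simp
  show "E q k \<in> sets M"
   unfolding E_def by (rule ito_sum_maximal(1)[OF eta C p, where e = "(1/8)^k"]) (use g[OF that] gap_def in auto)
  have "prob (E q k) <= (1/8)^k / ((1/2)^k)^2"
   unfolding E_def by (rule ito_sum_maximal(2)[OF eta C p]) (use g[OF that] gap_def in auto)
  also have "... = (1/2)^k"
  proof -
   have "((1/2::real)^k)^2 = (1/4)^k" by (simp add: power_mult[symmetric] power_mult mult.commute power2_eq_square flip: power_mult_distrib)
   then show ?thesis by (simp add: power_divide[symmetric])
  qed
  finally show "prob (E q k) <= (1/2)^k" .
 qed
 \<comment> \<open>The shift by \<open>q\<close> skips the indices \<open>k < q\<close>, for which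
   no bound is available.\<close>
 have "AE w in M. \<forall>\<^sub>F k in sequentially. w \<in> space M - E q (k + q)" for q
 proof (rule borel_cantelli_AE1)
  show "E q (k + q) \<in> sets M" for k by (rule E) simp
  show "emeasure M (E q (k + q)) < \<infinity>" for k by (simp add: less_top[symmetric])
  show "summable (%k. measure M (E q (k + q)))"
  proof (rule summable_comparison_test')
   show "summable (%k. (1/2::real)^(k + q))"
    using summable_geometric[of "1/2::real"] by (subst summable_iff_shift) simp
   show "norm (measure M (E q (k + q))) <= (1/2)^(k + q)" if "0 <= k" for k using E(2)[of q "k + q"] by simp
  qed
 qed
 then have "AE w in M. \<forall>q. \<forall>\<^sub>F k in sequentially. w \<in> space M - E q (k + q)" by (subst AE_all_countable) blast
 then have "AE w in M. \<forall>q H. uniformly_convergent_on {0..real H} (%n t. ito_sum (eta q) (r n) t w)"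
 proof eventually_elim
  case (elim w)
  show ?case
  proof (intro allI geometric_increments_uniformly_convergent)
   fix q H
   have "\<forall>\<^sub>F k in sequentially. w \<in> space M - E q (k + q)" using elim by blast
   then have "\<forall>\<^sub>F k in sequentially. w \<in> space M - E q k"
    by (subst eventually_sequentially_seg[symmetric, of _ q])
   then show "\<forall>\<^sub>F k in sequentially. \<forall>t\<in>{0..real H}. abs (ito_sum (eta q) (r k) t w - ito_sum (eta q) (r (Suc k)) t w) <= (1/2)^k"
    using eventually_ge_at_top[of H]
   proof eventually_elim
    case (elim k)
    then have "!!t. t \<in> {0..real H} ==> t \<in> {0..real k}" by auto
    then show ?case using elim(1) unfolding E_def by (auto simp: not_less)
   qed
  qed
 qed
 with r show ?thesis by (rule that)
qed

end

section \<open>Exit times from compact subintervals of the positive half-line\<close>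

lemma ereal_le_less_trans: "s <= t ==> ereal t < x ==> ereal s < x"
 by (meson ereal_less_eq(3) le_less_trans)

context brownian
begin

lemma AE_B_neq:
 assumes t: "0 < t"
 shows "AE w in M. B t w \<noteq> c"
proof -
 have D: "distributed M lborel (%w. B t w - B 0 w) (normal_density 0 (sqrt (t - 0)))"
  by (rule B_increment_distributed) (use t in auto)
 have "AE x in lborel. x \<noteq> c - x0" by (rule AE_lborel_singleton)
 then have "AE x in lborel. 0 < ennreal (normal_density 0 (sqrt (t - 0)) x) --> x \<noteq> c - x0" by eventually_elim simp
 then have "AE x in distr M lborel (%w. B t w - B 0 w). x \<noteq> c - x0"
  unfolding distributed_distr_eq_density[OF D] by (subst AE_density) (auto intro: distributed_borel_measurable[OF D])
 then have "AE w in M. B t w - B 0 w \<noteq> c - x0"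
  by (subst (asm) AE_distr_iff) (auto intro!: borel_measurable_diff B_measurable less_imp_le[OF t])
 then show ?thesis using AE_space by eventually_elim (use B_0 in auto)
qed

lemma AE_B_notin_countable:
 assumes t: "0 < t" and "countable A"
 shows "AE w in M. B t w \<notin> A"
proof -
 have "AE w in M. \<forall>c\<in>A. B t w \<noteq> c" by (subst AE_ball_countable[OF assms(2)]) (use AE_B_neq[OF t] in blast)
 then show ?thesis by eventually_elim auto
qed

definition lower :: "nat => real" where "lower l = x0 / (real l + 2)"
definition upper :: "nat => real" where "upper k = x0 + 1 + real k"

lemma lower_pos: "0 < lower l" and lower_less: "lower l < x0" and upper_greater: "x0 < upper k"
proof -
 show "0 < lower l" "x0 < upper k" using x0_pos by (auto simp: lower_def upper_def)
 have "x0 * 1 < x0 * (real l + 2)" using x0_pos by (intro mult_strict_left_mono) auto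
 then show "lower l < x0" by (simp add: lower_def divide_less_eq)
qed

lemma lower_small: "0 < e ==> \<exists>l0. \<forall>l\<ge>l0. lower l < e"
proof -
 assume e: "0 < e"
 obtain l0 :: nat where l0: "x0 / e < real l0" using reals_Archimedean2 by blast
 have "lower l < e" if "l0 <= l" for l
 proof -
  have "real l0 <= real l" using that by simp
  then have "x0 / e < real l + 2" using l0 by linarith
  then show ?thesis using e by (simp add: lower_def divide_less_eq mult.commute)
 qed
 then show ?thesis by blast
qed

text \<open>Encoded through a single real process, so that the results on zeros apply; the product
  vanishes exactly at the two levels.\<close>

definition exit :: "nat => nat => 'a => ereal" where
 "exit l k = hitting_time (%t w. (B t w - lower l) * (upper k - B t w)) 0"

lemma exit_stopping_time: "stopping_time_ext M F (exit l k)"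
proof -
 have "adapted F (%t w. (B t w - lower l) * (upper k - B t w))"
  unfolding adapted_def by (intro allI impI borel_measurable_times borel_measurable_diff B_adapted borel_measurable_const)
 then have "stopping_time_ext M F (%w. Inf {ereal t |t. 0 <= t & (B t w - lower l) * (upper k - B t w) = 0})"
  by (rule hit_zero_stopping_time) (intro continuous_on_mult continuous_on_diff continuous_on_const B_continuous)
 then show ?thesis by (simp add: exit_def hitting_time_def[abs_def])
qed

lemma exit_nonneg: "0 <= exit l k w"
 unfolding exit_def hitting_time_def by (intro Inf_greatest) auto

lemma exit_le_iff:
 assumes w: "w \<in> space M" and t: "0 <= t"
 shows "exit l k w <= ereal t \<longleftrightarrow> (\<exists>s\<in>{0..t}. B s w = lower l \<or> B s w = upper k)"
proof -
 have "continuous_on {0..} (%t. (B t w - lower l) * (upper k - B t w))"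
  by (intro continuous_on_mult continuous_on_diff continuous_on_const B_continuous w)
 from hit_zero_le_iff[where Y = "%t w. (B t w - lower l) * (upper k - B t w)", OF this t]
 show ?thesis unfolding exit_def hitting_time_def by (simp only: mult_eq_0_iff right_minus_eq eq_commute[of "upper k"])
qed

lemma before_exit_iff:
 assumes w: "w \<in> space M" and t: "0 <= t"
 shows "ereal t < exit l k w \<longleftrightarrow> (\<forall>s\<in>{0..t}. lower l < B s w & B s w < upper k)"
proof
 assume "\<forall>s\<in>{0..t}. lower l < B s w & B s w < upper k"
 then show "ereal t < exit l k w" using exit_le_iff[OF assms, of l k] by (force simp: not_le[symmetric])
next
 assume "ereal t < exit l k w"
 then have ne: "B s w \<noteq> lower l" "B s w \<noteq> upper k" if "s \<in> {0..t}" for s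
  using exit_le_iff[OF assms, of l k] that by auto
 show "\<forall>s\<in>{0..t}. lower l < B s w & B s w < upper k"
 proof (intro ballI conjI)
  fix s assume s: "s \<in> {0..t}"
  have c: "continuous_on {0..s} (%t. B t w)" by (rule continuous_on_subset[OF B_continuous[OF w]]) auto
  show "lower l < B s w"
  proof (rule ccontr)
   assume "\<not> lower l < B s w"
   then obtain u where "0 <= u" "u <= s" "B u w = lower l"
    using IVT2'[of "%t. B t w" s "lower l" 0] B_0[OF w] lower_less[of l] s c by auto
   then show False using ne(1)[of u] s by auto
  qed
  show "B s w < upper k"
  proof (rule ccontr)
   assume "\<not> B s w < upper k"
   then obtain u where "0 <= u" "u <= s" "B u w = upper k"
    using IVT'[of "%t. B t w" 0 "upper k" s] B_0[OF w] upper_greater[of k] s c by auto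
   then show False using ne(2)[of u] s by auto
  qed
 qed
qed

lemma exit_le_hitting_time:
 assumes w: "w \<in> space M"
 shows "exit l k w <= H0 w"
proof (rule ccontr)
 assume *: "\<not> exit l k w <= H0 w"
 then obtain r where r: "H0 w = ereal r" "0 <= r" using hitting_time_nonneg[of w] by (cases "H0 w") auto
 then have "SB r w = 0" by (intro hitting_time_attained[OF w]) auto
 then have "B r w = 0" using stopped_before[of r H0 w B] r by simp
 moreover have "lower l < B r w" using * r before_exit_iff[OF w r(2), of l k] by (simp add: not_le)
 ultimately show False using lower_pos[of l] by linarith
qed

text \<open>Up to \<open>t\<close> the path has a positive minimum, and \<open>lower l\<close> falls
  below it.\<close>

lemma before_exit_exhaust:
 assumes w: "w \<in> space M" and t: "0 <= t" "ereal t < H0 w" and bd: "!!s. s \<in> {0..t} ==> B s w < upper k"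
 shows "\<exists>l0. \<forall>l\<ge>l0. ereal t < exit l k w"
proof -
 have c: "continuous_on {0..t} (%t. B t w)" by (rule continuous_on_subset[OF B_continuous[OF w]]) auto
 obtain u where u: "u \<in> {0..t}" "!!s. s \<in> {0..t} ==> B u w <= B s w"
  using continuous_attains_inf[OF compact_Icc _ c] t(1) by auto
 have "ereal u < H0 w" using u(1) by (intro ereal_le_less_trans[OF _ t(2)]) simp
 then have "0 < B u w" using u(1) by (intro B_pos_before_hitting[OF w]) auto
 from lower_small[OF this] obtain l0 where "\<forall>l\<ge>l0. lower l < B u w" by blast
 then have "ereal t < exit l k w" if "l0 <= l" for l
  unfolding before_exit_iff[OF w t(1)] using that u(2) bd by (auto intro: less_le_trans)
 then show ?thesis by blast
qed

lemma B_bounded_path: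
 assumes w: "w \<in> space M"
 shows "\<exists>k0. \<forall>k\<ge>k0. \<forall>s\<in>{0..t}. B s w < upper k"
proof -
 have c: "continuous_on {0..t} (%t. B t w)" by (rule continuous_on_subset[OF B_continuous[OF w]]) auto
 from compact_imp_bounded[OF compact_continuous_image[OF c compact_Icc]]
 obtain K where K: "!!s. s \<in> {0..t} ==> B s w <= K" unfolding bounded_real by (force simp: abs_le_iff)
 obtain k0 :: nat where k0: "K < real k0" using reals_Archimedean2 by blast
 have "B s w < upper k" if "k0 <= k" "s \<in> {0..t}" for k s
  using K[OF that(2)] k0 that(1) x0_pos of_nat_mono[OF that(1), where 'a = real] by (simp add: upper_def)
 then show ?thesis by blast
qed

text \<open>The sequence \<open>exit q q\<close> covers all times before \<open>H0\<close>, so a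
  countable family of integrands suffices.\<close>

lemma before_exit_diagonal:
 assumes w: "w \<in> space M" and t: "0 <= t" "ereal t < H0 w"
 shows "\<exists>q. ereal t < exit q q w"
proof -
 obtain k0 where k0: "!!k s. k0 <= k ==> s \<in> {0..t} ==> B s w < upper k" using B_bounded_path[OF w, of t] by blast
 from before_exit_exhaust[OF w t k0[OF order_refl]] obtain l0 where "\<forall>l\<ge>l0. ereal t < exit l k0 w" by blast
 then have "ereal t < exit (max l0 k0) k0 w" by simp
 then have "ereal t < exit (max l0 k0) (max l0 k0) w"
  unfolding before_exit_iff[OF w t(1)] using k0[of "max l0 k0"] by auto
 then show ?thesis ..
qed

end

section \<open>Convex functions of Brownian motion\<close>

locale convex_tanaka = brownian +
 fixes h :: "real => real"
 assumes h_convex: "convex_on {0..} h" and h_continuous: "continuous_on {0..} h"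
begin

lemma h_convex_pos: "convex_on {0<..} h"
 by (rule convex_on_subset[OF h_convex]) auto

text \<open>The value \<open>0\<close> off \<open>(0,\<infinity>)\<close> gives a Borel function on
  the whole line.\<close>

definition D :: "real => real" where "D x = (if 0 < x then right_derivative h x else 0)"

lemma D_support: "0 < x ==> 0 < y ==> h x + D x * (y - x) <= h y"
 using convex_pos_support[OF h_convex_pos] by (simp add: D_def)

lemma D_mono: "0 < x ==> x <= y ==> D x <= D y"
 using right_derivative_mono_convex[OF h_convex_pos, of x y] by (simp add: D_def)

lemma D_mono_on: "mono_on {0<..} D"
 by (auto intro!: mono_onI D_mono)

lemma D_measurable: "D \<in> borel_measurable borel"
proof -
 have "(%x. indicator {0<..} x *\<^sub>R D x) \<in> borel_measurable borel"
  using borel_measurable_mono_on_fnc[OF D_mono_on] by (subst (asm) borel_measurable_restrict_space_iff) auto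
 moreover have "(%x. indicator {0<..} x *\<^sub>R D x) = D" by (auto simp: D_def fun_eq_iff split: split_indicator)
 ultimately show ?thesis by (simp only:)
qed

definition integrand :: "nat => nat => real => 'a => real" where
 "integrand l k t w = (if 0 <= t & ereal t < exit l k w then D (B t w) else 0)"

lemma integrand_adapted: "adapted F (integrand l k)"
 unfolding adapted_def
proof (intro allI impI)
 fix t :: real assume t: "0 <= t"
 have P: "Measurable.pred (F t) (%w. exit l k w <= ereal t)"
  using exit_stopping_time t by (simp add: stopping_time_ext_def)
 have "(%w. if exit l k w <= ereal t then 0 else D (B t w)) \<in> borel_measurable (F t)"
  by (intro measurable_If borel_measurable_const measurable_compose[OF B_adapted[OF t] D_measurable] predE P)
 moreover have "integrand l k t = (%w. if exit l k w <= ereal t then 0 else D (B t w))"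
  using t by (auto simp: integrand_def fun_eq_iff)
 ultimately show "integrand l k t \<in> borel_measurable (F t)" by simp
qed

lemma integrand_bounded:
 assumes "w \<in> space M"
 shows "abs (integrand l k t w) <= abs (D (lower l)) + abs (D (upper k))"
proof (cases "0 <= t & ereal t < exit l k w")
 case True
 then have "lower l < B t w" "B t w < upper k" using before_exit_iff[OF assms, of t l k] by auto
 then have "D (lower l) <= D (B t w)" "D (B t w) <= D (upper k)" using lower_pos[of l] by (auto intro!: D_mono)
 then show ?thesis using True by (auto simp: integrand_def)
qed (auto simp: integrand_def)

text \<open>Being monotone, \<open>D\<close> has countably many discontinuities; at a fixed time
  \<open>B s\<close> almost surely avoids them as well as the two exit levels. So the integrand
  converges along the grid both before and after the exit.\<close>

lemma integrand_left_continuous: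
 assumes s: "0 < s"
 shows "AE w in M. (%n. integrand l k (left_grid n s) w) \<longlonglongrightarrow> integrand l k s w"
proof -
 have "countable {a\<in>{0<..}. \<not> isCont D a}" by (rule mono_on_ctble_discont_open[OF open_greaterThan D_mono_on])
 then have "countable ({a\<in>{0<..}. \<not> isCont D a} \<union> {lower l, upper k})" by simp
 from AE_B_notin_countable[OF s this] show ?thesis
  using AE_space
 proof eventually_elim
  case (elim w)
  have lg: "0 <= left_grid n s" "left_grid n s <= s" for n using left_grid_bounds[of s n] s by auto
  have lim: "(%n. left_grid n s) \<longlonglongrightarrow> s" using s by (intro left_grid_tendsto) simp
  show ?case
  proof (cases "ereal s < exit l k w")
   case True
   have "lower l < B s w" using before_exit_iff[OF elim(2), of s l k] True s by auto
   then have "isCont D (B s w)" using elim(1) lower_pos[of l] by auto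
   moreover have "(%n. B (left_grid n s) w) \<longlonglongrightarrow> B s w"
    by (rule continuous_on_tendsto_compose[OF B_continuous[OF elim(2)] lim]) (use lg s in auto)
   ultimately have "(%n. D (B (left_grid n s) w)) \<longlonglongrightarrow> D (B s w)" by (rule isCont_tendsto_compose)
   moreover have "integrand l k (left_grid n s) w = D (B (left_grid n s) w)" for n
    using lg[of n] ereal_le_less_trans[OF lg(2) True, of n] by (simp add: integrand_def)
   moreover have "integrand l k s w = D (B s w)" using True s by (simp add: integrand_def)
   ultimately show ?thesis by simp
  next
   case False
   then obtain u where u: "u \<in> {0..s}" "B u w = lower l \<or> B u w = upper k"
    using exit_le_iff[OF elim(2), of s l k] s by auto
   then have "u \<noteq> s" using elim(1) by auto
   then have "u < s" using u(1) by simp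
   then have "\<forall>\<^sub>F n in sequentially. u < left_grid n s" by (rule order_tendstoD(1)[OF lim])
   then have "\<forall>\<^sub>F n in sequentially. integrand l k s w = integrand l k (left_grid n s) w"
   proof eventually_elim
    case (elim n)
    have "exit l k w <= ereal (left_grid n s)"
     using u elim lg[of n] exit_le_iff[OF \<open>w \<in> space M\<close> lg(1), of l k n] by (auto intro!: bexI[of _ u])
    then show ?case using False by (auto simp: integrand_def dest: leD)
   qed
   then show ?thesis by (rule Lim_transform_eventually[OF tendsto_const])
  qed
 qed
qed

text \<open>One process for all \<open>l\<close> and \<open>k\<close>: up to the exit it agrees with
  the sums of the truncated integrands, which makes the limits for growing intervals
  consistent.\<close>

definition NN :: "nat => real => 'a => real" where "NN = ito_sum (%t w. D (B t w))"

lemma NN_eq_before_exit: "ereal t <= exit l k w ==> NN n t w = ito_sum (integrand l k) n t w"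
 unfolding NN_def by (rule ito_sum_cong_before) (auto simp: integrand_def not_less dest: order_trans[of "ereal t"])

text \<open>A single subsequence, fixed once by choice, so that limits for different intervals are
  compatible.\<close>

definition r :: "nat => nat" where
 "r = (SOME r. strict_mono r & (AE w in M. \<forall>q H. uniformly_convergent_on {0..real H} (%n t. ito_sum (integrand q q) (r n) t w)))"

lemma r: "strict_mono r" "AE w in M. \<forall>q H. uniformly_convergent_on {0..real H} (%n t. ito_sum (integrand q q) (r n) t w)"
proof -
 obtain r' :: "nat => nat" where "strict_mono r'"
  "AE w in M. \<forall>q H. uniformly_convergent_on {0..real H} (%n t. ito_sum (integrand q q) (r' n) t w)"
  by (rule ito_sums_converge[where eta = "%q. integrand q q" and C = "%q. abs (D (lower q)) + abs (D (upper q))"])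
   (use integrand_adapted integrand_bounded integrand_left_continuous in auto)
 then have "\<exists>r. strict_mono r & (AE w in M. \<forall>q H. uniformly_convergent_on {0..real H} (%n t. ito_sum (integrand q q) (r n) t w))" by blast
 from someI_ex[OF this] show "strict_mono r" "AE w in M. \<forall>q H. uniformly_convergent_on {0..real H} (%n t. ito_sum (integrand q q) (r n) t w)"
  unfolding r_def by blast+
qed

definition good :: "'a => bool" where
 "good w \<longleftrightarrow> w \<in> space M & (\<forall>q H. uniformly_convergent_on {0..real H} (%n t. ito_sum (integrand q q) (r n) t w))"

lemma AE_good: "AE w in M. good w"
 using r(2) AE_space unfolding good_def by eventually_elim blast

lemma h_max_continuous: "continuous_on UNIV (%x. h (max 0 x))"
 by (rule continuous_on_compose2[OF h_continuous]) (auto intro!: continuous_intros)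

text \<open>A limit formula for every outcome, hence adapted to the raw filtration;
  \<open>max 0\<close> extends \<open>h\<close> to the negative values that \<open>B\<close> may
  take after \<open>H0\<close>.\<close>

definition A :: "real => 'a => real" where
 "A t w = lim (%n. h (max 0 (B t w)) - h x0 - NN (r n) t w)"

lemma NN_adapted: "0 <= t ==> NN n t \<in> borel_measurable (F t)"
proof -
 assume t: "0 <= t"
 have dt: "real i / 2^n <= t" if "i < nat \<lceil>t * 2^n\<rceil>" for i
 proof -
  have "real i <= t * 2^n" using that by linarith
  then show ?thesis by (simp add: divide_le_eq)
 qed
 show ?thesis
  unfolding NN_def ito_sum_def[abs_def]
  by (intro borel_measurable_sum borel_measurable_times borel_measurable_diff B_adapted_mono
    measurable_compose[OF B_adapted_mono D_measurable]) (use t in \<open>auto intro: dt\<close>)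
qed

lemma A_adapted: "0 <= t ==> A t \<in> borel_measurable (F t)"
 unfolding A_def[abs_def]
 by (intro borel_measurable_lim_metric borel_measurable_diff NN_adapted borel_measurable_const
   measurable_compose[OF B_adapted borel_measurable_continuous_onI[OF h_max_continuous]])

text \<open>Some interval \<open>(lower q, upper q)\<close> contains the path up to
  \<open>t\<close>, and there \<open>NN\<close> is a sum with bounded integrand.\<close>

lemma NN_uniform_limit:
 assumes good: "good w" and t: "0 <= t" "ereal t < H0 w"
 shows "uniform_limit {0..t} (%n s. NN (r n) s w) (%s. h (max 0 (B s w)) - h x0 - A s w) sequentially"
proof -
 have w: "w \<in> space M" using good by (simp add: good_def)
 obtain q where q: "ereal t < exit q q w" using before_exit_diagonal[OF w t] by blast
 obtain H :: nat where H: "t <= real H" using real_arch_simple by blast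
 have "uniformly_convergent_on {0..real H} (%n t. ito_sum (integrand q q) (r n) t w)"
  using good by (simp add: good_def)
 then have u: "uniform_limit {0..t} (%n s. ito_sum (integrand q q) (r n) s w) (%s. lim (%n. ito_sum (integrand q q) (r n) s w)) sequentially"
  unfolding uniformly_convergent_uniform_limit_iff by (rule uniform_limit_on_subset) (use H in auto)
 have eq: "ito_sum (integrand q q) n s w = NN n s w" if "s \<in> {0..t}" for n s
  by (rule NN_eq_before_exit[symmetric], rule less_imp_le, rule ereal_le_less_trans[OF _ q]) (use that in simp)
 have u': "uniform_limit {0..t} (%n s. NN (r n) s w) (%s. lim (%n. NN (r n) s w)) sequentially"
  using u by (rule uniform_limit_cong'[THEN iffD1, rotated 2]) (use eq in auto)
 have "lim (%n. NN (r n) s w) = h (max 0 (B s w)) - h x0 - A s w" if s: "s \<in> {0..t}" for s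
 proof -
  have "(%n. NN (r n) s w) \<longlonglongrightarrow> lim (%n. NN (r n) s w)" by (rule tendsto_uniform_limitI[OF u' s])
  then have "(%n. h (max 0 (B s w)) - h x0 - NN (r n) s w) \<longlonglongrightarrow> h (max 0 (B s w)) - h x0 - lim (%n. NN (r n) s w)"
   by (intro tendsto_intros)
  from limI[OF this] show ?thesis by (simp add: A_def)
 qed
 then show ?thesis using u' by (subst uniform_limit_cong') auto
qed

lemma A_continuous:
 assumes good: "good w" and t: "0 <= t" "ereal t < H0 w"
 shows "continuous_on {0..t} (%s. A s w)"
proof -
 have w: "w \<in> space M" using good by (simp add: good_def)
 have c1: "continuous_on {0..t} (%s. h (max 0 (B s w)) - h x0 - A s w)"
  by (rule uniform_limit_theorem[OF _ NN_uniform_limit[OF assms]])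
   (auto simp: NN_def intro!: always_eventually continuous_on_subset[OF ito_sum_continuous[OF w]])
 have c2: "continuous_on {0..t} (%s. h (max 0 (B s w)))"
  by (rule continuous_on_compose2[OF h_max_continuous continuous_on_subset[OF B_continuous[OF w]]]) auto
 have "continuous_on {0..t} (%s. h (max 0 (B s w)) - h x0 - (h (max 0 (B s w)) - h x0 - A s w))"
  by (rule continuous_on_diff[OF continuous_on_diff[OF c2 continuous_on_const] c1])
 then show ?thesis by simp
qed

lemma A_0: "w \<in> space M ==> A 0 w = 0"
 using B_0[of w] x0_pos by (simp add: A_def NN_def ito_sum_0 max_def)

text \<open>Summand by summand this is the supporting line inequality at the left end of each
  cell.\<close>

lemma NN_grid_increment_le:
 assumes w: "w \<in> space M" and ij: "i <= j" and j: "ereal (real j / 2^n) < H0 w"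
 shows "NN n (real j / 2^n) w - NN n (real i / 2^n) w <= h (B (real j / 2^n) w) - h (B (real i / 2^n) w)"
proof -
 have pos: "0 < B (real k / 2^n) w" if "k <= j" for k
 proof (rule B_pos_before_hitting[OF w])
  have "real k / 2^n <= real j / 2^n" using that by (intro divide_right_mono) auto
  then show "ereal (real k / 2^n) < H0 w" by (rule ereal_le_less_trans[OF _ j])
 qed simp
 let ?b = "%k. B (real k / 2^n) w"
 have "NN n (real j / 2^n) w - NN n (real i / 2^n) w = (\<Sum>k\<in>{i..<j}. D (?b k) * (?b (Suc k) - ?b k))"
  unfolding NN_def ito_sum_dyadic[OF order_refl] left_grid_dyadic[OF order_refl]
  using ij by (simp add: lessThan_atLeast0 sum_diff_nat_ivl)
 also have "... <= (\<Sum>k\<in>{i..<j}. h (?b (Suc k)) - h (?b k))"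
 proof (rule sum_mono)
  fix k assume "k \<in> {i..<j}"
  then show "D (?b k) * (?b (Suc k) - ?b k) <= h (?b (Suc k)) - h (?b k)"
   using D_support[OF pos[of k] pos[of "Suc k"]] by simp
 qed
 also have "... = h (?b j) - h (?b i)" using sum_Suc_diff'[OF ij, of "%k. h (?b k)"] .
 finally show ?thesis .
qed

text \<open>The inequality for the sums holds between grid points of level \<open>r n\<close>;
  uniform convergence and continuity carry it to arbitrary times.\<close>

lemma A_mono:
 assumes good: "good w" and st: "0 <= s" "s <= t" "ereal t < H0 w"
 shows "A s w <= A t w"
proof -
 have w: "w \<in> space M" using good by (simp add: good_def)
 have t: "0 <= t" using st by simp
 let ?f = "%u. h (max 0 (B u w)) - h x0 - A u w"
 let ?h = "%u. h (max 0 (B u w))"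
 have hc: "continuous_on {0..t} ?h"
  by (rule continuous_on_compose2[OF h_max_continuous continuous_on_subset[OF B_continuous[OF w]]]) auto
 have fc: "continuous_on {0..t} ?f" by (intro continuous_on_diff hc continuous_on_const A_continuous[OF good t st(3)])
 have lr: "(%n. left_grid (r n) u) \<longlonglongrightarrow> u" if "0 <= u" for u
  using LIMSEQ_subseq_LIMSEQ[OF left_grid_tendsto[OF that] r(1)] by (simp add: o_def)
 have lgI: "left_grid n u \<in> {0..t}" if "0 <= u" "u <= t" for u n using left_grid_bounds[OF that(1), of n] that by auto
 have Nl: "(%n. NN (r n) (left_grid (r n) u) w) \<longlonglongrightarrow> ?f u" if u: "0 <= u" "u <= t" for u
 proof (rule tendstoI)
  fix e :: real assume e: "0 < e"
  have "\<forall>\<^sub>F n in sequentially. \<forall>v\<in>{0..t}. dist (NN (r n) v w) (?f v) < e / 2"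
   by (rule uniform_limitD[OF NN_uniform_limit[OF good t st(3)]]) (use e in simp)
  moreover have "(%n. ?f (left_grid (r n) u)) \<longlonglongrightarrow> ?f u"
   by (rule continuous_on_tendsto_compose[OF fc lr[OF u(1)]]) (use u lgI[OF u] in auto)
  then have "\<forall>\<^sub>F n in sequentially. dist (?f (left_grid (r n) u)) (?f u) < e / 2"
   by (rule tendstoD) (use e in simp)
  ultimately show "\<forall>\<^sub>F n in sequentially. dist (NN (r n) (left_grid (r n) u) w) (?f u) < e"
  proof eventually_elim
   case (elim n)
   then show ?case using lgI[OF u, of "r n"] dist_triangle_half_l[of _ "?f (left_grid (r n) u)" e "?f u"]
    by (meson dist_triangle_half_r dist_commute_lessI)
  qed
 qed
 have Hl: "(%n. ?h (left_grid (r n) u)) \<longlonglongrightarrow> ?h u" if u: "0 <= u" "u <= t" for u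
  by (rule continuous_on_tendsto_compose[OF hc lr[OF u(1)]]) (use u lgI[OF u] in auto)
 have s': "s <= t" by (rule st(2))
 have le: "NN (r n) (left_grid (r n) t) w - NN (r n) (left_grid (r n) s) w <= ?h (left_grid (r n) t) - ?h (left_grid (r n) s)" for n
 proof -
  have tl: "ereal (left_grid (r n) u) < H0 w" if "0 <= u" "u <= t" for u
   using lgI[OF that, of "r n"] by (intro ereal_le_less_trans[OF _ st(3)]) simp
  have pos: "0 < B (left_grid (r n) u) w" if "0 <= u" "u <= t" for u
   by (rule B_pos_before_hitting[OF w tl[OF that]]) (use lgI[OF that, of "r n"] in auto)
  have m: "nat \<lfloor>s * 2^r n\<rfloor> <= nat \<lfloor>t * 2^r n\<rfloor>" using st by (intro nat_mono floor_mono mult_right_mono) auto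
  show ?thesis
   using NN_grid_increment_le[OF w m, of "r n"] tl[OF t order_refl] pos[OF t order_refl] pos[OF st(1) st(2)]
   by (simp add: left_grid_def max_def)
 qed
 have "?f t - ?f s <= ?h t - ?h s"
  by (rule LIMSEQ_le[OF tendsto_diff[OF Nl[OF t order_refl] Nl[OF st(1,2)]] tendsto_diff[OF Hl[OF t order_refl] Hl[OF st(1,2)]]])
   (use le in blast)
 then show ?thesis by simp
qed

end

section \<open>Limits of the sums as stopped martingales\<close>

context brownian
begin

text \<open>The \<open>L1\<close> Cauchy property and Fatou's lemma turn the almost sure limit into
  an \<open>L1\<close> limit, and the martingale identities pass to it.\<close>

lemma ito_limit_martingale:
 assumes eta: "adapted F eta" and C: "!!t w. w \<in> space M ==> abs (eta t w) <= C"
  and LC: "!!s. 0 < s ==> AE w in M. (%n. eta (left_grid n s) w) \<longlonglongrightarrow> eta s w"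
  and r: "strict_mono r" and Z: "!!t. 0 <= t ==> AE w in M. (%n. ito_sum eta (r n) t w) \<longlonglongrightarrow> Z t w"
  and Zm: "!!t. 0 <= t ==> Z t \<in> borel_measurable M"
 shows "0 <= t ==> integrable M (Z t)"
  and "0 <= s ==> s <= t ==> xi \<in> borel_measurable (F s) ==> (!!w. w \<in> space M ==> abs (xi w) <= C') ==>
   (LINT w|M. xi w * Z t w) = (LINT w|M. xi w * Z s w)"
proof -
 let ?Z = "%n t w. ito_sum eta (r n) t w"
 have mart: "martingale M F (?Z n)" for n by (rule ito_sum_martingale[OF eta C])
 have int: "integrable M (?Z n t)" if "0 <= t" for n t using mart that by (simp add: martingale_def)
 have L1: "\<exists>n0. \<forall>n\<ge>n0. integrable M (%w. ?Z n t w - Z t w) & (LINT w|M. abs (?Z n t w - Z t w)) <= e" if e: "0 < e" and t: "0 <= t" for e t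
 proof -
  obtain n0 where n0: "!!n n'. n0 <= n ==> n <= n' ==> (LINT w|M. abs (ito_sum eta n t w - ito_sum eta n' t w)) <= e"
   using ito_sum_L1_cauchy[OF eta C LC e t] by blast
  show ?thesis
  proof (intro exI allI impI)
   fix n assume n: "n0 <= n"
   have "(LINT w|M. abs (?Z n t w - ?Z m t w)) <= e" if "n <= m" for m
    by (rule n0) (use n that seq_suble[OF r, of n] strict_mono_less_eq[OF r] in auto)
   note L = L1_limit_le[where Y = "%n. ?Z n t" and Z = "Z t", OF borel_measurable_integrable[OF int[OF t]] Zm[OF t] Z[OF t]
     leb_integrable_diff[OF int[OF t] int[OF t]] this]
   show "integrable M (%w. ?Z n t w - Z t w) & (LINT w|M. abs (?Z n t w - Z t w)) <= e"
    by (rule conjI; rule L; assumption)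
  qed
 qed
 show iZ: "integrable M (Z t)" if t: "0 <= t" for t
 proof -
  obtain n where "integrable M (%w. ?Z n t w - Z t w)" using L1[OF zero_less_one t] by blast
  from leb_integrable_diff[OF int[OF t, of n] this] show ?thesis by simp
 qed
 assume st: "0 <= s" "s <= t" and xi: "xi \<in> borel_measurable (F s)" "!!w. w \<in> space M ==> abs (xi w) <= C'"
 have t: "0 <= t" using st by simp
 have xiM: "xi \<in> borel_measurable M" by (rule measurable_F[OF xi(1) st(1)])
 have C': "0 <= C'" using xi(2) not_empty abs_ge_zero order_trans by blast
 have lim: "(%n. LINT w|M. xi w * ?Z n u w) \<longlonglongrightarrow> (LINT w|M. xi w * Z u w)" if u: "0 <= u" for u
 proof (rule LIMSEQ_I)
  fix e :: real assume e: "0 < e"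
  define e' where "e' = e / (2 * (C' + 1))"
  have e': "0 < e'" using e C' by (simp add: e'_def)
  obtain n0 where n0: "!!n. n0 <= n ==> (LINT w|M. abs (?Z n u w - Z u w)) <= e'" using L1[OF e' u] by blast
  have "norm ((LINT w|M. xi w * ?Z n u w) - (LINT w|M. xi w * Z u w)) < e" if n: "n0 <= n" for n
  proof -
   let ?d = "%w. ?Z n u w - Z u w"
   have id: "integrable M ?d" by (intro leb_integrable_diff int iZ u)
   have "(LINT w|M. xi w * ?Z n u w) - (LINT w|M. xi w * Z u w) = (LINT w|M. xi w * ?d w)"
    using integrable_bounded_mult[OF int[OF u] xiM xi(2)] integrable_bounded_mult[OF iZ[OF u] xiM xi(2)]
    by (simp add: right_diff_distrib)
   also have "abs (...) <= (LINT w|M. abs (xi w * ?d w))" by (rule integral_abs_bound)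
   also have "... <= (LINT w|M. C' * abs (?d w))"
    using integrable_bounded_mult[OF id xiM xi(2)] id xi(2)
    by (intro integral_mono integrable_abs integrable_mult_right) (auto simp: abs_mult intro!: mult_right_mono)
   also have "... = C' * (LINT w|M. abs (?d w))" by simp
   also have "... <= C' * e'" by (rule mult_left_mono[OF n0[OF n] C'])
   also have "C' * e' < e"
   proof -
    have "C' * e' <= (C' + 1) * e'" using e' by (intro mult_right_mono) auto
    also have "... = e / 2" using C' by (simp add: e'_def field_simps)
    finally show ?thesis using e by simp
   qed
   finally show ?thesis by simp
  qed
  then show "\<exists>n0. \<forall>n\<ge>n0. norm ((LINT w|M. xi w * ?Z n u w) - (LINT w|M. xi w * Z u w)) < e" by blast
 qed
 have "(LINT w|M. xi w * ?Z n t w) = (LINT w|M. xi w * ?Z n s w)" for n by (rule martingaleD[OF mart st xi])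
 then have "(%n. LINT w|M. xi w * ?Z n s w) \<longlonglongrightarrow> (LINT w|M. xi w * Z t w)" using lim[OF t] by simp
 then show "(LINT w|M. xi w * Z t w) = (LINT w|M. xi w * Z s w)" by (rule LIMSEQ_unique[OF _ lim[OF st(1)]])
qed

lemma min_exit_less_hitting_time:
 fixes l k :: nat
 assumes w: "w \<in> space M" and t: "0 <= t"
 defines "tht \<equiv> real_of_ereal (min (ereal t) (exit l k w))"
 shows "0 <= tht" "tht <= t" "ereal tht <= exit l k w" "ereal tht < H0 w" "lower l <= B tht w" "B tht w <= upper k"
proof -
 have thte: "ereal tht = min (ereal t) (exit l k w)" unfolding tht_def by (rule real_min_ereal(1)[OF exit_nonneg t])
 show tht0: "0 <= tht" and thtt: "tht <= t" unfolding tht_def by (rule real_min_ereal[OF exit_nonneg t])+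
 show le: "ereal tht <= exit l k w" using thte by simp
 have before: "lower l < B s w" "B s w < upper k" if "0 <= s" "s < tht" for s
 proof -
  have "ereal s < exit l k w" using that le by (meson ereal_less(2) less_ereal.simps(1) less_le_trans)
  then show "lower l < B s w" "B s w < upper k" using before_exit_iff[OF w that(1), of l k] that by auto
 qed
 have b: "lower l <= B tht w & B tht w <= upper k"
 proof (cases "ereal tht < exit l k w")
  case True
  then show ?thesis using before_exit_iff[OF w tht0, of l k] tht0 by (auto intro: less_imp_le)
 next
  case False
  then obtain u where u: "u \<in> {0..tht}" "B u w = lower l \<or> B u w = upper k"
   using exit_le_iff[OF w tht0, of l k] by (auto simp: not_less)
  then have "\<not> u < tht" using before[of u] by auto
  then have "u = tht" using u(1) by simp
  then show ?thesis using u(2) lower_less[of l] upper_greater[of k] by auto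
 qed
 then show "lower l <= B tht w" "B tht w <= upper k" by auto
 show "ereal tht < H0 w"
 proof (rule ccontr)
  assume "\<not> ereal tht < H0 w"
  then obtain u where u: "u \<in> {0..tht}" "B u w = 0"
   using hit_zero_le_iff[where Y = B, OF B_continuous[OF w] tht0] by (auto simp: hitting_time_def not_less)
  then show False using before(1)[of u] b lower_pos[of l] by (cases "u = tht") auto
 qed
qed

end

context convex_tanaka
begin

definition Z :: "nat => nat => real => 'a => real" where
 "Z l k t w = lim (%n. ito_sum (integrand l k) (r n) t w)"

text \<open>Beyond the exit the truncated integrand vanishes except on the cell that contains the
  exit time, where it was fixed at the left end. That cell contributes at most a constant times an
  increment of \<open>B\<close> over a shrinking interval.\<close>

lemma Z_tendsto:
 fixes l k :: nat
 assumes good: "good w" and t: "0 <= t"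
 defines "tht \<equiv> real_of_ereal (min (ereal t) (exit l k w))"
 shows "(%n. ito_sum (integrand l k) (r n) t w) \<longlonglongrightarrow> h (max 0 (B tht w)) - h x0 - A tht w"
proof -
 have w: "w \<in> space M" using good by (simp add: good_def)
 note tht = min_exit_less_hitting_time[OF w t, of l k, folded tht_def]
 have N: "(%n. NN (r n) tht w) \<longlonglongrightarrow> h (max 0 (B tht w)) - h x0 - A tht w"
  by (rule tendsto_uniform_limitI[OF NN_uniform_limit[OF good tht(1,4)]]) (use tht(1) in simp)
 have NI: "NN n tht w = ito_sum (integrand l k) n tht w" for n by (rule NN_eq_before_exit[OF tht(3)])
 have "(%n. ito_sum (integrand l k) n t w - ito_sum (integrand l k) n tht w) \<longlonglongrightarrow> 0"
 proof (cases "tht = t")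
  case False
  have ex: "exit l k w = ereal tht"
   using False real_min_ereal(1)[OF exit_nonneg t, of l k w] unfolding tht_def[symmetric] by (auto simp: min_def split: if_splits)
  \<comment> \<open>The last grid index strictly before the exit; the ceiling minus one picks the
    correct cell also if the exit time is a grid point.\<close>
  define i0 where "i0 n = nat \<lceil>tht * 2^n\<rceil> - 1" for n :: nat
  define u where "u n = min t (max tht (real (Suc (i0 n)) / 2^n))" for n :: nat
  define v where "v n = min t (max tht (real (i0 n) / 2^n))" for n :: nat
  have one: "abs (ito_sum (integrand l k) n t w - ito_sum (integrand l k) n tht w) <= (abs (D (lower l)) + abs (D (upper k))) * abs (B (u n) w - B (v n) w)" for n
  proof -
   obtain K :: nat where K: "max (t * 2^n) (real (Suc (i0 n))) <= real K" using real_arch_simple by blast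
   have "ito_sum (integrand l k) n t w - ito_sum (integrand l k) n tht w = (\<Sum>i<K. integrand l k (real i / 2^n) w *
    (B (min t (max tht (real (Suc i) / 2^n))) w - B (min t (max tht (real i / 2^n))) w))"
    by (rule ito_sum_increment[OF tht(2)]) (use K in simp)
   also have "... = (\<Sum>i<K. if i = i0 n then integrand l k (real (i0 n) / 2^n) w * (B (u n) w - B (v n) w) else 0)"
   proof (rule sum.cong)
    fix i
    consider "i = i0 n" | "i < i0 n" | "i0 n < i" by linarith
    then show "integrand l k (real i / 2^n) w * (B (min t (max tht (real (Suc i) / 2^n))) w - B (min t (max tht (real i / 2^n))) w)
     = (if i = i0 n then integrand l k (real (i0 n) / 2^n) w * (B (u n) w - B (v n) w) else 0)"
    proof cases
     case 1
     then show ?thesis by (simp add: u_def v_def)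
    next
     case 2
     then have "int (Suc i) < \<lceil>tht * 2^n\<rceil>" by (simp add: i0_def)
     then have "real (Suc i) < tht * 2^n" by linarith
     then have "real (Suc i) / 2^n <= tht" by (simp add: divide_le_eq)
     moreover have "real i / 2^n <= real (Suc i) / 2^n" by (intro divide_right_mono) auto
     ultimately show ?thesis using 2 by simp
    next
     case 3
     then have "\<lceil>tht * 2^n\<rceil> <= int i" by (simp add: i0_def)
     then have "tht <= real i / 2^n" by (simp add: le_divide_eq ceiling_le_iff)
     then have "integrand l k (real i / 2^n) w = 0" using ex by (simp add: integrand_def)
     then show ?thesis using 3 by simp
    qed
   qed simp
   also have "... = integrand l k (real (i0 n) / 2^n) w * (B (u n) w - B (v n) w)" using K by simp
   finally show ?thesis
    by (simp only: abs_mult) (intro mult_right_mono integrand_bounded[OF w] abs_ge_zero)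
  qed
  have sm: "(%n. tht + (1/2)^n) \<longlonglongrightarrow> tht" using tendsto_add[OF tendsto_const LIMSEQ_power_zero[of "1/2::real"], of tht] by simp
  have iu: "real (Suc (i0 n)) / 2^n <= tht + (1/2)^n" for n
  proof -
   have "0 <= tht * 2^n" using tht(1) by simp
   then have "real (Suc (i0 n)) <= tht * 2^n + 1" unfolding i0_def by linarith
   then show ?thesis by (simp add: divide_le_eq power_one_over field_simps)
  qed
  have bu: "tht <= u n" "u n <= tht + (1/2)^n" "tht <= v n" "v n <= tht + (1/2)^n" for n
  proof -
   have "real (i0 n) / 2^n <= real (Suc (i0 n)) / 2^n" by (intro divide_right_mono) auto
   moreover have "0 <= (1/2::real)^n" by simp
   ultimately show "tht <= u n" "u n <= tht + (1/2)^n" "tht <= v n" "v n <= tht + (1/2)^n"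
    unfolding u_def v_def using tht(2) iu[of n] by linarith+
  qed
  have "u \<longlonglongrightarrow> tht" "v \<longlonglongrightarrow> tht"
   by (rule tendsto_sandwich[OF _ _ tendsto_const sm], use bu in simp, use bu in simp)+
  moreover have "\<forall>\<^sub>F n in sequentially. u n \<in> {0..}" "\<forall>\<^sub>F n in sequentially. v n \<in> {0..}"
   using bu tht(1) by (auto intro!: always_eventually intro: order_trans)
  ultimately have "(%n. B (u n) w) \<longlonglongrightarrow> B tht w" "(%n. B (v n) w) \<longlonglongrightarrow> B tht w"
   using tht(1) by (auto intro!: continuous_on_tendsto_compose[OF B_continuous[OF w]])
  then have "(%n. (abs (D (lower l)) + abs (D (upper k))) * abs (B (u n) w - B (v n) w)) \<longlonglongrightarrow> (abs (D (lower l)) + abs (D (upper k))) * abs (B tht w - B tht w)"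
   by (intro tendsto_intros)
  then have "(%n. (abs (D (lower l)) + abs (D (upper k))) * abs (B (u n) w - B (v n) w)) \<longlonglongrightarrow> 0" by simp
  then show ?thesis by (rule Lim_null_comparison[rotated]) (use one in simp)
 qed simp
 then have "(%n. ito_sum (integrand l k) (r n) t w - NN (r n) tht w) \<longlonglongrightarrow> 0"
  unfolding NI using LIMSEQ_subseq_LIMSEQ[OF _ r(1)] by (fastforce simp: o_def)
 from tendsto_add[OF this N] show ?thesis by simp
qed

lemma Z_eq:
 fixes l k :: nat
 assumes "good w" "0 <= t"
 defines "tht \<equiv> real_of_ereal (min (ereal t) (exit l k w))"
 shows "Z l k t w = h (max 0 (B tht w)) - h x0 - A tht w"
 unfolding Z_def tht_def by (rule limI[OF Z_tendsto[OF assms(1,2)]])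

lemma Z_martingale:
 shows "0 <= t ==> integrable M (Z l k t)"
  and "0 <= s ==> s <= t ==> xi \<in> borel_measurable (F s) ==> (!!w. w \<in> space M ==> abs (xi w) <= C') ==>
   (LINT w|M. xi w * Z l k t w) = (LINT w|M. xi w * Z l k s w)"
proof -
 have m: "Z l k t \<in> borel_measurable M" if t: "0 <= t" for t
 proof -
  have "integrable M (ito_sum (integrand l k) n t)" for n
   using ito_sum_martingale[OF integrand_adapted integrand_bounded] t by (simp add: martingale_def)
  then show ?thesis unfolding Z_def[abs_def] by (intro borel_measurable_lim_metric borel_measurable_integrable)
 qed
 have lim: "AE w in M. (%n. ito_sum (integrand l k) (r n) t w) \<longlonglongrightarrow> Z l k t w" if t: "0 <= t" for t
  using AE_good by eventually_elim (simp only: Z_eq[OF _ t] Z_tendsto[OF _ t])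
 note lm = ito_limit_martingale[OF integrand_adapted integrand_bounded integrand_left_continuous r(1) lim m]
 show "0 <= t ==> integrable M (Z l k t)" by (rule lm(1))
 show "(LINT w|M. xi w * Z l k t w) = (LINT w|M. xi w * Z l k s w)"
  if "0 <= s" "s <= t" "xi \<in> borel_measurable (F s)" "!!w. w \<in> space M ==> abs (xi w) <= C'"
  by (rule lm(2)) (rule that | assumption)+
qed

end

section \<open>The increasing part up to and beyond the hitting time\<close>

definition dyadics :: "real set" where "dyadics = (\<Union>n. range (%i. real i / 2^n))"

lemma countable_dyadics: "countable dyadics"
 unfolding dyadics_def by (intro countable_UN countable_image) auto

lemma dyadics_nonneg: "s \<in> dyadics ==> 0 <= s"
 by (auto simp: dyadics_def)

lemma left_grid_dyadics: "left_grid n s \<in> dyadics"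
 by (auto simp: dyadics_def left_grid_def)

context filtered_prob_space
begin

text \<open>The complement is a countable union of events \<open>T <= q\<close> over rational
  \<open>q < s\<close>.\<close>

lemma stopping_time_ge_measurable:
 assumes T: "stopping_time_ext M F T" and s: "0 <= s" "s <= t"
 shows "Measurable.pred (F t) (%w. ereal s <= T w)"
proof -
 have eq: "ereal s <= T w \<longleftrightarrow> \<not> (\<exists>q::rat. 0 <= real_of_rat q & of_rat q < s & T w <= ereal (of_rat q))" if w: "w \<in> space (F t)" for w
 proof
  assume "ereal s <= T w"
  then show "\<not> (\<exists>q::rat. 0 <= real_of_rat q & of_rat q < s & T w <= ereal (of_rat q))"
   by (meson ereal_less_eq(3) leD order_trans)
 next
  assume *: "\<not> (\<exists>q::rat. 0 <= real_of_rat q & of_rat q < s & T w <= ereal (of_rat q))"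
  have T0: "0 <= T w" using T w s space_F[of t] by (auto simp: stopping_time_ext_def)
  show "ereal s <= T w"
  proof (rule ccontr)
   assume "\<not> ereal s <= T w"
   then obtain u where u: "T w = ereal u" "u < s" "0 <= u" using T0 by (cases "T w") auto
   obtain q where q: "u < real_of_rat q" "real_of_rat q < s" using of_rat_dense[OF u(2)] by blast
   then have "0 <= real_of_rat q" using u(3) by linarith
   moreover have "T w <= ereal (real_of_rat q)" using q(1) u(1) by simp
   ultimately show False using * q(2) by blast
  qed
 qed
 have "Measurable.pred (F t) (%w. \<exists>q::rat. 0 <= real_of_rat q & of_rat q < s & T w <= ereal (of_rat q))"
 proof (rule pred_intros_countable(2))
  fix q :: rat
  show "Measurable.pred (F t) (%w. 0 <= real_of_rat q & of_rat q < s & T w <= ereal (of_rat q))"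
  proof (cases "0 <= (of_rat q :: real) & of_rat q < s")
   case True
   then have "Measurable.pred (F (of_rat q)) (%w. T w <= ereal (of_rat q))" using T by (simp add: stopping_time_ext_def)
   then have "Measurable.pred (F t) (%w. T w <= ereal (of_rat q))" by (rule measurable_F_mono) (use True s in auto)
   then show ?thesis using True by simp
  next
   case False
   then have "(%w. 0 <= real_of_rat q & of_rat q < s & T w <= ereal (of_rat q)) = (%_. False)" by auto
   then show ?thesis by simp
  qed
 qed
 then have "Measurable.pred (F t) (%w. \<not> (\<exists>q::rat. 0 <= real_of_rat q & of_rat q < s & T w <= ereal (of_rat q)))"
  by (rule pred_intros_logic(2))
 then show ?thesis by (subst measurable_cong[OF eq])
qed

end

context brownian
begin

lemma stopped_0_between:
 assumes "0 <= s"
 shows "\<exists>u. 0 <= u & u <= s & SB s w = B u w"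
 using real_min_ereal(2,3)[OF hitting_time_nonneg[of w] assms] unfolding stopped_def by blast

text \<open>Taken along the stopped path, hence infinite if \<open>0\<close> is reached first. This
  sequence is the one that localises the martingale part.\<close>

definition level :: "nat => 'a => ereal" where
 "level k = hitting_time SB (upper k)"

lemma level_stopping_time: "stopping_time_ext M F (level k)"
proof -
 have "adapted F (%t w. SB t w - upper k)"
  unfolding adapted_def by (intro allI impI borel_measurable_diff stopped_0_measurable borel_measurable_const)
 then have "stopping_time_ext M F (%w. Inf {ereal t |t. 0 <= t & SB t w - upper k = 0})"
  by (rule hit_zero_stopping_time) (intro continuous_on_diff continuous_on_const continuous_stopped_0)
 then show ?thesis by (simp add: level_def hitting_time_def[abs_def])
qed

lemma level_nonneg: "0 <= level k w"
 unfolding level_def hitting_time_def by (intro Inf_greatest) auto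

lemma level_le: "0 <= t ==> SB t w = upper k ==> level k w <= ereal t"
 unfolding level_def hitting_time_def by (intro Inf_lower) auto

lemma reaching_level:
 assumes w: "w \<in> space M" and s: "0 <= s" "upper k <= SB s w"
 shows "level k w <= ereal s"
proof -
 have "continuous_on {0..s} (%t. SB t w)"
  by (rule continuous_on_subset[OF continuous_stopped_0[OF w]]) auto
 then obtain u where u: "0 <= u" "u <= s" "SB u w = upper k"
  using IVT'[of "%t. SB t w" 0 "upper k" s] stopped_0_0[OF w] upper_greater[of k] s by auto
 have "level k w <= ereal u" by (rule level_le[OF u(1,3)])
 also have "... <= ereal s" using u(2) by simp
 finally show ?thesis .
qed

lemma level_incseq: "w \<in> space M ==> incseq (%k. level k w)"
proof (rule incseq_SucI)
 fix k assume w: "w \<in> space M"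
 have "level k w <= ereal t" if "0 <= t" "SB t w = upper (Suc k)" for t
  by (rule reaching_level[OF w that(1)]) (use that(2) in \<open>simp add: upper_def\<close>)
 then show "level k w <= level (Suc k) w"
  unfolding level_def[of "Suc k"] hitting_time_def by (intro Inf_greatest) auto
qed

lemma level_eventually_large:
 assumes w: "w \<in> space M"
 shows "\<forall>\<^sub>F k in sequentially. ereal t < level k w"
proof -
 obtain k0 where k0: "!!k s. k0 <= k ==> s \<in> {0..t + 1} ==> B s w < upper k" using B_bounded_path[OF w, of "t + 1"] by blast
 have "ereal (t + 1) <= level k w" if k: "k0 <= k" for k
  unfolding level_def hitting_time_def[of SB]
 proof (rule Inf_greatest)
  fix x assume "x \<in> {ereal t |t. 0 <= t & SB t w = upper k}"
  then obtain s where s: "x = ereal s" "0 <= s" "SB s w = upper k" by blast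
  obtain u where u: "0 <= u" "u <= s" "SB s w = B u w" using stopped_0_between[OF s(2)] by blast
  have "\<not> s <= t + 1" using k0[OF k, of u] u s by auto
  then show "ereal (t + 1) <= x" using s by simp
 qed
 moreover have "ereal t < ereal (t + 1)" by simp
 ultimately show ?thesis unfolding eventually_sequentially by (meson less_le_trans)
qed

lemma level_tendsto: "w \<in> space M ==> (%k. level k w) \<longlonglongrightarrow> \<infinity>"
 using level_eventually_large by (simp add: tendsto_PInfty)

lemma exit_le_level:
 assumes w: "w \<in> space M"
 shows "exit l k w <= level k w"
 unfolding level_def hitting_time_def[of SB]
proof (rule Inf_greatest)
 fix x assume "x \<in> {ereal t |t. 0 <= t & SB t w = upper k}"
 then obtain s where s: "x = ereal s" "0 <= s" "SB s w = upper k" by blast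
 obtain u where u: "0 <= u" "u <= s" "SB s w = B u w" using stopped_0_between[OF s(2)] by blast
 have "exit l k w <= ereal s" using exit_le_iff[OF w s(2), of l k] u s(3) by auto
 then show "exit l k w <= x" using s by simp
qed

text \<open>As \<open>l\<close> grows, this time tends to \<open>TH k t w\<close>, which may be the
  hitting time: martingale facts are proved at \<open>tht\<close>, strictly before
  \<open>H0\<close>, and then carried over to \<open>TH\<close>.\<close>

definition tht :: "nat => nat => real => 'a => real" where
 "tht l k t w = real_of_ereal (min (ereal t) (exit l k w))"

definition TH :: "nat => real => 'a => real" where
 "TH k t w = real_of_ereal (min (ereal t) (min (level k w) (H0 w)))"

lemma ereal_tht: "0 <= t ==> ereal (tht l k t w) = min (ereal t) (exit l k w)"
 unfolding tht_def by (rule real_min_ereal(1)[OF exit_nonneg])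

lemma ereal_TH: "0 <= t ==> ereal (TH k t w) = min (ereal t) (min (level k w) (H0 w))"
 unfolding TH_def by (rule real_min_ereal(1)) (simp add: level_nonneg hitting_time_nonneg)

lemma TH_bounds: "0 <= t ==> 0 <= TH k t w" "0 <= t ==> TH k t w <= t"
 unfolding TH_def by (rule real_min_ereal; simp add: level_nonneg hitting_time_nonneg)+

lemma tht_le_TH: "w \<in> space M ==> 0 <= t ==> tht l k t w <= TH k t w"
proof -
 assume w: "w \<in> space M" and t: "0 <= t"
 have "ereal (tht l k t w) <= ereal (TH k t w)"
  unfolding ereal_tht[OF t] ereal_TH[OF t] using exit_le_level[OF w] exit_le_hitting_time[OF w]
  by (intro min.mono) auto
 then show ?thesis by simp
qed

lemma tht_tendsto:
 assumes w: "w \<in> space M" and t: "0 <= t"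
 shows "(%l. tht l k t w) \<longlonglongrightarrow> TH k t w"
proof (rule order_tendstoI)
 fix u assume u: "u < TH k t w"
 show "\<forall>\<^sub>F l in sequentially. u < tht l k t w"
 proof (cases "0 <= u")
  case True
  define v where "v = (u + TH k t w) / 2"
  have v: "u < v" "v < TH k t w" "0 <= v" using u True by (auto simp: v_def)
  then have "ereal v < ereal (TH k t w)" by simp
  then have vt: "ereal v < ereal t" "ereal v < level k w" "ereal v < H0 w" unfolding ereal_TH[OF t] by auto
  have "B s w < upper k" if s: "s \<in> {0..v}" for s
  proof (rule ccontr)
   assume "\<not> B s w < upper k"
   moreover have "SB s w = B s w"
    using s ereal_le_less_trans[OF _ vt(3), of s] by (intro stopped_before) auto
   ultimately have "level k w <= ereal s" using s by (intro reaching_level[OF w]) auto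
   then show False using ereal_le_less_trans[OF _ vt(2), of s] s by auto
  qed
  from before_exit_exhaust[OF w v(3) vt(3) this] obtain l0 where l0: "!!l. l0 <= l ==> ereal v < exit l k w" by blast
  have "u < tht l k t w" if "l0 <= l" for l
  proof -
   have "ereal v < ereal (tht l k t w)" unfolding ereal_tht[OF t] using l0[OF that] vt(1) by simp
   then show ?thesis using v(1) by simp
  qed
  then show ?thesis unfolding eventually_sequentially by blast
 next
  case False
  then have "u < tht l k t w" for l using min_exit_less_hitting_time(1)[OF w t, of l k] by (simp add: tht_def)
  then show ?thesis by simp
 qed
next
 fix u assume "TH k t w < u"
 then show "\<forall>\<^sub>F l in sequentially. tht l k t w < u"
  using tht_le_TH[OF w t] by (intro always_eventually allI) (meson le_less_trans)
qed

lemma stopped_stopped_level: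
 assumes w: "w \<in> space M" and t: "0 <= t"
 shows "SB (real_of_ereal (min (ereal t) (level k w))) w = B (TH k t w) w"
  "0 <= B (TH k t w) w" "B (TH k t w) w <= upper k"
proof -
 show 1: "SB (real_of_ereal (min (ereal t) (level k w))) w = B (TH k t w) w"
  unfolding stopped_def TH_def real_min_ereal(1)[OF level_nonneg t] by (simp add: min.assoc)
 have n: "0 <= real_of_ereal (min (ereal t) (level k w))" by (rule real_min_ereal(2)[OF level_nonneg t])
 show "0 <= B (TH k t w) w" using stopped_0_nonneg[OF w n] unfolding 1 .
 have "(%l. B (tht l k t w) w) \<longlonglongrightarrow> B (TH k t w) w"
  by (rule continuous_on_tendsto_compose[OF B_continuous[OF w] tht_tendsto[OF w t]])
   (use TH_bounds[OF t] min_exit_less_hitting_time(1)[OF w t] in \<open>auto simp: tht_def\<close>)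
 then show "B (TH k t w) w <= upper k"
  by (rule LIMSEQ_le_const2) (use min_exit_less_hitting_time(6)[OF w t] in \<open>auto simp: tht_def\<close>)
qed

end

context convex_tanaka
begin

text \<open>The limit \<open>A\<close> is meaningful only before \<open>H0\<close>; the supremum extends it monotonically past that time.\<close>

definition Ae :: "real => 'a => ennreal" where
 "Ae t w = (SUP s\<in>dyadics. if s <= t & ereal s < H0 w then ennreal (A s w) else 0)"

definition Ahat :: "real => 'a => real" where "Ahat t w = enn2real (Ae t w)"

text \<open>Stopping turns the time condition on \<open>s\<close> into \<open>s <= T\<close>, which
  is known at time \<open>t\<close>; the countable supremum keeps measurability.\<close>

lemma Ae_stopped_measurable:
 assumes T: "stopping_time_ext M F T" and t: "0 <= t"
 shows "(%w. Ae (real_of_ereal (min (ereal t) (T w))) w) \<in> borel_measurable (F t)"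
 unfolding Ae_def[abs_def]
proof (rule borel_measurable_SUP[OF countable_dyadics])
 fix s assume "s \<in> dyadics"
 then have s: "0 <= s" by (rule dyadics_nonneg)
 let ?f = "%w. if s <= real_of_ereal (min (ereal t) (T w)) & ereal s < H0 w then ennreal (A s w) else 0"
 have sp: "space (F t) = space M" by (rule space_F[OF t])
 show "?f \<in> borel_measurable (F t)"
 proof (cases "s <= t")
  case True
  have "(%w. if ereal s <= T w & \<not> H0 w <= ereal s then ennreal (A s w) else 0) \<in> borel_measurable (F t)"
  proof (intro measurable_If predE pred_intros_logic(2,3))
   show "Measurable.pred (F t) (%w. ereal s <= T w)" by (rule stopping_time_ge_measurable[OF T s True])
   have "Measurable.pred (F s) (%w. H0 w <= ereal s)"
    using hitting_time_0_stopping s by (simp add: stopping_time_ext_def)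
   then show "Measurable.pred (F t) (%w. H0 w <= ereal s)" by (rule measurable_F_mono[OF _ s True])
   show "(%w. ennreal (A s w)) \<in> borel_measurable (F t)"
    by (rule measurable_compose[OF measurable_F_mono[OF A_adapted[OF s] s True] measurable_ennreal])
  qed simp
  moreover have "?f w = (if ereal s <= T w & \<not> H0 w <= ereal s then ennreal (A s w) else 0)" if "w \<in> space (F t)" for w
  proof -
   have "0 <= T w" using T that sp by (auto simp: stopping_time_ext_def)
   from real_min_ereal(1)[OF this t] have "s <= real_of_ereal (min (ereal t) (T w)) \<longleftrightarrow> ereal s <= min (ereal t) (T w)"
    by (metis ereal_less_eq(3))
   then show ?thesis using True by (auto simp: not_le)
  qed
  ultimately show ?thesis by (subst measurable_cong) auto
 next
  case False
  have "?f w = 0" if "w \<in> space (F t)" for w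
  proof -
   have "0 <= T w" using T that sp by (auto simp: stopping_time_ext_def)
   from real_min_ereal(3)[OF this t] show ?thesis using False by auto
  qed
  then show ?thesis by (subst measurable_cong[where g = "%_. 0"]) auto
 qed
qed

lemma Ahat_adapted: "adapted F Ahat"
 unfolding adapted_def
proof (intro allI impI)
 fix t :: real assume t: "0 <= t"
 have "stopping_time_ext M F (%_. \<infinity>)" by (simp add: stopping_time_ext_def)
 from Ae_stopped_measurable[OF this t] show "Ahat t \<in> borel_measurable (F t)"
  unfolding Ahat_def[abs_def] by (simp add: borel_measurable_enn2real)
qed

lemma Ae_mono: "s <= t ==> Ae s w <= Ae t w"
 unfolding Ae_def by (intro SUP_mono) (auto intro!: bexI)

lemma Ae_stopped: "0 <= t ==> Ae (real_of_ereal (min (ereal t) (level k w))) w = Ae (TH k t w) w"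
proof -
 assume t: "0 <= t"
 have "s <= real_of_ereal (min (ereal t) (level k w)) \<longleftrightarrow> s <= TH k t w" if "ereal s < H0 w" for s
 proof -
  have "s <= real_of_ereal (min (ereal t) (level k w)) \<longleftrightarrow> ereal s <= min (ereal t) (level k w)"
   using real_min_ereal(1)[OF level_nonneg t, of k w] by (metis ereal_less_eq(3))
  moreover have "s <= TH k t w \<longleftrightarrow> ereal s <= min (ereal t) (min (level k w) (H0 w))"
   using ereal_TH[OF t, of k w] by (metis ereal_less_eq(3))
  ultimately show ?thesis using that by (auto intro: less_imp_le)
 qed
 then show ?thesis unfolding Ae_def by (intro SUP_cong refl) auto
qed

lemma A_nonneg: "good w ==> 0 <= s ==> ereal s < H0 w ==> 0 <= A s w"
 using A_mono[of w 0 s] A_0[of w] by (simp add: good_def)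

text \<open>Monotonicity bounds the supremum by the value at \<open>u\<close>, and dyadic times
  approaching \<open>u\<close> from below attain it by continuity.\<close>

lemma Ae_before:
 assumes good: "good w" and u: "0 <= u" "ereal u < H0 w"
 shows "Ae u w = ennreal (A u w)"
proof (rule antisym)
 show "Ae u w <= ennreal (A u w)"
  unfolding Ae_def using A_mono[OF good dyadics_nonneg _ u(2)] by (intro SUP_least) (auto intro!: ennreal_leI)
 have lg: "left_grid n u \<in> {0..u}" for n using left_grid_bounds[OF u(1), of n] by auto
 have "(%n. A (left_grid n u) w) \<longlonglongrightarrow> A u w"
  by (rule continuous_on_tendsto_compose[OF A_continuous[OF good u] left_grid_tendsto[OF u(1)]]) (use u(1) lg in auto)
 then have "(%n. ennreal (A (left_grid n u) w)) \<longlonglongrightarrow> ennreal (A u w)" by (rule tendsto_ennrealI)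
 moreover have "ennreal (A (left_grid n u) w) <= Ae u w" for n
 proof -
  have "(if left_grid n u <= u & ereal (left_grid n u) < H0 w then ennreal (A (left_grid n u) w) else 0) <= Ae u w"
   unfolding Ae_def by (rule SUP_upper[OF left_grid_dyadics])
  then show ?thesis using lg[of n] ereal_le_less_trans[OF _ u(2), of "left_grid n u"] by simp
 qed
 ultimately show "ennreal (A u w) <= Ae u w" by (intro LIMSEQ_le_const2) auto
qed

lemma Ahat_before:
 assumes good: "good w" and u: "0 <= u" "ereal u < H0 w"
 shows "Ahat u w = A u w"
 unfolding Ahat_def Ae_before[OF assms] using A_nonneg[OF assms] by simp

lemma Ahat_0: "w \<in> space M ==> Ahat 0 w = 0"
proof -
 assume w: "w \<in> space M"
 have "Ae 0 w <= 0"
  unfolding Ae_def using A_0[OF w] by (intro SUP_least) (auto dest!: dyadics_nonneg)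
 then show ?thesis by (simp add: Ahat_def)
qed

lemma tht_facts:
 assumes "w \<in> space M" "0 <= t"
 shows "0 <= tht l k t w" "ereal (tht l k t w) < H0 w" "lower l <= B (tht l k t w) w" "B (tht l k t w) w <= upper k"
 unfolding tht_def by (rule min_exit_less_hitting_time[OF assms])+

text \<open>If \<open>TH\<close> lies before the hitting time, this is continuity. Otherwise every
  dyadic time before \<open>H0\<close> is eventually below \<open>tht\<close>, and monotonicity
  gives the bound term by term.\<close>

lemma Ae_le_liminf:
 assumes good: "good w" and t: "0 <= t"
 shows "Ae (TH k t w) w <= liminf (%l. ennreal (A (tht l k t w) w))"
proof -
 have w: "w \<in> space M" using good by (simp add: good_def)
 note th = tht_facts[OF w t, of _ k]
 show ?thesis
 proof (cases "ereal (TH k t w) < H0 w")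
  case True
  have "(%l. A (tht l k t w) w) \<longlonglongrightarrow> A (TH k t w) w"
   by (rule continuous_on_tendsto_compose[OF A_continuous[OF good TH_bounds(1)[OF t] True] tht_tendsto[OF w t]])
    (use TH_bounds(1)[OF t, of k w] th(1) tht_le_TH[OF w t] in auto)
  then have "(%l. ennreal (A (tht l k t w) w)) \<longlonglongrightarrow> Ae (TH k t w) w"
   unfolding Ae_before[OF good TH_bounds(1)[OF t] True] by (rule tendsto_ennrealI)
  from lim_imp_Liminf[OF sequentially_bot this] show ?thesis by simp
 next
  case False
  show ?thesis
   unfolding Ae_def
  proof (rule SUP_least)
   fix s assume s: "s \<in> dyadics"
   show "(if s <= TH k t w & ereal s < H0 w then ennreal (A s w) else 0) <= liminf (%l. ennreal (A (tht l k t w) w))"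
   proof (cases "s <= TH k t w & ereal s < H0 w")
    case True
    then have "ereal s < ereal (TH k t w)" using False by (meson not_le less_le_trans)
    then have "s < TH k t w" by simp
    then have "\<forall>\<^sub>F l in sequentially. s < tht l k t w" by (rule order_tendstoD(1)[OF tht_tendsto[OF w t]])
    then have "\<forall>\<^sub>F l in sequentially. ennreal (A s w) <= ennreal (A (tht l k t w) w)"
     by eventually_elim (intro ennreal_leI A_mono[OF good dyadics_nonneg[OF s] _ th(2)] less_imp_le)
    then have "ennreal (A s w) <= liminf (%l. ennreal (A (tht l k t w) w))" by (rule Liminf_bounded)
    then show ?thesis using True by simp
   qed auto
  qed
 qed
qed

lemma h_bounded: "\<exists>K. \<forall>x\<in>{0..upper k}. abs (h x) <= K"
proof -
 have "bounded (h ` {0..upper k})"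
  by (intro compact_imp_bounded compact_continuous_image continuous_on_subset[OF h_continuous]) auto
 then show ?thesis unfolding bounded_real by auto
qed

text \<open>At the exit times \<open>A\<close> is the increment of \<open>h\<close> along
  \<open>B\<close> minus a martingale of mean zero, hence has expectation at most
  \<open>2 * K\<close>. Fatou's lemma lets the lower end tend to \<open>0\<close>; this is where
  boundedness of \<open>h\<close> down to \<open>0\<close> enters.\<close>

lemma Ae_expectation:
 assumes t: "0 <= t" and K: "!!x. x \<in> {0..upper k} ==> abs (h x) <= K"
 shows "(\<integral>\<^sup>+w. Ae (TH k t w) w \<partial>M) <= ennreal (2 * K)"
proof -
 define V where "V l w = h (max 0 (stopped (exit l k) B t w)) - h x0 - Z l k t w" for l w
 have x0k: "x0 \<in> {0..upper k}" using x0_pos upper_greater[of k] by auto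
 have K0: "0 <= K" using K[OF x0k] by linarith
 have sB: "stopped (exit l k) B t w = B (tht l k t w) w" for l w by (simp add: stopped_def tht_def)
 have VA: "V l w = A (tht l k t w) w" if "good w" for l w
  using Z_eq[OF that t, of l k] by (simp add: V_def sB tht_def)
 have hm: "(%w. h (max 0 (stopped (exit l k) B t w))) \<in> borel_measurable M" for l
  by (rule measurable_compose[OF measurable_F[OF stopped_B_measurable[OF exit_stopping_time t] t] borel_measurable_continuous_onI[OF h_max_continuous]])
 have hb: "abs (h (max 0 (stopped (exit l k) B t w))) <= K" if "w \<in> space M" for l w
  unfolding sB using tht_facts(3,4)[OF that t, of l k] lower_pos[of l] by (intro K) auto
 have hi: "integrable M (%w. h (max 0 (stopped (exit l k) B t w)))" for l by (rule integrable_bounded[OF hm hb])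
 have Vi: "integrable M (V l)" for l unfolding V_def by (intro leb_integrable_diff hi Z_martingale(1)[OF t]) simp
 have EZ: "(LINT w|M. Z l k t w) = 0" for l
 proof -
  have "(LINT w|M. 1 * Z l k t w) = (LINT w|M. 1 * Z l k 0 w)"
   by (rule Z_martingale(2)[OF order_refl t, where C' = 1]) auto
  also have "... = (LINT w|M. 0)"
  proof (rule integral_cong_AE)
   show "AE w in M. 1 * Z l k 0 w = 0"
    using AE_good
   proof eventually_elim
    case (elim w)
    have "min 0 (exit l k w) = 0" using exit_nonneg[of l k w] by (simp add: min_def)
    then show ?case using Z_eq[OF elim order_refl, of l k] A_0[of w] B_0[of w] x0_pos elim
     by (simp add: good_def max_def zero_ereal_def[symmetric])
   qed
  qed (use borel_measurable_integrable[OF Z_martingale(1)[OF order_refl]] in simp_all)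
  finally show ?thesis by simp
 qed
 have EV: "(\<integral>\<^sup>+w. ennreal (V l w) \<partial>M) <= ennreal (2 * K)" for l
 proof -
  have "(\<integral>\<^sup>+w. ennreal (V l w) \<partial>M) = ennreal (LINT w|M. V l w)"
  proof (rule nn_integral_eq_integral[OF Vi])
   show "AE w in M. 0 <= V l w"
    using AE_good by eventually_elim (use VA A_nonneg tht_facts(1,2)[OF _ t] good_def in auto)
  qed
  also have "(LINT w|M. V l w) = (LINT w|M. h (max 0 (stopped (exit l k) B t w))) - h x0"
   unfolding V_def using hi Z_martingale(1)[OF t] EZ by (simp add: prob_space)
  also have "... <= 2 * K"
  proof -
   have "h (max 0 (stopped (exit l k) B t w)) <= K" if "w \<in> space M" for w using hb[OF that, of l] by linarith
   then have "(LINT w|M. h (max 0 (stopped (exit l k) B t w))) <= K" by (intro integral_le_const hi AE_I2)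
   then show ?thesis using K[OF x0k] by linarith
  qed
  finally show ?thesis using ennreal_leI by blast
 qed
 have "(\<integral>\<^sup>+w. Ae (TH k t w) w \<partial>M) <= (\<integral>\<^sup>+w. liminf (%l. ennreal (V l w)) \<partial>M)"
  by (rule nn_integral_mono_AE, use AE_good in eventually_elim) (simp only: VA Ae_le_liminf[OF _ t])
 also have "... <= liminf (%l. \<integral>\<^sup>+w. ennreal (V l w) \<partial>M)"
  by (rule nn_integral_liminf) (use Vi in \<open>intro measurable_compose[OF borel_measurable_integrable measurable_ennreal]\<close>)
 also have "... <= ennreal (2 * K)" by (rule Liminf_le) (use EV in auto)
 finally show ?thesis .
qed

definition nice :: "'a => bool" where "nice w \<longleftrightarrow> good w & (\<forall>t\<ge>0. Ae t w < \<top>)"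

lemma AE_nice: "AE w in M. nice w"
proof -
 have "AE w in M. Ae (TH k (real n) w) w \<noteq> \<infinity>" for k n
 proof (rule nn_integral_PInf_AE)
  have "(%w. Ae (real_of_ereal (min (ereal (real n)) (level k w))) w) \<in> borel_measurable M"
   by (rule measurable_F[OF Ae_stopped_measurable[OF level_stopping_time]]) auto
  then show "(%w. Ae (TH k (real n) w) w) \<in> borel_measurable M" by (simp add: Ae_stopped)
  obtain K where "!!x. x \<in> {0..upper k} ==> abs (h x) <= K" using h_bounded by blast
  from Ae_expectation[where k = k, OF _ this, of "real n"] show "(\<integral>\<^sup>+w. Ae (TH k (real n) w) w \<partial>M) \<noteq> \<infinity>"
   by (auto simp: top_unique)
 qed
 then have "AE w in M. \<forall>k n. Ae (TH k (real n) w) w \<noteq> \<infinity>" by (simp add: AE_all_countable)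
 then show ?thesis
  using AE_good
 proof eventually_elim
  case (elim w)
  have w: "w \<in> space M" using elim(2) by (simp add: good_def)
  have "Ae t w < \<top>" if "0 <= t" for t
  proof -
   obtain n :: nat where n: "t <= real n" using real_arch_simple by blast
   obtain k where k: "ereal (real n) < level k w"
    using level_eventually_large[OF w, of "real n"] by (auto simp: eventually_sequentially)
   have "Ae t w <= Ae (real n) w" by (rule Ae_mono[OF n])
   also have "... = Ae (TH k (real n) w) w" using Ae_stopped[of "real n" k w] less_imp_le[OF k] by (simp add: min_def)
   also have "... < \<top>" using elim(1) by (simp add: less_top)
   finally show ?thesis .
  qed
  then show ?case using elim(2) by (simp add: nice_def)
 qed
qed

lemma Ahat_mono: "nice w ==> 0 <= s ==> s <= t ==> Ahat s w <= Ahat t w"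
 unfolding Ahat_def nice_def by (intro enn2real_mono Ae_mono) auto

lemma Ahat_after: "H0 w <= ereal s ==> s <= t ==> Ahat t w = Ahat s w"
proof -
 assume s: "H0 w <= ereal s" "s <= t"
 have "u <= t & ereal u < H0 w \<longleftrightarrow> u <= s & ereal u < H0 w" for u
  using s by (metis ereal_less(2) less_ereal.simps(1) less_imp_le less_le_trans order_trans)
 then show ?thesis by (simp add: Ahat_def Ae_def)
qed

text \<open>The delicate time is the hitting time: the supremum over earlier times gives left
  continuity there, and afterwards the process is constant.\<close>

lemma Ahat_continuous:
 assumes nice: "nice w"
 shows "continuous_on {0..} (%t. Ahat t w)"
 unfolding continuous_on_eq_continuous_within
proof
 fix t :: real assume "t \<in> {0..}"
 then have t: "0 <= t" by simp
 have good: "good w" and fin: "!!t. 0 <= t ==> Ae t w < \<top>" using nice by (auto simp: nice_def)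
 show "continuous (at t within {0..}) (%t. Ahat t w)"
 proof (cases "ereal t < H0 w")
  case True
  obtain v where v: "t < v" "ereal v < H0 w"
   using ereal_dense2[OF True] by auto
  have v0: "0 <= v" using t v by simp
  have "continuous_on {0..v} (%s. Ahat s w)"
   using A_continuous[OF good v0 v(2)]
   by (rule continuous_on_eq) (use Ahat_before[OF good] ereal_le_less_trans[OF _ v(2)] in auto)
  then have "continuous (at t within {0..v}) (%s. Ahat s w)"
   using t v by (auto simp: continuous_on_eq_continuous_within)
  moreover have "at t within {0..v} = at t within {0..}"
   by (rule at_within_nhd[of t "{..<v}"]) (use v in auto)
  ultimately show ?thesis by (simp add: continuous_within)
 next
  case False
  then have tt: "H0 w <= ereal t" by simp
  show ?thesis
   unfolding continuous_within
  proof (rule tendstoI)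
   fix e :: real assume e: "0 < e"
   have At: "Ae t w = ennreal (Ahat t w)" unfolding Ahat_def using fin[OF t] by simp
   \<comment> \<open>Some earlier time already carries the value up to \<open>e\<close>; if the
     value is \<open>0\<close>, monotonicity settles all earlier times.\<close>
   have "\<exists>s0. 0 <= s0 & s0 < t & Ahat t w - e < Ahat s0 w \<or> Ahat t w = 0 & s0 = 0"
   proof (cases "Ahat t w = 0")
    case False
    then have pos: "0 < Ahat t w" by (simp add: Ahat_def less_le)
    have "ennreal (Ahat t w - e) < Ae t w" unfolding At using e pos by (simp add: ennreal_less_iff ennreal_lessI)
    then obtain s where s: "s \<in> dyadics" "ennreal (Ahat t w - e) < (if s <= t & ereal s < H0 w then ennreal (A s w) else 0)"
     unfolding Ae_def[of t] less_SUP_iff by blast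
    then have s': "s <= t" "ereal s < H0 w" "ennreal (Ahat t w - e) < ennreal (A s w)" by (auto split: if_splits)
    have "ereal s < ereal t" by (rule less_le_trans[OF s'(2) tt])
    moreover have "Ahat t w - e < Ahat s w"
     unfolding Ahat_before[OF good dyadics_nonneg[OF s(1)] s'(2)]
     by (metis s'(3) ennreal_leI not_less)
    ultimately show ?thesis using dyadics_nonneg[OF s(1)] by auto
   qed auto
   then obtain s0 where s0: "0 <= s0 & s0 < t & Ahat t w - e < Ahat s0 w \<or> Ahat t w = 0 & s0 = 0" by blast
   have near: "dist (Ahat s w) (Ahat t w) < e" if s: "0 <= s" "s0 < s \<or> Ahat t w = 0" for s
   proof (cases "s <= t")
    case True
    have "Ahat s w <= Ahat t w" by (rule Ahat_mono[OF nice s(1) True])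
    moreover have "Ahat t w - e < Ahat s w"
    proof (cases "Ahat t w = 0")
     case True
     moreover have "0 <= Ahat s w" by (simp add: Ahat_def)
     ultimately show ?thesis using e by simp
    next
     case False
     then have "0 <= s0" "s0 <= s" "Ahat t w - e < Ahat s0 w" using s0 s by auto
     then show ?thesis using Ahat_mono[OF nice, of s0 s] by linarith
    qed
    ultimately show ?thesis by (simp add: dist_real_def)
   next
    case False
    then show ?thesis using Ahat_after[OF tt, of s] e by simp
   qed
   show "\<forall>\<^sub>F s in at t within {0..}. dist (Ahat s w) (Ahat t w) < e"
   proof (cases "Ahat t w = 0")
    case True
    then show ?thesis using near by (auto simp: eventually_at_filter)
   next
    case False
    then have "s0 < t" using s0 by simp
    have "\<forall>\<^sub>F s in at t within {0..}. s \<in> {s0<..}"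
     by (rule eventually_at_topological[THEN iffD2]) (use \<open>s0 < t\<close> in \<open>auto intro!: exI[of _ "{s0<..}"]\<close>)
    moreover have "\<forall>\<^sub>F s in at t within {0..}. s \<in> {0..}" by (simp add: eventually_at_filter)
    ultimately show ?thesis by eventually_elim (use near in auto)
   qed
  qed
 qed
qed

text \<open>The martingales \<open>Z l k\<close> converge to the stopped process as \<open>l\<close>
  grows and are dominated by a constant plus \<open>Ahat\<close> at \<open>TH\<close>, which is
  integrable by the expectation bound.\<close>

lemma martingale_part:
 "martingale M F (%t w. stopped (level k) (%t w. h (SB t w) - h x0 - Ahat t w) t w
  - (h (SB 0 w) - h x0 - Ahat 0 w))" (is "martingale M F ?Y")
proof -
 obtain K where K: "!!x. x \<in> {0..upper k} ==> abs (h x) <= K" using h_bounded by blast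
 have x0k: "x0 \<in> {0..upper k}" using x0_pos upper_greater[of k] by auto
 have K0: "0 <= K" using K[OF x0k] by linarith
 have Yeq: "?Y t w = h (max 0 (B (TH k t w) w)) - h x0 - Ahat (TH k t w) w" if "w \<in> space M" "0 <= t" for t w
  using stopped_stopped_level[OF that, of k] Ae_stopped[OF that(2), of k w] stopped_0_0[OF that(1)] Ahat_0[OF that(1)]
  by (simp add: stopped_def[of "level k"] Ahat_def max_def)
 have Yad: "?Y t \<in> borel_measurable (F t)" if t: "0 <= t" for t
 proof -
  have s: "stopped (level k) SB t \<in> borel_measurable (F t)"
   by (rule stopped_measurable[OF _ continuous_stopped_0 level_stopping_time t]) (simp add: adapted_def stopped_0_measurable)
  have "(%w. h (max 0 (stopped (level k) SB t w)) - h x0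
    - enn2real (Ae (real_of_ereal (min (ereal t) (level k w))) w)) \<in> borel_measurable (F t)"
   by (intro borel_measurable_diff borel_measurable_const measurable_compose[OF s borel_measurable_continuous_onI[OF h_max_continuous]]
     borel_measurable_enn2real Ae_stopped_measurable[OF level_stopping_time t])
  moreover have "?Y t w = h (max 0 (stopped (level k) SB t w)) - h x0
    - enn2real (Ae (real_of_ereal (min (ereal t) (level k w))) w)" if "w \<in> space (F t)" for w
  proof -
   have w: "w \<in> space M" using that space_F[OF t] by simp
   have "?Y t w = h (max 0 (B (TH k t w) w)) - h x0 - Ahat (TH k t w) w" by (rule Yeq[OF w t])
   then show ?thesis
    unfolding stopped_def[of "level k" SB] stopped_stopped_level(1)[OF w t] Ae_stopped[OF t] Ahat_def .
  qed
  ultimately show ?thesis by (subst measurable_cong) auto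
 qed
 have Aint: "integrable M (%w. Ahat (TH k t w) w)" if t: "0 <= t" for t
 proof (rule integrableI_bounded)
  have "(%w. enn2real (Ae (real_of_ereal (min (ereal t) (level k w))) w)) \<in> borel_measurable M"
   by (rule borel_measurable_enn2real[OF measurable_F[OF Ae_stopped_measurable[OF level_stopping_time t] t]])
  then show "(%w. Ahat (TH k t w) w) \<in> borel_measurable M" by (simp add: Ae_stopped[OF t] Ahat_def)
  have "(\<integral>\<^sup>+w. ennreal (norm (Ahat (TH k t w) w)) \<partial>M) <= (\<integral>\<^sup>+w. Ae (TH k t w) w \<partial>M)"
   by (rule nn_integral_mono) (simp add: Ahat_def ennreal_enn2real_if)
  also have "... <= ennreal (2 * K)" by (rule Ae_expectation[OF t K])
  also have "... < \<infinity>" by simp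
  finally show "(\<integral>\<^sup>+w. ennreal (norm (Ahat (TH k t w) w)) \<partial>M) < \<infinity>" .
 qed
 have hb: "abs (h (max 0 x) - h x0) <= 2 * K" if "x <= upper k" for x
  using K[of "max 0 x"] K[OF x0k] that x0k by (auto simp: abs_le_iff)
 have lim: "AE w in M. (%l. Z l k t w) \<longlonglongrightarrow> ?Y t w" and bd: "AE w in M. \<forall>l. abs (Z l k t w) <= 2 * K + Ahat (TH k t w) w"
  if t: "0 <= t" for t
 proof -
  have Zeq: "Z l k t w = h (max 0 (B (tht l k t w) w)) - h x0 - Ahat (tht l k t w) w" if "nice w" for l w
   using that Z_eq[OF _ t, of w l k] Ahat_before[of w, OF _ tht_facts(1,2)[OF _ t]]
   by (simp add: nice_def good_def tht_def)
  show "AE w in M. (%l. Z l k t w) \<longlonglongrightarrow> ?Y t w"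
   using AE_nice
  proof eventually_elim
   case (elim w)
   then have w: "w \<in> space M" by (simp add: nice_def good_def)
   have ev: "\<forall>\<^sub>F l in sequentially. tht l k t w \<in> {0..}" using tht_facts(1)[OF w t] by simp
   have TH0: "TH k t w \<in> {0..}" using TH_bounds(1)[OF t] by simp
   have "(%l. B (tht l k t w) w) \<longlonglongrightarrow> B (TH k t w) w"
    by (rule continuous_on_tendsto_compose[OF B_continuous[OF w] tht_tendsto[OF w t] TH0 ev])
   then have "(%l. h (max 0 (B (tht l k t w) w))) \<longlonglongrightarrow> h (max 0 (B (TH k t w) w))"
    by (rule continuous_on_tendsto_compose[OF h_max_continuous]) auto
   moreover have "(%l. Ahat (tht l k t w) w) \<longlonglongrightarrow> Ahat (TH k t w) w"
    by (rule continuous_on_tendsto_compose[OF Ahat_continuous[OF elim] tht_tendsto[OF w t] TH0 ev])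
   ultimately show ?case
    unfolding Zeq[OF elim] Yeq[OF w t] by (intro tendsto_diff tendsto_const)
  qed
  show "AE w in M. \<forall>l. abs (Z l k t w) <= 2 * K + Ahat (TH k t w) w"
  proof (rule AE_mp[OF AE_nice], intro AE_I2 impI allI)
   fix w l assume nice: "nice w"
   then have w: "w \<in> space M" by (simp add: nice_def good_def)
   have "0 <= Ahat (tht l k t w) w" by (simp add: Ahat_def)
   moreover have "Ahat (tht l k t w) w <= Ahat (TH k t w) w"
    by (rule Ahat_mono[OF nice tht_facts(1)[OF w t] tht_le_TH[OF w t]])
   ultimately show "abs (Z l k t w) <= 2 * K + Ahat (TH k t w) w"
    unfolding Zeq[OF nice] using hb[OF tht_facts(4)[OF w t, of l k]] by linarith
  qed
 qed
 have YM: "?Y t \<in> borel_measurable M" if "0 <= t" for t by (rule measurable_F[OF Yad[OF that] that])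
 have Wi: "integrable M (%w. 2 * K + Ahat (TH k t w) w)" if "0 <= t" for t using Aint[OF that] by simp
 show ?thesis
 proof (rule martingaleI)
  show "adapted F ?Y" unfolding adapted_def using Yad by blast
  show iY: "integrable M (?Y t)" if t: "0 <= t" for t
   by (rule integrable_dominated_convergence[OF YM[OF t] borel_measurable_integrable[OF Z_martingale(1)[OF t]] Wi[OF t] lim[OF t]])
    (use bd[OF t] in \<open>eventually_elim, simp\<close>)
  fix s t S assume st: "0 <= s" "s <= t" and S: "S \<in> sets (F s)"
  have t: "0 <= t" using st by simp
  have Sm: "(indicator S :: 'a => real) \<in> borel_measurable (F s)" using S by (rule borel_measurable_indicator)
  have SM: "(indicator S :: 'a => real) \<in> borel_measurable M" by (rule measurable_F[OF Sm st(1)])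
  have conv: "(%l. LINT w|M. indicator S w * Z l k u w) \<longlonglongrightarrow> (LINT w|M. indicator S w * ?Y u w)" if u: "0 <= u" for u
  proof (rule integral_dominated_convergence[where w = "%w. 2 * K + Ahat (TH k u w) w"])
   show "(%w. indicator S w * ?Y u w) \<in> borel_measurable M" by (rule borel_measurable_times[OF SM YM[OF u]])
   show "(%w. indicator S w * Z l k u w) \<in> borel_measurable M" for l
    by (rule borel_measurable_times[OF SM borel_measurable_integrable[OF Z_martingale(1)[OF u]]])
   show "integrable M (%w. 2 * K + Ahat (TH k u w) w)" by (rule Wi[OF u])
   show "AE w in M. (%l. indicator S w * Z l k u w) \<longlonglongrightarrow> indicator S w * ?Y u w"
    using lim[OF u] by eventually_elim (intro tendsto_mult tendsto_const)
   show "AE w in M. norm (indicator S w * Z l k u w) <= 2 * K + Ahat (TH k u w) w" for l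
    using bd[OF u]
   proof eventually_elim
    case (elim w)
    have "norm (indicator S w * Z l k u w) <= abs (Z l k u w)" by (simp split: split_indicator)
    then show ?case using elim by (meson order_trans)
   qed
  qed
  have "(LINT w|M. indicator S w * Z l k t w) = (LINT w|M. indicator S w * Z l k s w)" for l
   by (rule Z_martingale(2)[OF st Sm, where C' = 1]) (simp split: split_indicator)
  then have "(%l. LINT w|M. indicator S w * Z l k s w) \<longlonglongrightarrow> (LINT w|M. indicator S w * ?Y t w)" using conv[OF t] by simp
  then show "(LINT w|M. indicator S w * ?Y t w) = (LINT w|M. indicator S w * ?Y s w)"
   by (rule LIMSEQ_unique[OF _ conv[OF st(1)]])
 qed
qed

end

section \<open>Assembling the decomposition\<close>

lemma continuous_imp_cadlag:
 assumes f: "continuous_on {0..} f"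
 shows "cadlag f"
 unfolding cadlag_def
proof (intro conjI allI impI)
 have lim: "(f \<longlongrightarrow> f t) (at t within {0..})" if "0 <= t" for t
  using f that by (auto simp: continuous_on_def)
 show "(f \<longlongrightarrow> f t) (at_right t)" if "0 <= t" for t
  by (rule tendsto_within_subset[OF lim[OF that]]) (use that in auto)
 show "\<exists>l. (f \<longlongrightarrow> l) (at_left t)" if "0 < t" for t
 proof
  have "at t within {0..} = at t" using that by (intro at_within_interior) auto
  then have "(f \<longlongrightarrow> f t) (at t)" using lim[of t] that by simp
  then show "(f \<longlongrightarrow> f t) (at_left t)" by (rule tendsto_within_subset[OF _ subset_UNIV])
 qed
qed

lemma cadlag_threshold: "cadlag (%t. if T <= ereal t then c else 0)"
 unfolding cadlag_def
proof (intro conjI allI impI)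
 fix t :: real
 show "((%t. if T <= ereal t then c else 0) \<longlongrightarrow> (if T <= ereal t then c else 0)) (at_right t)"
 proof (cases "T <= ereal t")
  case True
  have "\<forall>\<^sub>F s in at_right t. c = (if T <= ereal s then c else 0)"
   using eventually_at_right_less[of t]
  proof eventually_elim
   case (elim s)
   have "T <= ereal s" by (rule order_trans[OF True]) (use elim in simp)
   then show ?case by simp
  qed
  from Lim_transform_eventually[OF tendsto_const this] show ?thesis using True by simp
 next
  case False
  obtain v where v: "t < v" "ereal v < T" using ereal_dense2[OF False[unfolded not_le]] by auto
  have "\<forall>\<^sub>F s in at_right t. 0 = (if T <= ereal s then c else 0)"
   using eventually_at_right_real[OF v(1)]
  proof eventually_elim
   case (elim s)
   have "ereal s < T" by (rule ereal_le_less_trans[OF _ v(2)]) (use elim in simp)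
   then show ?case by simp
  qed
  from Lim_transform_eventually[OF tendsto_const this] show ?thesis using False by simp
 qed
next
 fix t :: real
 show "\<exists>l. ((%t. if T <= ereal t then c else 0) \<longlongrightarrow> l) (at_left t)"
 proof (cases "T < ereal t")
  case True
  then obtain v where v: "T < ereal v" "v < t" using ereal_dense2[OF True] by auto
  have "\<forall>\<^sub>F s in at_left t. c = (if T <= ereal s then c else 0)"
   using eventually_at_left_real[OF v(2)]
  proof eventually_elim
   case (elim s)
   have "T < ereal s" by (rule less_trans[OF v(1)]) (use elim in simp)
   then show ?case by simp
  qed
  from Lim_transform_eventually[OF tendsto_const this] show ?thesis by blast
 next
  case False
  have lt: "t - 1 < t" by simp
  have "\<forall>\<^sub>F s in at_left t. 0 = (if T <= ereal s then c else 0)"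
   using eventually_at_left_real[OF lt]
  proof eventually_elim
   case (elim s)
   have "ereal s < T" by (rule less_le_trans[of _ "ereal t"]) (use elim False in auto)
   then show ?case by simp
  qed
  from Lim_transform_eventually[OF tendsto_const this] show ?thesis by blast
 qed
qed

lemma finite_variation_onI:
 assumes "!!s t. a <= s ==> s <= t ==> t <= b ==> abs (f t - f s) <= G t - G s"
 shows "finite_variation_on a b f"
 unfolding finite_variation_on_def
proof (intro exI allI impI)
 fix n and p :: "nat => real" assume p: "mono p & p ` {..n} \<subseteq> {a..b}"
 then have ab: "a <= p i" "p i <= b" if "i <= n" for i using that by (auto simp: image_subset_iff)
 have "(\<Sum>i<n. abs (f (p (Suc i)) - f (p i))) <= (\<Sum>i<n. G (p (Suc i)) - G (p i))"
  using p ab by (intro sum_mono assms) (auto simp: mono_def)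
 also have "... = G (p n) - G (p 0)" by (rule sum_lessThan_telescope)
 also have "... <= G b - G a"
  using assms[of a "p 0"] assms[of "p n" b] ab[of 0] ab[of n] by auto
 finally show "(\<Sum>i<n. abs (f (p (Suc i)) - f (p i))) <= G b - G a" .
qed

context filtered_prob_space
begin

lemma martingale_diff:
 assumes X: "martingale M F X" and Y: "martingale M F Y"
 shows "martingale M F (%t w. X t w - Y t w)"
proof (rule martingaleI)
 show "adapted F (%t w. X t w - Y t w)"
  using X Y unfolding martingale_def adapted_def by (intro allI impI borel_measurable_diff) blast+
 have i: "integrable M (X t)" "integrable M (Y t)" if "0 <= t" for t using X Y that by (auto simp: martingale_def)
 show "integrable M (%w. X t w - Y t w)" if "0 <= t" for t using i[OF that] by simp
 fix s t S assume st: "0 <= s" "s <= t" and S: "S \<in> sets (F s)"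
 have t: "0 <= t" using st by simp
 have m: "(indicator S :: 'a => real) \<in> borel_measurable (F s)" using S by (rule borel_measurable_indicator)
 have b: "abs (indicator S w :: real) <= 1" for w by (simp split: split_indicator)
 note I = integrable_bounded_mult[OF _ measurable_F[OF m st(1)] b]
 show "(LINT w|M. indicator S w * (X t w - Y t w)) = (LINT w|M. indicator S w * (X s w - Y s w))"
  unfolding right_diff_distrib leb_integral_diff[OF I[OF i(1)[OF t]] I[OF i(2)[OF t]]]
   leb_integral_diff[OF I[OF i(1)[OF st(1)]] I[OF i(2)[OF st(1)]]]
   martingaleD[OF X st m b] martingaleD[OF Y st m b] ..
qed

end

context brownian
begin

lemma stopped_0_eq_0_iff:
 assumes "w \<in> space M" "0 <= t"
 shows "SB t w = 0 \<longleftrightarrow> H0 w <= ereal t"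
proof
 assume "SB t w = 0"
 then show "H0 w <= ereal t"
  using B_pos_before_hitting[OF assms(1) _ assms(2)] stopped_before[of t H0 w B] by fastforce
qed (rule hitting_time_attained[OF assms(1) _ assms(2)])

text \<open>Each convex function contributes a local martingale and an increasing process. The
  difference \<open>c\<close> between \<open>g 0\<close> and the limit of \<open>g\<close> at
  \<open>0\<close> shows only from the hitting time on, as a single jump that goes into the finite
  variation part.\<close>

lemma convex_diff_pos_imp_semimartingale:
 assumes "convex_diff_pos g"
 shows "semimartingale M F (%t w. g (SB t w))"
proof -
 obtain h1 h2 where h: "convex_on {0..} h1" "continuous_on {0..} h1" "convex_on {0..} h2" "continuous_on {0..} h2"
  "!!x. 0 < x ==> g x = h1 x - h2 x"
  using convex_diff_pos_extend[OF assms] by blast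
 interpret t1: convex_tanaka M F B x0 h1 by unfold_locales (use h in auto)
 interpret t2: convex_tanaka M F B x0 h2 by unfold_locales (use h in auto)
 let ?S = "%t w. SB t w"
 define c where "c = g 0 - (h1 0 - h2 0)"
 define N1 where "N1 t w = h1 (?S t w) - h1 x0 - t1.Ahat t w" for t w
 define N2 where "N2 t w = h2 (?S t w) - h2 x0 - t2.Ahat t w" for t w
 define L where "L t w = N1 t w - N2 t w" for t w
 define A where "A t w = (t1.Ahat t w - t2.Ahat t w) + (if H0 w <= ereal t then c else 0)" for t w
 have g: "g (?S t w) = h1 (?S t w) - h2 (?S t w) + (if H0 w <= ereal t then c else 0)"
  if "w \<in> space M" "0 <= t" for t w
  using h(5)[of "?S t w"] stopped_0_nonneg[OF that] stopped_0_eq_0_iff[OF that]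
  by (cases "?S t w = 0") (auto simp: c_def)
 have hS: "(%w. f (?S t w)) \<in> borel_measurable (F t)" if t: "0 <= t" and f: "continuous_on UNIV (%x. f (max 0 x))" for t f
 proof -
  have "(%w. f (max 0 (?S t w))) \<in> borel_measurable (F t)"
   by (rule measurable_compose[OF stopped_0_measurable[OF t] borel_measurable_continuous_onI[OF f]])
  moreover have "f (?S t w) = f (max 0 (?S t w))" if "w \<in> space (F t)" for w
   using stopped_0_nonneg[of w t] that t space_F[OF t] by (simp add: max_def)
  ultimately show ?thesis by (subst measurable_cong) auto
 qed
 have hSc: "continuous_on {0..} (%t. f (?S t w))" if "w \<in> space M" "continuous_on {0..} f" for f w
  by (rule continuous_on_compose2[OF that(2) continuous_stopped_0[OF that(1)]]) (use stopped_0_nonneg[OF that(1)] in auto)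
 have ind: "(%w. if H0 w <= ereal t then c else 0) \<in> borel_measurable (F t)" if "0 <= t" for t
  using hitting_time_0_stopping that by (intro measurable_If borel_measurable_const predE) (simp add: stopping_time_ext_def)
 have Ah: "t1.Ahat t \<in> borel_measurable (F t)" "t2.Ahat t \<in> borel_measurable (F t)" if "0 <= t" for t
  using t1.Ahat_adapted t2.Ahat_adapted that by (auto simp: adapted_def)
 have "local_martingale M F L"
  unfolding local_martingale_def
 proof (intro conjI exI allI)
  show "adapted F L"
   unfolding adapted_def L_def[abs_def] N1_def N2_def
   by (intro allI impI borel_measurable_diff borel_measurable_const hS Ah t1.h_max_continuous t2.h_max_continuous)
  show "AE w in M. cadlag (%t. L t w)"
   using t1.AE_nice t2.AE_nice AE_space
  proof eventually_elim
   case (elim w)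
   show ?case
    unfolding L_def N1_def N2_def
    by (intro continuous_imp_cadlag continuous_on_diff continuous_on_const hSc[OF elim(3)] h
      t1.Ahat_continuous[OF elim(1)] t2.Ahat_continuous[OF elim(2)])
  qed
  show "stopping_time_ext M F (level n)" for n by (rule level_stopping_time)
  show "AE w in M. incseq (%n. level n w) & (%n. level n w) \<longlonglongrightarrow> \<infinity>"
   by (intro AE_I2 conjI level_incseq level_tendsto)
  show "martingale M F (%t w. stopped (level n) L t w - L 0 w)" for n
  proof -
   have "martingale M F (%t w. (stopped (level n) N1 t w - N1 0 w) - (stopped (level n) N2 t w - N2 0 w))"
    unfolding N1_def N2_def by (rule martingale_diff[OF t1.martingale_part t2.martingale_part])
   moreover have "(%t w. (stopped (level n) N1 t w - N1 0 w) - (stopped (level n) N2 t w - N2 0 w))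
     = (%t w. stopped (level n) L t w - L 0 w)"
    by (simp add: L_def stopped_def fun_eq_iff)
   ultimately show ?thesis by simp
  qed
 qed
 moreover have "finite_variation_process M F A"
  unfolding finite_variation_process_def
 proof
  show "adapted F A"
   unfolding adapted_def A_def[abs_def] by (intro allI impI borel_measurable_add borel_measurable_diff Ah ind)
  show "AE w in M. cadlag (%t. A t w) & (\<forall>t\<ge>0. finite_variation_on 0 t (%s. A s w))"
   using t1.AE_nice t2.AE_nice
  proof eventually_elim
   case (elim w)
   have "cadlag (%t. t1.Ahat t w - t2.Ahat t w)"
    by (intro continuous_imp_cadlag continuous_on_diff t1.Ahat_continuous[OF elim(1)] t2.Ahat_continuous[OF elim(2)])
   then have "cadlag (%t. A t w)" unfolding A_def by (rule cadlag_add[OF _ cadlag_threshold])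
   moreover have "finite_variation_on 0 t (%s. A s w)" for t
   proof (rule finite_variation_onI[where G = "%s. t1.Ahat s w + t2.Ahat s w + (if H0 w <= ereal s then \<bar>c\<bar> else 0)"])
    fix s u :: real assume su: "0 <= s" "s <= u"
    have "H0 w <= ereal s ==> H0 w <= ereal u" using su by (meson ereal_less_eq(3) order_trans)
    then show "abs (A u w - A s w) <= (t1.Ahat u w + t2.Ahat u w + (if H0 w <= ereal u then \<bar>c\<bar> else 0))
      - (t1.Ahat s w + t2.Ahat s w + (if H0 w <= ereal s then \<bar>c\<bar> else 0))"
     using t1.Ahat_mono[OF elim(1) su] t2.Ahat_mono[OF elim(2) su] by (auto simp: A_def)
   qed
   ultimately show ?case by blast
  qed
 qed
 moreover have "AE w in M. L 0 w = 0 & A 0 w = 0 & (\<forall>t\<ge>0. g (?S t w) = g (?S 0 w) + L t w + A t w)"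
 proof (rule AE_I2, intro conjI allI impI)
  fix w assume w: "w \<in> space M"
  have S0: "?S 0 w = x0" by (rule stopped_0_0[OF w])
  show "L 0 w = 0" by (simp add: L_def N1_def N2_def S0 t1.Ahat_0[OF w] t2.Ahat_0[OF w])
  have "\<not> H0 w <= ereal 0" using stopped_0_eq_0_iff[OF w order_refl] S0 x0_pos by simp
  then show "A 0 w = 0" by (simp add: A_def t1.Ahat_0[OF w] t2.Ahat_0[OF w])
  show "g (?S t w) = g (?S 0 w) + L t w + A t w" if "0 <= t" for t
   unfolding g[OF w that] S0 using h(5)[OF x0_pos] by (simp add: L_def N1_def N2_def A_def)
 qed
 moreover have "adapted F (%t w. g (?S t w))"
  unfolding adapted_def
 proof (intro allI impI)
  fix t :: real assume t: "0 <= t"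
  have "(%w. h1 (?S t w) - h2 (?S t w) + (if H0 w <= ereal t then c else 0)) \<in> borel_measurable (F t)"
   by (intro borel_measurable_add borel_measurable_diff hS t1.h_max_continuous t2.h_max_continuous ind t)
  then show "(%w. g (?S t w)) \<in> borel_measurable (F t)"
   by (subst measurable_cong[OF g[OF _ t]]) (use space_F[OF t] in auto)
 qed
 ultimately show ?thesis unfolding semimartingale_def by (intro conjI exI)
qed

end

text \<open>Conditions \<open>a\<close> and \<open>b\<close> do not see the value of
  \<open>g\<close> at \<open>0\<close>: the indicator of \<open>{0}\<close> satisfies both, but is
  not a difference of functions continuous at \<open>0\<close>. Therefore \<open>c\<close> is
  recovered from \<open>b\<close> under continuity of \<open>g\<close> at \<open>0\<close>.\<close>

theorem theorem5p4:
  fixes M :: "'a measure" and F :: "real \<Rightarrow> 'a measure"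
    and B :: "real \<Rightarrow> 'a \<Rightarrow> real" and x0 :: real and g :: "real \<Rightarrow> real"
  assumes "filtered_prob_space M F"
    and "0 < x0"
    and "brownian_motion M F x0 B"
    and "g \<in> borel_measurable (restrict_space borel {0..})"
  shows
    "let a = semimartingale M F (\<lambda>t \<omega>. g (stopped (hitting_time B 0) B t \<omega>));
         b = (difference_of_convex_on {0<..} g \<and>
              (\<exists>\<nu>. second_derivative_measure g \<nu> \<and>
                (\<exists>z>0. (\<integral>\<^sup>+x\<in>{0<..<z}. ennreal x \<partial>variation_measure \<nu>) < \<infinity>)));
         c = (\<exists>h1 h2. convex_on {0..} h1 \<and> continuous (at 0 within {0..}) h1 \<and>
              convex_on {0..} h2 \<and> continuous (at 0 within {0..}) h2 \<and>
              (\<forall>x\<ge>0. g x = h1 x - h2 x))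
     in (a \<longleftrightarrow> b) \<and> (c \<longrightarrow> b) \<and> (continuous (at 0 within {0..}) g \<longrightarrow> b \<longrightarrow> c)"
proof -
 interpret brownian M F B x0
  using assms(1-3) by (simp add: brownian_def brownian_axioms_def)
 define b where "b \<longleftrightarrow> difference_of_convex_on {0<..} g \<and>
   (\<exists>\<nu>. second_derivative_measure g \<nu> \<and> (\<exists>z>0. (\<integral>\<^sup>+x\<in>{0<..<z}. ennreal x \<partial>variation_measure \<nu>) < \<infinity>))"
 have b: "b \<longleftrightarrow> convex_diff_pos g"
 proof
  assume b
  then obtain \<nu> z where "difference_of_convex_on {0<..} g" "second_derivative_measure g \<nu>" "0 < z"
   "(\<integral>\<^sup>+x\<in>{0<..<z}. ennreal x \<partial>variation_measure \<nu>) < \<infinity>"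
   unfolding b_def by (elim conjE exE)
  then show "convex_diff_pos g" by (rule second_derivative_imp_convex_diff_pos)
 qed (unfold b_def, intro conjI convex_diff_pos_imp_second_derivative)
 have a: "semimartingale M F (%t w. g (SB t w)) \<longleftrightarrow> convex_diff_pos g"
  by (rule iffI[OF semimartingale_imp_convex_diff_pos[OF assms(4)] convex_diff_pos_imp_semimartingale])
 show ?thesis
  unfolding Let_def b_def[symmetric] a b
 proof (intro conjI impI)
  show "convex_diff_pos g \<longleftrightarrow> convex_diff_pos g" by (rule refl)
 next
  assume "\<exists>h1 h2. convex_on {0..} h1 \<and> continuous (at 0 within {0..}) h1 \<and>
   convex_on {0..} h2 \<and> continuous (at 0 within {0..}) h2 \<and> (\<forall>x\<ge>0. g x = h1 x - h2 x)"
  then obtain h1 h2 where "convex_on {0..} h1" "convex_on {0..} h2" "\<forall>x\<ge>0. g x = h1 x - h2 x"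
   by (elim exE conjE)
  then show "convex_diff_pos g" by (intro convex_diff_imp_convex_diff_pos[of h1 h2]) simp_all
 next
  assume "continuous (at 0 within {0..}) g" "convex_diff_pos g"
  then show "\<exists>h1 h2. convex_on {0..} h1 \<and> continuous (at 0 within {0..}) h1 \<and>
   convex_on {0..} h2 \<and> continuous (at 0 within {0..}) h2 \<and> (\<forall>x\<ge>0. g x = h1 x - h2 x)"
   by (rule convex_diff_pos_imp_convex_diff[rotated])
 qed
qed

end
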